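(* Let $X\subseteq\mathbb{P}^n$ be an irreducible closed subvariety, defined over the real numbers and not contained in $\mathcal{H}$. Then the likelihood correspondence $\mathcal{L}_X\subseteq \mathbb{P}^n_p\times\mathbb{P}^n_u$ is an irreducible variety of dimension $n$. The projection $\mathrm{pr}_1:\mathcal{L}_X\to\mathbb{P}^n_p$ to the first factor is a projective bundle over $X_{\mathrm{reg}}\setminus\mathcal{H}$, and the projection $\mathrm{pr}_2:\mathcal{L}_X\to\mathbb{P}^n_u$ to the second factor is generically finite-to-one.
   Context: Work over $\mathbb{C}$. Let $\mathbb{P}^n=\mathbb{P}^n_p$ have homogeneous coordinates $p_0,\dots,p_n$, put $p_+=\sum_{i=0}^n p_i$, and let $\mathcal{H}=\{p_0p_1\cdots p_n\,p_+=0\}\subset\mathbb{P}^n$, an arrangement of $n+2$ hyperplanes. The data space $\mathbb{P}^n_u$ is another copy of $\mathbb{P}^n$ with coordinates $u_0,\dots,u_n$; put $u_+=\sum u_i$. The likelihood function is $\ell_u=\prod_i p_i^{u_i}/p_+^{u_+}$. Its logarithmic differential is $\mathrm{dlog}(\ell_u)=\sum_{i=0}^n u_i\,\mathrm{dlog}(p_i/p_+)$, a regular 1-form on $\mathbb{P}^n\setminus\mathcal{H}$, which makes sense for every complex vector $u$. Write $X_{\mathrm{reg}}=X\setminus X_{\mathrm{sing}}$ for the smooth locus of $X$. A point $p\in X_{\mathrm{reg}}\setminus\mathcal{H}$ is a critical point of $\ell_u$ on $X$ if the restriction of $\mathrm{dlog}(\ell_u)$ to $X_{\mathrm{reg}}\setminus\mathcal{H}$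 (a section of its cotangent bundle) vanishes at $p$. The likelihood correspondence $\mathcal{L}_X$ is the Zariski closure in $\mathbb{P}^n_p\times\mathbb{P}^n_u$ of the set of pairs $(p,u)$ with $p\in X_{\mathrm{reg}}\setminus\mathcal{H}$ a critical point of $\ell_u$ on $X$. *)

theory Defs
  imports "HOL-Analysis.Analysis" "HOL-Library.Poly_Mapping"
    "HOL-Library.Function_Algebras"
begin

section \<open>Polynomials and projective space\<close>

text \<open>
  Vectors of \<open>\<complex>\<^bsup>n+1\<^esup>\<close> are functions \<open>nat \<Rightarrow> complex\<close> vanishing beyond \<open>n\<close>, so that the dimension is an
  ordinary variable.  Points of projective space are classes of nonzero vectors modulo scaling.
\<close>

type_synonym cvector = "nat \<Rightarrow> complex"
type_synonym ppoint = "cvector set"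
type_synonym 'v cpoly = "('v \<Rightarrow>\<^sub>0 nat) \<Rightarrow>\<^sub>0 complex"

interpretation cfun: vector_space "\<lambda>(c::complex) (v::cvector) i. c * v i"
  by unfold_locales (auto simp: fun_eq_iff algebra_simps)

definition cvectors :: "nat \<Rightarrow> cvector set" where
  "cvectors n = {v. \<forall>i>n. v i = 0}"

definition proportional :: "nat \<Rightarrow> (cvector \<times> cvector) set" where
  "proportional n = {(x, y). x \<in> cvectors n - {0} \<and> y \<in> cvectors n - {0} \<and>
                             (\<exists>c. c \<noteq> 0 \<and> y = (\<lambda>i. c * x i))}"

definition proj_space :: "nat \<Rightarrow> ppoint set" where
  "proj_space n = (cvectors n - {0}) // proportional n"

definition monom_eval :: "('v \<Rightarrow>\<^sub>0 nat) \<Rightarrow> ('v \<Rightarrow> complex) \<Rightarrow> complex" where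
  "monom_eval m x = (\<Prod>i\<in>Poly_Mapping.keys m. x i ^ Poly_Mapping.lookup m i)"

definition poly_eval :: "'v cpoly \<Rightarrow> ('v \<Rightarrow> complex) \<Rightarrow> complex" where
  "poly_eval f x = (\<Sum>m\<in>Poly_Mapping.keys f. Poly_Mapping.lookup f m * monom_eval m x)"

definition partial_deriv :: "'v \<Rightarrow> 'v cpoly \<Rightarrow> ('v \<Rightarrow> complex) \<Rightarrow> complex" where
  "partial_deriv i f x = deriv (\<lambda>t. poly_eval f (x(i := t))) (x i)"

text \<open>Homogeneous polynomials of degree \<open>d\<close> in the variables \<open>0, \<dots>, n\<close>.\<close>

definition forms :: "nat \<Rightarrow> nat \<Rightarrow> nat cpoly set" where
  "forms n d = {f. \<forall>m\<in>Poly_Mapping.keys f.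
      Poly_Mapping.keys m \<subseteq> {..n} \<and> (\<Sum>i\<le>n. Poly_Mapping.lookup m i) = d}"

text \<open>Bihomogeneous polynomials of bidegree \<open>(d, e)\<close> on \<open>\<complex>\<^bsup>n+1\<^esup> \<times> \<complex>\<^bsup>k+1\<^esup>\<close>.\<close>

definition biforms :: "nat \<Rightarrow> nat \<Rightarrow> nat \<Rightarrow> nat \<Rightarrow> (nat + nat) cpoly set" where
  "biforms n k d e = {f. \<forall>m\<in>Poly_Mapping.keys f.
      Poly_Mapping.keys m \<subseteq> Inl ` {..n} \<union> Inr ` {..k} \<and>
      (\<Sum>i\<le>n. Poly_Mapping.lookup m (Inl i)) = d \<and> (\<Sum>j\<le>k. Poly_Mapping.lookup m (Inr j)) = e}"


section \<open>Zariski topologies\<close>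

definition proj_zeros :: "nat \<Rightarrow> nat cpoly set \<Rightarrow> ppoint set" where
  "proj_zeros n F = {P \<in> proj_space n. \<forall>f\<in>F. \<forall>x\<in>P. poly_eval f x = 0}"

definition biproj_zeros :: "nat \<Rightarrow> nat \<Rightarrow> (nat + nat) cpoly set \<Rightarrow> (ppoint \<times> ppoint) set" where
  "biproj_zeros n k F = {(P, Q) \<in> proj_space n \<times> proj_space k.
      \<forall>f\<in>F. \<forall>x\<in>P. \<forall>y\<in>Q. poly_eval f (case_sum x y) = 0}"

definition zariski :: "nat \<Rightarrow> ppoint topology" where
  "zariski n = topology (\<lambda>U. \<exists>F \<subseteq> (\<Union>d. forms n d). U = proj_space n - proj_zeros n F)"

text \<open>The Zariski topology of the product variety (not the product topology).\<close>

definition bizariski :: "nat \<Rightarrow> nat \<Rightarrow> (ppoint \<times> ppoint) topology" where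
  "bizariski n k = topology (\<lambda>U. \<exists>F \<subseteq> (\<Union>d e. biforms n k d e).
      U = proj_space n \<times> proj_space k - biproj_zeros n k F)"

definition irreducible_in :: "'a topology \<Rightarrow> 'a set \<Rightarrow> bool" where
  "irreducible_in T S \<longleftrightarrow> S \<subseteq> topspace T \<and> S \<noteq> {} \<and>
     (\<forall>A B. closedin T A \<longrightarrow> closedin T B \<longrightarrow> S \<subseteq> A \<union> B \<longrightarrow> S \<subseteq> A \<or> S \<subseteq> B)"

text \<open>Krull dimension; the empty space gets dimension \<open>0\<close> by this convention.\<close>

definition krull_dim :: "'a topology \<Rightarrow> enat" where
  "krull_dim T = Sup {enat k | k. \<exists>Z :: nat \<Rightarrow> 'a set.
      (\<forall>i\<le>k. closedin T (Z i) \<and> irreducible_in T (Z i)) \<and> (\<forall>i<k. Z i \<subset> Z (Suc i))}"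

definition defined_over_reals :: "nat \<Rightarrow> ppoint set \<Rightarrow> bool" where
  "defined_over_reals n X \<longleftrightarrow> (\<exists>F \<subseteq> (\<Union>d. forms n d).
      (\<forall>f\<in>F. \<forall>m. Poly_Mapping.lookup f m \<in> \<real>) \<and> X = proj_zeros n F)"


section \<open>Smooth points and the likelihood correspondence\<close>

definition vanishing_forms :: "nat \<Rightarrow> ppoint set \<Rightarrow> nat cpoly set" where
  "vanishing_forms n X = {f \<in> (\<Union>d. forms n d). \<forall>P\<in>X. \<forall>x\<in>P. poly_eval f x = 0}"

text \<open>
  Tangent space at \<open>x\<close> of the affine cone over \<open>X\<close>.  The tangent space of \<open>X\<close> at the class of \<open>x\<close> is
  its quotient by the line spanned by \<open>x\<close>.
\<close>

definition cone_tangent :: "nat \<Rightarrow> ppoint set \<Rightarrow> cvector \<Rightarrow> cvector set" where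
  "cone_tangent n X x = {v \<in> cvectors n.
      \<forall>f\<in>vanishing_forms n X. (\<Sum>i\<le>n. partial_deriv i f x * v i) = 0}"

text \<open>
  The smooth locus of an irreducible closed \<open>X\<close>: the tangent space has the dimension of \<open>X\<close>, that is,
  the tangent space of the cone has one dimension more.
\<close>

definition smooth_locus :: "nat \<Rightarrow> ppoint set \<Rightarrow> ppoint set" where
  "smooth_locus n X = {P \<in> X. \<forall>x\<in>P.
      enat (cfun.dim (cone_tangent n X x)) = krull_dim (subtopology (zariski n) X) + 1}"

definition arrangement :: "nat \<Rightarrow> ppoint set" where
  "arrangement n = {P \<in> proj_space n. \<forall>x\<in>P. (\<Prod>i\<le>n. x i) * (\<Sum>i\<le>n. x i) = 0}"

text \<open>The logarithmic differential of \<open>g\<close> at \<open>x\<close>, applied to the vector \<open>v\<close>.\<close>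

definition dlog :: "(cvector \<Rightarrow> complex) \<Rightarrow> cvector \<Rightarrow> cvector \<Rightarrow> complex" where
  "dlog g x v = deriv (\<lambda>t. g (\<lambda>i. x i + t * v i)) 0 / g x"

text \<open>
  The pullback of \<open>dlog \<ell>\<^sub>u\<close> to the cone.  It vanishes on the direction \<open>x\<close>, because the functions
  \<open>p\<^sub>i / p\<^sub>+\<close> have degree \<open>0\<close>; hence it vanishes on the tangent space of \<open>X\<close> iff it vanishes on the
  tangent space of the cone.
\<close>

definition dlog_likelihood :: "nat \<Rightarrow> cvector \<Rightarrow> cvector \<Rightarrow> cvector \<Rightarrow> complex" where
  "dlog_likelihood n u x v = (\<Sum>i\<le>n. u i * dlog (\<lambda>p. p i / (\<Sum>j\<le>n. p j)) x v)"

definition critical_pairs :: "nat \<Rightarrow> ppoint set \<Rightarrow> (ppoint \<times> ppoint) set" where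
  "critical_pairs n X = {(P, U). P \<in> smooth_locus n X - arrangement n \<and> U \<in> proj_space n \<and>
      (\<forall>x\<in>P. \<forall>u\<in>U. \<forall>v\<in>cone_tangent n X x. dlog_likelihood n u x v = 0)}"

definition likelihood_correspondence :: "nat \<Rightarrow> ppoint set \<Rightarrow> (ppoint \<times> ppoint) set" where
  "likelihood_correspondence n X = bizariski n n closure_of critical_pairs n X"


section \<open>Morphisms, projective bundles, generically finite maps\<close>

definition regular_fun :: "nat \<Rightarrow> ppoint set \<Rightarrow> (ppoint \<Rightarrow> complex) \<Rightarrow> bool" where
  "regular_fun n A h \<longleftrightarrow> (\<forall>P0\<in>A. \<exists>W d. \<exists>F\<in>forms n d. \<exists>G\<in>forms n d.
      openin (zariski n) W \<and> P0 \<in> W \<and>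
      (\<forall>P\<in>A \<inter> W. \<forall>x\<in>P. poly_eval G x \<noteq> 0 \<and> h P = poly_eval F x / poly_eval G x))"

text \<open>Morphisms to \<open>k\<close>-space from a locally closed subset \<open>A\<close> of the product of \<open>n\<close>- and \<open>m\<close>-space.\<close>

definition regular_map :: "nat \<Rightarrow> nat \<Rightarrow> nat \<Rightarrow> (ppoint \<times> ppoint) set \<Rightarrow>
    (ppoint \<times> ppoint \<Rightarrow> ppoint) \<Rightarrow> bool" where
  "regular_map n m k A h \<longleftrightarrow> h \<in> A \<rightarrow> proj_space k \<and>
     (\<forall>a\<in>A. \<exists>W d e. \<exists>G :: nat \<Rightarrow> (nat + nat) cpoly.
        openin (bizariski n m) W \<and> a \<in> W \<and> (\<forall>j\<le>k. G j \<in> biforms n m d e) \<and>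
        (\<forall>(P, Q)\<in>A \<inter> W. \<forall>x\<in>P. \<forall>y\<in>Q.
           (\<lambda>j. if j \<le> k then poly_eval (G j) (case_sum x y) else 0) \<in> h (P, Q)))"

text \<open>
  \<open>(P, t) \<mapsto> (P, \<psi> (P, t))\<close> is an isomorphism, over \<open>U\<close>, from \<open>U\<close> times \<open>r\<close>-space onto the part of \<open>E\<close>
  over \<open>U\<close>, with inverse \<open>(P, Q) \<mapsto> (P, \<phi> (P, Q))\<close>.
\<close>

definition trivialization :: "nat \<Rightarrow> nat \<Rightarrow> (ppoint \<times> ppoint) set \<Rightarrow> nat \<Rightarrow> ppoint set \<Rightarrow>
    (ppoint \<times> ppoint \<Rightarrow> ppoint) \<Rightarrow> (ppoint \<times> ppoint \<Rightarrow> ppoint) \<Rightarrow> bool" where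
  "trivialization n m E r U \<psi> \<phi> \<longleftrightarrow>
     regular_map n r m (U \<times> proj_space r) \<psi> \<and>
     regular_map n m r {e \<in> E. fst e \<in> U} \<phi> \<and>
     (\<forall>P\<in>U. \<forall>t\<in>proj_space r. (P, \<psi> (P, t)) \<in> E \<and> \<phi> (P, \<psi> (P, t)) = t) \<and>
     (\<forall>(P, Q)\<in>E. P \<in> U \<longrightarrow> \<psi> (P, \<phi> (P, Q)) = Q)"

text \<open>
  The first projection from the subset \<open>E\<close> of a product of projective spaces is, over \<open>B\<close>, the
  projectivization of an algebraic vector bundle of rank \<open>r + 1\<close>: there are local trivializations,
  indexed here by the points of \<open>B\<close>, whose transition maps are induced by a cocycle of invertible
  matrices of regular functions (invertible by the cocycle conditions).
\<close>

definition projective_bundle_over :: "nat \<Rightarrow> nat \<Rightarrow> (ppoint \<times> ppoint) set \<Rightarrow> ppoint set \<Rightarrow> bool" where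
  "projective_bundle_over n m E B \<longleftrightarrow>
     (\<exists>r. \<exists>U :: ppoint \<Rightarrow> ppoint set. \<exists>\<psi> \<phi> :: ppoint \<Rightarrow> ppoint \<times> ppoint \<Rightarrow> ppoint.
      \<exists>g :: ppoint \<Rightarrow> ppoint \<Rightarrow> ppoint \<Rightarrow> nat \<Rightarrow> nat \<Rightarrow> complex.
      (\<forall>a\<in>B. a \<in> U a \<and> openin (subtopology (zariski n) B) (U a) \<and>
             trivialization n m E r (U a) (\<psi> a) (\<phi> a)) \<and>
      (\<forall>a\<in>B. \<forall>b\<in>B. \<forall>i\<le>r. \<forall>j\<le>r. regular_fun n (U a \<inter> U b) (\<lambda>P. g a b P i j)) \<and>
      (\<forall>a\<in>B. \<forall>P\<in>U a. \<forall>i\<le>r. \<forall>j\<le>r. g a a P i j = (if i = j then 1 else 0)) \<and>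
      (\<forall>a\<in>B. \<forall>b\<in>B. \<forall>c\<in>B. \<forall>P\<in>U a \<inter> U b \<inter> U c. \<forall>i\<le>r. \<forall>k\<le>r.
         g a c P i k = (\<Sum>j\<le>r. g b c P i j * g a b P j k)) \<and>
      (\<forall>a\<in>B. \<forall>b\<in>B. \<forall>P\<in>U a \<inter> U b. \<forall>t\<in>proj_space r. \<forall>y\<in>t.
         (\<lambda>i. if i \<le> r then (\<Sum>j\<le>r. g a b P i j * y j) else 0) \<in> \<phi> b (P, \<psi> a (P, t))))"

text \<open>
  Finite fibres over a dense open set of the target.  The fibres may be empty, so the map need not be
  dominant.
\<close>

definition generically_finite_to_one :: "'b topology \<Rightarrow> ('a \<Rightarrow> 'b) \<Rightarrow> 'a set \<Rightarrow> bool" where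
  "generically_finite_to_one T f E \<longleftrightarrow>
     (\<exists>W. openin T W \<and> T closure_of W = topspace T \<and> (\<forall>w\<in>W. finite {e \<in> E. f e = w}))"


section \<open>The Zariski topologies are topologies\<close>

lemma monom_eval_superset:
  assumes "finite S" "Poly_Mapping.keys m \<subseteq> S"
  shows "monom_eval m x = (\<Prod>i\<in>S. x i ^ Poly_Mapping.lookup m i)"
  unfolding monom_eval_def
  by (rule prod.mono_neutral_left) (use assms in \<open>auto simp: not_in_keys_iff_lookup_eq_zero\<close>)

lemma monom_eval_add: "monom_eval (a + b) x = monom_eval a x * monom_eval b x"
proof -
  let ?S = "Poly_Mapping.keys a \<union> Poly_Mapping.keys b"
  have "Poly_Mapping.keys (a + b) \<subseteq> ?S" by (rule keys_add)
  then show ?thesis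
    by (simp add: monom_eval_superset[of ?S] lookup_add power_add prod.distrib)
qed

lemma poly_eval_superset:
  assumes "finite S" "Poly_Mapping.keys f \<subseteq> S"
  shows "poly_eval f x = (\<Sum>m\<in>S. Poly_Mapping.lookup f m * monom_eval m x)"
  unfolding poly_eval_def
  by (rule sum.mono_neutral_left) (use assms in \<open>auto simp: not_in_keys_iff_lookup_eq_zero\<close>)

lemma poly_eval_add: "poly_eval (f + g) x = poly_eval f x + poly_eval g x"
proof -
  let ?S = "Poly_Mapping.keys f \<union> Poly_Mapping.keys g"
  have "Poly_Mapping.keys (f + g) \<subseteq> ?S" by (rule keys_add)
  then show ?thesis
    by (simp add: poly_eval_superset[of ?S] lookup_add distrib_right sum.distrib)
qed

lemma poly_eval_0 [simp]: "poly_eval 0 x = 0"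
  by (simp add: poly_eval_def)

lemma poly_eval_single: "poly_eval (Poly_Mapping.single m c) x = c * monom_eval m x"
  by (subst poly_eval_superset[of "{m}"]) (auto simp: lookup_single)

lemma update_eq_add_single:
  assumes "k \<notin> Poly_Mapping.keys f"
  shows "Poly_Mapping.update k c f = f + Poly_Mapping.single k (c :: complex)"
  using assms
  by (intro poly_mapping_eqI) (auto simp: lookup_update lookup_add lookup_single when_def
      not_in_keys_iff_lookup_eq_zero)

lemma poly_eval_mult: "poly_eval (f * g) x = poly_eval f x * poly_eval g x"
proof (induction f rule: update_induct)
  case const
  then show ?case by simp
next
  case (update f a c)
  have "poly_eval (Poly_Mapping.single a c * g) x = c * monom_eval a x * poly_eval g x"
  proof (induction g rule: update_induct)
    case const
    then show ?case by simp
  next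
    case (update g b e)
    then show ?case
      by (simp add: update_eq_add_single distrib_left poly_eval_add mult_single
          poly_eval_single monom_eval_add algebra_simps)
  qed
  with update show ?case
    by (simp add: update_eq_add_single distrib_right poly_eval_add poly_eval_single)
qed

lemma forms_mult:
  assumes "f \<in> forms n d" "g \<in> forms n d'"
  shows "f * g \<in> forms n (d + d')"
  unfolding forms_def
proof safe
  fix m i assume "m \<in> Poly_Mapping.keys (f * g)"
  then obtain a b where m: "m = a + b" and ab: "a \<in> Poly_Mapping.keys f" "b \<in> Poly_Mapping.keys g"
    using keys_mult[of f g] by blast
  show "(\<Sum>i\<le>n. Poly_Mapping.lookup m i) = d + d'"
    using assms ab by (auto simp: forms_def m lookup_add sum.distrib)
  assume "i \<in> Poly_Mapping.keys m"
  then have "i \<in> Poly_Mapping.keys a \<union> Poly_Mapping.keys b"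
    using keys_add[of a b] m by blast
  then show "i \<le> n" using assms ab by (fastforce simp: forms_def)
qed

lemma biforms_mult:
  assumes "f \<in> biforms n k d e" "g \<in> biforms n k d' e'"
  shows "f * g \<in> biforms n k (d + d') (e + e')"
  unfolding biforms_def
proof (intro CollectI ballI conjI)
  fix m assume "m \<in> Poly_Mapping.keys (f * g)"
  then obtain a b where m: "m = a + b" and ab: "a \<in> Poly_Mapping.keys f" "b \<in> Poly_Mapping.keys g"
    using keys_mult[of f g] by blast
  show "(\<Sum>i\<le>n. Poly_Mapping.lookup m (Inl i)) = d + d'"
    "(\<Sum>i\<le>k. Poly_Mapping.lookup m (Inr i)) = e + e'"
    using assms ab by (auto simp: biforms_def m lookup_add sum.distrib)
  have "Poly_Mapping.keys m \<subseteq> Poly_Mapping.keys a \<union> Poly_Mapping.keys b"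
    using keys_add[of a b] m by blast
  moreover have "Poly_Mapping.keys a \<subseteq> Inl ` {..n} \<union> Inr ` {..k}"
    "Poly_Mapping.keys b \<subseteq> Inl ` {..n} \<union> Inr ` {..k}"
    using assms ab unfolding biforms_def by blast+
  ultimately show "Poly_Mapping.keys m \<subseteq> Inl ` {..n} \<union> Inr ` {..k}" by blast
qed

lemma poly_eval_scale:
  assumes "f \<in> forms n d"
  shows "poly_eval f (\<lambda>i. c * x i) = c ^ d * poly_eval f x"
proof -
  have "monom_eval m (\<lambda>i. c * x i) = c ^ d * monom_eval m x" if "m \<in> Poly_Mapping.keys f" for m
  proof -
    have m: "Poly_Mapping.keys m \<subseteq> {..n}" "(\<Sum>i\<le>n. Poly_Mapping.lookup m i) = d"
      using assms that by (auto simp: forms_def)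
    show ?thesis
      using m by (simp add: monom_eval_superset[of "{..n}"] power_mult_distrib prod.distrib
          flip: power_sum)
  qed
  then show ?thesis by (simp add: poly_eval_def sum_distrib_left algebra_simps)
qed

lemma poly_eval_biscale:
  assumes "f \<in> biforms n k d e"
  shows "poly_eval f (case_sum (\<lambda>i. b * x i) (\<lambda>j. c * y j)) = b ^ d * c ^ e * poly_eval f (case_sum x y)"
proof -
  let ?S = "Inl ` {..n} \<union> Inr ` {..k}"
  have split: "(\<Prod>i\<in>?S. h i) = (\<Prod>i\<le>n. h (Inl i)) * (\<Prod>j\<le>k. h (Inr j))"
    for h :: "nat + nat \<Rightarrow> complex"
    by (subst prod.union_disjoint) (auto simp: prod.reindex)
  have "monom_eval m (case_sum (\<lambda>i. b * x i) (\<lambda>j. c * y j)) = b ^ d * c ^ e * monom_eval m (case_sum x y)"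
    if "m \<in> Poly_Mapping.keys f" for m
  proof -
    have m: "Poly_Mapping.keys m \<subseteq> ?S" "(\<Sum>i\<le>n. Poly_Mapping.lookup m (Inl i)) = d"
      "(\<Sum>i\<le>k. Poly_Mapping.lookup m (Inr i)) = e"
      using assms that unfolding biforms_def by blast+
    show ?thesis
      using m by (simp add: monom_eval_superset[of ?S] split power_mult_distrib prod.distrib
          algebra_simps flip: power_sum)
  qed
  then show ?thesis by (simp add: poly_eval_def sum_distrib_left algebra_simps)
qed

lemma proj_space_rep:
  assumes "P \<in> proj_space n"
  obtains x where "x \<in> cvectors n - {0}" "P = {y. \<exists>c. c \<noteq> 0 \<and> y = (\<lambda>i. c * x i)}"
proof -
  obtain x where x: "x \<in> cvectors n - {0}" "P = proportional n `` {x}"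
    using assms by (auto simp: proj_space_def quotient_def)
  have "(\<lambda>i. c * x i) \<in> cvectors n - {0}" if "c \<noteq> 0" for c
    using x(1) that by (auto simp: cvectors_def fun_eq_iff)
  then have "P = {y. \<exists>c. c \<noteq> 0 \<and> y = (\<lambda>i. c * x i)}"
    using x by (auto simp: proportional_def)
  with x(1) show ?thesis using that by blast
qed

lemma zero_at_point_iff:
  assumes "P \<in> proj_space n" "f \<in> forms n d" "x \<in> P"
  shows "(\<forall>y\<in>P. poly_eval f y = 0) \<longleftrightarrow> poly_eval f x = 0"
proof -
  obtain z where P: "P = {y. \<exists>c. c \<noteq> 0 \<and> y = (\<lambda>i. c * z i)}"
    using proj_space_rep[OF assms(1)] by blast
  have "poly_eval f y = 0 \<longleftrightarrow> poly_eval f z = 0" if "y \<in> P" for y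
    using that poly_eval_scale[OF assms(2)] by (auto simp: P)
  then show ?thesis using assms(3) by blast
qed

lemma zero_at_pair_iff:
  assumes "P \<in> proj_space n" "Q \<in> proj_space k" "f \<in> biforms n k d e" "x \<in> P" "y \<in> Q"
  shows "(\<forall>x\<in>P. \<forall>y\<in>Q. poly_eval f (case_sum x y) = 0) \<longleftrightarrow> poly_eval f (case_sum x y) = 0"
proof -
  obtain z where P: "P = {y. \<exists>c. c \<noteq> 0 \<and> y = (\<lambda>i. c * z i)}"
    using proj_space_rep[OF assms(1)] by blast
  obtain w where Q: "Q = {y. \<exists>c. c \<noteq> 0 \<and> y = (\<lambda>i. c * w i)}"
    using proj_space_rep[OF assms(2)] by blast
  have "poly_eval f (case_sum x y) = 0 \<longleftrightarrow> poly_eval f (case_sum z w) = 0"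
    if "x \<in> P" "y \<in> Q" for x y
    using that poly_eval_biscale[OF assms(3)] by (auto simp: P Q)
  then show ?thesis using assms(4,5) by blast
qed

lemma proj_space_nonempty_point:
  assumes "P \<in> proj_space n"
  obtains x where "x \<in> P"
proof -
  obtain z where "P = {y. \<exists>c. c \<noteq> 0 \<and> y = (\<lambda>i. c * z i)}"
    using proj_space_rep[OF assms] by blast
  then have "(\<lambda>i. 1 * z i) \<in> P" using one_neq_zero by blast
  then show ?thesis using that by blast
qed

lemma istopology_zero_loci:
  assumes V: "\<And>F. V F = {p \<in> S. \<forall>f\<in>F. Z f p}"
    and mult: "\<And>f g. f \<in> A \<Longrightarrow> g \<in> A \<Longrightarrow> \<exists>h\<in>A. \<forall>p\<in>S. Z h p \<longleftrightarrow> Z f p \<or> Z g p"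
  shows "istopology (\<lambda>U. \<exists>F\<subseteq>A. U = S - V F)"
  unfolding istopology_def
proof (intro conjI allI impI)
  fix U U' assume "\<exists>F\<subseteq>A. U = S - V F" "\<exists>F\<subseteq>A. U' = S - V F"
  then obtain F G where F: "F \<subseteq> A" "U = S - V F" and G: "G \<subseteq> A" "U' = S - V G" by blast
  obtain h where h: "\<And>f g. f \<in> A \<Longrightarrow> g \<in> A \<Longrightarrow> h f g \<in> A \<and> (\<forall>p\<in>S. Z (h f g) p \<longleftrightarrow> Z f p \<or> Z g p)"
    using mult by metis
  let ?H = "{h f g | f g. f \<in> F \<and> g \<in> G}"
  have "?H \<subseteq> A" using h F(1) G(1) by blast
  moreover have "U \<inter> U' = S - V ?H"
  proof (rule set_eqI)
    fix p
    show "p \<in> U \<inter> U' \<longleftrightarrow> p \<in> S - V ?H"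
    proof (cases "p \<in> S")
      case True
      have "(\<forall>k\<in>?H. Z k p) \<longleftrightarrow> (\<forall>f\<in>F. \<forall>g\<in>G. Z (h f g) p)" by blast
      also have "\<dots> \<longleftrightarrow> (\<forall>f\<in>F. \<forall>g\<in>G. Z f p \<or> Z g p)"
        using h True F(1) G(1) by (meson subsetD)
      finally show ?thesis using True by (auto simp: F(2) G(2) V)
    qed (simp add: F(2))
  qed
  ultimately show "\<exists>F\<subseteq>A. U \<inter> U' = S - V F" by blast
next
  fix K assume K: "\<forall>U\<in>K. \<exists>F\<subseteq>A. U = S - V F"
  then obtain F where F: "\<And>U. U \<in> K \<Longrightarrow> F U \<subseteq> A \<and> U = S - V (F U)" by metis
  have "\<Union>K = (\<Union>U\<in>K. S - V (F U))" using F by auto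
  also have "\<dots> = S - V (\<Union>(F ` K))" by (auto simp: V)
  finally have "\<Union>K = S - V (\<Union>(F ` K))" .
  moreover have "\<Union>(F ` K) \<subseteq> A" using F by blast
  ultimately show "\<exists>F\<subseteq>A. \<Union>K = S - V F" by blast
qed

lemma openin_zariski:
  "openin (zariski n) U \<longleftrightarrow> (\<exists>F \<subseteq> (\<Union>d. forms n d). U = proj_space n - proj_zeros n F)"
proof -
  have "istopology (\<lambda>U. \<exists>F\<subseteq>(\<Union>d. forms n d). U = proj_space n - proj_zeros n F)"
  proof (rule istopology_zero_loci[where Z = "\<lambda>f P. \<forall>x\<in>P. poly_eval f x = 0"])
    fix f g assume "f \<in> (\<Union>d. forms n d)" "g \<in> (\<Union>d. forms n d)"
    then obtain d e where fg: "f \<in> forms n d" "g \<in> forms n e" by blast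
    have "(\<forall>x\<in>P. poly_eval (f * g) x = 0) \<longleftrightarrow>
        (\<forall>x\<in>P. poly_eval f x = 0) \<or> (\<forall>x\<in>P. poly_eval g x = 0)" if P: "P \<in> proj_space n" for P
    proof -
      obtain x where x: "x \<in> P" using proj_space_nonempty_point[OF P] .
      show ?thesis
        using zero_at_point_iff[OF P fg(1) x] zero_at_point_iff[OF P fg(2) x]
          zero_at_point_iff[OF P forms_mult[OF fg] x]
        by (simp only: poly_eval_mult mult_eq_0_iff)
    qed
    then show "\<exists>h\<in>(\<Union>d. forms n d). \<forall>P\<in>proj_space n. (\<forall>x\<in>P. poly_eval h x = 0) \<longleftrightarrow>
        (\<forall>x\<in>P. poly_eval f x = 0) \<or> (\<forall>x\<in>P. poly_eval g x = 0)"
      using forms_mult[OF fg] by blast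
  qed (simp add: proj_zeros_def)
  then show ?thesis unfolding zariski_def by simp
qed

lemma openin_bizariski:
  "openin (bizariski n k) U \<longleftrightarrow>
     (\<exists>F \<subseteq> (\<Union>d e. biforms n k d e). U = proj_space n \<times> proj_space k - biproj_zeros n k F)"
proof -
  let ?Z = "\<lambda>f (P, Q). \<forall>x\<in>P. \<forall>y\<in>Q. poly_eval f (case_sum x y) = 0"
  let ?A = "\<Union>d e. biforms n k d e"
  have "istopology (\<lambda>U. \<exists>F\<subseteq>?A. U = proj_space n \<times> proj_space k - biproj_zeros n k F)"
  proof (rule istopology_zero_loci[where Z = ?Z])
    fix f g assume "f \<in> ?A" "g \<in> ?A"
    then obtain d e d' e' where fg: "f \<in> biforms n k d e" "g \<in> biforms n k d' e'" by blast
    have "?Z (f * g) p \<longleftrightarrow> ?Z f p \<or> ?Z g p" if "p \<in> proj_space n \<times> proj_space k" for p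
    proof -
      obtain P Q where p: "p = (P, Q)" by (cases p)
      with that have PQ: "P \<in> proj_space n" "Q \<in> proj_space k" by auto
      obtain x where x: "x \<in> P" using proj_space_nonempty_point[OF PQ(1)] .
      obtain y where y: "y \<in> Q" using proj_space_nonempty_point[OF PQ(2)] .
      show ?thesis
        using zero_at_pair_iff[OF PQ fg(1) x y] zero_at_pair_iff[OF PQ fg(2) x y]
          zero_at_pair_iff[OF PQ biforms_mult[OF fg] x y]
        by (simp only: p prod.case poly_eval_mult mult_eq_0_iff)
    qed
    then show "\<exists>h\<in>?A. \<forall>p\<in>proj_space n \<times> proj_space k. ?Z h p \<longleftrightarrow> ?Z f p \<or> ?Z g p"
      using biforms_mult[OF fg] by blast
  qed (auto simp: biproj_zeros_def)
  then show ?thesis unfolding bizariski_def by simp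
qed

lemma forms_one: "1 \<in> forms n 0"
  by (simp add: forms_def)

lemma poly_eval_one [simp]: "poly_eval 1 x = 1"
  using poly_eval_single[of 0 1 x] by (simp add: monom_eval_def)

lemma topspace_zariski [simp]: "topspace (zariski n) = proj_space n"
proof -
  have empty: "proj_zeros n {1} = {}"
  proof (rule equals0I)
    fix P assume "P \<in> proj_zeros n {1}"
    then have "P \<in> proj_space n" and z: "\<forall>x\<in>P. poly_eval 1 x = 0"
      unfolding proj_zeros_def by blast+
    then obtain x where "x \<in> P" using proj_space_nonempty_point by metis
    with z show False by force
  qed
  have "{1} \<subseteq> (\<Union>d. forms n d)" using forms_one by blast
  moreover have "proj_space n = proj_space n - proj_zeros n {1}" by (simp only: empty Diff_empty)
  ultimately have "openin (zariski n) (proj_space n)" unfolding openin_zariski by blast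
  moreover have "U \<subseteq> proj_space n" if "openin (zariski n) U" for U
    using that unfolding openin_zariski by blast
  ultimately show ?thesis unfolding topspace_def by blast
qed

lemma topspace_bizariski [simp]: "topspace (bizariski n k) = proj_space n \<times> proj_space k"
proof -
  let ?S = "proj_space n \<times> proj_space k"
  have empty: "biproj_zeros n k {1} = {}"
  proof (rule equals0I)
    fix p assume p: "p \<in> biproj_zeros n k {1}"
    obtain P Q where pq: "p = (P, Q)" by (cases p)
    have PQ: "P \<in> proj_space n" "Q \<in> proj_space k"
      and z: "\<forall>x\<in>P. \<forall>y\<in>Q. poly_eval 1 (case_sum x y) = 0"
      using p unfolding biproj_zeros_def pq by blast+
    obtain x where "x \<in> P" using proj_space_nonempty_point[OF PQ(1)] .
    moreover obtain y where "y \<in> Q" using proj_space_nonempty_point[OF PQ(2)] .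
    ultimately have "poly_eval 1 (case_sum x y) = 0" using z by blast
    then show False by simp
  qed
  have "1 \<in> biforms n k 0 0" by (simp add: biforms_def)
  then have "{1} \<subseteq> (\<Union>d e. biforms n k d e)" by blast
  moreover have "?S = ?S - biproj_zeros n k {1}" by (simp only: empty Diff_empty)
  ultimately have "openin (bizariski n k) ?S" unfolding openin_bizariski by blast
  moreover have "U \<subseteq> ?S" if "openin (bizariski n k) U" for U
    using that unfolding openin_bizariski by blast
  ultimately show ?thesis unfolding topspace_def by blast
qed

lemma complement_eq_iff: "A \<subseteq> S \<Longrightarrow> C \<subseteq> S \<and> S - C = S - A \<longleftrightarrow> C = A"
  by blast

lemma closedin_zariski:
  "closedin (zariski n) C \<longleftrightarrow> (\<exists>F \<subseteq> (\<Union>d. forms n d). C = proj_zeros n F)"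
proof -
  have "proj_zeros n F \<subseteq> proj_space n" for F unfolding proj_zeros_def by blast
  note eq = complement_eq_iff[OF this, where C = C]
  show ?thesis
    unfolding closedin_def openin_zariski topspace_zariski eq[symmetric] by blast
qed

lemma closedin_bizariski:
  "closedin (bizariski n k) C \<longleftrightarrow> (\<exists>F \<subseteq> (\<Union>d e. biforms n k d e). C = biproj_zeros n k F)"
proof -
  let ?S = "proj_space n \<times> proj_space k"
  have "biproj_zeros n k F \<subseteq> ?S" for F unfolding biproj_zeros_def by blast
  note eq = complement_eq_iff[OF this, where C = C]
  show ?thesis
    unfolding closedin_def openin_bizariski topspace_bizariski eq[symmetric] by blast
qed

end

theory Submission
  imports Defs "HOL-Complex_Analysis.Complex_Analysis" "Jordan_Normal_Form.Determinant"
begin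

text \<open>
  Write \<open>S\<close> for the cone over \<open>X\<close>. In characteristic zero, the derivations along a transcendence basis of the
  coordinate functions extend to all coordinates, so the tangent space at a general point of \<open>S\<close> has the
  transcendence degree as its dimension. Flowing along these derivations (power series, controlled by Cauchy's
  estimates) produces chains of irreducible closed sets of full length; as the transcendence degree drops strictly
  along every such chain, the Krull dimension equals the transcendence degree.

  At a smooth point off the arrangement, choose forms whose gradients span the conormal space. The critical
  data are then a linear space of dimension \<open>n + 1 - dim X\<close> with a frame that is polynomial in the point, the
  inverse being given by an adjugate matrix. This yields the local trivializations, and with them irreducibility
  and the dimension \<open>dim X + (n - dim X) = n\<close>. The dimension forces any two coordinates of \<open>p\<close> to satisfy a
  homogeneous equation over \<open>u\<close>, so that a general fibre of the second projection is finite.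
\<close>

section \<open>Polynomial functions and derivations\<close>

text \<open>The algebra is carried by point sets and polynomial functions: a set counts as
  irreducible when the polynomials vanishing on it form a prime ideal, whether or not the set is
  closed. Images, torus orbits and pieces of flow lines can then stand in for varieties, and only
  their ideals have to survive the passage to closures. The obstacle is the lower bound for a Krull
  dimension, which asks for actual chains. One flow step enlarges an irreducible set to an
  irreducible set, because orders of vanishing along a derivation add up in a product. Projective
  space and the product of two of them differ only in the number of scalings, so the count is made
  once for spaces of torus orbits, the dimension being the rank of the cone minus the rank of the
  torus. The correspondence is studied before \<open>u\<close> is made projective, zero data
  included, since its fibres are then linear spaces. Frame vectors share one degree and inverses are
  kept up to a polynomial factor, so that the frame equations are polynomial, persist on the
  closure, and show that the closure adds no points over the smooth points off the
  arrangement.\<close>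

inductive_set poly_funs :: "'v set \<Rightarrow> (('v \<Rightarrow> complex) \<Rightarrow> complex) set" for V where
  const: "(\<lambda>x. c) \<in> poly_funs V"
| var: "v \<in> V \<Longrightarrow> (\<lambda>x. x v) \<in> poly_funs V"
| add: "f \<in> poly_funs V \<Longrightarrow> g \<in> poly_funs V \<Longrightarrow> (\<lambda>x. f x + g x) \<in> poly_funs V"
| mult: "f \<in> poly_funs V \<Longrightarrow> g \<in> poly_funs V \<Longrightarrow> (\<lambda>x. f x * g x) \<in> poly_funs V"

lemma poly_funs_diff:
  assumes "f \<in> poly_funs V" "g \<in> poly_funs V"
  shows "(\<lambda>x. f x - g x) \<in> poly_funs V"
  using poly_funs.add[OF assms(1) poly_funs.mult[OF poly_funs.const[of "-1"] assms(2)]] by simp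

lemma poly_funs_uminus:
  assumes "f \<in> poly_funs V"
  shows "(\<lambda>x. - f x) \<in> poly_funs V"
  using poly_funs.mult[OF poly_funs.const[of "-1"] assms] by simp

lemma poly_funs_sum:
  assumes "\<And>i. i \<in> A \<Longrightarrow> f i \<in> poly_funs V"
  shows "(\<lambda>x. \<Sum>i\<in>A. f i x) \<in> poly_funs V"
proof (cases "finite A")
  case True
  then show ?thesis using assms
    by (induction A) (auto intro: poly_funs.const poly_funs.add)
qed (auto intro: poly_funs.const)

lemma poly_funs_prod:
  assumes "\<And>i. i \<in> A \<Longrightarrow> f i \<in> poly_funs V"
  shows "(\<lambda>x. \<Prod>i\<in>A. f i x) \<in> poly_funs V"
proof (cases "finite A")
  case True
  then show ?thesis using assms
    by (induction A) (auto intro: poly_funs.const poly_funs.mult)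
qed (auto intro: poly_funs.const)

lemma poly_funs_power:
  assumes "f \<in> poly_funs V"
  shows "(\<lambda>x. f x ^ k) \<in> poly_funs V"
  by (induction k) (auto intro: poly_funs.const poly_funs.mult assms)

lemmas poly_funs_intros = poly_funs.intros poly_funs_diff poly_funs_uminus poly_funs_sum
  poly_funs_prod poly_funs_power

lemma poly_funs_mono:
  assumes "f \<in> poly_funs U" "U \<subseteq> V"
  shows "f \<in> poly_funs V"
  using assms(1) by induction (use assms(2) in \<open>auto intro: poly_funs.intros\<close>)

lemma poly_funs_cong:
  assumes "f \<in> poly_funs V" "\<And>v. v \<in> V \<Longrightarrow> x v = y v"
  shows "f x = f y"
  using assms(1) by induction (use assms(2) in auto)

lemma poly_funs_comp:
  assumes "f \<in> poly_funs W" "\<And>w. w \<in> W \<Longrightarrow> g w \<in> poly_funs V"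
  shows "(\<lambda>x. f (\<lambda>w. g w x)) \<in> poly_funs V"
  using assms(1) by induction (use assms(2) in \<open>auto intro: poly_funs.intros\<close>)

section \<open>Partial derivatives and derivations with polynomial coefficients\<close>

definition pd :: "'v \<Rightarrow> (('v \<Rightarrow> complex) \<Rightarrow> complex) \<Rightarrow> ('v \<Rightarrow> complex) \<Rightarrow> complex" where
  "pd i f x = deriv (\<lambda>t. f (x(i := t))) (x i)"

lemma poly_funs_differentiable:
  assumes "f \<in> poly_funs V"
  shows "(\<lambda>t. f (x(i := t))) field_differentiable at s"
  using assms
proof induction
  case (var v)
  then show ?case by (cases "v = i") auto
qed (auto intro: field_differentiable_add field_differentiable_mult)

lemma poly_funs_has_pd:
  assumes "f \<in> poly_funs V"
  shows "((\<lambda>t. f (x(i := t))) has_field_derivative pd i f x) (at (x i))"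
  unfolding pd_def DERIV_deriv_iff_field_differentiable
  by (rule poly_funs_differentiable[OF assms])

lemma pd_const [simp]: "pd i (\<lambda>x. c) = (\<lambda>x. 0)"
  by (simp add: pd_def fun_eq_iff)

lemma pd_var: "pd i (\<lambda>x. x v) = (\<lambda>x. if v = i then 1 else 0)"
  by (cases "v = i") (simp_all add: pd_def fun_eq_iff)

lemma pd_add:
  assumes "f \<in> poly_funs V" "g \<in> poly_funs V"
  shows "pd i (\<lambda>x. f x + g x) = (\<lambda>x. pd i f x + pd i g x)"
proof
  fix x
  have "((\<lambda>t. f (x(i := t)) + g (x(i := t))) has_field_derivative pd i f x + pd i g x) (at (x i))"
    by (intro DERIV_add poly_funs_has_pd[OF assms(1)] poly_funs_has_pd[OF assms(2)])
  then show "pd i (\<lambda>x. f x + g x) x = pd i f x + pd i g x"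
    unfolding pd_def[of i "\<lambda>x. f x + g x"] by (rule DERIV_imp_deriv)
qed

lemma pd_mult:
  assumes "f \<in> poly_funs V" "g \<in> poly_funs V"
  shows "pd i (\<lambda>x. f x * g x) = (\<lambda>x. pd i f x * g x + pd i g x * f x)"
proof
  fix x
  have "((\<lambda>t. f (x(i := t)) * g (x(i := t))) has_field_derivative
      pd i f x * g (x(i := x i)) + pd i g x * f (x(i := x i))) (at (x i))"
    by (intro DERIV_mult poly_funs_has_pd[OF assms(1)] poly_funs_has_pd[OF assms(2)])
  then show "pd i (\<lambda>x. f x * g x) x = pd i f x * g x + pd i g x * f x"
    unfolding pd_def[of i "\<lambda>x. f x * g x"] by (simp add: DERIV_imp_deriv)
qed

lemma pd_in_poly_funs:
  assumes "f \<in> poly_funs V"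
  shows "pd i f \<in> poly_funs V"
  using assms
  by induction (auto simp: pd_var pd_add pd_mult intro!: poly_funs.intros)

lemma pd_outside:
  assumes "f \<in> poly_funs V" "i \<notin> V"
  shows "pd i f = (\<lambda>x. 0)"
  using assms(1)
  by induction (use assms(2) in \<open>auto simp: pd_var pd_add pd_mult\<close>)

lemma pd_comp:
  assumes "f \<in> poly_funs W" "finite W" "\<And>w. w \<in> W \<Longrightarrow> g w \<in> poly_funs V"
  shows "pd i (\<lambda>x. f (\<lambda>w. g w x)) = (\<lambda>x. \<Sum>w\<in>W. pd w f (\<lambda>w. g w x) * pd i (g w) x)"
  using assms(1)
proof induction
  case (const c)
  then show ?case by simp
next
  case (var v)
  have "(\<Sum>w\<in>W. pd w (\<lambda>x. x v) (\<lambda>w. g w x) * pd i (g w) x) = (\<Sum>w\<in>W. if w = v then pd i (g w) x else 0)"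
    for x
    by (intro sum.cong) (auto simp: pd_var)
  then show ?case using assms(2) var by simp
next
  case (add f h)
  note c = poly_funs_comp[OF _ assms(3)]
  have "pd i (\<lambda>x. f (\<lambda>w. g w x) + h (\<lambda>w. g w x)) =
      (\<lambda>x. pd i (\<lambda>x. f (\<lambda>w. g w x)) x + pd i (\<lambda>x. h (\<lambda>w. g w x)) x)"
    by (rule pd_add[OF c[OF add.hyps(1)] c[OF add.hyps(2)]])
  then show ?case
    unfolding pd_add[OF add.hyps] add.IH by (simp add: sum.distrib algebra_simps)
next
  case (mult f h)
  note c = poly_funs_comp[OF _ assms(3)]
  have "pd i (\<lambda>x. f (\<lambda>w. g w x) * h (\<lambda>w. g w x)) =
      (\<lambda>x. pd i (\<lambda>x. f (\<lambda>w. g w x)) x * h (\<lambda>w. g w x) + pd i (\<lambda>x. h (\<lambda>w. g w x)) x * f (\<lambda>w. g w x))"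
    by (rule pd_mult[OF c[OF mult.hyps(1)] c[OF mult.hyps(2)]])
  then show ?case
    unfolding pd_mult[OF mult.hyps] mult.IH by (simp add: sum.distrib algebra_simps sum_distrib_left)
qed

definition der :: "'v set \<Rightarrow> ('v \<Rightarrow> ('v \<Rightarrow> complex) \<Rightarrow> complex) \<Rightarrow> (('v \<Rightarrow> complex) \<Rightarrow> complex) \<Rightarrow>
    ('v \<Rightarrow> complex) \<Rightarrow> complex" where
  "der V w f x = (\<Sum>v\<in>V. w v x * pd v f x)"

lemma der_const [simp]: "der V w (\<lambda>x. c) = (\<lambda>x. 0)"
  by (simp add: der_def fun_eq_iff)

lemma der_var: "finite V \<Longrightarrow> v \<in> V \<Longrightarrow> der V w (\<lambda>x. x v) = w v"
  by (simp add: der_def fun_eq_iff pd_var if_distrib sum.delta' cong: if_cong)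

lemma der_add:
  assumes "f \<in> poly_funs V" "g \<in> poly_funs V"
  shows "der W w (\<lambda>x. f x + g x) = (\<lambda>x. der W w f x + der W w g x)"
  by (simp add: der_def fun_eq_iff pd_add[OF assms] sum.distrib algebra_simps)

lemma der_mult:
  assumes "f \<in> poly_funs V" "g \<in> poly_funs V"
  shows "der W w (\<lambda>x. f x * g x) = (\<lambda>x. der W w f x * g x + f x * der W w g x)"
  by (simp add: der_def fun_eq_iff pd_mult[OF assms] sum.distrib sum_distrib_left sum_distrib_right
      algebra_simps)

lemma der_uminus:
  assumes "f \<in> poly_funs V"
  shows "der W w (\<lambda>x. - f x) = (\<lambda>x. - der W w f x)"
  using der_mult[OF poly_funs.const[of "-1"] assms, of W w] by simp

lemma der_diff:
  assumes "f \<in> poly_funs V" "g \<in> poly_funs V"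
  shows "der W w (\<lambda>x. f x - g x) = (\<lambda>x. der W w f x - der W w g x)"
  using der_add[OF assms(1) poly_funs_uminus[OF assms(2)], of W w] by (simp add: der_uminus[OF assms(2)])

lemma der_sum:
  assumes "\<And>i. i \<in> A \<Longrightarrow> f i \<in> poly_funs V"
  shows "der W w (\<lambda>x. \<Sum>i\<in>A. f i x) = (\<lambda>x. \<Sum>i\<in>A. der W w (f i) x)"
proof (cases "finite A")
  case True
  then show ?thesis using assms
  proof induction
    case (insert a A)
    have "der W w (\<lambda>x. f a x + (\<Sum>i\<in>A. f i x)) = (\<lambda>x. der W w (f a) x + der W w (\<lambda>x. \<Sum>i\<in>A. f i x) x)"
      by (rule der_add) (use insert in \<open>auto intro: poly_funs_sum\<close>)
    then show ?case using insert by simp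
  qed simp
qed simp

lemma der_in_poly_funs:
  assumes "f \<in> poly_funs V" "\<And>v. v \<in> W \<Longrightarrow> w v \<in> poly_funs V"
  shows "der W w f \<in> poly_funs V"
  unfolding der_def[abs_def] by (intro poly_funs_intros pd_in_poly_funs assms)

lemma der_cong_set:
  assumes "f \<in> poly_funs U" "U \<subseteq> V" "finite V"
  shows "der V w f = der U w f"
  unfolding der_def fun_eq_iff
  by (intro allI sum.mono_neutral_right) (use assms pd_outside[OF assms(1)] in auto)

lemma der_power:
  assumes "f \<in> poly_funs V"
  shows "der W w (\<lambda>x. f x ^ k) = (\<lambda>x. of_nat k * f x ^ (k - 1) * der W w f x)"
proof (induction k)
  case (Suc k)
  have "der W w (\<lambda>x. f x * f x ^ k) = (\<lambda>x. der W w f x * f x ^ k + f x * der W w (\<lambda>x. f x ^ k) x)"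
    by (rule der_mult[OF assms poly_funs_power[OF assms]])
  then show ?case using Suc by (cases k) (simp_all add: fun_eq_iff algebra_simps)
qed simp

lemma pd_eq_der: "pd i f = der {i} (\<lambda>v x. 1) f"
  by (simp add: der_def fun_eq_iff)

section \<open>Expansion in one variable and the absence of zero divisors\<close>

lemma poly_funs_expand:
  assumes "f \<in> poly_funs (insert y U)"
  shows "\<exists>N c. (\<forall>k. c k \<in> poly_funs U) \<and> f = (\<lambda>x. \<Sum>k\<le>N. c k x * x y ^ k)"
proof -
  \<comment> \<open>\<open>Q\<close> is shown to be closed under sums and products, so that the rule
    induction at the end only meets generators. \<open>N\<close> merely bounds the degree; missing
    coefficients are padded with zero.\<close>
  define Q where "Q = {f. \<exists>(N::nat) c. (\<forall>k. c k \<in> poly_funs U) \<and> f = (\<lambda>x. \<Sum>k\<le>N. c k x * x y ^ k)}"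
  have mono: "(\<lambda>x. c x * x y ^ m) \<in> Q" if "c \<in> poly_funs U" for c m
  proof -
    have "(\<lambda>x. c x * x y ^ m) = (\<lambda>x. \<Sum>k\<le>m. (if k = m then c else (\<lambda>x. 0)) x * x y ^ k)"
      by (simp add: fun_eq_iff if_distrib [where f = "\<lambda>h. h _"] sum.delta if_distribR cong: if_cong)
         (simp add: if_distrib[where f = "\<lambda>h. h * _"] sum.delta cong: if_cong)
    moreover have "\<forall>k. (if k = m then c else (\<lambda>x. 0)) \<in> poly_funs U"
      using that by (auto intro: poly_funs.intros)
    ultimately show ?thesis unfolding Q_def mem_Collect_eq
      by (intro exI[of _ m] exI[of _ "\<lambda>k. if k = m then c else (\<lambda>x. 0)"] conjI)
  qed
  have add: "(\<lambda>x. f x + g x) \<in> Q" if fg: "f \<in> Q" "g \<in> Q" for f g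
  proof -
    obtain N c where c: "\<forall>k. c k \<in> poly_funs U" "f = (\<lambda>x. \<Sum>k\<le>(N::nat). c k x * x y ^ k)"
      using fg(1) unfolding Q_def by blast
    obtain M d where d: "\<forall>k. d k \<in> poly_funs U" "g = (\<lambda>x. \<Sum>k\<le>(M::nat). d k x * x y ^ k)"
      using fg(2) unfolding Q_def by blast
    let ?e = "\<lambda>k x. (if k \<le> N then c k x else 0) + (if k \<le> M then d k x else 0)"
    have "?e k \<in> poly_funs U" for k
      using c(1) d(1) by (cases "k \<le> N"; cases "k \<le> M") (auto intro: poly_funs.intros)
    moreover have "(\<lambda>x. f x + g x) = (\<lambda>x. \<Sum>k\<le>max N M. ?e k x * x y ^ k)"
    proof
      fix x
      have "f x = (\<Sum>k\<le>max N M. (if k \<le> N then c k x else 0) * x y ^ k)"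
        unfolding c(2) by (intro sum.mono_neutral_cong_left) auto
      moreover have "g x = (\<Sum>k\<le>max N M. (if k \<le> M then d k x else 0) * x y ^ k)"
        unfolding d(2) by (intro sum.mono_neutral_cong_left) auto
      ultimately show "f x + g x = (\<Sum>k\<le>max N M. ?e k x * x y ^ k)"
        by (simp only: sum.distrib distrib_right)
    qed
    ultimately show ?thesis unfolding Q_def mem_Collect_eq by (intro exI[of _ "max N M"] exI[of _ ?e]) simp
  qed
  have sum: "(\<lambda>x. \<Sum>i\<in>A. h i x) \<in> Q" if "finite A" "\<And>i. i \<in> A \<Longrightarrow> h i \<in> Q" for A and h :: "'b \<Rightarrow> _"
    using that
    by (induction A) (auto intro: add mono[OF poly_funs.const, of 0 0, simplified])
  have mult: "(\<lambda>x. f x * g x) \<in> Q" if fg: "f \<in> Q" "g \<in> Q" for f g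
  proof -
    obtain N c where c: "\<forall>k. c k \<in> poly_funs U" "f = (\<lambda>x. \<Sum>k\<le>(N::nat). c k x * x y ^ k)"
      using fg(1) unfolding Q_def by blast
    obtain M d where d: "\<forall>k. d k \<in> poly_funs U" "g = (\<lambda>x. \<Sum>k\<le>(M::nat). d k x * x y ^ k)"
      using fg(2) unfolding Q_def by blast
    have "(\<lambda>x. \<Sum>p\<in>{..N}\<times>{..M}. (c (fst p) x * d (snd p) x) * x y ^ (fst p + snd p)) \<in> Q"
      by (intro sum mono poly_funs.mult) (use c(1) d(1) in auto)
    moreover have "(\<lambda>x. f x * g x) = (\<lambda>x. \<Sum>p\<in>{..N}\<times>{..M}. (c (fst p) x * d (snd p) x) * x y ^ (fst p + snd p))"
      unfolding c(2) d(2) sum_product sum.cartesian_product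
      by (intro ext sum.cong) (auto simp: power_add)
    ultimately show ?thesis by simp
  qed
  have "f \<in> Q" using assms
  proof induction
    case (const c)
    show ?case using mono[OF poly_funs.const, of c 0] by simp
  next
    case (var v)
    show ?case
      using mono[OF poly_funs.const, of 1 1] mono[OF poly_funs.var, of v 0] var by (cases "v = y") auto
  qed (auto intro: add mult)
  then show ?thesis unfolding Q_def by blast
qed

text \<open>In the expansion along the last variable each nonzero factor has a nonzero coefficient,
  and by induction one such coefficient of each is nonzero at a common point. Freezing the other
  variables there leaves two nonzero univariate polynomials, whose product cannot have every number
  as a root.\<close>

lemma poly_funs_nonzero_mult:
  assumes "finite V" "f \<in> poly_funs V" "g \<in> poly_funs V" "\<And>x. f x * g x = 0"
  shows "f = (\<lambda>x. 0) \<or> g = (\<lambda>x. 0)"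
  using assms
proof (induction V arbitrary: f g)
  case empty
  have "f x = f (\<lambda>_. 0)" "g x = g (\<lambda>_. 0)" for x
    using poly_funs_cong[OF empty(1), of x "\<lambda>_. 0"] poly_funs_cong[OF empty(2), of x "\<lambda>_. 0"] by auto
  then show ?case using empty(3)[of "\<lambda>_. 0"] by (auto simp: fun_eq_iff)
next
  case (insert y U)
  obtain N c where c: "\<And>k. c k \<in> poly_funs U" "f = (\<lambda>x. \<Sum>k\<le>(N::nat). c k x * x y ^ k)"
    using poly_funs_expand[OF insert.prems(1)] by blast
  obtain M d where d: "\<And>k. d k \<in> poly_funs U" "g = (\<lambda>x. \<Sum>k\<le>(M::nat). d k x * x y ^ k)"
    using poly_funs_expand[OF insert.prems(2)] by blast
  show ?case
  proof (rule ccontr)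
    assume nz: "\<not> ?thesis"
    obtain k l where k: "c k \<noteq> (\<lambda>x. 0)" "k \<le> N" and l: "d l \<noteq> (\<lambda>x. 0)" "l \<le> M"
    proof -
      have "\<exists>k\<le>N. c k \<noteq> (\<lambda>x. 0)" using nz unfolding c(2) by (auto intro!: sum.neutral)
      moreover have "\<exists>l\<le>M. d l \<noteq> (\<lambda>x. 0)" using nz unfolding d(2) by (auto intro!: sum.neutral)
      ultimately show ?thesis using that by blast
    qed
    have "\<exists>x. c k x * d l x \<noteq> 0"
      using insert.IH[OF c(1) d(1), of k l] k l by blast
    then obtain x where x: "c k x \<noteq> 0" "d l x \<noteq> 0" by auto
    define p where "p = (\<Sum>k\<le>N. monom (c k x) k)"
    define q where "q = (\<Sum>k\<le>M. monom (d k x) k)"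
    have "coeff p k \<noteq> 0" "coeff q l \<noteq> 0"
      using x k l by (auto simp: p_def q_def coeff_sum)
    then have "p * q \<noteq> 0" by force
    moreover have "poly (p * q) t = 0" for t
    proof -
      have "c k (x(y := t)) = c k x" "d k (x(y := t)) = d k x" for k
        using insert.hyps by (auto intro: poly_funs_cong[OF c(1)] poly_funs_cong[OF d(1)])
      then have "f (x(y := t)) = poly p t" "g (x(y := t)) = poly q t"
        by (simp_all add: c(2) d(2) p_def q_def poly_sum poly_monom)
      then show ?thesis using insert.prems(3)[of "x(y := t)"] by (simp only: poly_mult)
    qed
    ultimately show False using poly_all_0_iff_0 by blast
  qed
qed

section \<open>Transcendence bases\<close>

definition vanishes :: "('v \<Rightarrow> complex) set \<Rightarrow> (('v \<Rightarrow> complex) \<Rightarrow> complex) \<Rightarrow> bool" where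
  "vanishes S f \<longleftrightarrow> (\<forall>x\<in>S. f x = 0)"

text \<open>The ideal of \<open>S\<close> is prime. Since \<open>S\<close> need not be closed,
  orbits and images of polynomial maps qualify.\<close>

definition irred :: "'v set \<Rightarrow> ('v \<Rightarrow> complex) set \<Rightarrow> bool" where
  "irred V S \<longleftrightarrow> S \<noteq> {} \<and> (\<forall>f\<in>poly_funs V. \<forall>g\<in>poly_funs V.
     vanishes S (\<lambda>x. f x * g x) \<longrightarrow> vanishes S f \<or> vanishes S g)"

text \<open>Algebraic independence of the coordinates \<open>J\<close> in the coordinate ring of
  \<open>S\<close>; maximal such sets are transcendence bases.\<close>

definition indep :: "('v \<Rightarrow> complex) set \<Rightarrow> 'v set \<Rightarrow> bool" where
  "indep S J \<longleftrightarrow> (\<forall>f\<in>poly_funs J. vanishes S f \<longrightarrow> f = (\<lambda>x. 0))"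

definition basis_of :: "'v set \<Rightarrow> ('v \<Rightarrow> complex) set \<Rightarrow> 'v set \<Rightarrow> bool" where
  "basis_of V S J \<longleftrightarrow> J \<subseteq> V \<and> indep S J \<and> (\<forall>y\<in>V - J. \<not> indep S (insert y J))"

lemma irred_mult:
  assumes "irred V S" "f \<in> poly_funs V" "g \<in> poly_funs V" "\<not> vanishes S f" "\<not> vanishes S g"
  shows "\<not> vanishes S (\<lambda>x. f x * g x)"
  using assms unfolding irred_def by blast

lemma irred_prod:
  assumes "irred V S" "finite A" "\<And>a. a \<in> A \<Longrightarrow> f a \<in> poly_funs V" "\<And>a. a \<in> A \<Longrightarrow> \<not> vanishes S (f a)"
  shows "\<not> vanishes S (\<lambda>x. \<Prod>a\<in>A. f a x)"
  using assms(2-)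
proof induction
  case empty
  then show ?case using assms(1) by (simp add: irred_def vanishes_def)
next
  case (insert a A)
  then show ?case
    using irred_mult[OF assms(1), of "f a" "\<lambda>x. \<Prod>a\<in>A. f a x"] poly_funs_prod[of A f V] by auto
qed

lemma irred_mono:
  assumes "irred V S" "U \<subseteq> V"
  shows "irred U S"
  using assms poly_funs_mono[OF _ assms(2)] unfolding irred_def by blast

lemma indep_superset:
  assumes "indep S J" "\<And>f. f \<in> poly_funs J \<Longrightarrow> vanishes S' f \<Longrightarrow> vanishes S f"
  shows "indep S' J"
  using assms unfolding indep_def by blast

lemma indep_extends_to_basis:
  assumes "finite V" "indep S K" "K \<subseteq> V"
  shows "\<exists>J. K \<subseteq> J \<and> basis_of V S J"
proof -
  let ?P = "\<lambda>J. K \<subseteq> J \<and> J \<subseteq> V \<and> indep S J"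
  have fin: "finite {J. ?P J}" using assms(1) by (auto intro: finite_subset[of _ "Pow V"])
  have "{J. ?P J} \<noteq> {}" using assms(2,3) by auto
  from finite_has_maximal[OF fin this]
  obtain J where J: "?P J" "\<forall>J'\<in>{J. ?P J}. J \<subseteq> J' \<longrightarrow> J = J'" by (elim bexE CollectE) (rule that)
  have "\<not> indep S (insert y J)" if "y \<in> V - J" for y
  proof
    assume "indep S (insert y J)"
    then have "insert y J \<in> {J. ?P J}" using J(1) that by auto
    then have "J = insert y J" using J(2) by blast
    then show False using that by blast
  qed
  then show ?thesis using J(1) unfolding basis_of_def by blast
qed

text \<open>In a relation of least degree in \<open>y\<close>, the derivative in \<open>y\<close> is of smaller degree and so not a relation.\<close>

lemma minimal_relation:
  assumes S: "irred (insert y W) S" and y: "y \<notin> W"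
    and G: "G \<in> poly_funs (insert y J)" "vanishes S G" "G \<noteq> (\<lambda>x. 0)" and J: "J \<subseteq> W" "indep S J"
  shows "\<exists>e c. (\<forall>k. c k \<in> poly_funs W) \<and> \<not> vanishes S (c e) \<and>
    vanishes S (\<lambda>x. \<Sum>k\<le>e. c k x * x y ^ k) \<and>
    \<not> vanishes S (\<lambda>x. \<Sum>k\<le>e. of_nat k * c k x * x y ^ (k - 1)) \<and>
    (\<forall>e' a. e' < e \<longrightarrow> (\<forall>k. a k \<in> poly_funs W) \<longrightarrow> vanishes S (\<lambda>x. \<Sum>k\<le>e'. a k x * x y ^ k) \<longrightarrow> vanishes S (a e'))"
proof -
  let ?R = "\<lambda>e. \<exists>c. (\<forall>k. c k \<in> poly_funs W) \<and> \<not> vanishes S (c e) \<and> vanishes S (\<lambda>x. \<Sum>k\<le>e. c k x * x y ^ k)"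
  obtain N c where c: "\<And>k. c k \<in> poly_funs J" "G = (\<lambda>x. \<Sum>k\<le>(N::nat). c k x * x y ^ k)"
    using poly_funs_expand[OF G(1)] by blast
  define M where "M = {k. k \<le> N \<and> c k \<noteq> (\<lambda>x. 0)}"
  have "M \<noteq> {}" using G(3) unfolding M_def c(2) by (auto intro!: sum.neutral)
  moreover have finM: "finite M" unfolding M_def by simp
  ultimately have "Max M \<in> M" by simp
  then have "c (Max M) \<noteq> (\<lambda>x. 0)" "Max M \<le> N" unfolding M_def by auto
  have "(\<Sum>k\<le>Max M. c k x * x y ^ k) = G x" for x
    unfolding c(2)
  proof (rule sum.mono_neutral_left)
    show "\<forall>i\<in>{..N} - {..Max M}. c i x * x y ^ i = 0"
    proof
      fix i assume i: "i \<in> {..N} - {..Max M}"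
      then have "i \<notin> M" using Max_ge[OF finM, of i] by auto
      then show "c i x * x y ^ i = 0" using i unfolding M_def by auto
    qed
  qed (use \<open>Max M \<le> N\<close> in auto)
  then have "vanishes S (\<lambda>x. \<Sum>k\<le>Max M. c k x * x y ^ k)" using G(2) by simp
  \<comment> \<open>Independence of \<open>J\<close> turns a coefficient that is nonzero as a
    polynomial into one that does not vanish on \<open>S\<close>. For coefficients in the larger set
    \<open>W\<close> this could fail.\<close>
  moreover have "\<not> vanishes S (c (Max M))"
    using J(2) c(1) \<open>c (Max M) \<noteq> _\<close> unfolding indep_def by blast
  moreover have "\<forall>k. c k \<in> poly_funs W" using c(1) poly_funs_mono[OF _ J(1)] by blast
  ultimately have ex: "\<exists>e. ?R e" by blast
  \<comment> \<open>Minimality is taken over coefficients in all of \<open>W\<close>, so that it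
    applies to every relation of lower degree met while the derivation is extended.\<close>
  define e where "e = (LEAST e. ?R e)"
  have "?R e" unfolding e_def by (rule LeastI_ex[OF ex])
  then obtain c where c: "\<And>k. c k \<in> poly_funs W" "\<not> vanishes S (c e)" "vanishes S (\<lambda>x. \<Sum>k\<le>e. c k x * x y ^ k)"
    by blast
  have min: "vanishes S (a e')" if "e' < e" "\<And>k. a k \<in> poly_funs W" "vanishes S (\<lambda>x. \<Sum>k\<le>e'. a k x * x y ^ k)" for e' a
    using not_less_Least[of e' ?R] that unfolding e_def by blast
  have "e \<noteq> 0" using c(2,3) by (intro notI) (simp add: vanishes_def)
  have "\<not> vanishes S (\<lambda>x. \<Sum>k\<le>e. of_nat k * c k x * x y ^ (k - 1))"
  proof
    assume v: "vanishes S (\<lambda>x. \<Sum>k\<le>e. of_nat k * c k x * x y ^ (k - 1))"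
    define a where "a = (\<lambda>k x. of_nat (Suc k) * c (Suc k) x)"
    have "(\<Sum>k\<le>e. of_nat k * c k x * x y ^ (k - 1)) = (\<Sum>k\<le>e - 1. a k x * x y ^ k)" for x
    proof -
      obtain e' where e': "e = Suc e'" using \<open>e \<noteq> 0\<close> not0_implies_Suc by blast
      show ?thesis unfolding e' a_def sum.atMost_Suc_shift by simp
    qed
    then have "vanishes S (\<lambda>x. \<Sum>k\<le>e - 1. a k x * x y ^ k)" using v by simp
    moreover have "a k \<in> poly_funs W" for k
      unfolding a_def by (intro poly_funs.mult poly_funs.const c(1))
    moreover have "e - 1 < e" using \<open>e \<noteq> 0\<close> by simp
    ultimately have "vanishes S (a (e - 1))" using min[of "e - 1" a] by simp
    then show False using c(2) \<open>e \<noteq> 0\<close> unfolding vanishes_def a_def by (auto simp del: of_nat_Suc)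
  qed
  then show ?thesis using c min by (intro exI[of _ e] exI[of _ c] conjI allI impI) simp_all
qed

text \<open>
  Differentiating the minimal relation of \<open>y\<close> leaves one value for the derivative of \<open>y\<close>; its denominator
  is removed by scaling the derivation.
\<close>

lemma derivation_extend:
  assumes fin: "finite W" and S: "irred (insert y W) S" and y: "y \<notin> W"
    and G: "G \<in> poly_funs (insert y J)" "vanishes S G" "G \<noteq> (\<lambda>x. 0)" and J: "J \<subseteq> W" "indep S J"
    and w: "\<And>v. v \<in> W \<Longrightarrow> w v \<in> poly_funs W"
    and D: "\<And>f. f \<in> poly_funs W \<Longrightarrow> vanishes S f \<Longrightarrow> vanishes S (der W w f)"
  obtains h w' where "h \<in> poly_funs (insert y W)" "\<not> vanishes S h"
    "\<And>v. v \<in> W \<Longrightarrow> w' v = (\<lambda>x. h x * w v x)" "w' y \<in> poly_funs (insert y W)"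
    "\<And>f. f \<in> poly_funs (insert y W) \<Longrightarrow> vanishes S f \<Longrightarrow> vanishes S (der (insert y W) w' f)"
proof -
  let ?Y = "insert y W"
  obtain e c where c: "\<And>k. c k \<in> poly_funs W" "\<not> vanishes S (c e)"
    and G: "vanishes S (\<lambda>x. \<Sum>k\<le>e. c k x * x y ^ k)"
    and G': "\<not> vanishes S (\<lambda>x. \<Sum>k\<le>e. of_nat k * c k x * x y ^ (k - 1))"
    and min: "\<And>e' a. e' < e \<Longrightarrow> (\<And>k. a k \<in> poly_funs W) \<Longrightarrow>
      vanishes S (\<lambda>x. \<Sum>k\<le>e'. a k x * x y ^ k) \<Longrightarrow> vanishes S (a e')"
  proof -
    from minimal_relation[OF S y G J] obtain e c where
      "(\<forall>k. c k \<in> poly_funs W) \<and> \<not> vanishes S (c e) \<and>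
      vanishes S (\<lambda>x. \<Sum>k\<le>e. c k x * x y ^ k) \<and>
      \<not> vanishes S (\<lambda>x. \<Sum>k\<le>e. of_nat k * c k x * x y ^ (k - 1)) \<and>
      (\<forall>e' a. e' < e \<longrightarrow> (\<forall>k. a k \<in> poly_funs W) \<longrightarrow> vanishes S (\<lambda>x. \<Sum>k\<le>e'. a k x * x y ^ k) \<longrightarrow> vanishes S (a e'))"
      by (elim exE)
    then show ?thesis by (intro that[of c e]) simp_all
  qed
  \<comment> \<open>\<open>h\<close> is the derivative in \<open>y\<close> of the minimal relation,
    and \<open>b\<close> is minus that relation with \<open>w\<close> applied to its coefficients.
    In the derivative of the relation the terms \<open>h * (- b)\<close> and \<open>h * b\<close>
    cancel identically, not only on \<open>S\<close>.\<close>
  define h where "h = (\<lambda>x. \<Sum>k\<le>e. of_nat k * c k x * x y ^ (k - 1))"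
  define G where "G = (\<lambda>x. \<Sum>k\<le>e. c k x * x y ^ k)"
  define b where "b = (\<lambda>x. - (\<Sum>k\<le>e. der W w (c k) x * x y ^ k))"
  define w' where "w' = (\<lambda>v. if v = y then b else (\<lambda>x. h x * w v x))"
  let ?D = "der ?Y w'"
  have mono: "f \<in> poly_funs ?Y" if "f \<in> poly_funs W" for f
    using poly_funs_mono[OF that] by blast
  have py: "(\<lambda>x. x y ^ k) \<in> poly_funs ?Y" for k by (intro poly_funs_intros) auto
  have DW: "?D f = (\<lambda>x. h x * der W w f x)" if f: "f \<in> poly_funs W" for f
  proof -
    have "?D f = der W w' f" by (rule der_cong_set[OF f]) (use fin in auto)
    also have "\<dots> = (\<lambda>x. h x * der W w f x)"
      unfolding der_def sum_distrib_left
      by (intro ext sum.cong) (use y in \<open>auto simp: w'_def algebra_simps\<close>)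
    finally show ?thesis .
  qed
  have Dy: "?D (\<lambda>x. x y) = b" by (subst der_var) (use fin in \<open>auto simp: w'_def\<close>)
  have Dterm: "?D (\<lambda>x. f x * x y ^ k) = (\<lambda>x. h x * der W w f x * x y ^ k + of_nat k * f x * x y ^ (k - 1) * b x)"
    if f: "f \<in> poly_funs W" for f k
  proof -
    have "?D (\<lambda>x. f x * x y ^ k) = (\<lambda>x. ?D f x * x y ^ k + f x * ?D (\<lambda>x. x y ^ k) x)"
      by (rule der_mult[OF mono[OF f] py])
    also have "?D (\<lambda>x. x y ^ k) = (\<lambda>x. of_nat k * x y ^ (k - 1) * ?D (\<lambda>x. x y) x)"
      by (rule der_power[OF poly_funs.var]) auto
    finally show ?thesis unfolding Dy DW[OF f] by (simp add: fun_eq_iff algebra_simps)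
  qed
  have pt: "(\<lambda>x. f x * x y ^ k) \<in> poly_funs ?Y" if "f \<in> poly_funs W" for f k
    by (intro poly_funs_intros mono that) auto
  have DG: "?D G x = 0" for x
  proof -
    have "?D G = (\<lambda>x. \<Sum>k\<le>e. ?D (\<lambda>x. c k x * x y ^ k) x)"
      unfolding G_def by (rule der_sum) (rule pt[OF c(1)])
    then have "?D G x = (\<Sum>k\<le>e. h x * (der W w (c k) x * x y ^ k)) + (\<Sum>k\<le>e. (of_nat k * c k x * x y ^ (k - 1)) * b x)"
      by (simp add: Dterm[OF c(1)] sum.distrib mult.assoc)
    also have "\<dots> = h x * (\<Sum>k\<le>e. der W w (c k) x * x y ^ k) + h x * b x"
      unfolding sum_distrib_left[symmetric] sum_distrib_right[symmetric] h_def ..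
    finally show ?thesis by (simp add: b_def)
  qed
  have hp: "h \<in> poly_funs ?Y" unfolding h_def by (intro poly_funs_intros mono c) auto
  have bp: "b \<in> poly_funs ?Y" unfolding b_def
    by (intro poly_funs_intros mono der_in_poly_funs[OF c(1)] w) auto
  have Gp: "G \<in> poly_funs ?Y" unfolding G_def by (intro poly_funs_intros mono c) auto
  have vG: "vanishes S G" using G unfolding G_def .
  \<comment> \<open>Pseudo-division by the minimal relation: \<open>c e\<close> times the given
    relation minus a multiple of \<open>G\<close> has lower degree. Differentiating it returns
    \<open>c e\<close> times the wanted derivative up to terms vanishing on \<open>S\<close>, and
    \<open>c e\<close> cancels by irreducibility. Below degree \<open>e\<close>, minimality strips
    the leading term instead.\<close>
  have key: "vanishes S (?D (\<lambda>x. \<Sum>k\<le>N. a k x * x y ^ k))"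
    if "\<And>k. a k \<in> poly_funs W" "vanishes S (\<lambda>x. \<Sum>k\<le>(N::nat). a k x * x y ^ k)" for N a
    using that
  proof (induction N arbitrary: a rule: less_induct)
    case (less N)
    let ?f = "\<lambda>x. \<Sum>k\<le>N. a k x * x y ^ k"
    have fp: "?f \<in> poly_funs ?Y" by (intro poly_funs_sum pt less.prems)
    show ?case
    proof (cases "N < e")
      case True
      have aN: "vanishes S (a N)" by (rule min[OF True less.prems])
      have DaN: "vanishes S (?D (\<lambda>x. a N x * x y ^ N))"
        using aN D[OF less.prems(1) aN] unfolding Dterm[OF less.prems(1)] vanishes_def by simp
      show ?thesis
      proof (cases N)
        case 0
        then show ?thesis using DaN by simp
      next
        case (Suc M)
        have "vanishes S (?D (\<lambda>x. \<Sum>k\<le>M. a k x * x y ^ k))"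
          using less.prems aN by (intro less.IH) (auto simp: Suc vanishes_def)
        moreover have "?D (\<lambda>x. (\<Sum>k\<le>M. a k x * x y ^ k) + a N x * x y ^ N) =
            (\<lambda>x. ?D (\<lambda>x. \<Sum>k\<le>M. a k x * x y ^ k) x + ?D (\<lambda>x. a N x * x y ^ N) x)"
          by (intro der_add[where V = ?Y] poly_funs_sum pt less.prems)
        ultimately show ?thesis using DaN by (simp add: Suc vanishes_def)
      qed
    next
      case False
      let ?q = "\<lambda>x. a N x * x y ^ (N - e)"
      define r where "r = (\<lambda>x. c e x * ?f x - ?q x * G x)"
      have qp: "?q \<in> poly_funs ?Y" by (intro pt less.prems)
      have ce: "c e \<in> poly_funs ?Y" by (intro mono c)
      have vf: "?f x = 0" "G x = 0" if "x \<in> S" for x using less.prems(2) vG that unfolding vanishes_def by auto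
      have "vanishes S (?D r)"
      proof (cases "N = 0")
        case True
        then have "e = 0" using False by simp
        then have "r = (\<lambda>x. 0)" by (simp add: r_def True fun_eq_iff G_def)
        then show ?thesis by (simp add: vanishes_def)
      next
        case N: False
        define a' where "a' = (\<lambda>k x. c e x * a k x - (if N - e \<le> k then a N x * c (k - (N - e)) x else 0))"
        have qG: "?q x * G x = (\<Sum>k\<le>N. (if N - e \<le> k then a N x * c (k - (N - e)) x else 0) * x y ^ k)" for x
        proof -
          have "?q x * G x = (\<Sum>k\<le>e. a N x * c k x * x y ^ (k + (N - e)))"
            unfolding G_def sum_distrib_left by (intro sum.cong) (auto simp: power_add algebra_simps)
          also have "\<dots> = (\<Sum>k\<in>(\<lambda>k. k + (N - e)) ` {..e}. a N x * c (k - (N - e)) x * x y ^ k)"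
            by (subst sum.reindex) auto
          also have "\<dots> = (\<Sum>k\<le>N. (if N - e \<le> k then a N x * c (k - (N - e)) x else 0) * x y ^ k)"
          proof (rule sum.mono_neutral_cong_left)
            have "k \<in> (\<lambda>k. k + (N - e)) ` {..e}" if "k \<le> N" "N - e \<le> k" for k
              by (rule image_eqI[of _ _ "k - (N - e)"]) (use that False in auto)
            then show "\<forall>i\<in>{..N} - (\<lambda>k. k + (N - e)) ` {..e}.
              (if N - e \<le> i then a N x * c (i - (N - e)) x else 0) * x y ^ i = 0" by auto
          qed (use False in auto)
          finally show ?thesis .
        qed
        have "r = (\<lambda>x. \<Sum>k\<le>N. a' k x * x y ^ k)"
          unfolding r_def qG a'_def by (simp add: sum_distrib_left sum_subtractf algebra_simps)
        also have "\<dots> = (\<lambda>x. \<Sum>k\<le>N - 1. a' k x * x y ^ k)"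
        proof -
          obtain M where M: "N = Suc M" using N not0_implies_Suc by blast
          have "a' N = (\<lambda>x. 0)" using False by (simp add: a'_def fun_eq_iff)
          then show ?thesis by (simp add: M)
        qed
        finally have r: "r = (\<lambda>x. \<Sum>k\<le>N - 1. a' k x * x y ^ k)" .
        have "vanishes S r" using vf unfolding r_def vanishes_def by simp
        moreover have "a' k \<in> poly_funs W" for k
          unfolding a'_def using c(1) less.prems(1)
          by (cases "N - e \<le> k") (auto intro!: poly_funs_intros)
        ultimately show ?thesis using less.IH[of "N - 1" a'] N unfolding r by simp
      qed
      moreover have "?D r = (\<lambda>x. (?D (c e) x * ?f x + c e x * ?D ?f x) - (?D ?q x * G x + ?q x * ?D G x))"
        unfolding r_def der_diff[OF poly_funs.mult[OF ce fp] poly_funs.mult[OF qp Gp]]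
          der_mult[OF ce fp] der_mult[OF qp Gp] ..
      ultimately have "vanishes S (\<lambda>x. c e x * ?D ?f x)"
        using vf DG unfolding vanishes_def by simp
      moreover have "?D ?f \<in> poly_funs ?Y"
        by (rule der_in_poly_funs[OF fp]) (use bp hp mono[OF w] in \<open>auto simp: w'_def intro: poly_funs.mult\<close>)
      ultimately show ?thesis using irred_mult[OF S ce, of "?D ?f"] c(2) by blast
    qed
  qed
  show ?thesis
  proof (rule that[of h w'])
    show "\<not> vanishes S h" using G' unfolding h_def .
    show "w' v = (\<lambda>x. h x * w v x)" if "v \<in> W" for v using that y by (auto simp: w'_def)
    show "w' y \<in> poly_funs ?Y" using bp by (simp add: w'_def)
    fix f assume f: "f \<in> poly_funs ?Y" "vanishes S f"
    obtain N a where a: "\<And>k. a k \<in> poly_funs W" "f = (\<lambda>x. \<Sum>k\<le>(N::nat). a k x * x y ^ k)"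
      using poly_funs_expand[OF f(1)] by blast
    show "vanishes S (?D f)" using key[of a N] a f(2) by simp
  qed (rule hp)
qed

text \<open>A vector field tangent to \<open>S\<close> that moves the basis coordinate
  \<open>i\<close> and fixes the other basis coordinates. On \<open>poly_funs J\<close> the partial
  derivative in \<open>i\<close> preserves the ideal, because independence leaves only zero in it.
  Every other coordinate is algebraic over \<open>J\<close>, so the field extends one coordinate at
  a time, each time at the cost of a factor that does not vanish on \<open>S\<close>.\<close>

lemma tangent_derivation:
  assumes fin: "finite V" and S: "irred V S" and J: "basis_of V S J" and i: "i \<in> J"
  obtains w where "\<And>v. v \<in> V \<Longrightarrow> w v \<in> poly_funs V" "\<not> vanishes S (w i)"
    "\<And>j. j \<in> J \<Longrightarrow> j \<noteq> i \<Longrightarrow> w j = (\<lambda>x. 0)"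
    "\<And>f. f \<in> poly_funs V \<Longrightarrow> vanishes S f \<Longrightarrow> vanishes S (der V w f)"
proof -
  have JV: "J \<subseteq> V" and indJ: "indep S J" using J unfolding basis_of_def by auto
  let ?P = "\<lambda>W w. (\<forall>v\<in>W. w v \<in> poly_funs W) \<and> \<not> vanishes S (w i) \<and> (\<forall>j\<in>J. j \<noteq> i \<longrightarrow> w j = (\<lambda>x. 0)) \<and>
    (\<forall>f\<in>poly_funs W. vanishes S f \<longrightarrow> vanishes S (der W w f))"
  have "\<exists>w. ?P (J \<union> U) w" if "U \<subseteq> V - J" "finite U" for U
    using that(2,1)
  proof (induction U)
    case empty
    let ?w = "\<lambda>v x. if v = i then 1 else 0 :: complex"
    have "vanishes S (der J ?w f)" if f: "f \<in> poly_funs J" "vanishes S f" for f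
    proof -
      have "f = (\<lambda>x. 0)" using indJ f unfolding indep_def by blast
      then show ?thesis by (simp add: vanishes_def)
    qed
    moreover have "\<not> vanishes S (?w i)" using S unfolding irred_def vanishes_def by auto
    moreover have "\<forall>v\<in>J. ?w v \<in> poly_funs J" by (auto intro: poly_funs.const)
    ultimately show ?case by (intro exI[of _ ?w]) auto
  next
    case (insert y U)
    then obtain w where w: "?P (J \<union> U) w" by auto
    let ?W = "J \<union> U"
    have y: "y \<in> V - J" using insert.prems by auto
    then obtain G where G: "G \<in> poly_funs (insert y J)" "vanishes S G" "G \<noteq> (\<lambda>x. 0)"
      using J unfolding basis_of_def indep_def by blast
    have sub: "insert y ?W \<subseteq> V" using insert.prems JV by auto
    obtain h w' where w': "h \<in> poly_funs (insert y ?W)" "\<not> vanishes S h"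
      "\<And>v. v \<in> ?W \<Longrightarrow> w' v = (\<lambda>x. h x * w v x)" "w' y \<in> poly_funs (insert y ?W)"
      "\<And>f. f \<in> poly_funs (insert y ?W) \<Longrightarrow> vanishes S f \<Longrightarrow> vanishes S (der (insert y ?W) w' f)"
    proof (rule derivation_extend[of ?W y S G J w])
      show "finite ?W" using finite_subset[OF JV fin] insert.hyps by auto
      show "irred (insert y ?W) S" by (rule irred_mono[OF S sub])
    qed (use y insert.hyps G indJ w in auto)
    have mono: "f \<in> poly_funs (insert y ?W)" if "f \<in> poly_funs ?W" for f
      using poly_funs_mono[OF that] by blast
    have "\<not> vanishes S (w' i)"
      unfolding w'(3)[OF UnI1[OF i]]
      by (rule irred_mult[OF irred_mono[OF S sub] w'(1) mono w'(2)]) (use w i in auto)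
    moreover have "\<forall>v\<in>insert y ?W. w' v \<in> poly_funs (insert y ?W)"
      using w'(1,3,4) w mono by (auto intro!: poly_funs.mult)
    moreover have "\<forall>j\<in>J. j \<noteq> i \<longrightarrow> w' j = (\<lambda>x. 0)" using w'(3) w by auto
    ultimately show ?case using w'(5) by (intro exI[of _ w']) auto
  qed
  from this[of "V - J"] obtain w where "?P (J \<union> (V - J)) w" using fin by auto
  moreover have "J \<union> (V - J) = V" using JV by auto
  ultimately have "?P V w" by simp
  then show ?thesis by (intro that[of w]) blast+
qed

text \<open>By characteristic zero, the relation of least degree is separable. At a general point
  its gradient therefore determines the \<open>y\<close>-component of a tangent vector from the
  components in \<open>J\<close>.\<close>

lemma basis_relation:
  assumes fin: "finite V" and S: "irred V S" and J: "basis_of V S J" and y: "y \<in> V - J"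
  obtains G where "G \<in> poly_funs (insert y J)" "vanishes S G" "\<not> vanishes S (pd y G)"
proof -
  obtain G where G: "G \<in> poly_funs (insert y J)" "vanishes S G" "G \<noteq> (\<lambda>x. 0)"
    using J y unfolding basis_of_def indep_def by blast
  have sub: "insert y J \<subseteq> V" "y \<notin> J" "indep S J" using J y unfolding basis_of_def by auto
  obtain e c where c: "\<And>k. c k \<in> poly_funs J" "vanishes S (\<lambda>x. \<Sum>k\<le>e. c k x * x y ^ k)"
    and nv: "\<not> vanishes S (\<lambda>x. \<Sum>k\<le>e. of_nat k * c k x * x y ^ (k - 1))"
    using minimal_relation[OF irred_mono[OF S sub(1)] sub(2) G order_refl sub(3)]
    by (elim exE conjE) (rule that, blast+)
  let ?G = "\<lambda>x. \<Sum>k\<le>e. c k x * x y ^ k"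
  have cp: "c k \<in> poly_funs (insert y J)" for k using poly_funs_mono[OF c(1)] by blast
  have yp: "(\<lambda>x. x y) \<in> poly_funs (insert y J)" by (intro poly_funs.var) simp
  have "pd y (\<lambda>x. c k x * x y ^ k) = (\<lambda>x. of_nat k * c k x * x y ^ (k - 1))" for k
    unfolding pd_eq_der der_mult[OF cp poly_funs_power[OF yp]] der_power[OF yp]
    unfolding pd_eq_der[symmetric] pd_outside[OF c(1) sub(2)] pd_var by (simp add: fun_eq_iff)
  moreover have "pd y ?G = (\<lambda>x. \<Sum>k\<le>e. pd y (\<lambda>x. c k x * x y ^ k) x)"
    unfolding pd_eq_der by (intro der_sum[where V = "insert y J"] poly_funs.mult poly_funs_power cp yp)
  ultimately have "pd y ?G = (\<lambda>x. \<Sum>k\<le>e. of_nat k * c k x * x y ^ (k - 1))" by simp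
  then show ?thesis using nv c(2) cp yp
    by (intro that[of ?G]) (auto intro!: poly_funs_sum poly_funs.mult poly_funs_power)
qed

text \<open>
  The transcendence degree argument on the graph of \<open>f\<close>: a derivation in the direction of a coordinate
  independent of \<open>J\<close> would vanish on all of \<open>V\<close>, hence on \<open>f\<close>.
\<close>

lemma algebraic_over_basis:
  assumes fin: "finite V" and S: "irred V S" and J: "basis_of V S J" and f: "f \<in> poly_funs V"
    and y: "y \<notin> V"
  obtains G where "G \<in> poly_funs (insert y J)" "G \<noteq> (\<lambda>x. 0)" "\<And>x. x \<in> S \<Longrightarrow> G (x(y := f x)) = 0"
proof -
  let ?Y = "insert y V"
  define T where "T = (\<lambda>x. x(y := f x)) ` S"
  have JV: "J \<subseteq> V" using J unfolding basis_of_def by blast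
  have pull: "(\<lambda>x. g (x(y := f x))) \<in> poly_funs V" if "g \<in> poly_funs ?Y" for g
  proof -
    have "(\<lambda>x. g (\<lambda>v. (if v = y then f else (\<lambda>x. x v)) x)) \<in> poly_funs V"
      by (rule poly_funs_comp[OF that]) (use f in \<open>auto intro: poly_funs.var\<close>)
    moreover have "(\<lambda>v. (if v = y then f else (\<lambda>x. x v)) x) = x(y := f x)" for x
      by auto
    ultimately show ?thesis by simp
  qed
  have vT: "vanishes T g \<longleftrightarrow> vanishes S (\<lambda>x. g (x(y := f x)))" for g
    unfolding T_def vanishes_def by blast
  have T: "irred ?Y T"
    unfolding irred_def vT
  proof (intro conjI ballI impI)
    show "T \<noteq> {}" using S unfolding T_def irred_def by blast
    fix g h assume "g \<in> poly_funs ?Y" "h \<in> poly_funs ?Y"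
      "vanishes S (\<lambda>x. g (x(y := f x)) * h (x(y := f x)))"
    then show "vanishes S (\<lambda>x. g (x(y := f x))) \<or> vanishes S (\<lambda>x. h (x(y := f x)))"
      using irred_mult[OF S pull[of g] pull[of h]] by blast
  qed
  have vV: "vanishes T g \<longleftrightarrow> vanishes S g" if "g \<in> poly_funs V" for g
  proof -
    have "g (x(y := f x)) = g x" for x by (rule poly_funs_cong[OF that]) (use y in auto)
    then show ?thesis unfolding vT by simp
  qed
  show ?thesis
  proof (cases "indep T (insert y J)")
    case False
    then show ?thesis using that unfolding indep_def vT by (auto simp: vanishes_def)
  next
    case True
    obtain K where K: "insert y J \<subseteq> K" "basis_of ?Y T K"
      using indep_extends_to_basis[OF _ True] fin JV by (metis finite_insert insert_mono)
    obtain w where w: "\<And>v. v \<in> ?Y \<Longrightarrow> w v \<in> poly_funs ?Y" "\<not> vanishes T (w y)"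
      "\<And>j. j \<in> K \<Longrightarrow> j \<noteq> y \<Longrightarrow> w j = (\<lambda>x. 0)"
      "\<And>f. f \<in> poly_funs ?Y \<Longrightarrow> vanishes T f \<Longrightarrow> vanishes T (der ?Y w f)"
      using tangent_derivation[OF _ T K(2), of y] K(1) fin by auto
    have mono: "g \<in> poly_funs ?Y" if "g \<in> poly_funs V" for g
      using poly_funs_mono[OF that] by blast
    have wv: "vanishes T (w v)" if v: "v \<in> V" for v
    proof (cases "v \<in> J")
      case True
      then have "w v = (\<lambda>x. 0)" using K(1) y v by (intro w(3)) auto
      then show ?thesis by (simp add: vanishes_def)
    next
      case False
      obtain G where G: "G \<in> poly_funs (insert v J)" "vanishes S G" "\<not> vanishes S (pd v G)"
        using basis_relation[OF fin S J, of v] v False by blast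
      have GV: "G \<in> poly_funs V" using poly_funs_mono[OF G(1)] JV v by auto
      have "der ?Y w G = der (insert v J) w G"
        by (rule der_cong_set[OF G(1)]) (use JV v fin in auto)
      also have "\<dots> = (\<lambda>x. w v x * pd v G x)"
      proof
        fix x
        have "(\<Sum>u\<in>J. w u x * pd u G x) = 0"
          by (intro sum.neutral ballI) (use w(3) K(1) y JV in force)
        then show "der (insert v J) w G x = w v x * pd v G x"
          using False finite_subset[OF JV fin] by (simp add: der_def)
      qed
      finally have "vanishes T (\<lambda>x. w v x * pd v G x)"
        using w(4)[OF mono[OF GV]] G(2) vV[OF GV] by simp
      moreover have "\<not> vanishes T (pd v G)" using G(3) vV pd_in_poly_funs[OF GV] by blast
      ultimately show ?thesis
        using irred_mult[OF T w(1)[of v] mono[OF pd_in_poly_funs[OF GV, of v]]] v by auto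
    qed
    let ?h = "\<lambda>x. x y - f x"
    have "vanishes T ?h"
    proof -
      have "f (x(y := f x)) = f x" for x by (rule poly_funs_cong[OF f]) (use y in auto)
      then show ?thesis unfolding vT by (simp add: vanishes_def)
    qed
    moreover have yp: "(\<lambda>x. x y) \<in> poly_funs ?Y" by (intro poly_funs.var) simp
    ultimately have "vanishes T (der ?Y w ?h)" by (intro w(4) poly_funs_diff yp mono[OF f])
    moreover have "der ?Y w ?h = (\<lambda>x. w y x - der V w f x)"
      unfolding der_diff[OF yp mono[OF f]] using fin
      by (simp add: der_var[OF finite.insertI[OF fin]] der_cong_set[OF f subset_insertI])
    moreover have "der V w f x = 0" if "x \<in> T" for x
      using wv that unfolding der_def by (simp add: vanishes_def)
    ultimately have "vanishes T (w y)" by (simp add: vanishes_def)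
    with w(2) show ?thesis by blast
  qed
qed

text \<open>If \<open>J\<close> were a basis on \<open>S\<close>, then \<open>f\<close> would
  satisfy an equation over \<open>J\<close> on \<open>S\<close>. Cancel the power of
  \<open>f\<close> in front of its lowest nonzero coefficient, which irreducibility allows, and pass
  to \<open>S'\<close>: there \<open>f\<close> is zero, so this coefficient vanishes on
  \<open>S'\<close>, against the independence of \<open>J\<close> there.\<close>

lemma indep_not_basis:
  assumes fin: "finite V" and S: "irred V S" and S': "S' \<noteq> {}" "indep S' J" and y: "y \<notin> V"
    and sub: "\<And>g. g \<in> poly_funs V \<Longrightarrow> vanishes S g \<Longrightarrow> vanishes S' g"
    and f: "f \<in> poly_funs V" "vanishes S' f" "\<not> vanishes S f"
  shows "\<not> basis_of V S J"
proof
  assume J: "basis_of V S J"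
  have JV: "J \<subseteq> V" using J unfolding basis_of_def by blast
  obtain G where G: "G \<in> poly_funs (insert y J)" "G \<noteq> (\<lambda>x. 0)" "\<And>x. x \<in> S \<Longrightarrow> G (x(y := f x)) = 0"
    using algebraic_over_basis[OF fin S J f(1) y] by metis
  obtain N c where c: "\<And>k. c k \<in> poly_funs J" "G = (\<lambda>x. \<Sum>k\<le>(N::nat). c k x * x y ^ k)"
    using poly_funs_expand[OF G(1)] by blast
  have cV: "c k \<in> poly_funs V" for k using poly_funs_mono[OF c(1) JV] .
  have cy: "c k (x(y := t)) = c k x" for k x t
    by (rule poly_funs_cong[OF c(1)]) (use y JV in auto)
  have ex: "\<exists>k. k \<le> N \<and> c k \<noteq> (\<lambda>x. 0)" using G(2) unfolding c(2) by (auto intro!: sum.neutral)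
  define m where "m = (LEAST k. k \<le> N \<and> c k \<noteq> (\<lambda>x. 0))"
  have m: "m \<le> N" "c m \<noteq> (\<lambda>x. 0)" using LeastI_ex[OF ex] unfolding m_def by auto
  have low: "c k = (\<lambda>x. 0)" if "k < m" for k
    using not_less_Least[of k "\<lambda>k. k \<le> N \<and> c k \<noteq> (\<lambda>x. 0)"] that m(1) unfolding m_def by auto
  let ?H = "\<lambda>x. \<Sum>k=m..N. c k x * f x ^ (k - m)"
  have "vanishes S (\<lambda>x. f x ^ m * ?H x)"
    unfolding vanishes_def
  proof
    fix x assume "x \<in> S"
    then have "(\<Sum>k\<le>N. c k x * f x ^ k) = 0" using G(3) by (auto simp: c(2) cy)
    also have "(\<Sum>k\<le>N. c k x * f x ^ k) = (\<Sum>k=m..N. c k x * f x ^ k)"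
      by (rule sum.mono_neutral_right) (use low in force)+
    also have "\<dots> = f x ^ m * ?H x"
      unfolding sum_distrib_left
      by (intro sum.cong) (auto simp: power_add[symmetric] algebra_simps simp flip: mult.assoc)
    finally show "f x ^ m * ?H x = 0" .
  qed
  moreover have "\<not> vanishes S (\<lambda>x. f x ^ m)"
    using irred_prod[OF S, of "{..<m}" "\<lambda>_. f"] f by simp
  moreover have Hp: "?H \<in> poly_funs V" by (intro poly_funs_intros cV f(1))
  ultimately have "vanishes S ?H"
    using irred_mult[OF S poly_funs_power[OF f(1), of m] Hp] by blast
  then have H: "vanishes S' ?H" by (rule sub[OF Hp])
  have "vanishes S' (c m)"
    unfolding vanishes_def
  proof
    fix x assume x: "x \<in> S'"
    then have fx: "f x = 0" using f(2) by (simp add: vanishes_def)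
    have "?H x = (\<Sum>k=m..N. if k = m then c m x else 0)"
      by (intro sum.cong) (auto simp: fx)
    also have "\<dots> = c m x" using m(1) by simp
    finally show "c m x = 0" using H x by (simp add: vanishes_def)
  qed
  then show False using S'(2) c(1) m(2) unfolding indep_def by blast
qed

section \<open>The rank of a set and its strict drop on smaller sets\<close>

definition rk :: "'v set \<Rightarrow> ('v \<Rightarrow> complex) set \<Rightarrow> nat" where
  "rk V S = Max (card ` {J. J \<subseteq> V \<and> indep S J})"

lemma indep_empty: "S \<noteq> {} \<Longrightarrow> indep S {}"
  unfolding indep_def
proof (intro ballI impI ext)
  fix f and x :: "'a \<Rightarrow> complex" assume S: "S \<noteq> {}" and f: "f \<in> poly_funs {}" "vanishes S f"
  obtain s where "s \<in> S" using S by blast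
  then show "f x = 0" using poly_funs_cong[OF f(1), of x s] f(2) by (simp add: vanishes_def)
qed

lemma card_indep_le_rk:
  assumes "finite V" "J \<subseteq> V" "indep S J"
  shows "card J \<le> rk V S"
  unfolding rk_def using assms by (intro Max_ge) auto

lemma rk_basis:
  assumes "finite V" "S \<noteq> {}"
  obtains J where "basis_of V S J" "card J = rk V S"
proof -
  have "rk V S \<in> card ` {J. J \<subseteq> V \<and> indep S J}"
    unfolding rk_def using assms indep_empty[OF assms(2)] by (intro Max_in) auto
  then obtain J where J: "J \<subseteq> V" "indep S J" "card J = rk V S" by auto
  have "\<not> indep S (insert y J)" if y: "y \<in> V - J" for y
  proof
    assume "indep S (insert y J)"
    then have "card (insert y J) \<le> rk V S" using y J(1) by (intro card_indep_le_rk assms(1)) auto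
    then show False using y J(3) finite_subset[OF J(1) assms(1)] by simp
  qed
  then show ?thesis using that J unfolding basis_of_def by blast
qed

text \<open>A largest independent set for \<open>S'\<close> stays independent for \<open>S\<close>
  but is not maximal there, so a further coordinate can be added.\<close>

lemma rk_less:
  assumes fin: "finite V" and S: "irred V S" and S': "S' \<noteq> {}" and y: "y \<notin> V"
    and sub: "\<And>g. g \<in> poly_funs V \<Longrightarrow> vanishes S g \<Longrightarrow> vanishes S' g"
    and f: "f \<in> poly_funs V" "vanishes S' f" "\<not> vanishes S f"
  shows "rk V S' < rk V S"
proof -
  obtain J where J: "basis_of V S' J" "card J = rk V S'" using rk_basis[OF fin S'] by blast
  have JV: "J \<subseteq> V" and ind: "indep S' J" using J(1) unfolding basis_of_def by auto
  have "indep S J"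
    by (rule indep_superset[OF ind]) (use sub poly_funs_mono[OF _ JV] in blast)
  moreover have "\<not> basis_of V S J" by (rule indep_not_basis[OF fin S S' ind y sub f])
  ultimately obtain z where z: "z \<in> V - J" "indep S (insert z J)"
    using JV unfolding basis_of_def by blast
  then have "card (insert z J) \<le> rk V S" using JV by (intro card_indep_le_rk fin) auto
  then show ?thesis using z(1) J(2) finite_subset[OF JV fin] by simp
qed

section \<open>Flows of polynomial vector fields\<close>

lemma der_pow_in_poly_funs:
  assumes "f \<in> poly_funs V" "w \<in> V \<rightarrow> poly_funs V"
  shows "(der V w ^^ k) f \<in> poly_funs V"
  by (induction k) (use assms in \<open>auto intro!: der_in_poly_funs\<close>)

lemma der_pow_const: "(der V w ^^ k) (\<lambda>x. c) = (\<lambda>x. if k = 0 then c else 0)"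
  by (induction k) auto

lemma der_pow_add:
  assumes "f \<in> poly_funs V" "g \<in> poly_funs V" and w: "w \<in> V \<rightarrow> poly_funs V"
  shows "(der V w ^^ k) (\<lambda>x. f x + g x) = (\<lambda>x. (der V w ^^ k) f x + (der V w ^^ k) g x)"
  by (induction k) (auto simp: der_add[OF der_pow_in_poly_funs[OF assms(1) w] der_pow_in_poly_funs[OF assms(2) w]])

lemma der_pow_mult:
  assumes f: "f \<in> poly_funs V" and g: "g \<in> poly_funs V" and w: "w \<in> V \<rightarrow> poly_funs V"
  shows "(der V w ^^ k) (\<lambda>x. f x * g x) =
    (\<lambda>x. \<Sum>i\<le>k. of_nat (k choose i) * (der V w ^^ i) f x * (der V w ^^ (k - i)) g x)"
proof (induction k)
  case (Suc k)
  let ?D = "der V w"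
  have fi: "(?D ^^ i) f \<in> poly_funs V" and gi: "(?D ^^ i) g \<in> poly_funs V" for i
    by (intro der_pow_in_poly_funs f g w)+
  have dterm: "?D (\<lambda>x. of_nat (k choose i) * (?D ^^ i) f x * (?D ^^ (k - i)) g x) =
     (\<lambda>x. of_nat (k choose i) * (?D ^^ Suc i) f x * (?D ^^ (k - i)) g x +
       of_nat (k choose i) * (?D ^^ i) f x * (?D ^^ Suc (k - i)) g x)" for i
  proof -
    have "?D (\<lambda>x. of_nat (k choose i) * (?D ^^ i) f x) = (\<lambda>x. of_nat (k choose i) * (?D ^^ Suc i) f x)"
      using der_mult[OF poly_funs.const[of "of_nat (k choose i)"] fi[of i], of V w] by simp
    then show ?thesis
      using der_mult[OF poly_funs.mult[OF poly_funs.const[of "of_nat (k choose i)"] fi[of i]] gi[of "k - i"], of V w]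
      by (simp only: funpow.simps comp_def)
  qed
  have "(?D ^^ Suc k) (\<lambda>x. f x * g x) =
      (\<lambda>x. \<Sum>i\<le>k. ?D (\<lambda>x. of_nat (k choose i) * (?D ^^ i) f x * (?D ^^ (k - i)) g x) x)"
    unfolding funpow.simps comp_def Suc.IH
    by (rule der_sum[where V = V]) (intro poly_funs.mult poly_funs.const fi gi)
  also have "\<dots> = (\<lambda>x. \<Sum>i\<le>Suc k. of_nat (Suc k choose i) * (?D ^^ i) f x * (?D ^^ (Suc k - i)) g x)"
  proof
    fix x
    define F where "F i = (?D ^^ i) f x" for i
    define G where "G i = (?D ^^ i) g x" for i
    have "(\<Sum>i\<le>k. of_nat (k choose i) * F (Suc i) * G (k - i) + of_nat (k choose i) * F i * G (Suc (k - i)))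
      = (\<Sum>i\<le>k. of_nat (k choose i) * F (Suc i) * G (k - i)) + (\<Sum>i\<le>k. of_nat (k choose i) * F i * G (Suc k - i))"
      by (simp add: sum.distrib Suc_diff_le)
    also have "(\<Sum>i\<le>k. of_nat (k choose i) * F i * G (Suc k - i)) =
        (\<Sum>i\<le>Suc k. of_nat (k choose i) * F i * G (Suc k - i))"
      by simp
    also have "\<dots> = F 0 * G (Suc k) + (\<Sum>i\<le>k. of_nat (k choose Suc i) * F (Suc i) * G (k - i))"
      by (subst sum.atMost_Suc_shift) simp
    also have "(\<Sum>i\<le>k. of_nat (k choose i) * F (Suc i) * G (k - i)) +
        (F 0 * G (Suc k) + (\<Sum>i\<le>k. of_nat (k choose Suc i) * F (Suc i) * G (k - i))) =
        F 0 * G (Suc k) + (\<Sum>i\<le>k. of_nat (Suc k choose Suc i) * F (Suc i) * G (k - i))"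
      by (simp add: sum.distrib[symmetric] algebra_simps)
    also have "\<dots> = (\<Sum>i\<le>Suc k. of_nat (Suc k choose i) * F i * G (Suc k - i))"
      by (subst sum.atMost_Suc_shift) simp
    finally show "(\<Sum>i\<le>k. ?D (\<lambda>x. of_nat (k choose i) * (?D ^^ i) f x * (?D ^^ (k - i)) g x) x) =
      (\<Sum>i\<le>Suc k. of_nat (Suc k choose i) * (?D ^^ i) f x * (?D ^^ (Suc k - i)) g x)"
      unfolding dterm F_def G_def .
  qed
  finally show ?case .
qed simp

lemma poly_funs_bounded:
  assumes "f \<in> poly_funs V"
  shows "\<exists>B\<ge>0. \<forall>x. (\<forall>v\<in>V. norm (x v - s v) \<le> r) \<longrightarrow> norm (f x) \<le> B"
    using assms
  proof induction
    case (const c)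
    then show ?case by (intro exI[of _ "norm c"]) auto
  next
    case (var v)
    have "norm (x v) \<le> norm (s v) + \<bar>r\<bar>" if "norm (x v - s v) \<le> r" for x
      using norm_triangle_sub[of "x v" "s v"] that by linarith
    then show ?case using var by (intro exI[of _ "norm (s v) + \<bar>r\<bar>"]) auto
  next
    case (add f g)
    then obtain A B where "A \<ge> 0" "B \<ge> 0" "\<forall>x. (\<forall>v\<in>V. norm (x v - s v) \<le> r) \<longrightarrow> norm (f x) \<le> A"
      "\<forall>x. (\<forall>v\<in>V. norm (x v - s v) \<le> r) \<longrightarrow> norm (g x) \<le> B" by auto
    then show ?case by (intro exI[of _ "A + B"]) (auto intro: norm_triangle_mono)
  next
    case (mult f g)
    then obtain A B where "A \<ge> 0" "B \<ge> 0" "\<forall>x. (\<forall>v\<in>V. norm (x v - s v) \<le> r) \<longrightarrow> norm (f x) \<le> A"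
      "\<forall>x. (\<forall>v\<in>V. norm (x v - s v) \<le> r) \<longrightarrow> norm (g x) \<le> B" by auto
    then show ?case by (intro exI[of _ "A * B"]) (auto simp: norm_mult intro: mult_mono)
  qed

lemma pd_bound:
  assumes g: "g \<in> poly_funs V" and e: "e > 0"
    and M: "\<And>x. (\<And>v. v \<in> V \<Longrightarrow> norm (x v - s v) \<le> r) \<Longrightarrow> norm (g x) \<le> M"
    and x: "\<And>v. v \<in> V \<Longrightarrow> norm (x v - s v) \<le> r - e"
  shows "norm (pd i g x) \<le> M / e"
proof -
  have d: "(\<lambda>t. g (x(i := t))) field_differentiable at t" for t
    by (rule poly_funs_differentiable[OF g])
  have hol: "(\<lambda>t. g (x(i := t))) holomorphic_on A" for A
    unfolding holomorphic_on_def using d field_differentiable_at_within by blast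
  have "norm ((deriv ^^ 1) (\<lambda>t. g (x(i := t))) (x i)) \<le> fact 1 * M / e ^ 1"
  proof (rule Cauchy_inequality[OF hol _ e])
    fix t assume t: "norm (x i - t) = e"
    show "norm (g (x(i := t))) \<le> M"
    proof (rule M)
      fix v assume v: "v \<in> V"
      have "norm (t - s i) \<le> norm (x i - t) + norm (x i - s i)"
        using norm_triangle_ineq[of "t - x i" "x i - s i"] by (simp add: norm_minus_commute)
      then show "norm ((x(i := t)) v - s v) \<le> r"
        using x[OF v] t e by auto
    qed
  qed (rule holomorphic_on_imp_continuous_on[OF hol])
  then show ?thesis by (simp add: pd_def)
qed

text \<open>A single term of the exponential series is at most the sum.\<close>

lemma power_le_exp_fact: "real k ^ k \<le> exp (real k) * fact k"
proof -
  have "real k ^ k / fact k \<le> suminf (\<lambda>j. real k ^ j / fact j)"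
    using sum_le_suminf[OF summable_exp_generic[of "real k"], of "{k}"] by (simp add: divide_inverse_commute)
  also have "\<dots> = exp (real k)" by (simp add: exp_def divide_inverse_commute)
  finally show ?thesis by (simp add: divide_simps)
qed

text \<open>Cauchy's estimate on \<open>k\<close> nested polydiscs of radii \<open>1 - j / k\<close>.\<close>

lemma der_pow_bound:
  assumes fin: "finite V" and w: "w \<in> V \<rightarrow> poly_funs V"
  shows "\<exists>A>0. \<forall>f\<in>poly_funs V. \<exists>M\<ge>0. \<forall>k. norm ((der V w ^^ k) f s) \<le> M * A ^ k * fact k"
proof -
  define P where "P r = {x. \<forall>v\<in>V. norm (x v - s v) \<le> r}" for r :: real
  have "\<exists>C\<ge>0. \<forall>v\<in>V. \<forall>x\<in>P 1. norm (w v x) \<le> C"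
  proof -
    have "\<exists>B. \<forall>v\<in>V. B v \<ge> 0 \<and> (\<forall>x\<in>P 1. norm (w v x) \<le> B v)"
    proof (rule bchoice, rule ballI)
      fix v assume v: "v \<in> V"
      show "\<exists>B. 0 \<le> B \<and> (\<forall>x\<in>P 1. norm (w v x) \<le> B)"
        using poly_funs_bounded[OF funcset_mem[OF w v], of s 1] unfolding P_def by simp
    qed
    then obtain B where B: "\<forall>v\<in>V. B v \<ge> 0 \<and> (\<forall>x\<in>P 1. norm (w v x) \<le> B v)" by blast
    have "B v \<le> sum B V" if "v \<in> V" for v
      using B fin that by (intro member_le_sum) auto
    then show ?thesis using B by (intro exI[of _ "sum B V"]) (force intro: sum_nonneg)
  qed
  then obtain C where C: "C \<ge> 0" "\<And>v x. v \<in> V \<Longrightarrow> x \<in> P 1 \<Longrightarrow> norm (w v x) \<le> C" by blast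
  \<comment> \<open>With radii differing by \<open>1 / k\<close>, each application of the derivation
    costs a factor \<open>card V * C * k\<close>; after \<open>k\<close> of them
    \<open>k ^ k\<close> is traded for \<open>exp 1 ^ k * fact k\<close>. The summand 1 keeps
    \<open>A\<close> positive when \<open>C\<close> is zero or \<open>V\<close> is empty.\<close>
  define A where "A = real (card V) * C * exp 1 + 1"
  have "A > 0" unfolding A_def using C(1) by (intro add_nonneg_pos) auto
  moreover have "\<exists>M\<ge>0. \<forall>k. norm ((der V w ^^ k) f s) \<le> M * A ^ k * fact k" if f: "f \<in> poly_funs V" for f
  proof -
    obtain M where M: "M \<ge> 0" "\<And>x. x \<in> P 1 \<Longrightarrow> norm (f x) \<le> M"
      using poly_funs_bounded[OF f, of s 1] unfolding P_def by blast
    have "norm ((der V w ^^ k) f s) \<le> M * A ^ k * fact k" for k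
    proof (cases "k = 0")
      case True
      then show ?thesis using M(2)[of s] by (simp add: P_def)
    next
      case False
      define e where "e = 1 / real k"
      have e: "e > 0" using False by (simp add: e_def)
      have "\<forall>x\<in>P (1 - real j * e). norm ((der V w ^^ j) f x) \<le> M * (real (card V) * C / e) ^ j" if "j \<le> k" for j
        using that
      proof (induction j)
        case 0
        then show ?case using M by simp
      next
        case (Suc j)
        show ?case
        proof
          fix x assume x: "x \<in> P (1 - real (Suc j) * e)"
          have "real (Suc j) * e \<ge> 0" using e by auto
          then have x1: "x \<in> P 1" using x unfolding P_def by (auto intro: order_trans)
          let ?g = "(der V w ^^ j) f"
          have pdb: "norm (pd v ?g x) \<le> M * (real (card V) * C / e) ^ j / e" for v
          proof (rule pd_bound[OF der_pow_in_poly_funs[OF f w] e, where s = s and r = "1 - real j * e"])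
            fix x assume "\<And>v. v \<in> V \<Longrightarrow> norm (x v - s v) \<le> 1 - real j * e"
            then show "norm (?g x) \<le> M * (real (card V) * C / e) ^ j"
              using Suc by (auto simp: P_def)
          next
            fix v assume "v \<in> V"
            then show "norm (x v - s v) \<le> 1 - real j * e - e"
              using x by (simp add: P_def algebra_simps)
          qed
          have "norm (der V w ?g x) \<le> (\<Sum>v\<in>V. norm (w v x) * norm (pd v ?g x))"
            unfolding der_def by (rule order_trans[OF norm_sum]) (simp add: norm_mult)
          also have "\<dots> \<le> (\<Sum>v\<in>V. C * (M * (real (card V) * C / e) ^ j / e))"
            by (intro sum_mono mult_mono C pdb x1) (use C(1) in auto)
          also have "\<dots> = M * (real (card V) * C / e) ^ Suc j" by simp
          finally show "norm ((der V w ^^ Suc j) f x) \<le> M * (real (card V) * C / e) ^ Suc j" by simp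
        qed
      qed
      from this[of k] have "norm ((der V w ^^ k) f s) \<le> M * (real (card V) * C / e) ^ k"
        using False by (simp add: P_def e_def)
      also have "\<dots> = M * ((real (card V) * C) ^ k * real k ^ k)"
        by (simp add: e_def power_mult_distrib)
      also have "\<dots> \<le> M * ((real (card V) * C) ^ k * (exp (real k) * fact k))"
        by (intro mult_left_mono power_le_exp_fact M(1)) (use C(1) in auto)
      also have "\<dots> = M * (real (card V) * C * exp 1) ^ k * fact k"
        by (simp add: power_mult_distrib exp_of_nat_mult[symmetric] flip: exp_of_nat2_mult)
      also have "\<dots> \<le> M * A ^ k * fact k"
        unfolding A_def by (intro mult_right_mono mult_left_mono power_mono M(1)) (use C(1) in auto)
      finally show ?thesis .
    qed
    then show ?thesis using M(1) by blast
  qed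
  ultimately show ?thesis by blast
qed

text \<open>The point \<open>exp (t D) s\<close>, encoded as a set with at most one element, which
  is empty when the expansion fails. Demanding the Taylor expansion of every polynomial, and not
  only of the coordinates, gives direct access to ideals and avoids solving a differential
  equation.\<close>

definition flow_points :: "'v set \<Rightarrow> ('v \<Rightarrow> ('v \<Rightarrow> complex) \<Rightarrow> complex) \<Rightarrow> ('v \<Rightarrow> complex) \<Rightarrow> complex \<Rightarrow>
    ('v \<Rightarrow> complex) set" where
  "flow_points V w s t = {z. (\<forall>v. v \<notin> V \<longrightarrow> z v = s v) \<and>
     (\<forall>f\<in>poly_funs V. (\<lambda>k. (der V w ^^ k) f s / fact k * t ^ k) sums f z)}"

text \<open>The coordinates of the point are the sums of their own Taylor series. The expansion
  passes to all polynomials because, by Leibniz's rule, the coefficients of a product form the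
  Cauchy product of those of the factors, which converge absolutely. One radius serves all
  polynomials, as \<open>A\<close> does not depend on \<open>f\<close>.\<close>

lemma flow_exists:
  assumes fin: "finite V" and w: "w \<in> V \<rightarrow> poly_funs V"
  shows "\<exists>r>0. \<forall>t. norm t < r \<longrightarrow> flow_points V w s t \<noteq> {}"
proof -
  let ?D = "der V w"
  obtain A where A: "A > 0" "\<And>f. f \<in> poly_funs V \<Longrightarrow> \<exists>M\<ge>0. \<forall>k. norm ((?D ^^ k) f s) \<le> M * A ^ k * fact k"
    using der_pow_bound[OF fin w, of s] by blast
  define c where "c f t k = (?D ^^ k) f s / fact k * t ^ k" for f t k
  have summ: "summable (\<lambda>k. norm (c f t k))" if f: "f \<in> poly_funs V" and t: "norm t < 1 / A" for f t
  proof -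
    obtain M where M: "M \<ge> 0" "\<And>k. norm ((?D ^^ k) f s) \<le> M * A ^ k * fact k" using A(2)[OF f] by blast
    have "norm (A * norm t) < 1" using t A(1) by (simp add: field_simps)
    then have "summable (\<lambda>k. M * (A * norm t) ^ k)" by (intro summable_mult summable_geometric)
    moreover have "norm (norm (c f t k)) \<le> M * (A * norm t) ^ k" for k
    proof -
      have "norm ((?D ^^ k) f s) / fact k * norm t ^ k \<le> M * A ^ k * norm t ^ k"
        by (intro mult_right_mono) (use M(2)[of k] in \<open>auto simp: divide_simps\<close>)
      then show ?thesis by (simp add: c_def norm_mult norm_divide norm_power power_mult_distrib mult.assoc)
    qed
    ultimately show ?thesis by (rule summable_comparison_test')
  qed
  have "flow_points V w s t \<noteq> {}" if t: "norm t < 1 / A" for t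
  proof -
    define z where "z v = (if v \<in> V then suminf (c (\<lambda>x. x v) t) else s v)" for v
    have "c f t sums f z" if "f \<in> poly_funs V" for f
      using that
    proof induction
      case (const b)
      have "c (\<lambda>x. b) t k = (if k = 0 then b else 0)" for k
        unfolding c_def der_pow_const by simp
      then show ?case using sums_single[of 0 "\<lambda>_. b"] by (simp add: fun_eq_iff[symmetric] cong: sums_cong)
    next
      case (var v)
      then show ?case
        using summable_sums[OF summable_norm_cancel[OF summ[OF poly_funs.var[OF var] t]]]
        by (simp add: z_def)
    next
      case (add f g)
      have "c (\<lambda>x. f x + g x) t = (\<lambda>k. c f t k + c g t k)"
        unfolding c_def der_pow_add[OF add.hyps w] by (simp add: field_simps)
      then show ?case using sums_add[OF add.IH] by simp
    next
      case (mult f g)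
      have "c (\<lambda>x. f x * g x) t k = (\<Sum>i\<le>k. c f t i * c g t (k - i))" for k
      proof -
        have "of_nat (k choose i) / fact k = (1 / (fact i * fact (k - i)) :: complex)" if "i \<le> k" for i
          using binomial_fact[OF that, where 'a = complex] by simp
        then have "of_nat (k choose i) * a * b / fact k * t ^ k = (a / fact i * t ^ i) * (b / fact (k - i) * t ^ (k - i))"
          if "i \<le> k" for i a b
          using that power_add[of t i "k - i"] by (simp add: field_simps)
        then show ?thesis
          unfolding c_def der_pow_mult[OF mult.hyps w] sum_divide_distrib sum_distrib_right
          by (intro sum.cong) auto
      qed
      then have "c (\<lambda>x. f x * g x) t = (\<lambda>k. \<Sum>i\<le>k. c f t i * c g t (k - i))" by blast
      then show ?case
        using Cauchy_product_sums[OF summ[OF mult.hyps(1) t] summ[OF mult.hyps(2) t]]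
        unfolding sums_unique[OF mult.IH(1), symmetric] sums_unique[OF mult.IH(2), symmetric] by (simp only:)
    qed
    then have "z \<in> flow_points V w s t" unfolding flow_points_def c_def by (simp add: z_def)
    then show ?thesis by blast
  qed
  then show ?thesis using A(1) by (intro exI[of _ "1 / A"]) simp
qed

definition flow_out :: "'v set \<Rightarrow> ('v \<Rightarrow> ('v \<Rightarrow> complex) \<Rightarrow> complex) \<Rightarrow> ('v \<Rightarrow> complex) set \<Rightarrow> ('v \<Rightarrow> complex) set" where
  "flow_out V w A = (\<Union>s\<in>A. \<Union>t. flow_points V w s t)"

text \<open>A power series vanishes on a disc exactly when all its coefficients do. The ideal of the
  flow-out is thus described by the derivatives on \<open>A\<close> alone.\<close>

lemma vanishes_flow_out:
  assumes fin: "finite V" and w: "w \<in> V \<rightarrow> poly_funs V" and f: "f \<in> poly_funs V"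
  shows "vanishes (flow_out V w A) f \<longleftrightarrow> (\<forall>k. vanishes A ((der V w ^^ k) f))"
proof
  assume v: "\<forall>k. vanishes A ((der V w ^^ k) f)"
  show "vanishes (flow_out V w A) f"
    unfolding vanishes_def
  proof
    fix z assume "z \<in> flow_out V w A"
    then obtain s t where s: "s \<in> A" "z \<in> flow_points V w s t" unfolding flow_out_def by blast
    have "(\<lambda>k. (der V w ^^ k) f s / fact k * t ^ k) sums f z"
      using s(2) f unfolding flow_points_def by blast
    moreover have "(der V w ^^ k) f s = 0" for k using v s(1) unfolding vanishes_def by blast
    ultimately show "f z = 0" by (simp add: sums_iff)
  qed
next
  assume v: "vanishes (flow_out V w A) f"
  show "\<forall>k. vanishes A ((der V w ^^ k) f)"
  proof (intro allI, unfold vanishes_def, intro ballI)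
    fix k s assume s: "s \<in> A"
    obtain r where r: "r > 0" "\<And>t. norm t < r \<Longrightarrow> flow_points V w s t \<noteq> {}" using flow_exists[OF fin w, of s] by blast
    let ?a = "\<lambda>k. (der V w ^^ k) f s / fact k"
    have sm: "(\<lambda>k. ?a k * (t - 0) ^ k) sums 0" if t: "norm (t - 0) < r" for t
    proof -
      obtain z where z: "z \<in> flow_points V w s t" using r(2) t by auto
      then have "f z = 0" using v s unfolding vanishes_def flow_out_def by blast
      then show ?thesis using z f unfolding flow_points_def by force
    qed
    have "?a k = 0"
    proof (cases "k = 0")
      case True
      have "?a 0 = 0" using sm[of 0] r(1) powser_sums_zero_iff[of ?a 0] by simp
      then show ?thesis using True by simp
    next
      case False
      show ?thesis
      proof (rule ccontr)
        assume nz: "?a k \<noteq> 0"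
        show False
        \<comment> \<open>A nonzero coefficient of positive order would make 0 an isolated zero of
          the sum, which is however zero on a whole disc. Order 0 has been settled by evaluating at
          \<open>t = 0\<close>.\<close>
        proof (rule powser_0_nonzero[where a = ?a and \<xi> = 0 and f = "\<lambda>_. 0" and r = r and m = k])
          show "k > 0" "r > 0" "?a k \<noteq> 0" using False r(1) nz by simp_all
          show "\<And>t. norm (t - 0) < r \<Longrightarrow> (\<lambda>k. ?a k * (t - 0) ^ k) sums 0" by (rule sm)
          fix d :: real assume d: "0 < d" "\<And>z. z \<in> cball (0::complex) d - {0} \<Longrightarrow> (0::complex) \<noteq> 0"
          show False using d(2)[of "of_real d"] d(1) by simp
        qed simp
      qed
    qed
    then show "(der V w ^^ k) f s = 0" by simp
  qed
qed

lemma flow_out_superset: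
  shows "A \<subseteq> flow_out V w A"
proof
  fix s assume "s \<in> A"
  moreover have "s \<in> flow_points V w s 0"
    unfolding flow_points_def using powser_sums_zero[of "\<lambda>k. (der V w ^^ k) f s / fact k" for f]
    by auto
  ultimately show "s \<in> flow_out V w A" unfolding flow_out_def by blast
qed

text \<open>Let \<open>k\<close> and \<open>l\<close> be the least orders of derivatives of
  \<open>f\<close> and \<open>g\<close> that do not vanish on \<open>A\<close>. In Leibniz's formula
  of order \<open>k + l\<close> every other term contains a derivative of smaller order and is zero
  on \<open>A\<close>. What remains is the product of these two derivatives times a binomial
  coefficient, nonzero in characteristic zero.\<close>

lemma irred_flow_out:
  assumes fin: "finite V" and w: "w \<in> V \<rightarrow> poly_funs V" and A: "irred V A"
  shows "irred V (flow_out V w A)"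
  unfolding irred_def
proof (intro conjI ballI impI)
  let ?D = "der V w"
  show "flow_out V w A \<noteq> {}" using A flow_out_superset[of A] unfolding irred_def by blast
  fix f g assume fg: "f \<in> poly_funs V" "g \<in> poly_funs V" "vanishes (flow_out V w A) (\<lambda>x. f x * g x)"
  have fp: "(?D ^^ i) f \<in> poly_funs V" and gp: "(?D ^^ i) g \<in> poly_funs V" for i
    using der_pow_in_poly_funs[OF fg(1) w] der_pow_in_poly_funs[OF fg(2) w] by auto
  show "vanishes (flow_out V w A) f \<or> vanishes (flow_out V w A) g"
  proof (rule ccontr)
    assume "\<not> ?thesis"
    then have ex: "\<exists>k. \<not> vanishes A ((?D ^^ k) f)" "\<exists>k. \<not> vanishes A ((?D ^^ k) g)"
      by (auto simp: vanishes_flow_out[OF fin w] fg(1,2))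
    define k where "k = (LEAST k. \<not> vanishes A ((?D ^^ k) f))"
    define l where "l = (LEAST k. \<not> vanishes A ((?D ^^ k) g))"
    have k: "\<not> vanishes A ((?D ^^ k) f)" "\<And>i. i < k \<Longrightarrow> vanishes A ((?D ^^ i) f)"
      using LeastI_ex[OF ex(1)] not_less_Least[of _ "\<lambda>k. \<not> vanishes A ((?D ^^ k) f)"] unfolding k_def by auto
    have l: "\<not> vanishes A ((?D ^^ l) g)" "\<And>i. i < l \<Longrightarrow> vanishes A ((?D ^^ i) g)"
      using LeastI_ex[OF ex(2)] not_less_Least[of _ "\<lambda>k. \<not> vanishes A ((?D ^^ k) g)"] unfolding l_def by auto
    have "vanishes A ((?D ^^ (k + l)) (\<lambda>x. f x * g x))"
      using fg(3) vanishes_flow_out[OF fin w poly_funs.mult[OF fg(1,2)]] by blast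
    then have "vanishes A (\<lambda>x. \<Sum>i\<le>k + l. of_nat (k + l choose i) * (?D ^^ i) f x * (?D ^^ (k + l - i)) g x)"
      unfolding der_pow_mult[OF fg(1,2) w] .
    moreover have "(\<Sum>i\<le>k + l. of_nat (k + l choose i) * (?D ^^ i) f x * (?D ^^ (k + l - i)) g x) =
        of_nat (k + l choose k) * ((?D ^^ k) f x * (?D ^^ l) g x)" if x: "x \<in> A" for x
    proof -
      have "of_nat (k + l choose i) * (?D ^^ i) f x * (?D ^^ (k + l - i)) g x = 0" if "i \<le> k + l" "i \<noteq> k" for i
      proof (cases "i < k")
        case True
        then show ?thesis using k(2) x by (simp add: vanishes_def)
      next
        case False
        then have "k + l - i < l" using that by auto
        then show ?thesis using l(2) x by (simp add: vanishes_def)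
      qed
      then have "(\<Sum>i\<le>k + l. of_nat (k + l choose i) * (?D ^^ i) f x * (?D ^^ (k + l - i)) g x) =
        (\<Sum>i\<in>{k}. of_nat (k + l choose i) * (?D ^^ i) f x * (?D ^^ (k + l - i)) g x)"
        by (intro sum.mono_neutral_right) auto
      then show ?thesis by simp
    qed
    ultimately have "vanishes A (\<lambda>x. (?D ^^ k) f x * (?D ^^ l) g x)"
      unfolding vanishes_def by (simp add: binomial_eq_0_iff)
    then show False using irred_mult[OF A fp gp k(1) l(1)] by blast
  qed
qed

text \<open>
  Flowing successively along the derivations dual to a basis gives a strictly increasing chain of irreducible
  sets; the coordinates of the basis not yet used stay constant.
\<close>

lemma irred_chain:
  assumes fin: "finite V" and S: "irred V S" and J: "basis_of V S J" and I: "I \<subseteq> J"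
    and g: "g \<in> poly_funs V" "\<not> vanishes S g"
  obtains s A and j :: "nat \<Rightarrow> 'v" where "s \<in> S" "g s \<noteq> 0" "bij_betw j {..<card (J - I)} (J - I)"
    "\<And>k. k \<le> card (J - I) \<Longrightarrow> irred V (A k) \<and> s \<in> A k \<and> (\<forall>x\<in>A k. \<forall>v. v \<notin> V \<longrightarrow> x v = s v) \<and>
      (\<forall>f\<in>poly_funs V. vanishes S f \<longrightarrow> vanishes (A k) f) \<and> (\<forall>x\<in>A k. \<forall>i\<in>I. x i = s i) \<and>
      (\<forall>x\<in>A k. \<forall>m\<ge>k. m < card (J - I) \<longrightarrow> x (j m) = s (j m))"
    "\<And>k. k < card (J - I) \<Longrightarrow> A k \<subseteq> A (Suc k) \<and> (\<exists>x\<in>A (Suc k). x (j k) \<noteq> s (j k))"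
proof -
  let ?N = "card (J - I)"
  have JV: "J \<subseteq> V" using J unfolding basis_of_def by blast
  have finJ: "finite J" using finite_subset[OF JV fin] .
  obtain j where j: "bij_betw j {..<?N} (J - I)"
    using ex_bij_betw_nat_finite[of "J - I"] finJ by (auto simp: atLeast0LessThan)
  have "\<exists>w. \<forall>i\<in>J. (\<forall>v\<in>V. w i v \<in> poly_funs V) \<and> \<not> vanishes S (w i i) \<and> (\<forall>k\<in>J. k \<noteq> i \<longrightarrow> w i k = (\<lambda>x. 0)) \<and>
    (\<forall>f\<in>poly_funs V. vanishes S f \<longrightarrow> vanishes S (der V (w i) f))"
  proof (rule bchoice, rule ballI)
    fix i assume "i \<in> J"
    then show "\<exists>w. (\<forall>v\<in>V. w v \<in> poly_funs V) \<and> \<not> vanishes S (w i) \<and> (\<forall>k\<in>J. k \<noteq> i \<longrightarrow> w k = (\<lambda>x. 0)) \<and>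
      (\<forall>f\<in>poly_funs V. vanishes S f \<longrightarrow> vanishes S (der V w f))"
      using tangent_derivation[OF fin S J, of i] by metis
  qed
  then obtain w where w: "\<And>i v. i \<in> J \<Longrightarrow> v \<in> V \<Longrightarrow> w i v \<in> poly_funs V" "\<And>i. i \<in> J \<Longrightarrow> \<not> vanishes S (w i i)"
    "\<And>i k. i \<in> J \<Longrightarrow> k \<in> J \<Longrightarrow> k \<noteq> i \<Longrightarrow> w i k = (\<lambda>x. 0)"
    "\<And>i f. i \<in> J \<Longrightarrow> f \<in> poly_funs V \<Longrightarrow> vanishes S f \<Longrightarrow> vanishes S (der V (w i) f)"
    by blast
  have w1: "w i \<in> V \<rightarrow> poly_funs V" if "i \<in> J" for i using w(1)[OF that] by blast
  have wii: "w i i \<in> poly_funs V" if "i \<in> J" for i using w(1)[OF that, of i] that JV by blast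
  \<comment> \<open>The chain starts at a general point, where every field \<open>w i\<close> really
    moves its own coordinate. The factor \<open>g\<close> leaves room for a further open condition
    on the starting point.\<close>
  have "\<not> vanishes S (\<lambda>x. g x * (\<Prod>i\<in>J. w i i x))"
    by (intro irred_mult[OF S g(1) _ g(2)] irred_prod[OF S finJ] poly_funs_prod wii w(2))
  then obtain s where s: "s \<in> S" "g s \<noteq> 0" "\<And>i. i \<in> J \<Longrightarrow> w i i s \<noteq> 0"
    using finJ unfolding vanishes_def by auto
  define A where "A = rec_nat {s} (\<lambda>k A. flow_out V (w (j k)) A)"
  have A0: "A 0 = {s}" and AS: "A (Suc k) = flow_out V (w (j k)) (A k)" for k by (auto simp: A_def)
  have jJ: "j k \<in> J" "j k \<notin> I" if "k < ?N" for k using bij_betwE[OF j] that by auto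
  have jinj: "j k \<noteq> j m" if "k < ?N" "m < ?N" "k \<noteq> m" for k m
    using bij_betw_imp_inj_on[OF j] that by (auto simp: inj_on_def)
  have const: "x i = s i" if k: "k < ?N" and i: "i \<in> J" "i \<noteq> j k" and "\<forall>x\<in>A k. x i = s i" and x: "x \<in> A (Suc k)" for k i x
  proof -
    have iV: "i \<in> V" using i JV by auto
    have ip: "(\<lambda>x. x i) \<in> poly_funs V" by (intro poly_funs.var iV)
    have p: "(\<lambda>x. x i - s i) \<in> poly_funs V" by (intro poly_funs_diff ip poly_funs.const)
    have d: "der V (w (j k)) (\<lambda>x. x i - s i) = (\<lambda>x. 0)"
      using der_diff[OF ip poly_funs.const[of "s i"], of V "w (j k)"] der_var[OF fin iV, of "w (j k)"]
        w(3)[OF jJ(1)[OF k] i] by auto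
    have "vanishes (A k) ((der V (w (j k)) ^^ m) (\<lambda>x. x i - s i))" for m
    proof (cases m)
      case 0
      then show ?thesis using that(4) by (simp add: vanishes_def)
    next
      case (Suc l)
      have "(der V (w (j k)) ^^ m) (\<lambda>x. x i - s i) = (der V (w (j k)) ^^ l) (\<lambda>x. 0)"
        unfolding Suc funpow_Suc_right comp_def d ..
      then show ?thesis unfolding der_pow_const vanishes_def by simp
    qed
    then have "vanishes (A (Suc k)) (\<lambda>x. x i - s i)"
      unfolding AS using vanishes_flow_out[OF fin w1[OF jJ(1)[OF k]] p] by blast
    then show ?thesis using x by (simp add: vanishes_def)
  qed
  have main: "irred V (A k) \<and> s \<in> A k \<and> (\<forall>x\<in>A k. \<forall>v. v \<notin> V \<longrightarrow> x v = s v) \<and>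
      (\<forall>f\<in>poly_funs V. vanishes S f \<longrightarrow> vanishes (A k) f) \<and> (\<forall>x\<in>A k. \<forall>i\<in>I. x i = s i) \<and>
      (\<forall>x\<in>A k. \<forall>m\<ge>k. m < ?N \<longrightarrow> x (j m) = s (j m))" if "k \<le> ?N" for k
    using that
  proof (induction k)
    case 0
    then show ?case using s(1) by (auto simp: A0 irred_def vanishes_def)
  next
    case (Suc k)
    then have k: "k < ?N" and IH: "irred V (A k)" "s \<in> A k" "\<And>x v. x \<in> A k \<Longrightarrow> v \<notin> V \<Longrightarrow> x v = s v"
      "\<And>f. f \<in> poly_funs V \<Longrightarrow> vanishes S f \<Longrightarrow> vanishes (A k) f" "\<And>x i. x \<in> A k \<Longrightarrow> i \<in> I \<Longrightarrow> x i = s i"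
      "\<And>x m. x \<in> A k \<Longrightarrow> m \<ge> k \<Longrightarrow> m < ?N \<Longrightarrow> x (j m) = s (j m)" by auto
    note wk = w1[OF jJ(1)[OF k]]
    have "irred V (A (Suc k))" unfolding AS by (rule irred_flow_out[OF fin wk IH(1)])
    moreover have "s \<in> A (Suc k)" using IH(2) flow_out_superset unfolding AS by blast
    moreover have "x v = s v" if "x \<in> A (Suc k)" "v \<notin> V" for x v
    proof -
      obtain u t where "u \<in> A k" "x \<in> flow_points V (w (j k)) u t"
        using \<open>x \<in> A (Suc k)\<close> unfolding AS flow_out_def by blast
      then show ?thesis using IH(3) \<open>v \<notin> V\<close> unfolding flow_points_def by auto
    qed
    moreover have "vanishes (A (Suc k)) f" if f: "f \<in> poly_funs V" "vanishes S f" for f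
    proof -
      have "vanishes S ((der V (w (j k)) ^^ m) f)" for m
      proof (induction m)
        case (Suc m)
        then show ?case using w(4)[OF jJ(1)[OF k] der_pow_in_poly_funs[OF f(1) wk]] by simp
      qed (simp add: f)
      then show ?thesis
        unfolding AS vanishes_flow_out[OF fin wk f(1)] using IH(4)[OF der_pow_in_poly_funs[OF f(1) wk]] by blast
    qed
    moreover have "x i = s i" if "x \<in> A (Suc k)" "i \<in> I" for x i
      by (rule const[OF k _ _ _ that(1)]) (use that(2) I jJ(2)[OF k] IH(5) in auto)
    moreover have "x (j m) = s (j m)" if "x \<in> A (Suc k)" "m \<ge> Suc k" "m < ?N" for x m
      by (rule const[OF k _ _ _ that(1)]) (use that jJ(1) jinj[of m k] k IH(6) in auto)
    ultimately show ?case by blast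
  qed
  have step: "A k \<subseteq> A (Suc k) \<and> (\<exists>x\<in>A (Suc k). x (j k) \<noteq> s (j k))" if k: "k < ?N" for k
  proof
    show "A k \<subseteq> A (Suc k)" unfolding AS by (rule flow_out_superset)
    note jk = jJ(1)[OF k]
    have jV: "j k \<in> V" using jk JV by auto
    have jp: "(\<lambda>x. x (j k)) \<in> poly_funs V" by (intro poly_funs.var jV)
    have p: "(\<lambda>x. x (j k) - s (j k)) \<in> poly_funs V" by (intro poly_funs_diff jp poly_funs.const)
    have "der V (w (j k)) (\<lambda>x. x (j k) - s (j k)) = w (j k) (j k)"
      using der_diff[OF jp poly_funs.const[of "s (j k)"], of V "w (j k)"] der_var[OF fin jV, of "w (j k)"]
      by auto
    \<comment> \<open>Strictness is visible to first order at \<open>s\<close>: the coordinate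
      \<open>j k\<close> moves with speed \<open>w (j k) (j k) s\<close>, which is nonzero.\<close>
    then have "(der V (w (j k)) ^^ 1) (\<lambda>x. x (j k) - s (j k)) s \<noteq> 0" using s(3)[OF jk] by simp
    moreover have "s \<in> A k" using main[OF less_imp_le[OF k]] by (elim conjE)
    ultimately have "\<not> vanishes (A k) ((der V (w (j k)) ^^ 1) (\<lambda>x. x (j k) - s (j k)))"
      unfolding vanishes_def by blast
    then have "\<not> vanishes (A (Suc k)) (\<lambda>x. x (j k) - s (j k))"
      unfolding AS vanishes_flow_out[OF fin w1[OF jk] p] by blast
    then show "\<exists>x\<in>A (Suc k). x (j k) \<noteq> s (j k)" unfolding vanishes_def by auto
  qed
  show ?thesis
  proof (rule that[of s j A])
    show "s \<in> S" "g s \<noteq> 0" by fact+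
    show "bij_betw j {..<?N} (J - I)" by fact
  next
    fix k assume "k \<le> ?N"
    from main[OF this]
    show "irred V (A k) \<and> s \<in> A k \<and> (\<forall>x\<in>A k. \<forall>v. v \<notin> V \<longrightarrow> x v = s v) \<and>
      (\<forall>f\<in>poly_funs V. vanishes S f \<longrightarrow> vanishes (A k) f) \<and> (\<forall>x\<in>A k. \<forall>i\<in>I. x i = s i) \<and>
      (\<forall>x\<in>A k. \<forall>m\<ge>k. m < ?N \<longrightarrow> x (j m) = s (j m))" .
  next
    fix k assume "k < ?N"
    from step[OF this] show "A k \<subseteq> A (Suc k) \<and> (\<exists>x\<in>A (Suc k). x (j k) \<noteq> s (j k))" .
  qed
qed

section \<open>Graded pieces\<close>

lemma poly_eval_in_poly_funs:
  assumes "\<And>m. m \<in> Poly_Mapping.keys f \<Longrightarrow> Poly_Mapping.keys m \<subseteq> V"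
  shows "poly_eval f \<in> poly_funs V"
  unfolding poly_eval_def[abs_def] monom_eval_def[abs_def]
  by (intro poly_funs_intros) (use assms in blast)

lemma poly_eval_sum: "poly_eval (\<Sum>i\<in>A. f i) x = (\<Sum>i\<in>A. poly_eval (f i) x)"
  by (induction A rule: infinite_finite_induct) (auto simp: poly_eval_add)

lemma poly_eval_var: "poly_eval (Poly_Mapping.single (Poly_Mapping.single v 1) 1) x = x v"
  by (simp add: poly_eval_single monom_eval_def)

lemma poly_mapping_sum_monomials:
  "f = (\<Sum>m\<in>Poly_Mapping.keys f. Poly_Mapping.single m (Poly_Mapping.lookup f m))"
  by (intro poly_mapping_eqI)
     (auto simp: lookup_sum lookup_single when_def not_in_keys_iff_lookup_eq_zero)

lemma poly_funs_imp_poly_eval: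
  assumes "F \<in> poly_funs V"
  shows "\<exists>f. (\<forall>m\<in>Poly_Mapping.keys f. Poly_Mapping.keys m \<subseteq> V) \<and> poly_eval f = F"
  using assms
proof induction
  case (const c)
  have "poly_eval (Poly_Mapping.single 0 c) = (\<lambda>x. c)"
    by (simp add: fun_eq_iff poly_eval_single monom_eval_def)
  then show ?case by (intro exI[of _ "Poly_Mapping.single 0 c"]) auto
next
  case (var v)
  then show ?case
    by (intro exI[of _ "Poly_Mapping.single (Poly_Mapping.single v 1) 1"])
       (use poly_eval_var[of v] in \<open>auto simp: fun_eq_iff\<close>)
next
  case (add F G)
  then obtain f g where "\<forall>m\<in>Poly_Mapping.keys f. Poly_Mapping.keys m \<subseteq> V" "poly_eval f = F"
    "\<forall>m\<in>Poly_Mapping.keys g. Poly_Mapping.keys m \<subseteq> V" "poly_eval g = G" by blast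
  then show ?case using keys_add[of f g]
    by (intro exI[of _ "f + g"] conjI) (blast, auto simp: fun_eq_iff poly_eval_add)
next
  case (mult F G)
  then obtain f g where fg: "\<forall>m\<in>Poly_Mapping.keys f. Poly_Mapping.keys m \<subseteq> V" "poly_eval f = F"
    "\<forall>m\<in>Poly_Mapping.keys g. Poly_Mapping.keys m \<subseteq> V" "poly_eval g = G" by blast
  have "Poly_Mapping.keys m \<subseteq> V" if m: "m \<in> Poly_Mapping.keys (f * g)" for m
  proof -
    obtain a b where "m = a + b" "a \<in> Poly_Mapping.keys f" "b \<in> Poly_Mapping.keys g"
      using m keys_mult[of f g] by blast
    then show ?thesis using keys_add[of a b] fg(1,3) by blast
  qed
  then show ?case using fg by (intro exI[of _ "f * g"]) (auto simp: fun_eq_iff poly_eval_mult)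
qed

text \<open>Sorting monomials by an arbitrary classifier \<open>\<kappa>\<close> treats degree and
  bidegree alike.\<close>

definition class_part :: "(('v \<Rightarrow>\<^sub>0 nat) \<Rightarrow> 'k) \<Rightarrow> 'k \<Rightarrow> 'v cpoly \<Rightarrow> 'v cpoly" where
  "class_part \<kappa> k f = (\<Sum>m\<in>{m\<in>Poly_Mapping.keys f. \<kappa> m = k}. Poly_Mapping.single m (Poly_Mapping.lookup f m))"

lemma keys_class_part: "Poly_Mapping.keys (class_part \<kappa> k f) \<subseteq> {m\<in>Poly_Mapping.keys f. \<kappa> m = k}"
proof
  fix m assume "m \<in> Poly_Mapping.keys (class_part \<kappa> k f)"
  then have "Poly_Mapping.lookup (class_part \<kappa> k f) m \<noteq> 0" by (simp add: in_keys_iff)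
  moreover have "Poly_Mapping.lookup (class_part \<kappa> k f) m =
      (\<Sum>m'\<in>{m\<in>Poly_Mapping.keys f. \<kappa> m = k}. if m' = m then Poly_Mapping.lookup f m' else 0)"
    by (simp add: class_part_def lookup_sum lookup_single when_def)
  ultimately show "m \<in> {m\<in>Poly_Mapping.keys f. \<kappa> m = k}" by (auto split: if_splits)
qed

lemma sum_class_parts:
  "poly_eval f x = (\<Sum>k\<in>\<kappa> ` Poly_Mapping.keys f. poly_eval (class_part \<kappa> k f) x)"
proof -
  have "(\<Sum>k\<in>\<kappa> ` Poly_Mapping.keys f. class_part \<kappa> k f) =
      (\<Sum>m\<in>Poly_Mapping.keys f. Poly_Mapping.single m (Poly_Mapping.lookup f m))"
    unfolding class_part_def by (rule sum.image_gen[symmetric]) simp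
  then show ?thesis using poly_mapping_sum_monomials[of f] by (metis poly_eval_sum)
qed

lemma poly_eval_class_part_outside: "k \<notin> \<kappa> ` Poly_Mapping.keys f \<Longrightarrow> poly_eval (class_part \<kappa> k f) x = 0"
proof -
  assume "k \<notin> \<kappa> ` Poly_Mapping.keys f"
  then have "{m\<in>Poly_Mapping.keys f. \<kappa> m = k} = {}" by blast
  then show ?thesis unfolding class_part_def by (simp only: sum.empty poly_eval_0)
qed

lemma poly_coeffs_unique:
  fixes a :: "'k \<Rightarrow> complex"
  assumes "finite A" "inj_on (e :: 'k \<Rightarrow> nat) A" "\<And>c. c \<noteq> 0 \<Longrightarrow> (\<Sum>k\<in>A. c ^ e k * a k) = 0" "k \<in> A"
  shows "a k = 0"
proof -
  define p where "p = (\<Sum>k\<in>A. monom (a k) (e k))"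
  \<comment> \<open>The hypothesis only speaks of nonzero \<open>c\<close>; the factor
    \<open>[:0, 1:]\<close> supplies the missing root 0.\<close>
  have "poly (p * [:0, 1:]) c = 0" for c
    using assms(3)[of c] by (cases "c = 0") (auto simp: p_def poly_sum poly_monom mult.commute)
  then have "p * [:0, 1:] = 0" using poly_all_0_iff_0 by blast
  then have "coeff p (e k) = 0" by simp
  moreover have "coeff p (e k) = (\<Sum>k'\<in>A. if k' = k then a k' else 0)"
    unfolding p_def coeff_sum using assms(2,4) by (intro sum.cong) (auto simp: inj_on_def)
  ultimately show ?thesis using assms(1,4) by simp
qed

text \<open>The substitution \<open>b = c\<^sup>M\<close> separates the monomials when \<open>M\<close> exceeds every exponent of \<open>c\<close>.\<close>

lemma poly_coeffs_unique2:
  fixes a :: "nat \<times> nat \<Rightarrow> complex"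
  assumes A: "finite A" "p \<in> A"
    and sum0: "\<And>b c. b \<noteq> 0 \<Longrightarrow> c \<noteq> 0 \<Longrightarrow> (\<Sum>p\<in>A. b ^ fst p * c ^ snd p * a p) = 0"
  shows "a p = 0"
proof -
  define M where "M = Suc (Max (snd ` A))"
  have M: "snd p < M" if "p \<in> A" for p
    unfolding M_def less_Suc_eq_le by (intro Max_ge) (use A(1) that in auto)
  define \<epsilon> where "\<epsilon> p = M * fst p + snd p" for p :: "nat \<times> nat"
  have inj: "inj_on \<epsilon> A"
  proof
    fix p q assume pq: "p \<in> A" "q \<in> A" "\<epsilon> p = \<epsilon> q"
    have "\<epsilon> p mod M = snd p" "\<epsilon> p div M = fst p" "\<epsilon> q mod M = snd q" "\<epsilon> q div M = fst q"
      using M[OF pq(1)] M[OF pq(2)] by (auto simp: \<epsilon>_def)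
    then show "p = q" using pq(3) by (simp add: prod_eq_iff)
  qed
  show ?thesis
  proof (rule poly_coeffs_unique[OF A(1) inj _ A(2)])
    fix c :: complex assume "c \<noteq> 0"
    then show "(\<Sum>k\<in>A. c ^ \<epsilon> k * a k) = 0"
      using sum0[of "c ^ M" c] by (simp add: \<epsilon>_def power_add power_mult)
  qed
qed

text \<open>Forms described by their behaviour under scaling. Closure under products, derivatives
  and determinants can be read off here without following monomials;
  \<open>hom_funs_imp_forms\<close> leads back to actual forms.\<close>

definition hom_funs :: "nat \<Rightarrow> nat \<Rightarrow> (cvector \<Rightarrow> complex) set" where
  "hom_funs n d = {F \<in> poly_funs {..n}. \<forall>c x. c \<noteq> 0 \<longrightarrow> F (\<lambda>i. c * x i) = c ^ d * F x}"

definition bihom_funs :: "nat \<Rightarrow> nat \<Rightarrow> nat \<Rightarrow> nat \<Rightarrow> ((nat + nat \<Rightarrow> complex) \<Rightarrow> complex) set" where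
  "bihom_funs n k d e = {F \<in> poly_funs (Inl ` {..n} \<union> Inr ` {..k}). \<forall>b c x y. b \<noteq> 0 \<longrightarrow> c \<noteq> 0 \<longrightarrow>
     F (case_sum (\<lambda>i. b * x i) (\<lambda>j. c * y j)) = b ^ d * c ^ e * F (case_sum x y)}"

lemma poly_eval_forms: "f \<in> forms n d \<Longrightarrow> poly_eval f \<in> hom_funs n d"
  using poly_eval_scale[of f n d] poly_eval_in_poly_funs[of f "{..n}"]
  unfolding hom_funs_def forms_def by blast

lemma poly_eval_biforms: "f \<in> biforms n k d e \<Longrightarrow> poly_eval f \<in> bihom_funs n k d e"
  using poly_eval_biscale[of f n k d e] poly_eval_in_poly_funs[of f "Inl ` {..n} \<union> Inr ` {..k}"]
  unfolding bihom_funs_def biforms_def by blast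

abbreviation "deg_of n m \<equiv> (\<Sum>i\<le>(n::nat). Poly_Mapping.lookup m i)"

abbreviation "bideg_of n k m \<equiv>
  ((\<Sum>i\<le>(n::nat). Poly_Mapping.lookup m (Inl i)), (\<Sum>j\<le>(k::nat). Poly_Mapping.lookup m (Inr j)))"

lemma class_part_forms:
  assumes "\<forall>m\<in>Poly_Mapping.keys f. Poly_Mapping.keys m \<subseteq> {..n}"
  shows "class_part (deg_of n) d f \<in> forms n d"
  unfolding forms_def using keys_class_part[of "deg_of n" d f] assms by fastforce

lemma class_part_biforms:
  assumes "\<forall>m\<in>Poly_Mapping.keys f. Poly_Mapping.keys m \<subseteq> Inl ` {..n} \<union> Inr ` {..k}"
  shows "class_part (bideg_of n k) (d, e) f \<in> biforms n k d e"
proof -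
  have "m \<in> Poly_Mapping.keys f" "(\<Sum>i\<le>n. Poly_Mapping.lookup m (Inl i)) = d"
    "(\<Sum>j\<le>k. Poly_Mapping.lookup m (Inr j)) = e"
    if "m \<in> Poly_Mapping.keys (class_part (bideg_of n k) (d, e) f)" for m
    using subsetD[OF keys_class_part that] by simp_all
  then show ?thesis unfolding biforms_def using assms by blast
qed

lemma poly_funs_hom_parts:
  assumes "F \<in> poly_funs {..n}"
  shows "\<exists>D H. finite D \<and> (\<forall>d. H d \<in> poly_eval ` forms n d) \<and>
    (\<forall>x. F x = (\<Sum>d\<in>D. H d x)) \<and> (\<forall>d x. d \<notin> D \<longrightarrow> H d x = 0)"
proof -
  obtain f where f: "\<forall>m\<in>Poly_Mapping.keys f. Poly_Mapping.keys m \<subseteq> {..n}" "poly_eval f = F"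
    using poly_funs_imp_poly_eval[OF assms] by blast
  show ?thesis
    by (intro exI[of _ "deg_of n ` Poly_Mapping.keys f"] exI[of _ "\<lambda>d. poly_eval (class_part (deg_of n) d f)"])
       (use class_part_forms[OF f(1)] sum_class_parts[of f _ "deg_of n"] f(2) poly_eval_class_part_outside in auto)
qed

lemma poly_funs_bihom_parts:
  assumes "F \<in> poly_funs (Inl ` {..n} \<union> Inr ` {..k})"
  shows "\<exists>D H. finite D \<and> (\<forall>d e. H (d, e) \<in> poly_eval ` biforms n k d e) \<and>
    (\<forall>x. F x = (\<Sum>d\<in>D. H d x)) \<and> (\<forall>d x. d \<notin> D \<longrightarrow> H d x = 0)"
proof -
  obtain f where f: "\<forall>m\<in>Poly_Mapping.keys f. Poly_Mapping.keys m \<subseteq> Inl ` {..n} \<union> Inr ` {..k}"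
    "poly_eval f = F" using poly_funs_imp_poly_eval[OF assms] by blast
  show ?thesis
    by (intro exI[of _ "bideg_of n k ` Poly_Mapping.keys f"]
        exI[of _ "\<lambda>d. poly_eval (class_part (bideg_of n k) d f)"])
       (use class_part_biforms[OF f(1)] sum_class_parts[of f _ "bideg_of n k"] f(2) poly_eval_class_part_outside in auto)
qed

text \<open>Comparing powers of \<open>c\<close> in \<open>F (\<lambda>i. c * x i)\<close> shows
  that only the component of degree \<open>d\<close> survives, so \<open>F\<close> is the evaluation
  of that component.\<close>

lemma hom_funs_imp_forms:
  assumes "F \<in> hom_funs n d"
  obtains f where "f \<in> forms n d" "poly_eval f = F"
proof -
  have F: "F \<in> poly_funs {..n}" "\<And>c x. c \<noteq> 0 \<Longrightarrow> F (\<lambda>i. c * x i) = c ^ d * F x"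
    using assms unfolding hom_funs_def by blast+
  obtain D H where D: "finite D" and H: "\<forall>e. H e \<in> poly_eval ` forms n e"
    and sum: "\<forall>x. F x = (\<Sum>e\<in>D. H e x)" and out: "\<forall>e x. e \<notin> D \<longrightarrow> H e x = 0"
    using poly_funs_hom_parts[OF F(1)] by (elim exE conjE)
  have hH: "H e (\<lambda>i. c * x i) = c ^ e * H e x" for e c x
  proof -
    obtain f where "H e = poly_eval f" "f \<in> forms n e" using spec[OF H, of e] by (elim imageE)
    then show ?thesis using poly_eval_scale by simp
  qed
  have "F x = H d x" for x
  proof -
    \<comment> \<open>\<open>a e\<close> is the coefficient of \<open>c ^ e\<close> in the
      difference of the two expressions for \<open>F\<close> at the scaled vector.\<close>
    define a where "a e = H e x - (if e = d then F x else 0)" for e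
    have "(\<Sum>e\<in>insert d D. c ^ id e * a e) = 0" if c: "c \<noteq> 0" for c
    proof -
      have "(\<Sum>e\<in>insert d D. c ^ id e * a e) = (\<Sum>e\<in>insert d D. c ^ e * H e x) -
          (\<Sum>e\<in>insert d D. if e = d then c ^ e * F x else 0)"
        unfolding sum_subtractf[symmetric] by (intro sum.cong) (auto simp: a_def algebra_simps)
      also have "(\<Sum>e\<in>insert d D. c ^ e * H e x) = (\<Sum>e\<in>D. H e (\<lambda>i. c * x i))"
        using D out by (intro sum.mono_neutral_cong_right) (auto simp: hH)
      finally show ?thesis using D by (simp add: spec[OF sum, symmetric] F(2)[OF c])
    qed
    then have "a d = 0" using D by (intro poly_coeffs_unique[of "insert d D" id a d]) auto
    then show ?thesis by (simp add: a_def)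
  qed
  then have "F = H d" by blast
  moreover obtain f where "H d = poly_eval f" "f \<in> forms n d" using spec[OF H, of d] by (elim imageE)
  ultimately show ?thesis by (intro that[of f]) simp_all
qed

lemma bihom_funs_imp_biforms:
  assumes "F \<in> bihom_funs n k d e"
  obtains f where "f \<in> biforms n k d e" "poly_eval f = F"
proof -
  have F: "F \<in> poly_funs (Inl ` {..n} \<union> Inr ` {..k})"
    "\<And>b c x y. b \<noteq> 0 \<Longrightarrow> c \<noteq> 0 \<Longrightarrow> F (case_sum (\<lambda>i. b * x i) (\<lambda>j. c * y j)) = b ^ d * c ^ e * F (case_sum x y)"
    using assms unfolding bihom_funs_def by blast+
  obtain D H where D: "finite D" and H: "\<forall>d e. H (d, e) \<in> poly_eval ` biforms n k d e"
    and sum: "\<forall>x. F x = (\<Sum>e\<in>D. H e x)" and out: "\<forall>e x. e \<notin> D \<longrightarrow> H e x = 0"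
    using poly_funs_bihom_parts[OF F(1)] by (elim exE conjE)
  have hH: "H p (case_sum (\<lambda>i. b * x i) (\<lambda>j. c * y j)) = b ^ fst p * c ^ snd p * H p (case_sum x y)" for p b c x y
  proof -
    obtain f where "H (fst p, snd p) = poly_eval f" "f \<in> biforms n k (fst p) (snd p)"
      using spec[OF spec[OF H, of "fst p"], of "snd p"] by (elim imageE)
    then show ?thesis using poly_eval_biscale by simp
  qed
  have "F (case_sum x y) = H (d, e) (case_sum x y)" for x y
  proof -
    let ?A = "insert (d, e) D"
    define a where "a p = H p (case_sum x y) - (if p = (d, e) then F (case_sum x y) else 0)" for p
    have "(\<Sum>p\<in>?A. b ^ fst p * c ^ snd p * a p) = 0" if bc: "b \<noteq> 0" "c \<noteq> 0" for b c
    proof -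
      let ?z = "case_sum (\<lambda>i. b * x i) (\<lambda>j. c * y j)"
      have "(\<Sum>p\<in>?A. b ^ fst p * c ^ snd p * a p) = (\<Sum>p\<in>?A. b ^ fst p * c ^ snd p * H p (case_sum x y)) -
          (\<Sum>p\<in>?A. if p = (d, e) then b ^ fst p * c ^ snd p * F (case_sum x y) else 0)"
        unfolding sum_subtractf[symmetric] by (intro sum.cong) (auto simp: a_def algebra_simps)
      also have "(\<Sum>p\<in>?A. b ^ fst p * c ^ snd p * H p (case_sum x y)) = (\<Sum>p\<in>D. H p ?z)"
        using D out by (intro sum.mono_neutral_cong_right) (auto simp: hH)
      finally show ?thesis using D F(2)[OF bc, of x y] by (simp add: spec[OF sum, symmetric])
    qed
    then have "a (d, e) = 0" using D by (intro poly_coeffs_unique2[of ?A "(d, e)" a]) auto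
    then show ?thesis by (simp add: a_def)
  qed
  moreover have "z = case_sum (z \<circ> Inl) (z \<circ> Inr)" for z :: "nat + nat \<Rightarrow> complex"
    by (auto simp: fun_eq_iff split: sum.split)
  ultimately have "F = H (d, e)" by (metis ext)
  moreover obtain f where "H (d, e) = poly_eval f" "f \<in> biforms n k d e"
    using spec[OF spec[OF H, of d], of e] by (elim imageE)
  ultimately show ?thesis by (intro that[of f]) simp_all
qed

section \<open>Dimension of closed sets in graded spaces\<close>

abbreviation zclosure :: "'a topology \<Rightarrow> 'a set \<Rightarrow> 'a set" where
  "zclosure \<equiv> Abstract_Topology.closure_of"

text \<open>\<open>pt\<close> is the quotient of the admissible vectors \<open>C\<close> by
  scalings, and \<open>H\<close> holds the homogeneous functions. \<open>parts\<close> says that a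
  polynomial vanishes on a whole orbit exactly when its graded components vanish;
  \<open>class_rank\<close> says that an orbit carries \<open>m\<close> independent coordinates, so
  that \<open>m\<close> is the rank lost on passing from cones to points. The fresh variable is the
  extra coordinate of graphs in \<open>algebraic_over_basis\<close>.\<close>

locale graded_space =
  fixes V :: "'v set" and C :: "('v \<Rightarrow> complex) set" and pt :: "('v \<Rightarrow> complex) \<Rightarrow> 'a"
    and T :: "'a topology" and H :: "(('v \<Rightarrow> complex) \<Rightarrow> complex) set" and m :: nat
  assumes finite_V: "finite V"
    and fresh: "\<exists>y. y \<notin> V"
    and H_poly: "H \<subseteq> poly_funs V"
    and topspace_T: "topspace T = pt ` C"
    and closedin_T: "closedin T A \<longleftrightarrow> (\<exists>F\<subseteq>H. A = pt ` {x\<in>C. \<forall>f\<in>F. f x = 0})"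
    and H_invariant: "f \<in> H \<Longrightarrow> x \<in> C \<Longrightarrow> y \<in> C \<Longrightarrow> pt x = pt y \<Longrightarrow> f x = 0 \<Longrightarrow> f y = 0"
    and parts: "f \<in> poly_funs V \<Longrightarrow>
      \<exists>P\<subseteq>H. \<forall>x\<in>C. (\<forall>y\<in>C. pt y = pt x \<longrightarrow> f y = 0) \<longleftrightarrow> (\<forall>p\<in>P. p x = 0)"
    and irred_class: "x \<in> C \<Longrightarrow> irred V {y\<in>C. pt y = pt x}"
    and class_rank: "x \<in> C \<Longrightarrow> \<exists>I\<subseteq>V. card I = m \<and> indep {y\<in>C. pt y = pt x} I"
begin

definition cone :: "'a set \<Rightarrow> ('v \<Rightarrow> complex) set" where
  "cone A = {x\<in>C. pt x \<in> A}"

text \<open>Dehomogenization: on the slice where the \<open>m\<close> coordinates in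
  \<open>I\<close> keep their nonzero values, the inhomogeneous condition \<open>x k = s k\<close>
  is the vanishing of a homogeneous function. Sets in the slice that differ in a coordinate can thus
  be told apart by closed sets.\<close>

definition normalizing :: "'v set \<Rightarrow> bool" where
  "normalizing I \<longleftrightarrow> I \<subseteq> V \<and> card I = m \<and> (\<forall>s\<in>C. (\<forall>i\<in>I. s i \<noteq> 0) \<longrightarrow>
     (\<forall>x. (\<forall>i\<in>I. x i = s i) \<longrightarrow> (\<forall>v. v \<notin> V \<longrightarrow> x v = s v) \<longrightarrow> x \<in> C) \<and>
     (\<forall>k\<in>V - I. \<exists>f\<in>H. \<forall>x. (\<forall>i\<in>I. x i = s i) \<longrightarrow> (f x = 0 \<longleftrightarrow> x k = s k)))"

lemma cone_mono: "A \<subseteq> B \<Longrightarrow> cone A \<subseteq> cone B"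
  unfolding cone_def by blast

lemma closed_eq_zeros:
  assumes "closedin T A"
  shows "\<exists>F\<subseteq>H. \<forall>x\<in>C. pt x \<in> A \<longleftrightarrow> (\<forall>f\<in>F. f x = 0)"
proof -
  obtain F where F: "F \<subseteq> H" "A = pt ` {x\<in>C. \<forall>f\<in>F. f x = 0}" using assms closedin_T by blast
  have "pt x \<in> A \<longleftrightarrow> (\<forall>f\<in>F. f x = 0)" if x: "x \<in> C" for x
  proof
    assume "pt x \<in> A"
    then obtain y where "y \<in> C" "\<forall>f\<in>F. f y = 0" "pt x = pt y" unfolding F(2) by blast
    then show "\<forall>f\<in>F. f x = 0" using H_invariant[of _ y x] x F(1) by auto
  qed (use x F(2) in blast)
  then show ?thesis using F(1) by blast
qed

lemma closed_zeros:
  assumes "F \<subseteq> H"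
  shows "closedin T (pt ` {x\<in>C. \<forall>f\<in>F. f x = 0})"
  unfolding closedin_T using assms by blast

text \<open>If neither \<open>f\<close> nor \<open>g\<close> vanishes on the cone, their graded
  parts cut out two closed sets, neither of which contains \<open>Z\<close>. A point of
  \<open>Z\<close> outside both has an orbit on which neither function vanishes identically; orbits
  being irreducible, the product is nonzero somewhere on it.\<close>

lemma irred_cone:
  assumes Z: "irreducible_in T Z"
  shows "irred V (cone Z)"
  unfolding irred_def
proof (intro conjI ballI impI)
  have ZT: "Z \<subseteq> pt ` C" "Z \<noteq> {}" using Z unfolding irreducible_in_def topspace_T by auto
  show "cone Z \<noteq> {}" using ZT unfolding cone_def by blast
  fix f g assume f: "f \<in> poly_funs V" and g: "g \<in> poly_funs V"
    and fg: "vanishes (cone Z) (\<lambda>x. f x * g x)"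
  show "vanishes (cone Z) f \<or> vanishes (cone Z) g"
  proof (rule ccontr)
    assume "\<not> ?thesis"
    then obtain x y where x: "x \<in> C" "pt x \<in> Z" "f x \<noteq> 0" and y: "y \<in> C" "pt y \<in> Z" "g y \<noteq> 0"
      unfolding vanishes_def cone_def by blast
    obtain P where P: "P \<subseteq> H" "\<forall>x\<in>C. (\<forall>y\<in>C. pt y = pt x \<longrightarrow> f y = 0) \<longleftrightarrow> (\<forall>p\<in>P. p x = 0)"
      using parts[OF f] by blast
    obtain Q where Q: "Q \<subseteq> H" "\<forall>x\<in>C. (\<forall>y\<in>C. pt y = pt x \<longrightarrow> g y = 0) \<longleftrightarrow> (\<forall>p\<in>Q. p x = 0)"
      using parts[OF g] by blast
    let ?A = "pt ` {x\<in>C. \<forall>f\<in>P. f x = 0}" and ?B = "pt ` {x\<in>C. \<forall>f\<in>Q. f x = 0}"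
    have "pt x \<notin> ?A"
    proof
      assume "pt x \<in> ?A"
      then obtain z where "z \<in> C" "\<forall>f\<in>P. f z = 0" "pt x = pt z" by blast
      then show False using P(2) x by metis
    qed
    moreover have "pt y \<notin> ?B"
    proof
      assume "pt y \<in> ?B"
      then obtain z where "z \<in> C" "\<forall>f\<in>Q. f z = 0" "pt y = pt z" by blast
      then show False using Q(2) y by metis
    qed
    ultimately have "\<not> Z \<subseteq> ?A \<union> ?B"
      using Z closed_zeros[OF P(1)] closed_zeros[OF Q(1)] x(2) y(2) unfolding irreducible_in_def by blast
    then obtain p where p: "p \<in> Z" "p \<notin> ?A" "p \<notin> ?B" by (auto simp del: image_eqI)
    have "p \<in> pt ` C" using p(1) ZT(1) by blast
    then obtain z where z0: "p = pt z" "z \<in> C" by (rule imageE)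
    have z: "z \<in> C" "pt z \<in> Z" "pt z \<notin> ?A" "pt z \<notin> ?B" using p z0 by simp_all
    let ?K = "{y\<in>C. pt y = pt z}"
    have "\<not> vanishes ?K f" "\<not> vanishes ?K g"
      using z P(2) Q(2) unfolding vanishes_def by blast+
    then have "\<not> vanishes ?K (\<lambda>x. f x * g x)" by (rule irred_mult[OF irred_class[OF z(1)] f g])
    then show False using fg z(2) unfolding vanishes_def cone_def by auto
  qed
qed

lemma irreducible_closure:
  assumes A: "irred V A" "A \<subseteq> C"
  shows "irreducible_in T (zclosure T (pt ` A))"
  unfolding irreducible_in_def
proof (intro conjI allI impI)
  have sub: "pt ` A \<subseteq> zclosure T (pt ` A)"
    using A(2) by (intro closure_of_subset) (auto simp: topspace_T)
  show "zclosure T (pt ` A) \<subseteq> topspace T" by (rule closure_of_subset_topspace)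
  show "zclosure T (pt ` A) \<noteq> {}" using sub A(1) unfolding irred_def by blast
  fix B D assume B: "closedin T B" and D: "closedin T D" and BD: "zclosure T (pt ` A) \<subseteq> B \<union> D"
  show "zclosure T (pt ` A) \<subseteq> B \<or> zclosure T (pt ` A) \<subseteq> D"
  proof (rule ccontr)
    assume "\<not> ?thesis"
    then have n: "\<not> pt ` A \<subseteq> B" "\<not> pt ` A \<subseteq> D"
      using closure_of_minimal[OF _ B] closure_of_minimal[OF _ D] by auto
    obtain F where F: "F \<subseteq> H" "\<And>x. x \<in> C \<Longrightarrow> pt x \<in> B \<longleftrightarrow> (\<forall>f\<in>F. f x = 0)"
      using closed_eq_zeros[OF B] by blast
    obtain G where G: "G \<subseteq> H" "\<And>x. x \<in> C \<Longrightarrow> pt x \<in> D \<longleftrightarrow> (\<forall>f\<in>G. f x = 0)"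
      using closed_eq_zeros[OF D] by blast
    obtain f where f: "f \<in> F" "\<not> vanishes A f" using n(1) F(2) A(2) unfolding vanishes_def by blast
    obtain g where g: "g \<in> G" "\<not> vanishes A g" using n(2) G(2) A(2) unfolding vanishes_def by blast
    have "\<not> vanishes A (\<lambda>x. f x * g x)"
      using f g F(1) G(1) H_poly by (intro irred_mult[OF A(1)]) auto
    then obtain x where "x \<in> A" "f x \<noteq> 0" "g x \<noteq> 0" unfolding vanishes_def by auto
    then show False using sub BD F(2) G(2) f(1) g(1) A(2) by blast
  qed
qed

lemma irreducible_in_subtopology:
  assumes "closedin T X" "Z \<subseteq> X"
  shows "irreducible_in (subtopology T X) Z \<longleftrightarrow> irreducible_in T Z"
proof -
  have X: "X \<subseteq> topspace T" using assms(1) closedin_subset by blast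
  have cl: "closedin (subtopology T X) A \<longleftrightarrow> A \<subseteq> X \<and> closedin T A" for A
    using closedin_closed_subtopology[OF assms(1)] by blast
  show ?thesis
  proof
    assume Z: "irreducible_in (subtopology T X) Z"
    show "irreducible_in T Z"
      unfolding irreducible_in_def
    proof (intro conjI allI impI)
      show "Z \<subseteq> topspace T" "Z \<noteq> {}" using Z X assms(2) unfolding irreducible_in_def by auto
      fix A B assume AB: "closedin T A" "closedin T B" "Z \<subseteq> A \<union> B"
      have "closedin (subtopology T X) (A \<inter> X)" "closedin (subtopology T X) (B \<inter> X)"
        unfolding cl using AB assms(1) by auto
      moreover have "Z \<subseteq> (A \<inter> X) \<union> (B \<inter> X)" using AB(3) assms(2) by blast
      ultimately show "Z \<subseteq> A \<or> Z \<subseteq> B" using Z unfolding irreducible_in_def by blast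
    qed
  next
    assume Z: "irreducible_in T Z"
    then show "irreducible_in (subtopology T X) Z"
      unfolding irreducible_in_def cl using assms(2) X by (auto simp: topspace_subtopology)
  qed
qed

text \<open>A homogeneous equation of \<open>Z\<close> that fails at some point of \<open>Y\<close>
  serves as the function separating the two cones.\<close>

lemma rk_cone_less:
  assumes Z: "closedin T Z" "irreducible_in T Z" and Y: "irreducible_in T Y" and "Z \<subset> Y"
  shows "rk V (cone Z) < rk V (cone Y)"
proof -
  obtain y where y: "y \<notin> V" using fresh by blast
  obtain F where F: "F \<subseteq> H" "\<And>x. x \<in> C \<Longrightarrow> pt x \<in> Z \<longleftrightarrow> (\<forall>f\<in>F. f x = 0)"
    using closed_eq_zeros[OF Z(1)] by blast
  obtain z where z: "z \<in> C" "pt z \<in> Y" "pt z \<notin> Z"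
    using \<open>Z \<subset> Y\<close> Y unfolding irreducible_in_def topspace_T by blast
  obtain f where f: "f \<in> F" "f z \<noteq> 0" using F(2)[OF z(1)] z(3) by blast
  show ?thesis
  proof (rule rk_less[OF finite_V irred_cone[OF Y] _ y])
    show "cone Z \<noteq> {}" using irred_cone[OF Z(2)] unfolding irred_def by blast
    show "vanishes (cone Z) g" if "vanishes (cone Y) g" for g
      using that cone_mono[of Z Y] \<open>Z \<subset> Y\<close> unfolding vanishes_def by blast
    show "f \<in> poly_funs V" using f F(1) H_poly by blast
    show "vanishes (cone Z) f" using f F(2) unfolding vanishes_def cone_def by blast
    show "\<not> vanishes (cone Y) f" using f(2) z unfolding vanishes_def cone_def by blast
  qed
qed

lemma rk_cone_ge:
  assumes "irreducible_in T Z"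
  shows "m \<le> rk V (cone Z)"
proof -
  obtain x where x: "x \<in> cone Z" using irred_cone[OF assms] unfolding irred_def by blast
  then obtain I where I: "I \<subseteq> V" "card I = m" "indep {y\<in>C. pt y = pt x} I"
    using class_rank unfolding cone_def by blast
  have "indep (cone Z) I"
    by (rule indep_superset[OF I(3)]) (use x in \<open>auto simp: vanishes_def cone_def\<close>)
  then show ?thesis using card_indep_le_rk[OF finite_V I(1)] I(2) by simp
qed

text \<open>The rank is at least \<open>m\<close> at the bottom of a chain, since a cone contains an
  orbit, and grows with every step.\<close>

lemma krull_dim_le:
  assumes X: "closedin T X" and XX: "irreducible_in T X"
  shows "krull_dim (subtopology T X) \<le> enat (rk V (cone X) - m)"
  unfolding krull_dim_def
proof (rule Sup_least)
  fix d assume "d \<in> {enat k |k. \<exists>Z. (\<forall>i\<le>k. closedin (subtopology T X) (Z i) \<and> irreducible_in (subtopology T X) (Z i)) \<and>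
      (\<forall>i<k. Z i \<subset> Z (Suc i))}"
  then obtain k Z where d: "d = enat k" and Z: "\<And>i. i \<le> k \<Longrightarrow> closedin (subtopology T X) (Z i)"
    "\<And>i. i \<le> k \<Longrightarrow> irreducible_in (subtopology T X) (Z i)" "\<And>i. i < k \<Longrightarrow> Z i \<subset> Z (Suc i)" by blast
  have Zc: "closedin T (Z i)" "Z i \<subseteq> X" if "i \<le> k" for i
    using Z(1)[OF that] closedin_closed_subtopology[OF X] by auto
  have Zi: "irreducible_in T (Z i)" if "i \<le> k" for i
    using Z(2)[OF that] irreducible_in_subtopology[OF X Zc(2)[OF that]] by simp
  have "m + i \<le> rk V (cone (Z i))" if "i \<le> k" for i
    using that
  proof (induction i)
    case 0
    then show ?case using rk_cone_ge[OF Zi[of 0]] by simp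
  next
    case (Suc i)
    then show ?case using rk_cone_less[OF Zc(1)[of i] Zi[of i] Zi[of "Suc i"] Z(3)[of i]] by simp
  qed
  from this[of k] have "m + k \<le> rk V (cone (Z k))" by simp
  also have "\<dots> \<le> rk V (cone X)"
  proof (cases "Z k = X")
    case False
    then have "Z k \<subset> X" using Zc(2)[of k] by blast
    then show ?thesis using rk_cone_less[OF Zc(1)[of k] Zi[of k] XX] by simp
  qed simp
  finally show "d \<le> enat (rk V (cone X) - m)" by (simp add: d)
qed

text \<open>The flow-outs are kept in a slice on which the coordinates of \<open>I\<close> are
  frozen, so \<open>card J - m\<close> flows remain. The closures of the images stay distinct: the
  coordinate that step \<open>k\<close> sets in motion is still constant on \<open>A k\<close>,
  which is a closed condition by normalization, and it is no longer constant on
  \<open>A (Suc k)\<close>.\<close>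

lemma krull_dim_ge:
  assumes X: "closedin T X" and XX: "irreducible_in T X"
    and J: "basis_of V (cone X) J" and I: "I \<subseteq> J" "normalizing I"
  shows "enat (card J - m) \<le> krull_dim (subtopology T X)"
proof -
  let ?S = "cone X" and ?N = "card (J - I)"
  note S = irred_cone[OF XX]
  have JV: "J \<subseteq> V" using J unfolding basis_of_def by blast
  have finI: "finite I" using I(1) JV finite_V by (meson finite_subset)
  have "\<not> vanishes ?S (\<lambda>x. x i)" if "i \<in> I" for i
  proof
    assume "vanishes ?S (\<lambda>x. x i)"
    moreover have "(\<lambda>x. x i) \<in> poly_funs J" using that I(1) by (intro poly_funs.var) auto
    ultimately have "(\<lambda>x. x i) = (\<lambda>x. 0 :: complex)" using J unfolding basis_of_def indep_def by blast
    from fun_cong[OF this, of "\<lambda>_. 1"] show False by simp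
  qed
  \<comment> \<open>Members of a basis do not vanish on the cone. Their product is handed to the
    chain so that it starts where all coordinates of \<open>I\<close> are nonzero.\<close>
  then have g: "\<not> vanishes ?S (\<lambda>x. \<Prod>i\<in>I. x i)"
    using I(1) JV by (intro irred_prod[OF S finI] poly_funs.var) auto
  have gp: "(\<lambda>x. \<Prod>i\<in>I. x i) \<in> poly_funs V" using I(1) JV by (intro poly_funs_prod poly_funs.var) auto
  obtain s A and j :: "nat \<Rightarrow> 'v" where s: "s \<in> ?S" "(\<Prod>i\<in>I. s i) \<noteq> 0" and j: "bij_betw j {..<?N} (J - I)"
    and A: "\<And>k. k \<le> ?N \<Longrightarrow> irred V (A k) \<and> s \<in> A k \<and> (\<forall>x\<in>A k. \<forall>v. v \<notin> V \<longrightarrow> x v = s v) \<and>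
      (\<forall>f\<in>poly_funs V. vanishes ?S f \<longrightarrow> vanishes (A k) f) \<and> (\<forall>x\<in>A k. \<forall>i\<in>I. x i = s i) \<and>
      (\<forall>x\<in>A k. \<forall>m\<ge>k. m < ?N \<longrightarrow> x (j m) = s (j m))"
    and Astep: "\<And>k. k < ?N \<Longrightarrow> A k \<subseteq> A (Suc k) \<and> (\<exists>x\<in>A (Suc k). x (j k) \<noteq> s (j k))"
    by (rule irred_chain[OF finite_V S J I(1) gp g]) (rule that; assumption)
  have sC: "s \<in> C" using s(1) unfolding cone_def by blast
  have s0: "\<forall>i\<in>I. s i \<noteq> 0" using s(2) finI by auto
  have nrm: "\<And>x. \<forall>i\<in>I. x i = s i \<Longrightarrow> \<forall>v. v \<notin> V \<longrightarrow> x v = s v \<Longrightarrow> x \<in> C"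
    "\<And>k. k \<in> V - I \<Longrightarrow> \<exists>f\<in>H. \<forall>x. (\<forall>i\<in>I. x i = s i) \<longrightarrow> (f x = 0 \<longleftrightarrow> x k = s k)"
    using I(2) sC s0 unfolding normalizing_def by blast+
  have AC: "A k \<subseteq> C" if "k \<le> ?N" for k using A[OF that] nrm(1) by blast
  define Z where "Z k = zclosure T (pt ` A k)" for k
  have ZX: "Z k \<subseteq> X" if k: "k \<le> ?N" for k
    unfolding Z_def
  proof (rule closure_of_minimal[OF _ X])
    obtain F where F: "F \<subseteq> H" "\<And>x. x \<in> C \<Longrightarrow> pt x \<in> X \<longleftrightarrow> (\<forall>f\<in>F. f x = 0)"
      using closed_eq_zeros[OF X] by blast
    have "vanishes ?S f" if "f \<in> F" for f using F(2) that unfolding vanishes_def cone_def by blast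
    then have "vanishes (A k) f" if "f \<in> F" for f using A[OF k] that F(1) H_poly by blast
    then show "pt ` A k \<subseteq> X" using F(2) AC[OF k] unfolding vanishes_def by blast
  qed
  have Zc: "closedin (subtopology T X) (Z k)" if "k \<le> ?N" for k
    unfolding closedin_closed_subtopology[OF X] using ZX[OF that] by (simp add: Z_def)
  have Zi: "irreducible_in (subtopology T X) (Z k)" if "k \<le> ?N" for k
    using irreducible_in_subtopology[OF X ZX[OF that]] irreducible_closure[of "A k"] A[OF that] AC[OF that]
    by (simp add: Z_def)
  have Zs: "Z k \<subset> Z (Suc k)" if k: "k < ?N" for k
  proof
    show "Z k \<subseteq> Z (Suc k)" unfolding Z_def using Astep[OF k] by (intro closure_of_mono image_mono) auto
    have "j k \<in> V - I" using bij_betwE[OF j] k JV by auto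
    then obtain f where f: "f \<in> H" "\<forall>x. (\<forall>i\<in>I. x i = s i) \<longrightarrow> (f x = 0 \<longleftrightarrow> x (j k) = s (j k))"
      using nrm(2) by blast
    let ?B = "pt ` {x\<in>C. \<forall>g\<in>{f}. g x = 0}"
    have "closedin T ?B" by (rule closed_zeros) (use f(1) in blast)
    moreover have "pt ` A k \<subseteq> ?B"
    proof -
      have "x \<in> C \<and> f x = 0" if "x \<in> A k" for x
      proof -
        have "\<forall>i\<in>I. x i = s i" "x (j k) = s (j k)" using A[of k] that k by auto
        then show ?thesis using f(2) AC[of k] that k by auto
      qed
      then show ?thesis by blast
    qed
    ultimately have ZB: "Z k \<subseteq> ?B" unfolding Z_def by (intro closure_of_minimal)
    obtain x where x: "x \<in> A (Suc k)" "x (j k) \<noteq> s (j k)" using Astep[OF k] by blast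
    have k1: "Suc k \<le> ?N" using k by simp
    have xC: "x \<in> C" using AC[OF k1] x(1) by blast
    have "\<forall>i\<in>I. x i = s i" using A[OF k1] x(1) by blast
    then have "f x \<noteq> 0" using f(2) x(2) by blast
    then have "pt x \<notin> ?B" using H_invariant[OF f(1) _ xC] by force
    moreover have "pt x \<in> Z (Suc k)"
      using closure_of_subset[of "pt ` A (Suc k)" T] AC[OF k1] x(1) unfolding Z_def topspace_T by blast
    ultimately show "Z k \<noteq> Z (Suc k)" using ZB by blast
  qed
  have "card J - m = ?N" using I finI JV unfolding normalizing_def by (simp add: card_Diff_subset)
  moreover have "enat ?N \<le> krull_dim (subtopology T X)"
    unfolding krull_dim_def
    by (rule Sup_upper) (use Zc Zi Zs in blast)
  ultimately show ?thesis by simp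
qed

end

section \<open>Tori, and projective space as a graded space\<close>

lemma irred_torus:
  assumes "finite W" "I \<subseteq> W"
  shows "irred W {t. \<forall>i\<in>I. t i \<noteq> 0}"
proof -
  let ?T = "{t. \<forall>i\<in>I. t i \<noteq> (0::complex)}"
  let ?p = "\<lambda>t. \<Prod>i\<in>I. t i :: complex"
  have finI: "finite I" using assms finite_subset by blast
  have pp: "?p \<in> poly_funs W" using assms(2) by (intro poly_funs_prod poly_funs.var) auto
  have p0: "?p \<noteq> (\<lambda>t. 0)"
  proof
    assume "?p = (\<lambda>t. 0)"
    from fun_cong[OF this, of "\<lambda>_. 1"] show False by simp
  qed
  have nz: "f \<noteq> (\<lambda>t. 0)" if "\<not> vanishes ?T f" for f using that by (auto simp: vanishes_def)
  show ?thesis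
    unfolding irred_def
  proof (intro conjI ballI impI)
    show "?T \<noteq> {}" by (auto intro: exI[of _ "\<lambda>_. 1"])
    fix f g assume f: "f \<in> poly_funs W" and g: "g \<in> poly_funs W" and fg: "vanishes ?T (\<lambda>x. f x * g x)"
    have "?p t * (f t * g t) = 0" for t
      using fg finI by (cases "t \<in> ?T") (auto simp: vanishes_def)
    then have "(\<lambda>t. f t * g t) = (\<lambda>t. 0)"
      using poly_funs_nonzero_mult[OF assms(1) pp poly_funs.mult[OF f g]] p0 by blast
    then have "f t * g t = 0" for t by (simp add: fun_eq_iff)
    then have "f = (\<lambda>t. 0) \<or> g = (\<lambda>t. 0)" by (rule poly_funs_nonzero_mult[OF assms(1) f g])
    then show "vanishes ?T f \<or> vanishes ?T g" using nz by blast
  qed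
qed

lemma irred_image:
  assumes A: "irred W A" and \<phi>: "\<And>v. v \<in> V \<Longrightarrow> (\<lambda>t. \<phi> t v) \<in> poly_funs W"
  shows "irred V (\<phi> ` A)"
  unfolding irred_def
proof (intro conjI ballI impI)
  show "\<phi> ` A \<noteq> {}" using A unfolding irred_def by blast
  fix f g assume fg: "f \<in> poly_funs V" "g \<in> poly_funs V" "vanishes (\<phi> ` A) (\<lambda>x. f x * g x)"
  have "(\<lambda>t. f (\<phi> t)) \<in> poly_funs W" "(\<lambda>t. g (\<phi> t)) \<in> poly_funs W"
    using poly_funs_comp[OF fg(1), of "\<lambda>v t. \<phi> t v" W] poly_funs_comp[OF fg(2), of "\<lambda>v t. \<phi> t v" W] \<phi> by auto
  moreover have "vanishes A (\<lambda>t. f (\<phi> t) * g (\<phi> t))" using fg(3) by (simp add: vanishes_def)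
  ultimately have "vanishes A (\<lambda>t. f (\<phi> t)) \<or> vanishes A (\<lambda>t. g (\<phi> t))" using irred_mult[OF A] by blast
  then show "vanishes (\<phi> ` A) f \<or> vanishes (\<phi> ` A) g" by (simp add: vanishes_def)
qed

text \<open>A relation would vanish on a torus; multiplied by the product of the coordinates it
  vanishes everywhere, and there are no zero divisors.\<close>

lemma indep_torus:
  assumes "finite I" "\<And>t. (\<forall>i\<in>I. t i \<noteq> 0) \<Longrightarrow> \<exists>s\<in>S. \<forall>i\<in>I. s i = t i"
  shows "indep S I"
  unfolding indep_def
proof (intro ballI impI)
  fix f assume f: "f \<in> poly_funs I" "vanishes S f"
  let ?T = "{t. \<forall>i\<in>I. t i \<noteq> (0::complex)}"
  let ?p = "\<lambda>t. \<Prod>i\<in>I. t i :: complex"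
  have pp: "?p \<in> poly_funs I" by (intro poly_funs_prod poly_funs.var)
  have "?p t * f t = 0" for t
  proof (cases "\<forall>i\<in>I. t i \<noteq> 0")
    case True
    then obtain s where s: "s \<in> S" "\<forall>i\<in>I. s i = t i" using assms(2) by blast
    then have "f t = f s" by (intro poly_funs_cong[OF f(1)]) auto
    then show ?thesis using f(2) s(1) by (simp add: vanishes_def)
  qed (use assms(1) in auto)
  then have "?p = (\<lambda>t. 0) \<or> f = (\<lambda>t. 0)" by (rule poly_funs_nonzero_mult[OF assms(1) pp f(1)])
  moreover have "?p \<noteq> (\<lambda>t. 0)"
  proof
    assume "?p = (\<lambda>t. 0)"
    from fun_cong[OF this, of "\<lambda>_. 1"] show False by simp
  qed
  ultimately show "f = (\<lambda>x. 0)" by blast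
qed

definition ppt :: "cvector \<Rightarrow> ppoint" where
  "ppt x = {y. \<exists>c. c \<noteq> 0 \<and> y = (\<lambda>i. c * x i)}"

lemma ppt_self: "x \<in> ppt x"
  unfolding ppt_def by (auto intro: exI[of _ 1])

lemma ppt_eq_iff: "ppt x = ppt y \<longleftrightarrow> (\<exists>c. c \<noteq> 0 \<and> y = (\<lambda>i. c * x i))"
proof
  assume "ppt x = ppt y"
  then have "y \<in> ppt x" using ppt_self by blast
  then show "\<exists>c. c \<noteq> 0 \<and> y = (\<lambda>i. c * x i)" unfolding ppt_def by blast
next
  assume "\<exists>c. c \<noteq> 0 \<and> y = (\<lambda>i. c * x i)"
  then obtain c where c: "c \<noteq> 0" "y = (\<lambda>i. c * x i)" by blast
  show "ppt x = ppt y"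
  proof (intro equalityI subsetI)
    fix z assume "z \<in> ppt x"
    then obtain a where "a \<noteq> 0" "z = (\<lambda>i. a * x i)" unfolding ppt_def by blast
    then show "z \<in> ppt y" using c unfolding ppt_def by (intro CollectI exI[of _ "a / c"]) simp
  next
    fix z assume "z \<in> ppt y"
    then obtain a where a: "a \<noteq> 0" "z = (\<lambda>i. a * y i)" unfolding ppt_def by blast
    have "z = (\<lambda>i. (a * c) * x i)" unfolding a(2) c(2) mult.assoc ..
    moreover have "a * c \<noteq> 0" using a(1) c(1) by simp
    ultimately show "z \<in> ppt x" unfolding ppt_def by blast
  qed
qed

lemma ppt_scale: "c \<noteq> 0 \<Longrightarrow> ppt (\<lambda>i. c * x i) = ppt x"
  using ppt_eq_iff[of x] by blast

lemma cvectors_scale: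
  assumes "x \<in> cvectors n - {0}" "c \<noteq> 0"
  shows "(\<lambda>i. c * x i) \<in> cvectors n - {0}"
  using assms by (auto simp: cvectors_def fun_eq_iff)

lemma proj_space_eq: "proj_space n = ppt ` (cvectors n - {0})"
proof
  show "proj_space n \<subseteq> ppt ` (cvectors n - {0})"
    using proj_space_rep unfolding ppt_def by blast
  show "ppt ` (cvectors n - {0}) \<subseteq> proj_space n"
  proof
    fix P assume "P \<in> ppt ` (cvectors n - {0})"
    then obtain x where x: "x \<in> cvectors n - {0}" "P = ppt x" by blast
    have "ppt x = proportional n `` {x}"
      using cvectors_scale[OF x(1)] x(1) by (auto simp: ppt_def proportional_def)
    then show "P \<in> proj_space n" unfolding proj_space_def x(2) using x(1) by (auto intro: quotientI)
  qed
qed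

lemma cvectors_nonzero_coord:
  assumes "x \<in> cvectors n - {0}"
  obtains i where "i \<le> n" "x i \<noteq> 0"
  using assms unfolding cvectors_def by (auto simp: fun_eq_iff not_le[symmetric])

definition proj_forms :: "nat \<Rightarrow> (cvector \<Rightarrow> complex) set" where
  "proj_forms n = (\<Union>d. hom_funs n d)"

lemma proj_forms_eq: "proj_forms n = poly_eval ` (\<Union>d. forms n d)"
proof
  show "proj_forms n \<subseteq> poly_eval ` (\<Union>d. forms n d)"
  proof
    fix F assume "F \<in> proj_forms n"
    then obtain d where "F \<in> hom_funs n d" unfolding proj_forms_def by blast
    then obtain f where "f \<in> forms n d" "poly_eval f = F" by (rule hom_funs_imp_forms)
    then show "F \<in> poly_eval ` (\<Union>d. forms n d)" by blast
  qed
  show "poly_eval ` (\<Union>d. forms n d) \<subseteq> proj_forms n"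
    unfolding proj_forms_def using poly_eval_forms by blast
qed

lemma all_ppt_zero_iff:
  assumes "f \<in> hom_funs n d"
  shows "(\<forall>y\<in>ppt x. f y = 0) \<longleftrightarrow> f x = 0"
  using assms ppt_self[of x] unfolding hom_funs_def ppt_def by auto

text \<open>The group of nonzero scalars acts, so the rank is 1. An orbit is the image of a
  one-dimensional torus under a linear map, hence irreducible, and any coordinate that is nonzero at
  \<open>x\<close> is independent on it.\<close>

interpretation proj: graded_space "{..n}" "cvectors n - {0}" ppt "zariski n" "proj_forms n" 1 for n
proof
  show "finite {..n}" "\<exists>y. y \<notin> {..n}" by (auto intro: exI[of _ "Suc n"])
  show "proj_forms n \<subseteq> poly_funs {..n}" unfolding proj_forms_def hom_funs_def by blast
  show "topspace (zariski n) = ppt ` (cvectors n - {0})" by (simp add: proj_space_eq)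
  have zeros: "proj_zeros n F = ppt ` {x \<in> cvectors n - {0}. \<forall>f\<in>poly_eval ` F. f x = 0}"
    if F: "F \<subseteq> (\<Union>d. forms n d)" for F
  proof -
    have iff: "(\<forall>f\<in>F. \<forall>y\<in>ppt x. poly_eval f y = 0) \<longleftrightarrow> (\<forall>f\<in>poly_eval ` F. f x = 0)" for x
    proof -
      have "(\<forall>y\<in>ppt x. poly_eval f y = 0) \<longleftrightarrow> poly_eval f x = 0" if "f \<in> F" for f
      proof -
        obtain d where "f \<in> forms n d" using F \<open>f \<in> F\<close> by blast
        from all_ppt_zero_iff[OF poly_eval_forms[OF this]] show ?thesis .
      qed
      then show ?thesis by auto
    qed
    show ?thesis
    proof (intro equalityI subsetI)
      fix p assume p: "p \<in> proj_zeros n F"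
      then have "p \<in> ppt ` (cvectors n - {0})" unfolding proj_space_eq[symmetric] proj_zeros_def by blast
      then obtain x where "p = ppt x" "x \<in> cvectors n - {0}" by (rule imageE)
      then show "p \<in> ppt ` {x \<in> cvectors n - {0}. \<forall>f\<in>poly_eval ` F. f x = 0}"
        using p iff[of x] unfolding proj_zeros_def by simp
    next
      fix p assume "p \<in> ppt ` {x \<in> cvectors n - {0}. \<forall>f\<in>poly_eval ` F. f x = 0}"
      then obtain x where x: "p = ppt x" "x \<in> cvectors n - {0}" "\<forall>f\<in>poly_eval ` F. f x = 0" by blast
      then have "p \<in> proj_space n" unfolding proj_space_eq by blast
      then show "p \<in> proj_zeros n F" using x iff[of x] unfolding proj_zeros_def by simp
    qed
  qed
  fix A
  show "closedin (zariski n) A \<longleftrightarrow> (\<exists>F\<subseteq>proj_forms n. A = ppt ` {x \<in> cvectors n - {0}. \<forall>f\<in>F. f x = 0})"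
  proof
    assume "closedin (zariski n) A"
    then obtain F where F: "F \<subseteq> (\<Union>d. forms n d)" "A = proj_zeros n F" unfolding closedin_zariski by (elim exE conjE)
    show "\<exists>F\<subseteq>proj_forms n. A = ppt ` {x \<in> cvectors n - {0}. \<forall>f\<in>F. f x = 0}"
      unfolding proj_forms_eq F(2) zeros[OF F(1)] by (rule exI, rule conjI, rule image_mono[OF F(1)], rule refl)
  next
    assume "\<exists>F\<subseteq>proj_forms n. A = ppt ` {x \<in> cvectors n - {0}. \<forall>f\<in>F. f x = 0}"
    then obtain G where G: "G \<subseteq> (\<Union>d. forms n d)" "A = ppt ` {x \<in> cvectors n - {0}. \<forall>f\<in>poly_eval ` G. f x = 0}"
      unfolding proj_forms_eq subset_image_iff by blast
    then have "A = proj_zeros n G" using zeros[OF G(1)] by simp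
    then show "closedin (zariski n) A" unfolding closedin_zariski using G(1) by blast
  qed
next
  fix n f and x y :: cvector
  assume "f \<in> proj_forms n" "ppt x = ppt y" "f x = 0"
  then show "f y = 0" unfolding proj_forms_def hom_funs_def ppt_eq_iff by auto
next
  fix n and f :: "cvector \<Rightarrow> complex" assume f: "f \<in> poly_funs {..n}"
  obtain D H where D: "finite D" and H: "\<forall>d. H d \<in> poly_eval ` forms n d"
    and sum: "\<forall>x. f x = (\<Sum>d\<in>D. H d x)" and "\<forall>d x. d \<notin> D \<longrightarrow> H d x = 0"
    using poly_funs_hom_parts[OF f] by (elim exE conjE)
  have Hh: "H d \<in> hom_funs n d" for d
  proof -
    obtain g where "H d = poly_eval g" "g \<in> forms n d" using spec[OF H, of d] by (elim imageE)
    then show ?thesis using poly_eval_forms by simp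
  qed
  have Hc: "H d (\<lambda>i. c * x i) = c ^ d * H d x" if "c \<noteq> 0" for c x d
    using Hh[of d] that unfolding hom_funs_def by blast
  have "(\<forall>y\<in>cvectors n - {0}. ppt y = ppt x \<longrightarrow> f y = 0) \<longleftrightarrow> (\<forall>p\<in>H ` D. p x = 0)"
    if x: "x \<in> cvectors n - {0}" for x
  proof
    assume a: "\<forall>y\<in>cvectors n - {0}. ppt y = ppt x \<longrightarrow> f y = 0"
    have "(\<Sum>d\<in>D. c ^ id d * H d x) = 0" if c: "c \<noteq> 0" for c
    proof -
      have "f (\<lambda>i. c * x i) = 0" using a cvectors_scale[OF x c] ppt_scale[OF c] by blast
      then show ?thesis using spec[OF sum, of "\<lambda>i. c * x i"] by (simp add: Hc[OF c])
    qed
    then show "\<forall>p\<in>H ` D. p x = 0" using poly_coeffs_unique[OF D, of id "\<lambda>d. H d x"] by auto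
  next
    assume a: "\<forall>p\<in>H ` D. p x = 0"
    show "\<forall>y\<in>cvectors n - {0}. ppt y = ppt x \<longrightarrow> f y = 0"
    proof (intro ballI impI)
      fix y assume "ppt y = ppt x"
      then obtain c where "c \<noteq> 0" "y = (\<lambda>i. c * x i)" using ppt_eq_iff[of x y] by auto
      then show "f y = 0" using a Hc by (simp add: spec[OF sum])
    qed
  qed
  moreover have "H ` D \<subseteq> proj_forms n" using Hh unfolding proj_forms_def by blast
  ultimately show "\<exists>P\<subseteq>proj_forms n. \<forall>x\<in>cvectors n - {0}.
      (\<forall>y\<in>cvectors n - {0}. ppt y = ppt x \<longrightarrow> f y = 0) \<longleftrightarrow> (\<forall>p\<in>P. p x = 0)"
    by (intro exI[of _ "H ` D"] conjI ballI)
next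
  fix n and x :: cvector assume x: "x \<in> cvectors n - {0}"
  have cl: "{y \<in> cvectors n - {0}. ppt y = ppt x} = (\<lambda>t i. t 0 * x i) ` {t. \<forall>i\<in>{0::nat}. t i \<noteq> 0}"
  proof (intro equalityI subsetI)
    fix y assume "y \<in> {y \<in> cvectors n - {0}. ppt y = ppt x}"
    then obtain c where "c \<noteq> 0" "y = (\<lambda>i. c * x i)" using ppt_eq_iff[of x y] by auto
    then show "y \<in> (\<lambda>t i. t 0 * x i) ` {t. \<forall>i\<in>{0::nat}. t i \<noteq> 0}"
      by (intro image_eqI[of _ _ "\<lambda>_. c"]) auto
  next
    fix y assume "y \<in> (\<lambda>t i. t 0 * x i) ` {t. \<forall>i\<in>{0::nat}. t i \<noteq> 0}"
    then obtain t where "t 0 \<noteq> 0" "y = (\<lambda>i. t (0::nat) * x i)" by auto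
    then show "y \<in> {y \<in> cvectors n - {0}. ppt y = ppt x}"
      using cvectors_scale[OF x] ppt_scale[of "t 0" x] by auto
  qed
  show "irred {..n} {y \<in> cvectors n - {0}. ppt y = ppt x}"
    unfolding cl by (rule irred_image[OF irred_torus[of "{0}"]]) (auto intro!: poly_funs.intros)
  obtain i where i: "i \<le> n" "x i \<noteq> 0" using cvectors_nonzero_coord[OF x] .
  have "indep {y \<in> cvectors n - {0}. ppt y = ppt x} {i}"
    unfolding cl
  proof (rule indep_torus)
    fix t :: cvector assume "\<forall>i\<in>{i}. t i \<noteq> 0"
    then show "\<exists>s\<in>(\<lambda>t i. t 0 * x i) ` {t. \<forall>i\<in>{0::nat}. t i \<noteq> 0}. \<forall>i\<in>{i}. s i = t i"
      using i by (intro bexI[of _ "\<lambda>j. (t i / x i) * x j"] image_eqI[of _ _ "\<lambda>_. t i / x i"]) auto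
  qed simp
  then show "\<exists>I\<subseteq>{..n}. card I = 1 \<and> indep {y \<in> cvectors n - {0}. ppt y = ppt x} I"
    using i by (intro exI[of _ "{i}"]) auto
qed

lemma proj_normalizing:
  assumes "i \<le> n"
  shows "proj.normalizing n {i}"
  unfolding proj.normalizing_def
proof (intro conjI ballI impI allI)
  show "{i} \<subseteq> {..n}" "card {i} = 1" using assms by auto
  fix s :: cvector assume s: "s \<in> cvectors n - {0}" "\<forall>i\<in>{i}. s i \<noteq> 0"
  show "x \<in> cvectors n - {0}" if "\<forall>i\<in>{i}. x i = s i" "\<forall>v. v \<notin> {..n} \<longrightarrow> x v = s v" for x
  proof -
    have "x i \<noteq> 0" using that(1) s(2) by simp
    then have "x \<noteq> 0" by auto
    moreover have "x v = 0" if "v > n" for v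
      using \<open>\<forall>v. v \<notin> {..n} \<longrightarrow> x v = s v\<close> s(1) that unfolding cvectors_def by auto
    ultimately show ?thesis unfolding cvectors_def by simp
  qed
  fix k assume k: "k \<in> {..n} - {i}"
  \<comment> \<open>On the slice \<open>x i = s i\<close> this linear form equals
    \<open>s i * (x k - s k)\<close>.\<close>
  let ?f = "\<lambda>x :: cvector. s i * x k - s k * x i"
  have "?f \<in> poly_funs {..n}" using assms k by (intro poly_funs_intros) auto
  then have "?f \<in> hom_funs n 1" unfolding hom_funs_def by (auto simp: algebra_simps)
  moreover have "?f x = 0 \<longleftrightarrow> x k = s k" if "x i = s i" for x
    using that s(2) by (auto simp: algebra_simps)
  ultimately show "\<exists>f\<in>proj_forms n. \<forall>x. (\<forall>i\<in>{i}. x i = s i) \<longrightarrow> (f x = 0) = (x k = s k)"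
    unfolding proj_forms_def by (intro bexI[of _ ?f]) auto
qed

section \<open>The product of two projective spaces as a graded space\<close>

definition bi_vars :: "nat \<Rightarrow> nat \<Rightarrow> (nat + nat) set" where
  "bi_vars n k = Inl ` {..n} \<union> Inr ` {..k}"

definition bi_vectors :: "nat \<Rightarrow> nat \<Rightarrow> (nat + nat \<Rightarrow> complex) set" where
  "bi_vectors n k = {z. z \<circ> Inl \<in> cvectors n - {0} \<and> z \<circ> Inr \<in> cvectors k - {0}}"

definition bippt :: "(nat + nat \<Rightarrow> complex) \<Rightarrow> ppoint \<times> ppoint" where
  "bippt z = (ppt (z \<circ> Inl), ppt (z \<circ> Inr))"

definition biproj_forms :: "nat \<Rightarrow> nat \<Rightarrow> ((nat + nat \<Rightarrow> complex) \<Rightarrow> complex) set" where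
  "biproj_forms n k = (\<Union>d e. bihom_funs n k d e)"

lemma biproj_forms_eq: "biproj_forms n k = poly_eval ` (\<Union>d e. biforms n k d e)"
proof
  show "biproj_forms n k \<subseteq> poly_eval ` (\<Union>d e. biforms n k d e)"
  proof
    fix F assume "F \<in> biproj_forms n k"
    then obtain d e where "F \<in> bihom_funs n k d e" unfolding biproj_forms_def by blast
    then obtain f where "f \<in> biforms n k d e" "poly_eval f = F" by (rule bihom_funs_imp_biforms)
    then show "F \<in> poly_eval ` (\<Union>d e. biforms n k d e)" by blast
  qed
  show "poly_eval ` (\<Union>d e. biforms n k d e) \<subseteq> biproj_forms n k"
  proof
    fix F assume "F \<in> poly_eval ` (\<Union>d e. biforms n k d e)"
    then obtain d e f where "f \<in> biforms n k d e" "F = poly_eval f" by blast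
    then have "F \<in> bihom_funs n k d e" using poly_eval_biforms by simp
    then show "F \<in> biproj_forms n k" unfolding biproj_forms_def by blast
  qed
qed

lemma case_sum_comp: "case_sum (z \<circ> Inl) (z \<circ> Inr) = z"
  by (auto simp: fun_eq_iff split: sum.split)

lemma case_sum_comp_Inl [simp]: "case_sum x y \<circ> Inl = x"
  and case_sum_comp_Inr [simp]: "case_sum x y \<circ> Inr = y"
  by auto

lemma bihom_scale:
  assumes "f \<in> bihom_funs n k d e" "b \<noteq> 0" "c \<noteq> 0"
  shows "f (case_sum (\<lambda>i. b * x i) (\<lambda>j. c * y j)) = b ^ d * c ^ e * f (case_sum x y)"
  using assms unfolding bihom_funs_def by blast

lemma all_bippt_zero_iff:
  assumes "f \<in> bihom_funs n k d e"
  shows "(\<forall>x'\<in>ppt x. \<forall>y'\<in>ppt y. f (case_sum x' y') = 0) \<longleftrightarrow> f (case_sum x y) = 0"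
proof
  assume "\<forall>x'\<in>ppt x. \<forall>y'\<in>ppt y. f (case_sum x' y') = 0"
  then show "f (case_sum x y) = 0" using ppt_self by blast
next
  assume "f (case_sum x y) = 0"
  then show "\<forall>x'\<in>ppt x. \<forall>y'\<in>ppt y. f (case_sum x' y') = 0"
    using bihom_scale[OF assms] unfolding ppt_def by auto
qed

lemma bippt_eqE:
  assumes "bippt z = bippt z'"
  obtains b c where "b \<noteq> 0" "c \<noteq> 0" "z' = case_sum (\<lambda>i. b * (z \<circ> Inl) i) (\<lambda>j. c * (z \<circ> Inr) j)"
proof -
  have "ppt (z \<circ> Inl) = ppt (z' \<circ> Inl)" "ppt (z \<circ> Inr) = ppt (z' \<circ> Inr)"
    using assms unfolding bippt_def by simp_all
  then obtain b c where bc: "b \<noteq> 0" "z' \<circ> Inl = (\<lambda>i. b * (z \<circ> Inl) i)" "c \<noteq> 0" "z' \<circ> Inr = (\<lambda>i. c * (z \<circ> Inr) i)"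
    unfolding ppt_eq_iff by blast
  have "z' = case_sum (z' \<circ> Inl) (z' \<circ> Inr)" by (rule case_sum_comp[symmetric])
  then show ?thesis unfolding bc(2,4) by (rule that[OF bc(1,3)])
qed

lemma bippt_scale:
  assumes "b \<noteq> 0" "c \<noteq> 0"
  shows "bippt (case_sum (\<lambda>i. b * (z \<circ> Inl) i) (\<lambda>j. c * (z \<circ> Inr) j)) = bippt z"
  unfolding bippt_def case_sum_comp_Inl case_sum_comp_Inr ppt_scale[OF assms(1)] ppt_scale[OF assms(2)] ..

lemma bi_vectors_scale:
  assumes "z \<in> bi_vectors n k" "b \<noteq> 0" "c \<noteq> 0"
  shows "case_sum (\<lambda>i. b * (z \<circ> Inl) i) (\<lambda>j. c * (z \<circ> Inr) j) \<in> bi_vectors n k"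
  using assms cvectors_scale[of "z \<circ> Inl" n b] cvectors_scale[of "z \<circ> Inr" k c]
  unfolding bi_vectors_def by simp

lemma bippt_image: "bippt ` bi_vectors n k = proj_space n \<times> proj_space k"
proof
  show "bippt ` bi_vectors n k \<subseteq> proj_space n \<times> proj_space k"
    unfolding bi_vectors_def bippt_def proj_space_eq by blast
  show "proj_space n \<times> proj_space k \<subseteq> bippt ` bi_vectors n k"
  proof
    fix p assume "p \<in> proj_space n \<times> proj_space k"
    then obtain x y where "x \<in> cvectors n - {0}" "y \<in> cvectors k - {0}" "p = (ppt x, ppt y)"
      unfolding proj_space_eq by blast
    then show "p \<in> bippt ` bi_vectors n k"
      by (intro image_eqI[of _ _ "case_sum x y"]) (simp_all add: bippt_def bi_vectors_def)
  qed
qed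

text \<open>Two scalars act independently, hence the rank 2; one nonzero coordinate from each factor
  gives the independent pair on an orbit.\<close>

interpretation biproj: graded_space "bi_vars n k" "bi_vectors n k" bippt "bizariski n k" "biproj_forms n k" 2 for n k
proof
  show "finite (bi_vars n k)" unfolding bi_vars_def by simp
  show "\<exists>y. y \<notin> bi_vars n k" unfolding bi_vars_def by (intro exI[of _ "Inl (Suc n)"]) auto
  show "biproj_forms n k \<subseteq> poly_funs (bi_vars n k)"
    unfolding biproj_forms_def bihom_funs_def bi_vars_def by blast
  show "topspace (bizariski n k) = bippt ` bi_vectors n k" by (simp add: bippt_image)
  have zeros: "biproj_zeros n k F = bippt ` {z \<in> bi_vectors n k. \<forall>f\<in>poly_eval ` F. f z = 0}"
    if F: "F \<subseteq> (\<Union>d e. biforms n k d e)" for F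
  proof -
    have iff: "(\<forall>f\<in>F. \<forall>x'\<in>ppt x. \<forall>y'\<in>ppt y. poly_eval f (case_sum x' y') = 0) \<longleftrightarrow>
        (\<forall>f\<in>poly_eval ` F. f (case_sum x y) = 0)" for x y
    proof -
      have "(\<forall>x'\<in>ppt x. \<forall>y'\<in>ppt y. poly_eval f (case_sum x' y') = 0) \<longleftrightarrow> poly_eval f (case_sum x y) = 0"
        if "f \<in> F" for f
      proof -
        obtain d e where "f \<in> biforms n k d e" using F \<open>f \<in> F\<close> by blast
        from all_bippt_zero_iff[OF poly_eval_biforms[OF this]] show ?thesis .
      qed
      then show ?thesis by auto
    qed
    show ?thesis
    proof (intro equalityI subsetI)
      fix p assume p: "p \<in> biproj_zeros n k F"
      then have "p \<in> bippt ` bi_vectors n k" unfolding bippt_image biproj_zeros_def by blast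
      then obtain z where z: "p = bippt z" "z \<in> bi_vectors n k" by (rule imageE)
      have "\<forall>f\<in>poly_eval ` F. f z = 0"
        using p iff[of "z \<circ> Inl" "z \<circ> Inr"] unfolding z(1) bippt_def biproj_zeros_def case_sum_comp by simp
      then show "p \<in> bippt ` {z \<in> bi_vectors n k. \<forall>f\<in>poly_eval ` F. f z = 0}" using z by blast
    next
      fix p assume "p \<in> bippt ` {z \<in> bi_vectors n k. \<forall>f\<in>poly_eval ` F. f z = 0}"
      then obtain z where z: "p = bippt z" "z \<in> bi_vectors n k" "\<forall>f\<in>poly_eval ` F. f z = 0" by blast
      then have "p \<in> proj_space n \<times> proj_space k" unfolding bippt_image[symmetric] by blast
      then show "p \<in> biproj_zeros n k F"
        using z(3) iff[of "z \<circ> Inl" "z \<circ> Inr"] unfolding z(1) bippt_def biproj_zeros_def case_sum_comp by simp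
    qed
  qed
  fix A
  show "closedin (bizariski n k) A \<longleftrightarrow> (\<exists>F\<subseteq>biproj_forms n k. A = bippt ` {x \<in> bi_vectors n k. \<forall>f\<in>F. f x = 0})"
  proof
    assume "closedin (bizariski n k) A"
    then obtain F where F: "F \<subseteq> (\<Union>d e. biforms n k d e)" "A = biproj_zeros n k F" unfolding closedin_bizariski by (elim exE conjE)
    show "\<exists>F\<subseteq>biproj_forms n k. A = bippt ` {x \<in> bi_vectors n k. \<forall>f\<in>F. f x = 0}"
      unfolding biproj_forms_eq F(2) zeros[OF F(1)] by (rule exI, rule conjI, rule image_mono[OF F(1)], rule refl)
  next
    assume "\<exists>F\<subseteq>biproj_forms n k. A = bippt ` {x \<in> bi_vectors n k. \<forall>f\<in>F. f x = 0}"
    then obtain G where G: "G \<subseteq> (\<Union>d e. biforms n k d e)" "A = bippt ` {x \<in> bi_vectors n k. \<forall>f\<in>poly_eval ` G. f x = 0}"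
      unfolding biproj_forms_eq subset_image_iff by blast
    then have "A = biproj_zeros n k G" using zeros[OF G(1)] by simp
    then show "closedin (bizariski n k) A" unfolding closedin_bizariski using G(1) by blast
  qed
next
  fix n k f x y
  assume f: "f \<in> biproj_forms n k" and xy: "bippt x = bippt y" and "f x = 0"
  obtain d e where f: "f \<in> bihom_funs n k d e" using f unfolding biproj_forms_def by blast
  obtain b c where "b \<noteq> 0" "c \<noteq> 0" "y = case_sum (\<lambda>i. b * (x \<circ> Inl) i) (\<lambda>j. c * (x \<circ> Inr) j)"
    using bippt_eqE[OF xy] .
  then show "f y = 0" using bihom_scale[OF f, of b c "x \<circ> Inl" "x \<circ> Inr"] \<open>f x = 0\<close> by (simp add: case_sum_comp)
next
  fix n k and f :: "(nat + nat \<Rightarrow> complex) \<Rightarrow> complex" assume f: "f \<in> poly_funs (bi_vars n k)"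
  obtain D H where D: "finite D" and H: "\<forall>d e. H (d, e) \<in> poly_eval ` biforms n k d e"
    and sum: "\<forall>x. f x = (\<Sum>d\<in>D. H d x)" and "\<forall>d x. d \<notin> D \<longrightarrow> H d x = 0"
    using poly_funs_bihom_parts[OF f[unfolded bi_vars_def]] by (elim exE conjE)
  have Hh: "H p \<in> bihom_funs n k (fst p) (snd p)" for p
  proof -
    obtain g where "H (fst p, snd p) = poly_eval g" "g \<in> biforms n k (fst p) (snd p)"
      using spec[OF spec[OF H, of "fst p"], of "snd p"] by (elim imageE)
    then show ?thesis using poly_eval_biforms by simp
  qed
  have "(\<forall>y\<in>bi_vectors n k. bippt y = bippt x \<longrightarrow> f y = 0) \<longleftrightarrow> (\<forall>p\<in>H ` D. p x = 0)"
    if x: "x \<in> bi_vectors n k" for x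
  proof
    assume a: "\<forall>y\<in>bi_vectors n k. bippt y = bippt x \<longrightarrow> f y = 0"
    have "(\<Sum>p\<in>D. b ^ fst p * c ^ snd p * H p x) = 0" if bc: "b \<noteq> 0" "c \<noteq> 0" for b c
    proof -
      let ?y = "case_sum (\<lambda>i. b * (x \<circ> Inl) i) (\<lambda>j. c * (x \<circ> Inr) j)"
      have "f ?y = 0" using a bi_vectors_scale[OF x bc] bippt_scale[OF bc, of x] by blast
      moreover have "H p ?y = b ^ fst p * c ^ snd p * H p x" for p
        using bihom_scale[OF Hh[of p] bc, of "x \<circ> Inl" "x \<circ> Inr"] by (simp only: case_sum_comp)
      ultimately show ?thesis using spec[OF sum, of ?y] by (simp only:)
    qed
    then show "\<forall>p\<in>H ` D. p x = 0" using poly_coeffs_unique2[OF D, of _ "\<lambda>p. H p x"] by blast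
  next
    assume a: "\<forall>p\<in>H ` D. p x = 0"
    show "\<forall>y\<in>bi_vectors n k. bippt y = bippt x \<longrightarrow> f y = 0"
    proof (intro ballI impI)
      fix y assume "bippt y = bippt x"
      then obtain b c where bc: "b \<noteq> 0" "c \<noteq> 0" "y = case_sum (\<lambda>i. b * (x \<circ> Inl) i) (\<lambda>j. c * (x \<circ> Inr) j)"
        using bippt_eqE[of x y] by metis
      have "H p y = b ^ fst p * c ^ snd p * H p x" for p
        unfolding bc(3) using bihom_scale[OF Hh[of p] bc(1,2), of "x \<circ> Inl" "x \<circ> Inr"] by (simp only: case_sum_comp)
      then show "f y = 0" using a by (simp add: spec[OF sum])
    qed
  qed
  moreover have "H ` D \<subseteq> biproj_forms n k" using Hh unfolding biproj_forms_def by blast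
  ultimately show "\<exists>P\<subseteq>biproj_forms n k. \<forall>x\<in>bi_vectors n k.
      (\<forall>y\<in>bi_vectors n k. bippt y = bippt x \<longrightarrow> f y = 0) \<longleftrightarrow> (\<forall>p\<in>P. p x = 0)"
    by (intro exI[of _ "H ` D"] conjI ballI)
next
  fix n k and x assume x: "x \<in> bi_vectors n k"
  let ?\<phi> = "\<lambda>t :: cvector. case_sum (\<lambda>i. t 0 * (x \<circ> Inl) i) (\<lambda>j. t 1 * (x \<circ> Inr) j)"
  let ?T = "{t :: cvector. \<forall>i\<in>{0, 1}. t i \<noteq> 0}"
  have cl: "{y \<in> bi_vectors n k. bippt y = bippt x} = ?\<phi> ` ?T"
  proof (intro equalityI subsetI)
    fix y assume "y \<in> {y \<in> bi_vectors n k. bippt y = bippt x}"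
    then have "bippt x = bippt y" by simp
    then obtain b c where "b \<noteq> 0" "c \<noteq> 0" "y = case_sum (\<lambda>i. b * (x \<circ> Inl) i) (\<lambda>j. c * (x \<circ> Inr) j)"
      by (rule bippt_eqE)
    then show "y \<in> ?\<phi> ` ?T" by (intro image_eqI[of _ _ "\<lambda>i. if i = 0 then b else c"]) auto
  next
    fix y assume "y \<in> ?\<phi> ` ?T"
    then obtain t where "t 0 \<noteq> 0" "t 1 \<noteq> 0" "y = ?\<phi> t" by auto
    then show "y \<in> {y \<in> bi_vectors n k. bippt y = bippt x}"
      using bi_vectors_scale[OF x] bippt_scale[of "t 0" "t 1" x] by auto
  qed
  show "irred (bi_vars n k) {y \<in> bi_vectors n k. bippt y = bippt x}"
    unfolding cl
  proof (rule irred_image[OF irred_torus[of "{0, 1}"]])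
    fix v show "(\<lambda>t. ?\<phi> t v) \<in> poly_funs {0, 1}"
      by (cases v) (auto intro!: poly_funs.intros)
  qed auto
  have x': "x \<circ> Inl \<in> cvectors n - {0}" "x \<circ> Inr \<in> cvectors k - {0}" using x unfolding bi_vectors_def by auto
  obtain i where i: "i \<le> n" "(x \<circ> Inl) i \<noteq> 0" using cvectors_nonzero_coord[OF x'(1)] .
  obtain j where j: "j \<le> k" "(x \<circ> Inr) j \<noteq> 0" using cvectors_nonzero_coord[OF x'(2)] .
  note ij = i[unfolded comp_def] j[unfolded comp_def]
  have "indep {y \<in> bi_vectors n k. bippt y = bippt x} {Inl i, Inr j}"
    unfolding cl
  proof (rule indep_torus)
    fix t :: "nat + nat \<Rightarrow> complex" assume "\<forall>i\<in>{Inl i, Inr j}. t i \<noteq> 0"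
    then show "\<exists>s\<in>?\<phi> ` ?T. \<forall>i\<in>{Inl i, Inr j}. s i = t i"
      using ij by (intro bexI[of _ "?\<phi> (\<lambda>l. if l = 0 then t (Inl i) / x (Inl i) else t (Inr j) / x (Inr j))"]
          image_eqI[OF refl]) auto
  qed simp
  moreover have "card {Inl i, Inr j} = 2" by simp
  ultimately show "\<exists>I\<subseteq>bi_vars n k. card I = 2 \<and> indep {y \<in> bi_vectors n k. bippt y = bippt x} I"
    using ij by (intro exI[of _ "{Inl i, Inr j}"]) (auto simp: bi_vars_def)
qed

lemma biproj_normalizing:
  assumes "i \<le> n" "j \<le> k"
  shows "biproj.normalizing n k {Inl i, Inr j}"
  unfolding biproj.normalizing_def
proof (intro conjI ballI impI allI)
  show "{Inl i, Inr j} \<subseteq> bi_vars n k" "card {Inl i, Inr j} = 2" using assms by (auto simp: bi_vars_def)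
  fix s assume s: "s \<in> bi_vectors n k" "\<forall>i\<in>{Inl i, Inr j}. s i \<noteq> 0"
  show "x \<in> bi_vectors n k" if x: "\<forall>i\<in>{Inl i, Inr j}. x i = s i" "\<forall>v. v \<notin> bi_vars n k \<longrightarrow> x v = s v" for x
  proof -
    have "x (Inl l) = 0" if "l > n" for l
    proof -
      have "Inl l \<notin> bi_vars n k" using that by (auto simp: bi_vars_def)
      then have "x (Inl l) = s (Inl l)" using x(2) by blast
      then show ?thesis using s(1) that by (auto simp: bi_vectors_def cvectors_def)
    qed
    moreover have "x (Inr l) = 0" if "l > k" for l
    proof -
      have "Inr l \<notin> bi_vars n k" using that by (auto simp: bi_vars_def)
      then have "x (Inr l) = s (Inr l)" using x(2) by blast
      then show ?thesis using s(1) that by (auto simp: bi_vectors_def cvectors_def)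
    qed
    moreover have "x \<circ> Inl \<noteq> 0" "x \<circ> Inr \<noteq> 0" using x(1) s(2) by (auto dest: fun_cong[of _ _ i] fun_cong[of _ _ j])
    ultimately show ?thesis unfolding bi_vectors_def cvectors_def by auto
  qed
  fix l assume l: "l \<in> bi_vars n k - {Inl i, Inr j}"
  have ex: "\<exists>f\<in>biproj_forms n k. \<forall>x. (\<forall>i\<in>{Inl i, Inr j}. x i = s i) \<longrightarrow> (f x = 0) = (x l = s l)"
    if "f \<in> bihom_funs n k d e" "v \<in> {Inl i, Inr j}" "f = (\<lambda>x. s v * x l - s l * x v)" for f d e v
    using that s(2) unfolding biproj_forms_def by (intro bexI[of _ f]) (auto simp: algebra_simps)
  show "\<exists>f\<in>biproj_forms n k. \<forall>x. (\<forall>i\<in>{Inl i, Inr j}. x i = s i) \<longrightarrow> (f x = 0) = (x l = s l)"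
  proof (cases l)
    case (Inl a)
    let ?f = "\<lambda>x. s (Inl i) * x l - s l * x (Inl i)"
    have "?f \<in> poly_funs (Inl ` {..n} \<union> Inr ` {..k})"
      using l assms by (intro poly_funs_intros) (auto simp: bi_vars_def)
    then have "?f \<in> bihom_funs n k 1 0" unfolding bihom_funs_def by (auto simp: Inl algebra_simps)
    then show ?thesis by (rule ex) auto
  next
    case (Inr a)
    let ?f = "\<lambda>x. s (Inr j) * x l - s l * x (Inr j)"
    have "?f \<in> poly_funs (Inl ` {..n} \<union> Inr ` {..k})"
      using l assms by (intro poly_funs_intros) (auto simp: bi_vars_def)
    then have "?f \<in> bihom_funs n k 0 1" unfolding bihom_funs_def by (auto simp: Inr algebra_simps)
    then show ?thesis by (rule ex) auto
  qed
qed

section \<open>Tangent spaces\<close>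

interpretation cv: vector_space "\<lambda>(c::complex) (v::'v \<Rightarrow> complex) i. c * v i"
  by unfold_locales (auto simp: fun_eq_iff algebra_simps)

section \<open>Dimension counts by pivots and dual vectors\<close>

lemma fun_sum_apply: "(\<Sum>j\<in>A. f j) i = (\<Sum>j\<in>A. f j i :: complex)"
  by (induction A rule: infinite_finite_induct) auto

text \<open>The vectors \<open>b j\<close> are dual to the functionals up to nonzero scalars, hence
  independent. Subtracting the evident combination from an element of \<open>T\<close> leaves a
  vector killed by all functionals, hence zero, so they also span.\<close>

lemma dim_eq_card_dual:
  fixes T :: "('v \<Rightarrow> complex) set" and \<phi> :: "'i \<Rightarrow> ('v \<Rightarrow> complex) \<Rightarrow> complex"
  assumes T: "cv.subspace T" and J: "finite J"
    and lin: "\<And>j u v. \<phi> j (u + v) = \<phi> j u + \<phi> j v" "\<And>j c v. \<phi> j (\<lambda>i. c * v i) = c * \<phi> j v"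
    and inj: "\<And>v. v \<in> T \<Longrightarrow> (\<And>j. j \<in> J \<Longrightarrow> \<phi> j v = 0) \<Longrightarrow> v = 0"
    and b: "\<And>j. j \<in> J \<Longrightarrow> b j \<in> T" "\<And>j. j \<in> J \<Longrightarrow> \<phi> j (b j) \<noteq> 0"
      "\<And>i j. i \<in> J \<Longrightarrow> j \<in> J \<Longrightarrow> i \<noteq> j \<Longrightarrow> \<phi> i (b j) = 0"
  shows "cv.dim T = card J"
proof -
  have \<phi>0: "\<phi> j 0 = 0" for j using lin(1)[of j 0 0] by simp
  have \<phi>sum: "\<phi> j (\<Sum>i\<in>A. f i) = (\<Sum>i\<in>A. \<phi> j (f i))" for j and f :: "'x \<Rightarrow> _" and A
    by (induction A rule: infinite_finite_induct) (simp_all only: sum.infinite sum.empty sum.insert lin \<phi>0 not_False_eq_True)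
  have \<phi>comb: "\<phi> i (\<Sum>j\<in>J. (\<lambda>v. c j * b j v)) = c i * \<phi> i (b i)" if i: "i \<in> J" for c i
  proof -
    have "\<phi> i (\<Sum>j\<in>J. (\<lambda>v. c j * b j v)) = (\<Sum>j\<in>J. if j = i then c i * \<phi> i (b i) else 0)"
      unfolding \<phi>sum lin(2) using b(3)[OF i] by (intro sum.cong) auto
    then show ?thesis using J i by simp
  qed
  have binj: "inj_on b J"
    by (rule inj_onI) (metis b(2,3))
  have indep: "cv.independent (b ` J)"
    unfolding cv.dependent_finite[OF finite_imageI[OF J]]
  proof
    assume "\<exists>u. (\<exists>v\<in>b ` J. u v \<noteq> 0) \<and> (\<Sum>v\<in>b ` J. (\<lambda>i. u v * v i)) = 0"
    then obtain u k where k: "k \<in> J" "u (b k) \<noteq> 0" and s: "(\<Sum>v\<in>b ` J. (\<lambda>i. u v * v i)) = 0" by blast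
    have "(\<Sum>v\<in>b ` J. (\<lambda>i. u v * v i)) = (\<Sum>j\<in>J. (\<lambda>v. u (b j) * b j v))"
      by (subst sum.reindex[OF binj]) simp
    then have "u (b k) * \<phi> k (b k) = 0" using \<phi>comb[OF k(1), of "\<lambda>j. u (b j)"] s \<phi>0 by simp
    then show False using k b(2) by simp
  qed
  have span: "T \<subseteq> cv.span (b ` J)"
  proof
    fix v assume v: "v \<in> T"
    let ?w = "\<Sum>j\<in>J. (\<lambda>i. (\<phi> j v / \<phi> j (b j)) * b j i)"
    have wT: "?w \<in> T" by (intro cv.subspace_sum[OF T] cv.subspace_scale[OF T] b(1))
    have "v - ?w = 0"
    proof (rule inj[OF cv.subspace_diff[OF T v wT]])
      fix k assume k: "k \<in> J"
      have "\<phi> k (v - ?w) = \<phi> k v - \<phi> k ?w"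
        using lin(1)[of k "v - ?w" ?w] by simp
      then show "\<phi> k (v - ?w) = 0" using \<phi>comb[OF k, of "\<lambda>j. \<phi> j v / \<phi> j (b j)"] b(2)[OF k] by simp
    qed
    then have "v = ?w" by simp
    moreover have "?w \<in> cv.span (b ` J)"
      by (intro cv.span_sum cv.span_scale cv.span_base imageI)
    ultimately show "v \<in> cv.span (b ` J)" by simp
  qed
  have "card (b ` J) = card J" using binj by (rule card_image)
  then show ?thesis using cv.dim_unique[OF _ span indep] b(1) by blast
qed

text \<open>Gauss elimination, one coordinate at a time: \<open>y\<close> becomes a pivot when some
  vector of \<open>\<Gamma>\<close> is zero at the old pivots but not at \<open>y\<close>. Elements
  of \<open>\<Gamma>\<close> are controlled only on \<open>V\<close>.\<close>

lemma echelon_basis: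
  fixes \<Gamma> :: "('v \<Rightarrow> complex) set"
  assumes "finite V" and \<Gamma>: "cv.subspace \<Gamma>"
  shows "\<exists>K e. K \<subseteq> V \<and> (\<forall>k\<in>K. e k \<in> \<Gamma> \<and> (\<forall>l\<in>K. e k l = (if l = k then 1 else 0))) \<and>
    (\<forall>g\<in>\<Gamma>. (\<forall>k\<in>K. g k = 0) \<longrightarrow> (\<forall>v\<in>V. g v = 0))"
  using assms(1)
proof induction
  case empty
  then show ?case by (intro exI[of _ "{}"]) auto
next
  case (insert y V)
  from insert.IH obtain K e where K: "K \<subseteq> V"
    and Ke: "\<forall>k\<in>K. e k \<in> \<Gamma> \<and> (\<forall>l\<in>K. e k l = (if l = k then 1 else 0))"
    and Kz: "\<forall>g\<in>\<Gamma>. (\<forall>k\<in>K. g k = 0) \<longrightarrow> (\<forall>v\<in>V. g v = 0)" by (elim exE conjE)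
  show ?case
  proof (cases "\<forall>g\<in>\<Gamma>. (\<forall>k\<in>K. g k = 0) \<longrightarrow> g y = 0")
    case True
    then have "\<forall>g\<in>\<Gamma>. (\<forall>k\<in>K. g k = 0) \<longrightarrow> (\<forall>v\<in>insert y V. g v = 0)" using Kz by auto
    then show ?thesis using K Ke by (intro exI[of _ K] exI[of _ e] conjI) auto
  next
    case False
    then obtain g where g: "g \<in> \<Gamma>" "\<forall>k\<in>K. g k = 0" "g y \<noteq> 0" by blast
    have yK: "y \<notin> K" using K insert.hyps by blast
    define d where "d = (\<lambda>v. inverse (g y) * g v)"
    \<comment> \<open>The new row \<open>d\<close> is zero at the old pivots, so multiples of it
      clear column \<open>y\<close> without disturbing them.\<close>
    define e' where "e' k = (if k = y then d else e k - (\<lambda>v. e k y * d v))" for k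
    have d: "d \<in> \<Gamma>" unfolding d_def by (rule cv.subspace_scale[OF \<Gamma> g(1)])
    have dv: "d y = 1" "\<And>k. k \<in> K \<Longrightarrow> d k = 0" using g by (auto simp: d_def)
    have 1: "e' k \<in> \<Gamma>" if "k \<in> insert y K" for k
      using that d by (auto simp: e'_def intro!: cv.subspace_diff[OF \<Gamma>] cv.subspace_scale[OF \<Gamma>] simp: Ke)
    have 2: "e' k l = (if l = k then 1 else 0)" if "k \<in> insert y K" "l \<in> insert y K" for k l
      using that Ke dv yK by (auto simp: e'_def)
    have 3: "h v = 0" if "h \<in> \<Gamma>" "\<forall>k\<in>insert y K. h k = 0" "v \<in> insert y V" for h v
      using that Kz by auto
    show ?thesis
    proof (rule exI[of _ "insert y K"], rule exI[of _ e'], intro conjI)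
      show "insert y K \<subseteq> insert y V" using K by blast
      show "\<forall>k\<in>insert y K. e' k \<in> \<Gamma> \<and> (\<forall>l\<in>insert y K. e' k l = (if l = k then 1 else 0))"
        by (intro ballI conjI 1 2)
      show "\<forall>g\<in>\<Gamma>. (\<forall>k\<in>insert y K. g k = 0) \<longrightarrow> (\<forall>v\<in>insert y V. g v = 0)"
        by (intro ballI impI) (rule 3)
    qed
  qed
qed

text \<open>The coordinates off the pivots are free, the equation \<open>e k\<close> being solved
  for coordinate \<open>k\<close>. The vector \<open>b j\<close> is the solution whose only nonzero
  free coordinate is a 1 at \<open>j\<close>.\<close>

lemma annihilator_dim:
  fixes \<Gamma> :: "('v \<Rightarrow> complex) set"
  assumes fin: "finite V" and \<Gamma>: "cv.subspace \<Gamma>" and K: "K \<subseteq> V"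
    and e: "\<And>k. k \<in> K \<Longrightarrow> e k \<in> \<Gamma>" "\<And>k l. k \<in> K \<Longrightarrow> l \<in> K \<Longrightarrow> e k l = (if l = k then 1 else 0)"
    and z: "\<And>g v. g \<in> \<Gamma> \<Longrightarrow> \<forall>k\<in>K. g k = 0 \<Longrightarrow> v \<in> V \<Longrightarrow> g v = 0"
  shows "cv.dim {v. (\<forall>i. i \<notin> V \<longrightarrow> v i = 0) \<and> (\<forall>g\<in>\<Gamma>. (\<Sum>i\<in>V. g i * v i) = 0)} = card (V - K)"
proof -
  let ?T = "{v. (\<forall>i. i \<notin> V \<longrightarrow> v i = 0) \<and> (\<forall>g\<in>\<Gamma>. (\<Sum>i\<in>V. g i * v i) = 0)}"
  have finK: "finite K" using fin K finite_subset by blast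
  define b where "b j = (\<lambda>i. if i \<in> K then - e i j else if i = j then 1 else (0::complex))" for j
  show ?thesis
  proof (rule dim_eq_card_dual[where \<phi> = "\<lambda>j v. v j" and b = b])
    show "cv.subspace ?T"
      unfolding cv.subspace_def
      by (auto simp: distrib_left sum.distrib mult.left_commute simp flip: sum_distrib_left)
    show "finite (V - K)" using fin by simp
    show "v = 0" if v: "v \<in> ?T" "\<And>j. j \<in> V - K \<Longrightarrow> v j = 0" for v
    proof
      fix i
      consider "i \<notin> V" | "i \<in> V - K" | "i \<in> K" by blast
      then show "v i = 0 i"
      proof cases
        case 3
        have "(\<Sum>l\<in>V. e i l * v l) = (\<Sum>l\<in>V. if l = i then v i else 0)"
        proof (intro sum.cong refl)
          fix l assume "l \<in> V"
          then show "e i l * v l = (if l = i then v i else 0)"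
            using v(2)[of l] e(2)[OF 3, of l] by (cases "l \<in> K") auto
        qed
        then show ?thesis using v(1) e(1)[OF 3] 3 K fin by auto
      qed (use v in auto)
    qed
    fix j assume j: "j \<in> V - K"
    show "b j j \<noteq> 0" using j by (simp add: b_def)
    show "b j i = 0" if "i \<in> V - K" "i \<noteq> j" for i using that by (simp add: b_def)
    have "(\<Sum>i\<in>V. g i * b j i) = 0" if g: "g \<in> \<Gamma>" for g
    proof -
      define h where "h = g - (\<Sum>k\<in>K. (\<lambda>v. g k * e k v))"
      have hG: "h \<in> \<Gamma>" unfolding h_def
        by (intro cv.subspace_diff[OF \<Gamma> g] cv.subspace_sum[OF \<Gamma>] cv.subspace_scale[OF \<Gamma>] e(1))
      have "h l = 0" if l: "l \<in> K" for l
      proof -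
        have "(\<Sum>k\<in>K. g k * e k l) = (\<Sum>k\<in>K. if k = l then g l else 0)"
          using e(2)[OF _ l] by (intro sum.cong) auto
        then show ?thesis using finK l by (simp add: h_def fun_sum_apply)
      qed
      then have "h j = 0" using z[OF hG, of j] j by blast
      have "(\<Sum>i\<in>V. g i * b j i) = (\<Sum>i\<in>K. g i * b j i) + (\<Sum>i\<in>V - K. g i * b j i)"
        using K fin by (metis add.commute sum.subset_diff)
      also have "(\<Sum>i\<in>K. g i * b j i) = - (\<Sum>i\<in>K. g i * e i j)"
        unfolding sum_negf[symmetric] by (intro sum.cong) (auto simp: b_def)
      also have "(\<Sum>i\<in>V - K. g i * b j i) = (\<Sum>i\<in>V - K. if i = j then g j else 0)"
        by (intro sum.cong) (auto simp: b_def)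
      finally show ?thesis using \<open>h j = 0\<close> j fin by (simp add: h_def fun_sum_apply)
    qed
    then show "b j \<in> ?T" using j K by (auto simp: b_def)
  qed auto
qed

text \<open>An echelon basis of \<open>T\<close> along \<open>J\<close> has as many pivots as the
  dimension, so every element of \<open>J\<close> is a pivot.\<close>

lemma full_rank_coords:
  fixes T :: "('v \<Rightarrow> complex) set"
  assumes T: "cv.subspace T" and J: "finite J" and inj: "\<And>v. v \<in> T \<Longrightarrow> \<forall>j\<in>J. v j = 0 \<Longrightarrow> v = 0"
    and dim: "cv.dim T = card J" and j: "j \<in> J"
  obtains v where "v \<in> T" "\<And>i. i \<in> J \<Longrightarrow> v i = (if i = j then 1 else 0)"
proof -
  obtain K e where K: "K \<subseteq> J" and Ke: "\<forall>k\<in>K. e k \<in> T \<and> (\<forall>l\<in>K. e k l = (if l = k then 1 else 0))"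
    and Kz: "\<forall>g\<in>T. (\<forall>k\<in>K. g k = 0) \<longrightarrow> (\<forall>v\<in>J. g v = 0)"
    using echelon_basis[OF J T] by (elim exE conjE)
  have "cv.dim T = card K"
  proof (rule dim_eq_card_dual[OF T, where \<phi> = "\<lambda>j v. v j" and b = e])
    show "finite K" using K J finite_subset by blast
    show "v = 0" if "v \<in> T" "\<And>j. j \<in> K \<Longrightarrow> v j = 0" for v
      using inj[OF that(1)] Kz that by blast
  qed (use Ke in auto)
  then have "K = J" using dim card_subset_eq[OF J K] by simp
  then show ?thesis using that[of "e j"] Ke j by auto
qed

section \<open>Zariski tangent spaces and their generic dimension\<close>

definition tangent :: "'v set \<Rightarrow> ('v \<Rightarrow> complex) set \<Rightarrow> ('v \<Rightarrow> complex) \<Rightarrow> ('v \<Rightarrow> complex) set" where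
  "tangent V S x = {v. (\<forall>i. i \<notin> V \<longrightarrow> v i = 0) \<and>
     (\<forall>f\<in>poly_funs V. vanishes S f \<longrightarrow> (\<Sum>i\<in>V. pd i f x * v i) = 0)}"

lemma subspace_tangent: "cv.subspace (tangent V S x)"
  unfolding cv.subspace_def tangent_def
  by (auto simp: distrib_left sum.distrib mult.left_commute simp flip: sum_distrib_left)

text \<open>The conormal space at \<open>x\<close>, whose annihilator is the tangent space.\<close>

definition gradients :: "'v set \<Rightarrow> ('v \<Rightarrow> complex) set \<Rightarrow> ('v \<Rightarrow> complex) \<Rightarrow> ('v \<Rightarrow> complex) set" where
  "gradients V S x = {(\<lambda>i. pd i f x) | f. f \<in> poly_funs V \<and> vanishes S f}"

lemma subspace_gradients: "cv.subspace (gradients V S x)"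
  unfolding cv.subspace_def
proof (intro conjI ballI allI)
  have "vanishes S (\<lambda>x. 0)" "(\<lambda>i. pd i (\<lambda>x. 0) x) = 0" by (auto simp: vanishes_def)
  then show "0 \<in> gradients V S x" unfolding gradients_def using poly_funs.const[of 0 V] by force
next
  fix g h assume "g \<in> gradients V S x" "h \<in> gradients V S x"
  then obtain f k where fk: "f \<in> poly_funs V" "vanishes S f" "g = (\<lambda>i. pd i f x)"
    "k \<in> poly_funs V" "vanishes S k" "h = (\<lambda>i. pd i k x)" unfolding gradients_def by blast
  have "g + h = (\<lambda>i. pd i (\<lambda>x. f x + k x) x)"
    using pd_add[OF fk(1,4)] unfolding fk(3,6) by (auto simp: fun_eq_iff)
  moreover have "vanishes S (\<lambda>x. f x + k x)" using fk by (simp add: vanishes_def)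
  ultimately show "g + h \<in> gradients V S x" unfolding gradients_def using poly_funs.add[OF fk(1,4)] by blast
next
  fix c g assume "g \<in> gradients V S x"
  then obtain f where f: "f \<in> poly_funs V" "vanishes S f" "g = (\<lambda>i. pd i f x)" unfolding gradients_def by blast
  have "(\<lambda>i. c * g i) = (\<lambda>i. pd i (\<lambda>x. c * f x) x)"
    using pd_mult[OF poly_funs.const[of c] f(1)] unfolding f(3) by (simp add: fun_eq_iff mult.commute)
  moreover have "vanishes S (\<lambda>x. c * f x)" using f by (simp add: vanishes_def)
  ultimately show "(\<lambda>i. c * g i) \<in> gradients V S x"
    unfolding gradients_def using poly_funs.mult[OF poly_funs.const[of c] f(1)] by blast
qed

lemma tangent_eq_annihilator:
  "tangent V S x = {v. (\<forall>i. i \<notin> V \<longrightarrow> v i = 0) \<and> (\<forall>g\<in>gradients V S x. (\<Sum>i\<in>V. g i * v i) = 0)}"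
  unfolding tangent_def gradients_def by auto

text \<open>At a general point the basis \<open>J\<close> gives linear coordinates on the tangent
  space. Injectivity comes from the separable relations \<open>G y\<close>, which determine the
  other components; the values of the derivations \<open>w i\<close> are tangent vectors dual to
  \<open>J\<close> up to scalars. \<open>\<gamma>\<close> is the product of everything that must be
  nonzero for this.\<close>

lemma generic_tangent:
  assumes fin: "finite V" and S: "irred V S" and J: "basis_of V S J"
  shows "\<exists>\<gamma>\<in>poly_funs V. \<not> vanishes S \<gamma> \<and> (\<forall>x\<in>S. \<gamma> x \<noteq> 0 \<longrightarrow>
    (\<forall>v\<in>tangent V S x. (\<forall>j\<in>J. v j = 0) \<longrightarrow> v = 0) \<and>
    (\<exists>b. \<forall>j\<in>J. b j \<in> tangent V S x \<and> b j j \<noteq> 0 \<and> (\<forall>i\<in>J. i \<noteq> j \<longrightarrow> b j i = 0)))"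
proof -
  have JV: "J \<subseteq> V" using J unfolding basis_of_def by blast
  have finJ: "finite J" using JV fin finite_subset by blast
  have "\<exists>w. \<forall>i\<in>J. (\<forall>v\<in>V. w i v \<in> poly_funs V) \<and> \<not> vanishes S (w i i) \<and> (\<forall>k\<in>J. k \<noteq> i \<longrightarrow> w i k = (\<lambda>x. 0)) \<and>
    (\<forall>f\<in>poly_funs V. vanishes S f \<longrightarrow> vanishes S (der V (w i) f))"
  proof (rule bchoice, rule ballI)
    fix i assume "i \<in> J"
    then show "\<exists>w. (\<forall>v\<in>V. w v \<in> poly_funs V) \<and> \<not> vanishes S (w i) \<and> (\<forall>k\<in>J. k \<noteq> i \<longrightarrow> w k = (\<lambda>x. 0)) \<and>
      (\<forall>f\<in>poly_funs V. vanishes S f \<longrightarrow> vanishes S (der V w f))"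
      using tangent_derivation[OF fin S J, of i] by metis
  qed
  then obtain w where w: "\<And>i v. i \<in> J \<Longrightarrow> v \<in> V \<Longrightarrow> w i v \<in> poly_funs V" "\<And>i. i \<in> J \<Longrightarrow> \<not> vanishes S (w i i)"
    "\<And>i k. i \<in> J \<Longrightarrow> k \<in> J \<Longrightarrow> k \<noteq> i \<Longrightarrow> w i k = (\<lambda>x. 0)"
    "\<And>i f. i \<in> J \<Longrightarrow> f \<in> poly_funs V \<Longrightarrow> vanishes S f \<Longrightarrow> vanishes S (der V (w i) f)"
    by blast
  have "\<exists>G. \<forall>y\<in>V - J. G y \<in> poly_funs (insert y J) \<and> vanishes S (G y) \<and> \<not> vanishes S (pd y (G y))"
  proof (rule bchoice, rule ballI)
    fix y assume "y \<in> V - J"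
    then show "\<exists>G. G \<in> poly_funs (insert y J) \<and> vanishes S G \<and> \<not> vanishes S (pd y G)"
      using basis_relation[OF fin S J, of y] by metis
  qed
  then obtain G where G: "\<And>y. y \<in> V - J \<Longrightarrow> G y \<in> poly_funs (insert y J)" "\<And>y. y \<in> V - J \<Longrightarrow> vanishes S (G y)"
    "\<And>y. y \<in> V - J \<Longrightarrow> \<not> vanishes S (pd y (G y))" by blast
  have GV: "G y \<in> poly_funs V" if "y \<in> V - J" for y
    using poly_funs_mono[OF G(1)[OF that]] that JV by blast
  let ?\<gamma> = "\<lambda>x. (\<Prod>i\<in>J. w i i x) * (\<Prod>y\<in>V - J. pd y (G y) x)"
  have wii: "w i i \<in> poly_funs V" if "i \<in> J" for i using w(1)[OF that, of i] that JV by blast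
  have p: "(\<lambda>x. \<Prod>i\<in>J. w i i x) \<in> poly_funs V" "(\<lambda>x. \<Prod>y\<in>V - J. pd y (G y) x) \<in> poly_funs V"
    by (intro poly_funs_prod wii pd_in_poly_funs GV; assumption)+
  have "\<not> vanishes S ?\<gamma>"
    by (intro irred_mult[OF S p] irred_prod[OF S] wii w(2) pd_in_poly_funs GV G(3) finJ finite_Diff fin; assumption)
  moreover have "(\<forall>v\<in>tangent V S x. (\<forall>j\<in>J. v j = 0) \<longrightarrow> v = 0) \<and>
    (\<exists>b. \<forall>j\<in>J. b j \<in> tangent V S x \<and> b j j \<noteq> 0 \<and> (\<forall>i\<in>J. i \<noteq> j \<longrightarrow> b j i = 0))"
    if x: "x \<in> S" "?\<gamma> x \<noteq> 0" for x
  proof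
    have nz: "w i i x \<noteq> 0" if "i \<in> J" for i using x(2) finJ that by auto
    have nzG: "pd y (G y) x \<noteq> 0" if "y \<in> V - J" for y using x(2) fin that by auto
    show "\<forall>v\<in>tangent V S x. (\<forall>j\<in>J. v j = 0) \<longrightarrow> v = 0"
    proof (intro ballI impI ext)
      fix v i assume v: "v \<in> tangent V S x" "\<forall>j\<in>J. v j = 0"
      show "v i = 0 i"
      proof (cases "i \<in> V - J")
        case True
        have "(\<Sum>l\<in>V. pd l (G i) x * v l) = (\<Sum>l\<in>V. if l = i then pd i (G i) x * v i else 0)"
        proof (intro sum.cong refl)
          fix l assume "l \<in> V"
          show "pd l (G i) x * v l = (if l = i then pd i (G i) x * v i else 0)"
            using pd_outside[OF G(1)[OF True], of l] v(2) by (cases "l \<in> insert i J") auto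
        qed
        moreover have "(\<Sum>l\<in>V. pd l (G i) x * v l) = 0"
          using v(1) GV[OF True] G(2)[OF True] unfolding tangent_def by blast
        ultimately have "pd i (G i) x * v i = 0" using fin True by simp
        then show ?thesis using nzG[OF True] by simp
      next
        case False
        then show ?thesis using v unfolding tangent_def by auto
      qed
    qed
    let ?b = "\<lambda>j i. if i \<in> V then w j i x else 0"
    have "?b j \<in> tangent V S x" if j: "j \<in> J" for j
    proof -
      have "(\<Sum>i\<in>V. pd i f x * ?b j i) = 0" if f: "f \<in> poly_funs V" "vanishes S f" for f
      proof -
        have "(\<Sum>i\<in>V. pd i f x * ?b j i) = der V (w j) f x"
          unfolding der_def by (intro sum.cong) auto
        then show ?thesis using w(4)[OF j f] x(1) by (simp add: vanishes_def)
      qed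
      then show ?thesis unfolding tangent_def by simp
    qed
    then show "\<exists>b. \<forall>j\<in>J. b j \<in> tangent V S x \<and> b j j \<noteq> 0 \<and> (\<forall>i\<in>J. i \<noteq> j \<longrightarrow> b j i = 0)"
      using nz w(3) JV by (intro exI[of _ ?b]) auto
  qed
  ultimately show ?thesis using poly_funs.mult[OF p] by (intro bexI[of _ ?\<gamma>]) auto
qed

lemma dim_tangent_coords:
  assumes "finite J" "\<forall>v\<in>tangent V S x. (\<forall>j\<in>J. v j = 0) \<longrightarrow> v = 0"
    "\<forall>j\<in>J. b j \<in> tangent V S x \<and> b j j \<noteq> 0 \<and> (\<forall>i\<in>J. i \<noteq> j \<longrightarrow> b j i = 0)"
  shows "cv.dim (tangent V S x) = card J"
  by (rule dim_eq_card_dual[OF subspace_tangent assms(1), where \<phi> = "\<lambda>j v. v j" and b = b])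
     (use assms(2,3) in auto)

section \<open>Smooth points and critical points\<close>

lemma hom_scale: "F \<in> hom_funs n d \<Longrightarrow> c \<noteq> 0 \<Longrightarrow> F (\<lambda>i. c * x i) = c ^ d * F x"
  unfolding hom_funs_def by blast

lemma hom_poly: "F \<in> hom_funs n d \<Longrightarrow> F \<in> poly_funs {..n}"
  unfolding hom_funs_def by blast

lemma hom_mult:
  assumes "F \<in> hom_funs n d" "G \<in> hom_funs n e"
  shows "(\<lambda>x. F x * G x) \<in> hom_funs n (d + e)"
  using assms poly_funs.mult[of F "{..n}" G] unfolding hom_funs_def by (auto simp: power_add)

lemma hom_sum:
  assumes "\<And>i. i \<in> A \<Longrightarrow> F i \<in> hom_funs n d"
  shows "(\<lambda>x. \<Sum>i\<in>A. F i x) \<in> hom_funs n d"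
  using assms poly_funs_sum[of A F "{..n}"] unfolding hom_funs_def by (auto simp: sum_distrib_left)

lemma hom_diff:
  assumes "F \<in> hom_funs n d" "G \<in> hom_funs n d"
  shows "(\<lambda>x. F x - G x) \<in> hom_funs n d"
  using assms poly_funs_diff[of F "{..n}" G] unfolding hom_funs_def by (auto simp: right_diff_distrib)

lemma hom_const: "(\<lambda>x. c) \<in> hom_funs n 0"
  unfolding hom_funs_def by (auto intro: poly_funs.const)

lemma hom_var: "i \<le> n \<Longrightarrow> (\<lambda>x. x i) \<in> hom_funs n 1"
  unfolding hom_funs_def by (auto intro: poly_funs.var)

lemma hom_prod:
  assumes "finite A" "\<And>i. i \<in> A \<Longrightarrow> F i \<in> hom_funs n 1"
  shows "(\<lambda>x. \<Prod>i\<in>A. F i x) \<in> hom_funs n (card A)"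
  using assms
proof induction
  case (insert a A)
  then show ?case using hom_mult[of "F a" n 1 "\<lambda>x. \<Prod>i\<in>A. F i x" "card A"] by simp
qed (simp add: hom_const)

lemma hom_power:
  assumes "F \<in> hom_funs n d"
  shows "(\<lambda>x. F x ^ k) \<in> hom_funs n (d * k)"
  using assms poly_funs_power[of F "{..n}" k] unfolding hom_funs_def
  by (auto simp: power_mult_distrib power_mult)

lemma pd_scale:
  fixes f :: "('v \<Rightarrow> complex) \<Rightarrow> complex"
  assumes "f \<in> poly_funs V" "finite V"
  shows "pd i (\<lambda>x. f (\<lambda>j. c * x j)) x = c * pd i f (\<lambda>j. c * x j)"
proof -
  have p: "(\<lambda>x. c * x j) \<in> poly_funs V" if "j \<in> V" for j
    by (intro poly_funs.mult poly_funs.const poly_funs.var that)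
  have pdc: "pd i (\<lambda>x. c * x j) x = (if j = i then c else 0)" if "j \<in> V" for j
    using pd_mult[OF poly_funs.const[of c V] poly_funs.var[OF that], of i] by (simp add: pd_var fun_eq_iff)
  have "pd i (\<lambda>x. f (\<lambda>j. c * x j)) x = (\<Sum>j\<in>V. pd j f (\<lambda>j. c * x j) * pd i (\<lambda>x. c * x j) x)"
    using fun_cong[OF pd_comp[OF assms, of "\<lambda>j x. c * x j", OF p], of i x] .
  also have "\<dots> = (\<Sum>j\<in>V. if j = i then c * pd i f (\<lambda>j. c * x j) else 0)"
    by (intro sum.cong refl) (auto simp: pdc)
  also have "\<dots> = c * pd i f (\<lambda>j. c * x j)"
    using assms pd_outside[OF assms(1), of i] by auto
  finally show ?thesis .
qed

text \<open>Differentiate the scaling law of \<open>F\<close> and cancel one factor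
  \<open>c\<close>.\<close>

lemma hom_pd:
  assumes F: "F \<in> hom_funs n (Suc d)"
  shows "pd i F \<in> hom_funs n d"
proof -
  note Fp = hom_poly[OF F]
  have "pd i F (\<lambda>j. c * x j) = c ^ d * pd i F x" if c: "c \<noteq> 0" for c x
  proof -
    have "(\<lambda>x. F (\<lambda>j. c * x j)) = (\<lambda>x. c ^ Suc d * F x)" using hom_scale[OF F c] by blast
    then have "c * pd i F (\<lambda>j. c * x j) = pd i (\<lambda>x. c ^ Suc d * F x) x"
      using pd_scale[OF Fp, of i c x] by simp
    also have "\<dots> = c ^ Suc d * pd i F x"
      using pd_mult[OF poly_funs.const[of "c ^ Suc d"] Fp, of i] by simp
    finally show ?thesis using c by simp
  qed
  then show ?thesis unfolding hom_funs_def using pd_in_poly_funs[OF Fp] by blast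
qed

lemma tangent_scale:
  fixes S :: "('v \<Rightarrow> complex) set"
  assumes fin: "finite V" and S: "\<And>x c. x \<in> S \<Longrightarrow> c \<noteq> 0 \<Longrightarrow> (\<lambda>i. c * x i) \<in> S" and c: "c \<noteq> 0"
  shows "tangent V S (\<lambda>i. c * x i) = tangent V S x"
proof -
  have sub: "tangent V S y \<subseteq> tangent V S (\<lambda>i. b * y i)" if b: "b \<noteq> 0" for b y
  proof
    fix v assume v: "v \<in> tangent V S y"
    have "(\<Sum>i\<in>V. pd i f (\<lambda>i. b * y i) * v i) = 0" if f: "f \<in> poly_funs V" "vanishes S f" for f
    proof -
      have "(\<lambda>x. f (\<lambda>j. b * x j)) \<in> poly_funs V"
        by (rule poly_funs_comp[OF f(1)]) (intro poly_funs.mult poly_funs.const poly_funs.var)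
      moreover have "vanishes S (\<lambda>x. f (\<lambda>j. b * x j))" using f(2) S b unfolding vanishes_def by blast
      ultimately have "(\<Sum>i\<in>V. pd i (\<lambda>x. f (\<lambda>j. b * x j)) y * v i) = 0" using v unfolding tangent_def by blast
      then have "b * (\<Sum>i\<in>V. pd i f (\<lambda>i. b * y i) * v i) = 0"
        unfolding pd_scale[OF f(1) fin] by (simp add: sum_distrib_left mult.assoc)
      then show ?thesis using b by simp
    qed
    then show "v \<in> tangent V S (\<lambda>i. b * y i)" using v unfolding tangent_def by blast
  qed
  have "(\<lambda>i. inverse c * (c * x i)) = x" using c by (simp add: fun_eq_iff)
  then show ?thesis using sub[of c x] sub[of "inverse c" "\<lambda>i. c * x i"] c by auto
qed

lemma dlog_ratio:
  fixes x v :: cvector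
  assumes "x i \<noteq> 0" "(\<Sum>j\<le>n. x j) \<noteq> 0"
  shows "dlog (\<lambda>p. p i / (\<Sum>j\<le>n. p j)) x v = v i / x i - (\<Sum>j\<le>n. v j) / (\<Sum>j\<le>n. x j)"
proof -
  let ?s = "\<Sum>j\<le>n. x j" and ?t = "\<Sum>j\<le>n. v j"
  have "(\<lambda>t. (x i + t * v i) / (\<Sum>j\<le>n. x j + t * v j)) = (\<lambda>t. (x i + t * v i) / (?s + t * ?t))"
    by (simp add: sum.distrib sum_distrib_left)
  moreover have "((\<lambda>t. (x i + t * v i) / (?s + t * ?t)) has_field_derivative
      (v i * ?s - x i * ?t) / (?s * ?s)) (at 0)"
    using assms(2) by (auto intro!: derivative_eq_intros)
  ultimately have "deriv (\<lambda>t. (x i + t * v i) / (\<Sum>j\<le>n. x j + t * v j)) 0 = (v i * ?s - x i * ?t) / (?s * ?s)"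
    by (simp add: DERIV_imp_deriv)
  then show ?thesis unfolding dlog_def using assms by (simp add: field_simps)
qed

section \<open>The cone over the variety, its smooth points and the critical equations\<close>

locale likelihood_variety =
  fixes n :: nat and X :: "ppoint set"
  assumes closed_X: "closedin (zariski n) X"
    and irreducible_X: "irreducible_in (zariski n) X"
    and X_not_in_arrangement: "\<not> X \<subseteq> arrangement n"
begin

definition S :: "cvector set" where "S = proj.cone n X"

lemma S_iff: "x \<in> S \<longleftrightarrow> x \<in> cvectors n - {0} \<and> ppt x \<in> X"
  unfolding S_def proj.cone_def by blast

lemma irred_S: "irred {..n} S"
  unfolding S_def by (rule proj.irred_cone[OF irreducible_X])

lemma S_scale: "x \<in> S \<Longrightarrow> c \<noteq> 0 \<Longrightarrow> (\<lambda>i. c * x i) \<in> S"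
  unfolding S_iff using cvectors_scale[of x n c] ppt_scale[of c x] by simp

lemma X_rep:
  assumes "P \<in> X"
  shows "\<exists>x\<in>S. P = ppt x"
proof -
  have "P \<in> proj_space n" using closedin_subset[OF closed_X] assms by auto
  then obtain x where "P = ppt x" "x \<in> cvectors n - {0}" unfolding proj_space_eq by (rule imageE)
  then show ?thesis using assms S_iff by blast
qed

text \<open>A basis of largest size is chosen, so that one number \<open>R\<close> enters both the
  upper and the lower bound for the dimension.\<close>

definition J :: "nat set" where
  "J = (SOME J. basis_of {..n} S J \<and> card J = rk {..n} S)"

abbreviation R :: nat where "R \<equiv> card J"

lemma basis_J: "basis_of {..n} S J" and card_J: "R = rk {..n} S"
proof -
  have "S \<noteq> {}" using irred_S unfolding irred_def by blast
  then obtain K where "basis_of {..n} S K" "card K = rk {..n} S"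
    by (rule rk_basis[OF finite_atMost])
  then have "\<exists>J. basis_of {..n} S J \<and> card J = rk {..n} S" by blast
  from someI_ex[OF this] show "basis_of {..n} S J" "R = rk {..n} S" unfolding J_def by auto
qed

lemma J_sub: "J \<subseteq> {..n}" and finite_J: "finite J"
  using basis_J finite_subset[of J "{..n}"] unfolding basis_of_def by auto

lemma R_bounds: "1 \<le> R" "R \<le> Suc n"
  using proj.rk_cone_ge[OF irreducible_X] card_mono[OF _ J_sub] unfolding card_J S_def[symmetric] by auto

text \<open>The rank of the cone exceeds the dimension by the one scaling. The threshold in the
  definition of the smooth locus thereby becomes \<open>R\<close>.\<close>

lemma krull_X: "krull_dim (subtopology (zariski n) X) + 1 = enat R"
proof -
  obtain i where "i \<in> J" using R_bounds(1) by (metis card.empty ex_in_conv not_one_le_zero)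
  then have "i \<le> n" and i: "{i} \<subseteq> J" using J_sub by auto
  note nrm = proj_normalizing[OF \<open>i \<le> n\<close>]
  have "enat (R - 1) \<le> krull_dim (subtopology (zariski n) X)"
    by (rule proj.krull_dim_ge[OF closed_X irreducible_X basis_J[unfolded S_def] i nrm])
  moreover have "krull_dim (subtopology (zariski n) X) \<le> enat (R - 1)"
    using proj.krull_dim_le[OF closed_X irreducible_X] unfolding card_J S_def .
  ultimately have "krull_dim (subtopology (zariski n) X) = enat (R - 1)" by simp
  then show ?thesis using R_bounds(1) by (simp add: one_enat_def)
qed

text \<open>\<open>S\<close> is stable under scaling, hence its ideal is homogeneous.\<close>

lemma hom_parts:
  assumes f: "f \<in> poly_funs {..n}" "vanishes S f"
  shows "\<exists>D H. finite D \<and> (\<forall>d. H d \<in> poly_eval ` forms n d \<and> vanishes S (H d)) \<and> (\<forall>x. f x = (\<Sum>d\<in>D. H d x))"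
proof -
  obtain D H where D: "finite D" and H: "\<forall>d. H d \<in> poly_eval ` forms n d"
    and sum: "\<forall>x. f x = (\<Sum>d\<in>D. H d x)" and out: "\<forall>d x. d \<notin> D \<longrightarrow> H d x = 0"
    using poly_funs_hom_parts[OF f(1)] by (elim exE conjE)
  have Hh: "H d \<in> hom_funs n d" for d
  proof -
    obtain g where "H d = poly_eval g" "g \<in> forms n d" using spec[OF H, of d] by (elim imageE)
    then show ?thesis using poly_eval_forms by simp
  qed
  have "H d x = 0" if x: "x \<in> S" for d x
  proof (cases "d \<in> D")
    case True
    have "(\<Sum>d\<in>D. c ^ id d * H d x) = 0" if c: "c \<noteq> 0" for c
    proof -
      have "f (\<lambda>i. c * x i) = 0" using f(2) S_scale[OF x c] unfolding vanishes_def by blast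
      then show ?thesis using spec[OF sum, of "\<lambda>i. c * x i"] hom_scale[OF Hh c] by simp
    qed
    then show ?thesis using poly_coeffs_unique[OF D, of id "\<lambda>d. H d x"] True by auto
  qed (use out in blast)
  then show ?thesis using D H sum by (intro exI[of _ D] exI[of _ H]) (auto simp: vanishes_def)
qed

lemma vanishing_forms_iff: "f \<in> vanishing_forms n X \<longleftrightarrow> (\<exists>d. f \<in> forms n d) \<and> vanishes S (poly_eval f)"
proof -
  have "(\<forall>P\<in>X. \<forall>x\<in>P. poly_eval f x = 0) \<longleftrightarrow> vanishes S (poly_eval f)" if f: "f \<in> forms n d" for d
  proof
    assume a: "\<forall>P\<in>X. \<forall>x\<in>P. poly_eval f x = 0"
    show "vanishes S (poly_eval f)"
      unfolding vanishes_def
    proof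
      fix x assume "x \<in> S"
      then have "ppt x \<in> X" using S_iff by blast
      then show "poly_eval f x = 0" using a ppt_self[of x] by blast
    qed
  next
    assume v: "vanishes S (poly_eval f)"
    show "\<forall>P\<in>X. \<forall>x\<in>P. poly_eval f x = 0"
    proof
      fix P assume "P \<in> X"
      then obtain x where "x \<in> S" "P = ppt x" using X_rep by blast
      then show "\<forall>x\<in>P. poly_eval f x = 0"
        using all_ppt_zero_iff[OF poly_eval_forms[OF f], of x] v unfolding vanishes_def by blast
    qed
  qed
  then show ?thesis unfolding vanishing_forms_def by blast
qed

text \<open>The ideal of \<open>S\<close> is spanned by forms, so that testing forms alone already
  yields the tangent space of the cone.\<close>

lemma cone_tangent_eq: "cone_tangent n X x = tangent {..n} S x"
proof (intro equalityI subsetI)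
  fix v assume v: "v \<in> cone_tangent n X x"
  have "(\<Sum>i\<le>n. pd i f x * v i) = 0" if f: "f \<in> poly_funs {..n}" "vanishes S f" for f
  proof -
    obtain D H where D: "finite D" and H: "\<forall>d. H d \<in> poly_eval ` forms n d \<and> vanishes S (H d)"
      and sum: "\<forall>x. f x = (\<Sum>d\<in>D. H d x)"
      using hom_parts[OF f] by (elim exE conjE)
    have Hp: "H d \<in> poly_funs {..n}" and H0: "(\<Sum>i\<le>n. pd i (H d) x * v i) = 0" for d
    proof -
      obtain g where g: "H d = poly_eval g" "g \<in> forms n d" using spec[OF H, of d] by (elim imageE conjE)
      from hom_poly[OF poly_eval_forms[OF g(2)]] show "H d \<in> poly_funs {..n}" unfolding g(1) .
      have "g \<in> vanishing_forms n X" using g spec[OF H, of d] vanishing_forms_iff by auto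
      then have "(\<Sum>i\<le>n. partial_deriv i g x * v i) = 0" using v unfolding cone_tangent_def by blast
      then show "(\<Sum>i\<le>n. pd i (H d) x * v i) = 0" unfolding g(1) partial_deriv_def pd_def .
    qed
    have "f = (\<lambda>x. \<Sum>d\<in>D. H d x)" using sum by blast
    then have "pd i f x = (\<Sum>d\<in>D. pd i (H d) x)" for i
      unfolding pd_eq_der using der_sum[of D H "{..n}" "{i}" "\<lambda>v x. 1"] Hp by simp
    then have "(\<Sum>i\<le>n. pd i f x * v i) = (\<Sum>d\<in>D. \<Sum>i\<le>n. pd i (H d) x * v i)"
      by (simp add: sum_distrib_right sum.swap[of _ D])
    then show ?thesis using H0 by simp
  qed
  then show "v \<in> tangent {..n} S x" using v unfolding tangent_def cone_tangent_def cvectors_def by auto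
next
  fix v assume v: "v \<in> tangent {..n} S x"
  have "(\<Sum>i\<le>n. partial_deriv i f x * v i) = 0" if f: "f \<in> vanishing_forms n X" for f
  proof -
    obtain d where "f \<in> forms n d" "vanishes S (poly_eval f)" using f vanishing_forms_iff by blast
    then have "(\<Sum>i\<le>n. pd i (poly_eval f) x * v i) = 0"
      using v hom_poly[OF poly_eval_forms] unfolding tangent_def by blast
    then show ?thesis unfolding partial_deriv_def pd_def .
  qed
  then show "v \<in> cone_tangent n X x" using v unfolding tangent_def cone_tangent_def cvectors_def by auto
qed

lemma tangent_ppt: "y \<in> ppt x \<Longrightarrow> tangent {..n} S y = tangent {..n} S x"
  using tangent_scale[of "{..n}" S, OF _ S_scale] unfolding ppt_def by auto

lemma smooth_iff:
  assumes "x \<in> S"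
  shows "ppt x \<in> smooth_locus n X \<longleftrightarrow> cv.dim (tangent {..n} S x) = R"
proof -
  have "ppt x \<in> X" using assms S_iff by blast
  then have "ppt x \<in> smooth_locus n X \<longleftrightarrow> (\<forall>y\<in>ppt x. cv.dim (tangent {..n} S y) = R)"
    unfolding smooth_locus_def krull_X cone_tangent_eq by simp
  also have "\<dots> \<longleftrightarrow> cv.dim (tangent {..n} S x) = R"
  proof
    assume "\<forall>y\<in>ppt x. cv.dim (tangent {..n} S y) = R"
    then show "cv.dim (tangent {..n} S x) = R" using ppt_self by (rule bspec)
  next
    assume "cv.dim (tangent {..n} S x) = R"
    then show "\<forall>y\<in>ppt x. cv.dim (tangent {..n} S y) = R"
      by (intro ballI) (simp only: tangent_ppt)
  qed
  finally show ?thesis .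
qed

definition h :: "cvector \<Rightarrow> complex" where "h x = (\<Prod>i\<le>n. x i) * (\<Sum>i\<le>n. x i)"

lemma h_hom: "h \<in> hom_funs n (n + 2)"
proof -
  have "(\<lambda>x. \<Prod>i\<in>{..n}. x i) \<in> hom_funs n (card {..n})" by (rule hom_prod[OF finite_atMost]) (rule hom_var, simp)
  moreover have "(\<lambda>x. \<Sum>i\<in>{..n}. x i) \<in> hom_funs n 1" by (rule hom_sum) (rule hom_var, simp)
  ultimately show ?thesis using hom_mult unfolding h_def[abs_def] by fastforce
qed

lemma h_nonzero: "h x \<noteq> 0 \<longleftrightarrow> (\<forall>i\<le>n. x i \<noteq> 0) \<and> (\<Sum>i\<le>n. x i) \<noteq> 0"
  unfolding h_def by auto

lemma arrangement_iff:
  assumes "x \<in> cvectors n - {0}"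
  shows "ppt x \<in> arrangement n \<longleftrightarrow> h x = 0"
proof -
  have "ppt x \<in> proj_space n" using assms proj_space_eq by blast
  then show ?thesis
    using all_ppt_zero_iff[OF h_hom, of x] unfolding arrangement_def h_def by simp
qed

lemma h_not_vanishes: "\<not> vanishes S h"
proof -
  obtain P where "P \<in> X" "P \<notin> arrangement n" using X_not_in_arrangement by blast
  then obtain x where "x \<in> S" "ppt x \<notin> arrangement n" using X_rep by blast
  then show ?thesis using arrangement_iff S_iff unfolding vanishes_def by blast
qed

definition B0 :: "cvector set" where
  "B0 = {x\<in>S. cv.dim (tangent {..n} S x) = R \<and> h x \<noteq> 0}"

lemma B0_iff: "x \<in> S \<Longrightarrow> x \<in> B0 \<longleftrightarrow> ppt x \<in> smooth_locus n X - arrangement n"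
  using smooth_iff arrangement_iff S_iff unfolding B0_def by blast

lemma B_rep: "P \<in> smooth_locus n X - arrangement n \<Longrightarrow> \<exists>x\<in>B0. P = ppt x"
  using X_rep B0_iff unfolding smooth_locus_def by (metis (no_types, lifting) DiffD1 mem_Collect_eq)

text \<open>Off the zeros of \<open>\<gamma>\<close> the basis coordinates are linear coordinates on
  the tangent space, which therefore has dimension \<open>R\<close>. The factor \<open>h\<close> in
  the witness avoids the arrangement, so general points of \<open>S\<close> lie in
  \<open>B0\<close>.\<close>

lemma generic:
  obtains \<gamma> where "\<gamma> \<in> poly_funs {..n}" "\<not> vanishes S \<gamma>"
    "\<And>x. x \<in> S \<Longrightarrow> \<gamma> x \<noteq> 0 \<Longrightarrow> x \<in> B0"
    "\<And>x. x \<in> S \<Longrightarrow> \<gamma> x \<noteq> 0 \<Longrightarrow> \<forall>v\<in>tangent {..n} S x. (\<forall>j\<in>J. v j = 0) \<longrightarrow> v = 0"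
    "\<And>x. x \<in> S \<Longrightarrow> \<gamma> x \<noteq> 0 \<Longrightarrow>
      \<exists>b. \<forall>j\<in>J. b j \<in> tangent {..n} S x \<and> b j j \<noteq> 0 \<and> (\<forall>i\<in>J. i \<noteq> j \<longrightarrow> b j i = 0)"
proof -
  obtain \<gamma> where \<gamma>: "\<gamma> \<in> poly_funs {..n}" "\<not> vanishes S \<gamma>"
    and g: "\<forall>x\<in>S. \<gamma> x \<noteq> 0 \<longrightarrow> (\<forall>v\<in>tangent {..n} S x. (\<forall>j\<in>J. v j = 0) \<longrightarrow> v = 0) \<and>
      (\<exists>b. \<forall>j\<in>J. b j \<in> tangent {..n} S x \<and> b j j \<noteq> 0 \<and> (\<forall>i\<in>J. i \<noteq> j \<longrightarrow> b j i = 0))"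
    using generic_tangent[OF finite_atMost irred_S basis_J] by (elim bexE conjE)
  let ?g = "\<lambda>x. \<gamma> x * h x"
  have "?g \<in> poly_funs {..n}" by (intro poly_funs.mult \<gamma> hom_poly[OF h_hom])
  moreover have "\<not> vanishes S ?g" by (rule irred_mult[OF irred_S \<gamma>(1) hom_poly[OF h_hom] \<gamma>(2) h_not_vanishes])
  moreover have "x \<in> B0" if x: "x \<in> S" "?g x \<noteq> 0" for x
  proof -
    have c: "\<forall>v\<in>tangent {..n} S x. (\<forall>j\<in>J. v j = 0) \<longrightarrow> v = 0"
      and "\<exists>b. \<forall>j\<in>J. b j \<in> tangent {..n} S x \<and> b j j \<noteq> 0 \<and> (\<forall>i\<in>J. i \<noteq> j \<longrightarrow> b j i = 0)"
      using g x by simp_all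
    then obtain b where "\<forall>j\<in>J. b j \<in> tangent {..n} S x \<and> b j j \<noteq> 0 \<and> (\<forall>i\<in>J. i \<noteq> j \<longrightarrow> b j i = 0)"
      by (elim exE)
    then have "cv.dim (tangent {..n} S x) = R" using dim_tangent_coords[OF finite_J c] by blast
    then show ?thesis using x unfolding B0_def by simp
  qed
  ultimately show ?thesis by (rule that) (use g in simp_all)
qed

text \<open>Since \<open>F\<close> vanishes on the ray through \<open>x\<close>, its derivative
  along the ray at \<open>x\<close> is zero. This form of Euler's relation holds for the whole
  ideal, not only for forms.\<close>

lemma euler:
  assumes F: "F \<in> poly_funs {..n}" "vanishes S F" and x: "x \<in> S"
  shows "(\<Sum>i\<le>n. pd i F x * x i) = 0"
proof -
  let ?g = "\<lambda>i (t :: cvector). t 0 * x i"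
  let ?f = "\<lambda>t. F (\<lambda>i. ?g i t)"
  have gp: "?g i \<in> poly_funs {0}" for i by (intro poly_funs.mult poly_funs.const poly_funs.var) simp
  have fp: "?f \<in> poly_funs {0}" by (rule poly_funs_comp[OF F(1) gp])
  have tp: "(\<lambda>t. t 0) \<in> poly_funs {0::nat}" by (intro poly_funs.var) simp
  \<comment> \<open>The extra factor covers \<open>t 0 = 0\<close>, where the scaled vector is zero
    and so outside \<open>S\<close>.\<close>
  have "t 0 * ?f t = 0" for t :: cvector
    using S_scale[OF x, of "t 0"] F(2) unfolding vanishes_def by (cases "t 0 = 0") auto
  then have "(\<lambda>t. t 0 :: complex) = (\<lambda>t :: cvector. 0) \<or> ?f = (\<lambda>t. 0)"
    by (rule poly_funs_nonzero_mult[OF _ tp fp, rotated]) simp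
  moreover have "(\<lambda>t. t 0 :: complex) \<noteq> (\<lambda>t :: cvector. 0)" by (auto dest: fun_cong[of _ _ "\<lambda>_. 1"])
  ultimately have "pd 0 ?f (\<lambda>_. 1) = 0" by simp
  moreover have "pd 0 ?f (\<lambda>_. 1) = (\<Sum>i\<le>n. pd i F (\<lambda>i. ?g i (\<lambda>_. 1)) * pd 0 (?g i) (\<lambda>_. 1))"
    by (rule fun_cong[OF pd_comp[of F "{..n}" ?g "{0}" 0, OF F(1) finite_atMost gp], of "\<lambda>_. 1"])
  moreover have "pd 0 (?g i) (\<lambda>_. 1) = x i" for i
    using pd_mult[OF tp poly_funs.const[of "x i"], of 0] by (simp add: pd_var)
  ultimately show ?thesis by simp
qed

text \<open>The likelihood form written out as a covector. It is linear in \<open>u\<close> and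
  makes sense for \<open>u = 0\<close>, so that the critical data over \<open>x\<close> form a
  linear space.\<close>

definition crit :: "cvector \<Rightarrow> cvector \<Rightarrow> bool" where
  "crit x u \<longleftrightarrow> (\<forall>v\<in>tangent {..n} S x.
     (\<Sum>i\<le>n. (u i / x i - (\<Sum>j\<le>n. u j) / (\<Sum>j\<le>n. x j)) * v i) = 0)"

lemma dlog_likelihood_eq:
  assumes "h x \<noteq> 0"
  shows "dlog_likelihood n u x v = (\<Sum>i\<le>n. (u i / x i - (\<Sum>j\<le>n. u j) / (\<Sum>j\<le>n. x j)) * v i)"
proof -
  let ?xs = "\<Sum>j\<le>n. x j" and ?us = "\<Sum>j\<le>n. u j" and ?vs = "\<Sum>j\<le>n. v j"
  have "dlog_likelihood n u x v = (\<Sum>i\<le>n. u i * (v i / x i - ?vs / ?xs))"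
    unfolding dlog_likelihood_def using assms unfolding h_nonzero
    by (intro sum.cong refl) (simp add: dlog_ratio)
  also have "\<dots> = (\<Sum>i\<le>n. u i / x i * v i) - ?us * (?vs / ?xs)"
    by (simp add: right_diff_distrib sum_subtractf sum_distrib_right sum_divide_distrib)
  also have "\<dots> = (\<Sum>i\<le>n. (u i / x i - ?us / ?xs) * v i)"
    unfolding left_diff_distrib sum_subtractf sum_distrib_left[symmetric] by simp
  finally show ?thesis .
qed

lemma crit_scale:
  assumes "b \<noteq> 0" "c \<noteq> 0"
  shows "crit (\<lambda>i. b * x i) (\<lambda>i. c * u i) \<longleftrightarrow> crit x u"
proof -
  have "tangent {..n} S (\<lambda>i. b * x i) = tangent {..n} S x"
    by (rule tangent_ppt) (use assms(1) in \<open>auto simp: ppt_def\<close>)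
  moreover have "(\<Sum>i\<le>n. (c * u i / (b * x i) - (\<Sum>j\<le>n. c * u j) / (\<Sum>j\<le>n. b * x j)) * v i) =
      (c / b) * (\<Sum>i\<le>n. (u i / x i - (\<Sum>j\<le>n. u j) / (\<Sum>j\<le>n. x j)) * v i)" for v
  proof -
    have s: "(\<Sum>j\<le>n. c * u j) = c * (\<Sum>j\<le>n. u j)" "(\<Sum>j\<le>n. b * x j) = b * (\<Sum>j\<le>n. x j)"
      by (simp_all add: sum_distrib_left)
    show ?thesis unfolding s sum_distrib_left[of "c / b"]
      by (intro sum.cong refl) (simp only: times_divide_times_eq[symmetric] right_diff_distrib[symmetric] mult.assoc)
  qed
  ultimately show ?thesis unfolding crit_def using assms by simp
qed

lemma critical_pairs_iff:
  assumes x: "x \<in> cvectors n - {0}" and u: "u \<in> cvectors n - {0}"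
  shows "(ppt x, ppt u) \<in> critical_pairs n X \<longleftrightarrow> x \<in> B0 \<and> crit x u"
proof (cases "x \<in> B0")
  case True
  then have xS: "x \<in> S" and hx: "h x \<noteq> 0" unfolding B0_def by auto
  have "h y \<noteq> 0" if "y \<in> ppt x" for y
    using that hx hom_scale[OF h_hom] unfolding ppt_def by auto
  then have "(\<forall>y\<in>ppt x. \<forall>w\<in>ppt u. \<forall>v\<in>cone_tangent n X y. dlog_likelihood n w y v = 0) \<longleftrightarrow>
      (\<forall>y\<in>ppt x. \<forall>w\<in>ppt u. crit y w)"
    unfolding crit_def cone_tangent_eq by (simp add: dlog_likelihood_eq)
  also have "\<dots> \<longleftrightarrow> crit x u"
    using crit_scale ppt_self unfolding ppt_def by blast
  finally show ?thesis
    using True B0_iff[OF xS] u unfolding critical_pairs_def proj_space_eq by blast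
next
  case False
  have "ppt x \<notin> smooth_locus n X - arrangement n"
    using False B0_iff[of x] x S_iff[of x] unfolding smooth_locus_def by blast
  then show ?thesis using False unfolding critical_pairs_def by blast
qed

end

section \<open>Frames of critical data\<close>

lemma det_in_poly_funs:
  assumes "\<And>a b. a < m \<Longrightarrow> b < m \<Longrightarrow> (\<lambda>x. N x a b) \<in> poly_funs V"
  shows "(\<lambda>x. Determinant.det (mat m m (\<lambda>(a, b). N x a b))) \<in> poly_funs V"
proof -
  have "Determinant.det (mat m m (\<lambda>(a, b). N x a b)) =
      (\<Sum>p\<in>{p. p permutes {0..<m}}. signof p * (\<Prod>i\<in>{0..<m}. N x i (p i)))" for x
  proof -
    have "Determinant.det (mat m m (\<lambda>(a, b). N x a b)) = (\<Sum>p\<in>{p. p permutes {0..<m}}.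
        signof p * (\<Prod>i = 0..<m. mat m m (\<lambda>(a, b). N x a b) $$ (i, p i)))"
      by (rule det_def') simp
    also have "\<dots> = (\<Sum>p\<in>{p. p permutes {0..<m}}. signof p * (\<Prod>i\<in>{0..<m}. N x i (p i)))"
    proof (intro sum.cong refl arg_cong2[where f = "(*)"] prod.cong)
      fix p i assume "p \<in> {p. p permutes {0..<m}}" "i \<in> {0..<m}"
      then have "i < m" "p i < m" using permutes_in_image[of p "{0..<m}" i] by auto
      then show "mat m m (\<lambda>(a, b). N x a b) $$ (i, p i) = N x i (p i)" by simp
    qed
    finally show ?thesis .
  qed
  moreover have "(\<lambda>x. \<Sum>p\<in>{p. p permutes {0..<m}}. signof p * (\<Prod>i\<in>{0..<m}. N x i (p i))) \<in> poly_funs V"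
  proof (intro poly_funs_sum poly_funs.mult poly_funs.const poly_funs_prod)
    fix p i assume "p \<in> {p. p permutes {0..<m}}" "i \<in> {0..<m}"
    then have "i < m" "p i < m" using permutes_in_image[of p "{0..<m}" i] by auto
    then show "(\<lambda>x. N x i (p i)) \<in> poly_funs V" by (rule assms)
  qed
  ultimately show ?thesis by simp
qed

text \<open>The adjugate inverts a matrix up to its determinant \<open>\<delta>\<close> without
  leaving the polynomials. The scaling clause supplies the degrees: entries of degree
  \<open>E\<close> give a determinant of degree \<open>E * card K\<close> and an adjugate of degree
  \<open>E * (card K - 1)\<close>.\<close>

lemma adjugate_family:
  fixes M :: "'k \<Rightarrow> 'k \<Rightarrow> ('v \<Rightarrow> complex) \<Rightarrow> complex"
  assumes fin: "finite K" and M: "\<forall>k\<in>K. \<forall>l\<in>K. M k l \<in> poly_funs V"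
  shows "\<exists>\<delta> A. \<delta> \<in> poly_funs V \<and> (\<forall>k\<in>K. \<forall>l\<in>K. A k l \<in> poly_funs V) \<and>
    (\<forall>x. \<forall>k\<in>K. \<forall>l\<in>K. (\<Sum>j\<in>K. A k j x * M j l x) = (if k = l then \<delta> x else 0)) \<and>
    (\<forall>x. \<forall>k\<in>K. \<forall>l\<in>K. (\<Sum>j\<in>K. M k j x * A j l x) = (if k = l then \<delta> x else 0)) \<and>
    (\<forall>x. (\<forall>k\<in>K. \<forall>l\<in>K. M k l x = (if k = l then 1 else 0)) \<longrightarrow> \<delta> x = 1) \<and>
    (\<forall>x y c. (\<forall>k\<in>K. \<forall>l\<in>K. M k l y = c * M k l x) \<longrightarrow>
      \<delta> y = c ^ card K * \<delta> x \<and> (\<forall>k\<in>K. \<forall>l\<in>K. A k l y = c ^ (card K - 1) * A k l x))"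
proof -
  define m where "m = card K"
  obtain \<kappa> where \<kappa>: "bij_betw \<kappa> {0..<m} K" using ex_bij_betw_nat_finite[OF fin] unfolding m_def by blast
  define \<iota> where "\<iota> = the_inv_into {0..<m} \<kappa>"
  have \<iota>: "\<iota> k < m" "\<kappa> (\<iota> k) = k" if "k \<in> K" for k
    using that \<kappa> bij_betwE[OF bij_betw_the_inv_into[OF \<kappa>]] f_the_inv_into_f_bij_betw[OF \<kappa>]
    unfolding \<iota>_def by auto
  have \<kappa>K: "\<kappa> a \<in> K" if "a < m" for a using bij_betwE[OF \<kappa>] that by auto
  have \<iota>\<kappa>: "\<iota> (\<kappa> a) = a" if "a < m" for a
    using the_inv_into_f_f[OF bij_betw_imp_inj_on[OF \<kappa>], of a] that unfolding \<iota>_def by auto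
  have \<iota>_eq: "\<iota> k = \<iota> l \<longleftrightarrow> k = l" if "k \<in> K" "l \<in> K" for k l using \<iota>(2)[OF that(1)] \<iota>(2)[OF that(2)] by metis
  define N where "N x = mat m m (\<lambda>(a, b). M (\<kappa> a) (\<kappa> b) x)" for x
  have Nc: "N x \<in> carrier_mat m m" for x unfolding N_def by simp
  have N_ent: "N x $$ (a, b) = M (\<kappa> a) (\<kappa> b) x" if "a < m" "b < m" for a b x
    using that unfolding N_def by simp
  define \<delta> where "\<delta> x = Determinant.det (N x)" for x
  define A where "A k l x = adj_mat (N x) $$ (\<iota> k, \<iota> l)" for k l x
  have adj: "adj_mat (N x) \<in> carrier_mat m m" for x using adj_mat(1)[OF Nc] .
  have A_eq: "A k l x = (-1) ^ (\<iota> l + \<iota> k) * Determinant.det (mat (m - 1) (m - 1)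
      (\<lambda>(i, j). M (\<kappa> (if i < \<iota> l then i else Suc i)) (\<kappa> (if j < \<iota> k then j else Suc j)) x))"
    if k: "k \<in> K" "l \<in> K" for k l x
  proof -
    have "mat_delete (N x) (\<iota> l) (\<iota> k) = mat (m - 1) (m - 1)
      (\<lambda>(i, j). M (\<kappa> (if i < \<iota> l then i else Suc i)) (\<kappa> (if j < \<iota> k then j else Suc j)) x)"
      using \<iota>(1)[OF k(1)] \<iota>(1)[OF k(2)] unfolding mat_delete_def
      by (intro eq_matI) (auto simp: N_def)
    then show ?thesis unfolding A_def adj_mat_def cofactor_def using \<iota>(1)[OF k(1)] \<iota>(1)[OF k(2)] Nc[of x] by auto
  qed
  have "\<delta> \<in> poly_funs V"
    unfolding \<delta>_def[abs_def] N_def by (rule det_in_poly_funs) (intro M[rule_format] \<kappa>K)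
  moreover have "A k l \<in> poly_funs V" if k: "k \<in> K" "l \<in> K" for k l
  proof -
    have "(\<lambda>x. Determinant.det (mat (m - 1) (m - 1)
      (\<lambda>(i, j). M (\<kappa> (if i < \<iota> l then i else Suc i)) (\<kappa> (if j < \<iota> k then j else Suc j)) x))) \<in> poly_funs V"
      by (rule det_in_poly_funs) (intro M[rule_format] \<kappa>K, auto)
    then show ?thesis unfolding A_eq[OF k, abs_def] by (intro poly_funs.mult poly_funs.const)
  qed
  moreover have "(\<Sum>j\<in>K. A k j x * M j l x) = (if k = l then \<delta> x else 0)" if k: "k \<in> K" "l \<in> K" for k l x
  proof -
    have "(\<Sum>j\<in>K. A k j x * M j l x) = (\<Sum>a\<in>{0..<m}. A k (\<kappa> a) x * M (\<kappa> a) l x)"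
      by (rule sum.reindex_bij_betw[OF \<kappa>, symmetric])
    also have "\<dots> = (adj_mat (N x) * N x) $$ (\<iota> k, \<iota> l)"
      using adj[of x] Nc[of x] \<iota>[OF k(1)] \<iota>[OF k(2)]
      by (simp add: scalar_prod_def A_def \<iota>\<kappa> N_ent)
    also have "\<dots> = (if k = l then \<delta> x else 0)"
      unfolding adj_mat(3)[OF Nc] using \<iota>(1)[OF k(1)] \<iota>(1)[OF k(2)] \<iota>_eq[OF k] by (simp add: \<delta>_def)
    finally show ?thesis .
  qed
  moreover have "(\<Sum>j\<in>K. M k j x * A j l x) = (if k = l then \<delta> x else 0)" if k: "k \<in> K" "l \<in> K" for k l x
  proof -
    have "(\<Sum>j\<in>K. M k j x * A j l x) = (\<Sum>a\<in>{0..<m}. M k (\<kappa> a) x * A (\<kappa> a) l x)"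
      by (rule sum.reindex_bij_betw[OF \<kappa>, symmetric])
    also have "\<dots> = (N x * adj_mat (N x)) $$ (\<iota> k, \<iota> l)"
      using adj[of x] Nc[of x] \<iota>[OF k(1)] \<iota>[OF k(2)]
      by (simp add: scalar_prod_def A_def \<iota>\<kappa> N_ent)
    also have "\<dots> = (if k = l then \<delta> x else 0)"
      unfolding adj_mat(2)[OF Nc] using \<iota>(1)[OF k(1)] \<iota>(1)[OF k(2)] \<iota>_eq[OF k] by (simp add: \<delta>_def)
    finally show ?thesis .
  qed
  moreover have "\<delta> x = 1" if I: "\<forall>k\<in>K. \<forall>l\<in>K. M k l x = (if k = l then 1 else 0)" for x
  proof -
    have "N x = 1\<^sub>m m"
      by (rule eq_matI) (use I \<kappa>K \<iota>\<kappa> in \<open>auto simp: N_def, metis\<close>)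
    then show ?thesis by (simp add: \<delta>_def)
  qed
  moreover have "\<delta> y = c ^ card K * \<delta> x \<and> (\<forall>k\<in>K. \<forall>l\<in>K. A k l y = c ^ (card K - 1) * A k l x)"
    if s: "\<forall>k\<in>K. \<forall>l\<in>K. M k l y = c * M k l x" for x y c
  proof (intro conjI ballI)
    have "N y = c \<cdot>\<^sub>m N x" by (rule eq_matI) (use s \<kappa>K in \<open>auto simp: N_def\<close>)
    then show "\<delta> y = c ^ card K * \<delta> x" using Nc[of x] by (simp add: \<delta>_def m_def)
    fix k l assume k: "k \<in> K" "l \<in> K"
    let ?B = "\<lambda>x. mat (m - 1) (m - 1)
      (\<lambda>(i, j). M (\<kappa> (if i < \<iota> l then i else Suc i)) (\<kappa> (if j < \<iota> k then j else Suc j)) x)"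
    have "?B y = c \<cdot>\<^sub>m ?B x" by (rule eq_matI) (use s \<kappa>K in auto)
    then have "Determinant.det (?B y) = c ^ (m - 1) * Determinant.det (?B x)" by simp
    then show "A k l y = c ^ (card K - 1) * A k l x" unfolding A_eq[OF k] m_def by (simp add: mult_ac)
  qed
  ultimately show ?thesis by (intro exI[of _ \<delta>] exI[of _ A]) blast
qed

section \<open>Forms spanning the conormal space, and frames built from them\<close>

context likelihood_variety
begin

text \<open>Each component \<open>H d\<close> is raised to degree \<open>N\<close> by a power of
  \<open>x 0 / a 0\<close>, which is 1 at \<open>a\<close>. As \<open>H d\<close> vanishes at
  \<open>a\<close>, differentiating the power contributes nothing there and the gradient is
  unchanged. Every large \<open>N\<close> works, so several functions can be given a common
  degree.\<close>

lemma homogenize: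
  assumes f: "f \<in> poly_funs {..n}" "vanishes S f" and a: "a \<in> S" "a 0 \<noteq> 0"
  shows "\<exists>N0. \<forall>N\<ge>N0. \<exists>F\<in>hom_funs n N. vanishes S F \<and> (\<forall>i. pd i F a = pd i f a)"
proof -
  obtain D H where D: "finite D" and H: "\<forall>d. H d \<in> poly_eval ` forms n d \<and> vanishes S (H d)"
    and sum: "\<forall>x. f x = (\<Sum>d\<in>D. H d x)"
    using hom_parts[OF f] by (elim exE conjE)
  have Hh: "H d \<in> hom_funs n d" for d
  proof -
    obtain g where "H d = poly_eval g" "g \<in> forms n d" using spec[OF H, of d] by (elim imageE conjE)
    then show ?thesis using poly_eval_forms by simp
  qed
  have Hv: "vanishes S (H d)" for d using H by blast
  have Hp: "H d \<in> poly_funs {..n}" for d by (rule hom_poly[OF Hh])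
  show ?thesis
  proof (intro exI[of _ "Max (insert 0 D)"] allI impI)
    fix N assume N: "Max (insert 0 D) \<le> N"
    then have dN: "d \<le> N" if "d \<in> D" for d using that D by auto
    define g where "g d x = (inverse (a 0) * x 0) ^ (N - d)" for d and x :: cvector
    define F where "F x = (\<Sum>d\<in>D. g d x * H d x)" for x
    have gh: "g d \<in> hom_funs n (N - d)" for d
      unfolding g_def[abs_def] using hom_power[OF hom_mult[OF hom_const hom_var[of 0 n]], of "inverse (a 0)" "N - d"] by simp
    have gp: "g d \<in> poly_funs {..n}" for d by (rule hom_poly[OF gh])
    have "F \<in> hom_funs n N"
      unfolding F_def[abs_def]
    proof (rule hom_sum)
      fix d assume "d \<in> D"
      then show "(\<lambda>x. g d x * H d x) \<in> hom_funs n N" using hom_mult[OF gh Hh, of d d] dN by simp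
    qed
    moreover have "vanishes S F" using Hv unfolding vanishes_def F_def by simp
    moreover have "pd i F a = pd i f a" for i
    proof -
      have "pd i (\<lambda>x. g d x * H d x) a = pd i (H d) a" for d
        using a Hv[of d] unfolding pd_mult[OF gp Hp] by (simp add: g_def vanishes_def)
      moreover have "pd i F a = (\<Sum>d\<in>D. pd i (\<lambda>x. g d x * H d x) a)"
        unfolding F_def[abs_def] pd_eq_der by (subst der_sum[where V = "{..n}"]) (intro poly_funs.mult gp Hp, simp)
      moreover have "pd i f a = (\<Sum>d\<in>D. pd i (H d) a)"
      proof -
        have "f = (\<lambda>x. \<Sum>d\<in>D. H d x)" using sum by blast
        then show ?thesis unfolding pd_eq_der by (simp add: der_sum[where V = "{..n}", OF Hp])
      qed
      ultimately show ?thesis by simp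
    qed
    ultimately show "\<exists>F\<in>hom_funs n N. vanishes S F \<and> (\<forall>i. pd i F a = pd i f a)" by blast
  qed
qed

text \<open>An echelon basis of the conormal space at \<open>a\<close>, realized by forms of one
  degree. Smoothness fixes the number of pivots, as the annihilator must have dimension
  \<open>R\<close>. With degree \<open>Suc E\<close> the partial derivatives have degree
  \<open>E\<close>.\<close>

lemma conormal_frame:
  assumes a: "a \<in> B0"
  shows "\<exists>K f E. K \<subseteq> {..n} \<and> card K + R = Suc n \<and> (\<forall>k\<in>K. f k \<in> hom_funs n (Suc E) \<and> vanishes S (f k) \<and>
    (\<forall>l\<in>K. pd l (f k) a = (if l = k then 1 else 0)))"
proof -
  have aS: "a \<in> S" and dim: "cv.dim (tangent {..n} S a) = R" and "h a \<noteq> 0" using a unfolding B0_def by auto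
  then have a0: "a 0 \<noteq> 0" unfolding h_nonzero by auto
  obtain K e where K: "K \<subseteq> {..n}"
    and e: "\<forall>k\<in>K. e k \<in> gradients {..n} S a \<and> (\<forall>l\<in>K. e k l = (if l = k then 1 else 0))"
    and z: "\<forall>g\<in>gradients {..n} S a. (\<forall>k\<in>K. g k = 0) \<longrightarrow> (\<forall>v\<in>{..n}. g v = 0)"
    using echelon_basis[of "{..n}" "gradients {..n} S a", OF finite_atMost subspace_gradients] by (elim exE conjE)
  have "cv.dim (tangent {..n} S a) = card ({..n} - K)"
    unfolding tangent_eq_annihilator
    by (rule annihilator_dim[OF finite_atMost subspace_gradients K, of e]) (use e z in auto)
  moreover have "card ({..n} - K) = Suc n - card K" using K finite_subset[OF K] by (simp add: card_Diff_subset)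
  moreover have "card K \<le> Suc n" using card_mono[OF _ K] by simp
  ultimately have cardK: "card K + R = Suc n" using dim by simp
  have finK: "finite K" using finite_subset[OF K] by simp
  have "\<exists>N0. \<forall>k\<in>K. \<forall>N\<ge>N0 k. \<exists>F\<in>hom_funs n N. vanishes S F \<and> (\<forall>i. pd i F a = e k i)"
  proof (rule bchoice, rule ballI)
    fix k assume "k \<in> K"
    then obtain f where "f \<in> poly_funs {..n}" "vanishes S f" "e k = (\<lambda>i. pd i f a)"
      using e unfolding gradients_def by blast
    then show "\<exists>N0. \<forall>N\<ge>N0. \<exists>F\<in>hom_funs n N. vanishes S F \<and> (\<forall>i. pd i F a = e k i)"
      using homogenize[OF _ _ aS a0, of f] by simp
  qed
  then obtain N0 where N0: "\<forall>k\<in>K. \<forall>N\<ge>N0 k. \<exists>F\<in>hom_funs n N. vanishes S F \<and> (\<forall>i. pd i F a = e k i)" by blast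
  define E where "E = (\<Sum>k\<in>K. N0 k)"
  have "\<exists>f. \<forall>k\<in>K. f k \<in> hom_funs n (Suc E) \<and> vanishes S (f k) \<and> (\<forall>i. pd i (f k) a = e k i)"
  proof (rule bchoice, rule ballI)
    fix k assume k: "k \<in> K"
    then have "N0 k \<le> Suc E" unfolding E_def using member_le_sum[of k K N0] finK by auto
    then show "\<exists>F. F \<in> hom_funs n (Suc E) \<and> vanishes S F \<and> (\<forall>i. pd i F a = e k i)" using N0 k by blast
  qed
  then obtain f where f: "\<forall>k\<in>K. f k \<in> hom_funs n (Suc E) \<and> vanishes S (f k) \<and> (\<forall>i. pd i (f k) a = e k i)"
    by (elim exE)
  have "\<forall>k\<in>K. f k \<in> hom_funs n (Suc E) \<and> vanishes S (f k) \<and> (\<forall>l\<in>K. pd l (f k) a = (if l = k then 1 else 0))"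
    using f e by simp
  then show ?thesis using K cardK by (intro exI conjI)
qed

text \<open>Subtract the combination of gradients that agrees with \<open>\<omega>\<close> at the
  pivots \<open>K\<close>. The invertible Jacobian block makes the tangent space inject into the
  coordinates off \<open>K\<close>, and by smoothness its dimension is their number. It therefore
  contains vectors with a single 1 off \<open>K\<close>; pairing with them shows that the difference
  is zero there as well.\<close>

lemma conormal_span:
  assumes x: "x \<in> B0" and K: "K \<subseteq> {..n}" "card K + R = Suc n"
    and f: "\<And>k. k \<in> K \<Longrightarrow> f k \<in> poly_funs {..n}" "\<And>k. k \<in> K \<Longrightarrow> vanishes S (f k)"
    and A: "\<And>k l. k \<in> K \<Longrightarrow> l \<in> K \<Longrightarrow> (\<Sum>j\<in>K. pd k (f j) x * A j l) = (if k = l then \<delta> else 0)"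
    and \<delta>: "\<delta> \<noteq> 0"
    and \<omega>: "\<And>v. v \<in> tangent {..n} S x \<Longrightarrow> (\<Sum>i\<le>n. \<omega> i * v i) = 0"
  shows "\<exists>s. \<forall>i\<le>n. \<omega> i = (\<Sum>l\<in>K. s l * pd i (f l) x)"
proof -
  have xS: "x \<in> S" and dim: "cv.dim (tangent {..n} S x) = R" using x unfolding B0_def by auto
  have finK: "finite K" using finite_subset[OF K(1)] by simp
  \<comment> \<open>Cramer's rule: these coefficients solve the linear system given by the rows in
    \<open>K\<close>.\<close>
  define s where "s l = (\<Sum>j\<in>K. A l j * \<omega> j) / \<delta>" for l
  define \<omega>' where "\<omega>' i = \<omega> i - (\<Sum>l\<in>K. s l * pd i (f l) x)" for i
  have K0: "\<omega>' k = 0" if k: "k \<in> K" for k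
  proof -
    have "(\<Sum>l\<in>K. s l * pd k (f l) x) * \<delta> = (\<Sum>l\<in>K. \<Sum>j\<in>K. pd k (f l) x * A l j * \<omega> j)"
      unfolding sum_distrib_right
    proof (intro sum.cong refl)
      fix l
      have "s l * \<delta> = (\<Sum>j\<in>K. A l j * \<omega> j)" using \<delta> by (simp add: s_def)
      then have "s l * pd k (f l) x * \<delta> = pd k (f l) x * (\<Sum>j\<in>K. A l j * \<omega> j)" by (metis mult.commute mult.assoc)
      then show "s l * pd k (f l) x * \<delta> = (\<Sum>j\<in>K. pd k (f l) x * A l j * \<omega> j)"
        by (simp add: sum_distrib_left mult.assoc)
    qed
    also have "\<dots> = (\<Sum>j\<in>K. (\<Sum>l\<in>K. pd k (f l) x * A l j) * \<omega> j)"
      by (subst sum.swap) (simp add: sum_distrib_right)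
    also have "\<dots> = (\<Sum>j\<in>K. if j = k then \<delta> * \<omega> k else 0)"
      by (intro sum.cong refl) (use A[OF k] in auto)
    finally have "(\<Sum>l\<in>K. s l * pd k (f l) x) * \<delta> = \<omega> k * \<delta>" using finK k by simp
    then show ?thesis using \<delta> by (simp add: \<omega>'_def)
  qed
  have T0: "(\<Sum>i\<le>n. pd i (f l) x * v i) = 0" if "l \<in> K" "v \<in> tangent {..n} S x" for l v
    using that f unfolding tangent_def by blast
  have kill: "(\<Sum>i\<le>n. \<omega>' i * v i) = 0" if v: "v \<in> tangent {..n} S x" for v
  proof -
    have "(\<Sum>i\<le>n. \<omega>' i * v i) = (\<Sum>i\<le>n. \<omega> i * v i) - (\<Sum>i\<le>n. \<Sum>l\<in>K. s l * (pd i (f l) x * v i))"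
      unfolding \<omega>'_def left_diff_distrib sum_subtractf sum_distrib_right by (simp add: mult.assoc)
    also have "(\<Sum>i\<le>n. \<Sum>l\<in>K. s l * (pd i (f l) x * v i)) = (\<Sum>l\<in>K. s l * (\<Sum>i\<le>n. pd i (f l) x * v i))"
      by (subst sum.swap) (simp add: sum_distrib_left)
    finally show ?thesis using \<omega>[OF v] T0[OF _ v] by simp
  qed
  let ?J = "{..n} - K"
  have cardJ: "card ?J = R" using K finK by (simp add: card_Diff_subset)
  have inj: "v = 0" if v: "v \<in> tangent {..n} S x" "\<forall>j\<in>?J. v j = 0" for v
  proof
    fix i
    show "v i = 0 i"
    proof (cases "i \<in> K")
      case True
      have row: "(\<Sum>j\<in>K. v j * pd j (f l) x) = 0" if l: "l \<in> K" for l
      proof -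
        have "(\<Sum>j\<le>n. pd j (f l) x * v j) = (\<Sum>j\<in>K. pd j (f l) x * v j)"
          by (rule sum.mono_neutral_right) (use K(1) v(2) in auto)
        then show ?thesis using T0[OF l v(1)] by (simp add: mult.commute)
      qed
      have "v i * \<delta> = (\<Sum>j\<in>K. if j = i then v i * \<delta> else 0)" using finK True by simp
      also have "\<dots> = (\<Sum>j\<in>K. v j * (\<Sum>l\<in>K. pd j (f l) x * A l i))"
        by (intro sum.cong refl) (use A[OF _ True] in auto)
      also have "\<dots> = (\<Sum>l\<in>K. (\<Sum>j\<in>K. v j * pd j (f l) x) * A l i)"
        unfolding sum_distrib_left sum_distrib_right by (subst sum.swap) (simp add: mult.assoc)
      finally show ?thesis using row \<delta> by simp
    next
      case False
      then show ?thesis using v unfolding tangent_def by auto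
    qed
  qed
  have "\<omega>' i = 0" if i: "i \<in> ?J" for i
  proof -
    obtain v where v: "v \<in> tangent {..n} S x" "\<And>j. j \<in> ?J \<Longrightarrow> v j = (if j = i then 1 else 0)"
    proof (rule full_rank_coords[of "tangent {..n} S x" ?J i])
      fix v assume "v \<in> tangent {..n} S x" "\<And>j. j \<in> ?J \<Longrightarrow> v j = (if j = i then 1 else 0)"
      then show thesis by (rule that)
    next
      fix v assume "v \<in> tangent {..n} S x" "\<forall>j\<in>?J. v j = 0"
      then show "v = 0" by (rule inj)
    qed (use subspace_tangent dim cardJ i in auto)
    have "(\<Sum>j\<le>n. \<omega>' j * v j) = (\<Sum>j\<le>n. if j = i then \<omega>' i else 0)"
    proof (intro sum.cong refl)
      fix j assume "j \<in> {..n}"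
      then show "\<omega>' j * v j = (if j = i then \<omega>' i else 0)"
        using K0[of j] v(2)[of j] i by (cases "j \<in> K") auto
    qed
    then show ?thesis using kill[OF v(1)] i by simp
  qed
  then have "\<omega>' i = 0" if "i \<le> n" for i using K0 that by (cases "i \<in> K") auto
  then show ?thesis unfolding \<omega>'_def by (intro exI[of _ s]) auto
qed

text \<open>The codimension of \<open>X\<close>, equal to the projective dimension of the fibres.
  Frames therefore have \<open>m + 1\<close> members, with indices up to \<open>m\<close>
  inclusive.\<close>

definition m :: nat where "m = Suc n - R"

lemma m_R: "m + R = Suc n"
  using R_bounds unfolding m_def by simp

definition comb :: "(nat \<Rightarrow> nat \<Rightarrow> cvector \<Rightarrow> complex) \<Rightarrow> cvector \<Rightarrow> cvector \<Rightarrow> cvector" where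
  "comb W x t = (\<lambda>i. if i \<le> n then \<Sum>l\<le>m. t l * W l i x else 0)"

text \<open>\<open>W\<close> is a frame of the critical data and \<open>L\<close> its left inverse
  up to \<open>\<Delta>\<close>. The frame vectors are critical over all of \<open>B0\<close> but
  are required to span only where \<open>\<Delta>\<close> is nonzero. Uniform degrees let the frame
  and its inverse descend to projective points.\<close>

definition chart :: "nat \<Rightarrow> nat \<Rightarrow> (nat \<Rightarrow> nat \<Rightarrow> cvector \<Rightarrow> complex) \<Rightarrow> (nat \<Rightarrow> nat \<Rightarrow> cvector \<Rightarrow> complex) \<Rightarrow>
    (cvector \<Rightarrow> complex) \<Rightarrow> bool" where
  "chart e \<tau> W L \<Delta> \<longleftrightarrow> (\<forall>l\<le>m. \<forall>i\<le>n. W l i \<in> hom_funs n e \<and> L l i \<in> hom_funs n \<tau>) \<and> \<Delta> \<in> hom_funs n (e + \<tau>) \<and>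
     (\<forall>x\<in>S. \<forall>l\<le>m. \<forall>k\<le>m. (\<Sum>i\<le>n. L l i x * W k i x) = (if l = k then \<Delta> x else 0)) \<and>
     (\<forall>x\<in>B0. \<forall>t. crit x (comb W x t)) \<and>
     (\<forall>x\<in>B0. \<Delta> x \<noteq> 0 \<longrightarrow> (\<forall>u\<in>cvectors n. crit x u \<longrightarrow> (\<exists>t. u = comb W x t)))"

text \<open>
  With gradients of forms \<open>f\<^sub>k\<close> spanning the conormal space, the critical data at \<open>x\<close> are
  \<open>u\<^sub>i = x\<^sub>i (c x\<^sub>0\<^bsup>E\<^esup> + \<Sum>\<^sub>k s\<^sub>k \<partial>\<^sub>i f\<^sub>k)\<close>: by Euler's relation, \<open>u\<^sub>+ = c x\<^sub>0\<^bsup>E\<^esup> x\<^sub>+\<close>.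
\<close>

lemma chart_exists:
  assumes a: "a \<in> B0"
  shows "\<exists>e \<tau> W L \<Delta>. chart e \<tau> W L \<Delta> \<and> \<Delta> a \<noteq> 0"
proof -
  obtain K f E where K: "K \<subseteq> {..n}" "card K + R = Suc n"
    and f: "\<forall>k\<in>K. f k \<in> hom_funs n (Suc E) \<and> vanishes S (f k) \<and> (\<forall>l\<in>K. pd l (f k) a = (if l = k then 1 else 0))"
    using conormal_frame[OF a] by (elim exE conjE)
  have fh: "f k \<in> hom_funs n (Suc E)" and fv: "vanishes S (f k)" if "k \<in> K" for k using f that by auto
  have fp: "f k \<in> poly_funs {..n}" if "k \<in> K" for k using fh[OF that] hom_poly by blast
  have ph: "pd i (f k) \<in> hom_funs n E" if "k \<in> K" for i k by (rule hom_pd[OF fh[OF that]])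
  have finK: "finite K" using finite_subset[OF K(1)] by simp
  have cardK: "card K = m" using K(2) m_R by simp
  have Mp: "\<forall>k\<in>K. \<forall>l\<in>K. pd k (f l) \<in> poly_funs {..n}" using hom_poly[OF ph] by blast
  obtain \<delta> A where \<delta>p: "\<delta> \<in> poly_funs {..n}" and Ap: "\<forall>k\<in>K. \<forall>l\<in>K. A k l \<in> poly_funs {..n}"
    and AM: "\<forall>x. \<forall>k\<in>K. \<forall>l\<in>K. (\<Sum>j\<in>K. A k j x * pd j (f l) x) = (if k = l then \<delta> x else 0)"
    and MA: "\<forall>x. \<forall>k\<in>K. \<forall>l\<in>K. (\<Sum>j\<in>K. pd k (f j) x * A j l x) = (if k = l then \<delta> x else 0)"
    and \<delta>1: "\<forall>x. (\<forall>k\<in>K. \<forall>l\<in>K. pd k (f l) x = (if k = l then 1 else 0)) \<longrightarrow> \<delta> x = 1"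
    and sc: "\<forall>x y c. (\<forall>k\<in>K. \<forall>l\<in>K. pd k (f l) y = c * pd k (f l) x) \<longrightarrow>
      \<delta> y = c ^ card K * \<delta> x \<and> (\<forall>k\<in>K. \<forall>l\<in>K. A k l y = c ^ (card K - 1) * A k l x)"
    using adjugate_family[of K "\<lambda>k l. pd k (f l)" "{..n}", OF finK Mp] by (elim exE conjE)
  have sc': "\<delta> (\<lambda>i. c * x i) = c ^ (E * m) * \<delta> x"
    "k \<in> K \<Longrightarrow> l \<in> K \<Longrightarrow> A k l (\<lambda>i. c * x i) = c ^ (E * (m - 1)) * A k l x" if "c \<noteq> 0" for c x k l
  proof -
    have "\<forall>k\<in>K. \<forall>l\<in>K. pd k (f l) (\<lambda>i. c * x i) = c ^ E * pd k (f l) x"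
      using hom_scale[OF ph that] by blast
    then have "\<delta> (\<lambda>i. c * x i) = (c ^ E) ^ card K * \<delta> x \<and>
      (\<forall>k\<in>K. \<forall>l\<in>K. A k l (\<lambda>i. c * x i) = (c ^ E) ^ (card K - 1) * A k l x)" using sc by blast
    then show "\<delta> (\<lambda>i. c * x i) = c ^ (E * m) * \<delta> x"
      "k \<in> K \<Longrightarrow> l \<in> K \<Longrightarrow> A k l (\<lambda>i. c * x i) = c ^ (E * (m - 1)) * A k l x"
      by (simp_all add: cardK power_mult)
  qed
  have \<delta>h: "\<delta> \<in> hom_funs n (E * m)" unfolding hom_funs_def using \<delta>p sc'(1) by blast
  have Ah: "A k l \<in> hom_funs n (E * (m - 1))" if "k \<in> K" "l \<in> K" for k l
    unfolding hom_funs_def using Ap sc'(2)[OF _ that] that by blast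
  obtain \<kappa> where \<kappa>: "bij_betw \<kappa> {..<m} K"
    using ex_bij_betw_nat_finite[OF finK] unfolding cardK by (auto simp: atLeast0LessThan)
  have \<kappa>K: "\<kappa> l \<in> K" if "l < m" for l using bij_betwE[OF \<kappa>] that by auto
  have \<kappa>_eq: "\<kappa> l = \<kappa> k \<longleftrightarrow> l = k" if "l < m" "k < m" for l k
    using bij_betw_imp_inj_on[OF \<kappa>] that by (auto simp: inj_on_def)
  define P where "P x = (\<Prod>i\<le>n. x i)" for x :: cvector
  define Q where "Q j x = (\<Prod>i\<in>{..n} - {j}. x i)" for j and x :: cvector
  define s where "s x = (\<Sum>i\<le>n. x i)" for x :: cvector
  have QP: "Q j x * x j = P x" if "j \<le> n" for j x
    unfolding P_def Q_def using prod.remove[of "{..n}" j x] that by (simp add: mult.commute)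
  have Ph: "P \<in> hom_funs n (Suc n)"
    unfolding P_def[abs_def] using hom_prod[OF finite_atMost[of n], of "\<lambda>i x. x i" n] hom_var by auto
  have Qh: "Q j \<in> hom_funs n n" if "j \<le> n" for j
  proof -
    have "(\<lambda>x. \<Prod>i\<in>{..n} - {j}. x i) \<in> hom_funs n (card ({..n} - {j}))"
      by (rule hom_prod) (auto intro: hom_var[unfolded One_nat_def])
    moreover have "card ({..n} - {j}) = n" using that by simp
    ultimately show ?thesis unfolding Q_def[abs_def] by simp
  qed
  have sh: "s \<in> hom_funs n 1" unfolding s_def[abs_def] by (rule hom_sum) (rule hom_var, simp)
  have x0h: "(\<lambda>x. x 0 ^ E) \<in> hom_funs n E" using hom_power[OF hom_var[of 0 n], of E] by simp
  define W where "W l i = (case l of 0 \<Rightarrow> (\<lambda>x. x i * x 0 ^ E) | Suc k \<Rightarrow> (\<lambda>x. x i * pd i (f (\<kappa> k)) x))"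
    for l i :: nat
  \<comment> \<open>\<open>L 0\<close> adds up the entries of \<open>u\<close>, which by Euler's
    relation detects only the first frame vector. The other rows divide by \<open>x i\<close>
    through \<open>Q i\<close>, isolate one gradient by the adjugate, and subtract the multiple of
    the sum of entries that cancels the first frame vector. The factors \<open>P\<close>,
    \<open>s\<close> and \<open>x 0 ^ E\<close> give all rows one degree and one scalar
    \<open>\<Delta>\<close>.\<close>
  define L where "L l i = (case l of 0 \<Rightarrow> (\<lambda>x. \<delta> x * P x) | Suc k \<Rightarrow>
      (\<lambda>x. x 0 ^ E * ((if i \<in> K then A (\<kappa> k) i x * (s x * Q i x) else 0) - (\<Sum>j\<in>K. A (\<kappa> k) j x) * P x)))"
    for l i :: nat
  define \<Delta> where "\<Delta> x = \<delta> x * P x * (x 0 ^ E * s x)" for x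
  define \<tau> where "\<tau> = E * m + Suc n"
  have Wh: "W l i \<in> hom_funs n (Suc E)" if "l \<le> m" "i \<le> n" for l i
  proof (cases l)
    case 0
    then show ?thesis using hom_mult[OF hom_var[OF that(2)] x0h] by (simp add: W_def)
  next
    case (Suc k)
    then show ?thesis using hom_mult[OF hom_var[OF that(2)] ph[OF \<kappa>K]] that(1) by (simp add: W_def)
  qed
  have Lh: "L l i \<in> hom_funs n \<tau>" if "l \<le> m" "i \<le> n" for l i
  proof (cases l)
    case 0
    then show ?thesis using hom_mult[OF \<delta>h Ph] by (simp add: L_def \<tau>_def)
  next
    case (Suc k)
    then have k: "\<kappa> k \<in> K" "m \<ge> 1" using \<kappa>K that(1) by auto
    let ?d = "E * (m - 1) + Suc n"
    have "(\<lambda>x. if i \<in> K then A (\<kappa> k) i x * (s x * Q i x) else 0) \<in> hom_funs n ?d"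
    proof (cases "i \<in> K")
      case True
      then show ?thesis using hom_mult[OF Ah[OF k(1) True] hom_mult[OF sh Qh[OF that(2)]]] by simp
    next
      case False
      then show ?thesis unfolding hom_funs_def by (auto intro: poly_funs.const)
    qed
    moreover have "(\<lambda>x. (\<Sum>j\<in>K. A (\<kappa> k) j x) * P x) \<in> hom_funs n ?d"
      by (intro hom_mult hom_sum Ah k(1) Ph)
    ultimately have "L l i \<in> hom_funs n (E + ?d)"
      unfolding L_def Suc nat.case by (intro hom_mult[OF x0h] hom_diff)
    \<comment> \<open>Rows of this kind occur only for positive \<open>m\<close>, so the truncated
      \<open>m - 1\<close> is harmless.\<close>
    moreover have "E + ?d = \<tau>" unfolding \<tau>_def using k(2) by (cases m) auto
    ultimately show ?thesis by simp
  qed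
  have \<Delta>h: "\<Delta> \<in> hom_funs n (Suc E + \<tau>)"
  proof -
    have "\<Delta> \<in> hom_funs n ((E * m + Suc n) + (E + 1))"
      unfolding \<Delta>_def[abs_def] by (intro hom_mult \<delta>h Ph x0h sh)
    then show ?thesis by (simp add: \<tau>_def add_ac)
  qed
  have eul: "(\<Sum>i\<le>n. x i * pd i (f k) x) = 0" if "x \<in> S" "k \<in> K" for x k
    using euler[OF fp[OF that(2)] fv[OF that(2)] that(1)] by (simp add: mult.commute)
  have sumW0: "(\<Sum>i\<le>n. W 0 i x) = s x * x 0 ^ E" for x
    by (simp add: W_def s_def sum_distrib_right)
  have sumWS: "(\<Sum>i\<le>n. W (Suc k) i x) = 0" if "x \<in> S" "k < m" for x k
    using eul[OF that(1) \<kappa>K[OF that(2)]] by (simp add: W_def)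
  have QW: "(\<Sum>i\<le>n. (if i \<in> K then A (\<kappa> k) i x * (s x * Q i x) else 0) * (x i * g i)) =
      s x * P x * (\<Sum>i\<in>K. A (\<kappa> k) i x * g i)" for k x and g :: "nat \<Rightarrow> complex"
  proof -
    have "(\<Sum>i\<le>n. (if i \<in> K then A (\<kappa> k) i x * (s x * Q i x) else 0) * (x i * g i)) =
      (\<Sum>i\<in>K. A (\<kappa> k) i x * (s x * Q i x) * (x i * g i))"
      by (rule sum.mono_neutral_cong_right) (use K(1) in auto)
    also have "\<dots> = (\<Sum>i\<in>K. s x * P x * (A (\<kappa> k) i x * g i))"
    proof (intro sum.cong refl)
      fix i assume "i \<in> K"
      then have "Q i x * x i = P x" using K(1) by (intro QP) auto
      then show "A (\<kappa> k) i x * (s x * Q i x) * (x i * g i) = s x * P x * (A (\<kappa> k) i x * g i)"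
        by (metis (no_types, lifting) mult.assoc mult.commute)
    qed
    finally show ?thesis by (simp add: sum_distrib_left)
  qed
  have LW: "(\<Sum>i\<le>n. L l i x * W k i x) = (if l = k then \<Delta> x else 0)" if x: "x \<in> S" and l: "l \<le> m" and k: "k \<le> m" for x l k
  proof (cases l)
    case 0
    have "(\<Sum>i\<le>n. L l i x * W k i x) = \<delta> x * P x * (\<Sum>i\<le>n. W k i x)"
      by (simp add: 0 L_def sum_distrib_left)
    then show ?thesis using sumW0[of x] sumWS[OF x] k
      by (cases k) (auto simp: 0 \<Delta>_def mult_ac)
  next
    case (Suc l')
    define c where "c i = (if i \<in> K then A (\<kappa> l') i x * (s x * Q i x) else 0)" for i
    define b where "b = (\<Sum>j\<in>K. A (\<kappa> l') j x)"
    have "(\<Sum>i\<le>n. L l i x * W k i x) = (\<Sum>i\<le>n. x 0 ^ E * (c i * W k i x) - x 0 ^ E * b * P x * W k i x)"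
      by (intro sum.cong refl) (simp add: Suc L_def c_def b_def algebra_simps)
    also have "\<dots> = x 0 ^ E * (\<Sum>i\<le>n. c i * W k i x) - x 0 ^ E * b * P x * (\<Sum>i\<le>n. W k i x)"
      unfolding sum_subtractf sum_distrib_left ..
    finally have eq: "(\<Sum>i\<le>n. L l i x * W k i x) =
        x 0 ^ E * (\<Sum>i\<le>n. c i * W k i x) - x 0 ^ E * b * P x * (\<Sum>i\<le>n. W k i x)" .
    show ?thesis
    proof (cases k)
      case 0
      have "(\<Sum>i\<le>n. c i * W k i x) = s x * P x * (b * x 0 ^ E)"
        using QW[of l' x "\<lambda>i. x 0 ^ E"] by (simp add: 0 W_def c_def b_def sum_distrib_right)
      then show ?thesis unfolding eq using sumW0[of x] by (simp add: 0 Suc mult_ac)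
    next
      case k': (Suc k')
      have lt: "l' < m" "k' < m" using l k Suc k' by auto
      have "(\<Sum>i\<le>n. c i * W k i x) = s x * P x * (\<Sum>i\<in>K. A (\<kappa> l') i x * pd i (f (\<kappa> k')) x)"
        using QW[of l' x "\<lambda>i. pd i (f (\<kappa> k')) x"] by (simp add: k' W_def c_def)
      also have "(\<Sum>i\<in>K. A (\<kappa> l') i x * pd i (f (\<kappa> k')) x) = (if l' = k' then \<delta> x else 0)"
        using AM \<kappa>K[OF lt(1)] \<kappa>K[OF lt(2)] \<kappa>_eq[OF lt] by simp
      finally show ?thesis unfolding eq using sumWS[OF x lt(2)] by (simp add: k' Suc \<Delta>_def mult_ac)
    qed
  qed
  have combW: "comb W x t i = x i * (t 0 * x 0 ^ E + (\<Sum>l<m. t (Suc l) * pd i (f (\<kappa> l)) x))" if "i \<le> n" for x t i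
    using that unfolding comb_def by (simp add: sum.atMost_shift W_def sum_distrib_left algebra_simps)
  have crit1: "crit x (comb W x t)" if x: "x \<in> B0" for x t
    unfolding crit_def
  proof
    fix v assume v: "v \<in> tangent {..n} S x"
    have xS: "x \<in> S" and "h x \<noteq> 0" using x unfolding B0_def by auto
    then have x0: "\<And>i. i \<le> n \<Longrightarrow> x i \<noteq> 0" and s0: "s x \<noteq> 0" unfolding h_nonzero s_def by auto
    have "(\<Sum>i\<le>n. comb W x t i) = (\<Sum>l\<le>m. t l * (\<Sum>i\<le>n. W l i x))"
      unfolding comb_def by (simp add: sum.swap[of _ "{..n}"] sum_distrib_left)
    also have "\<dots> = t 0 * x 0 ^ E * s x"
      using sumW0[of x] sumWS[OF xS] by (simp add: sum.atMost_shift)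
    finally have us: "(\<Sum>i\<le>n. comb W x t i) / (\<Sum>j\<le>n. x j) = t 0 * x 0 ^ E"
      using s0 unfolding s_def[symmetric] by simp
    have "(\<Sum>i\<le>n. (comb W x t i / x i - (\<Sum>j\<le>n. comb W x t j) / (\<Sum>j\<le>n. x j)) * v i) =
      (\<Sum>i\<le>n. (\<Sum>l<m. t (Suc l) * pd i (f (\<kappa> l)) x) * v i)"
      unfolding us using combW x0 by (intro sum.cong refl) simp
    also have "\<dots> = (\<Sum>l<m. t (Suc l) * (\<Sum>i\<le>n. pd i (f (\<kappa> l)) x * v i))"
      by (simp add: sum_distrib_right sum_distrib_left mult.assoc sum.swap[of _ "{..n}"])
    also have "\<dots> = 0"
    proof (rule sum.neutral, rule ballI)
      fix l assume "l \<in> {..<m}"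
      then have k: "\<kappa> l \<in> K" using \<kappa>K by simp
      have "(\<Sum>i\<le>n. pd i (f (\<kappa> l)) x * v i) = 0" using v fp[OF k] fv[OF k] unfolding tangent_def by blast
      then show "t (Suc l) * (\<Sum>i\<le>n. pd i (f (\<kappa> l)) x * v i) = 0" by simp
    qed
    finally show "(\<Sum>i\<le>n. (comb W x t i / x i - (\<Sum>j\<le>n. comb W x t j) / (\<Sum>j\<le>n. x j)) * v i) = 0" .
  qed
  have crit2: "\<exists>t. u = comb W x t" if x: "x \<in> B0" "\<Delta> x \<noteq> 0" and u: "u \<in> cvectors n" "crit x u" for x u
  proof -
    have "h x \<noteq> 0" using x unfolding B0_def by auto
    then have x0: "\<And>i. i \<le> n \<Longrightarrow> x i \<noteq> 0" and s0: "s x \<noteq> 0" unfolding h_nonzero s_def by auto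
    have \<delta>0: "\<delta> x \<noteq> 0" using x(2) unfolding \<Delta>_def by auto
    define \<omega> where "\<omega> i = u i / x i - (\<Sum>j\<le>n. u j) / s x" for i
    have "\<exists>c. \<forall>i\<le>n. \<omega> i = (\<Sum>l\<in>K. c l * pd i (f l) x)"
      by (rule conormal_span[OF x(1) K fp fv _ \<delta>0, where A = "\<lambda>j l. A j l x"])
         (use MA u(2) in \<open>auto simp: crit_def \<omega>_def s_def\<close>)
    then obtain c where c: "\<And>i. i \<le> n \<Longrightarrow> \<omega> i = (\<Sum>l\<in>K. c l * pd i (f l) x)" by blast
    \<comment> \<open>The first coordinate is forced by the sum of the entries of \<open>u\<close>;
      the others express the critical covector through gradients.\<close>
    define t where "t l = (case l of 0 \<Rightarrow> (\<Sum>j\<le>n. u j) / s x / x 0 ^ E | Suc k \<Rightarrow> c (\<kappa> k))" for l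
    have "u i = comb W x t i" for i
    proof (cases "i \<le> n")
      case True
      have "(\<Sum>l<m. t (Suc l) * pd i (f (\<kappa> l)) x) = \<omega> i"
        unfolding c[OF True] t_def nat.case by (rule sum.reindex_bij_betw[OF \<kappa>])
      then have "comb W x t i = x i * ((\<Sum>j\<le>n. u j) / s x + \<omega> i)"
        unfolding combW[OF True] using x0[of 0] by (simp add: t_def)
      then show ?thesis using x0[OF True] by (simp add: \<omega>_def)
    next
      case False
      then show ?thesis using u(1) unfolding cvectors_def comb_def by auto
    qed
    then show ?thesis by (intro exI[of _ t]) blast
  qed
  have "chart (Suc E) \<tau> W L \<Delta>"
    unfolding chart_def using Wh Lh \<Delta>h LW crit1 crit2 by blast
  moreover have "\<Delta> a \<noteq> 0"
  proof -
    have "h a \<noteq> 0" using a unfolding B0_def by auto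
    then have "P a \<noteq> 0" "s a \<noteq> 0" "a 0 \<noteq> 0" unfolding h_nonzero P_def s_def by auto
    moreover have "\<delta> a = 1" using \<delta>1 f by auto
    ultimately show ?thesis by (simp add: \<Delta>_def)
  qed
  ultimately show ?thesis by blast
qed

end

section \<open>Dimension of the correspondence\<close>

lemma vanishesD: "vanishes S f \<Longrightarrow> x \<in> S \<Longrightarrow> f x = 0"
  unfolding vanishes_def by blast

lemma not_vanishesI: "x \<in> S \<Longrightarrow> f x \<noteq> 0 \<Longrightarrow> \<not> vanishes S f"
  unfolding vanishes_def by blast

lemma sum_bi_vars: "(\<Sum>w\<in>bi_vars n k. f w) = (\<Sum>i\<le>n. f (Inl i)) + (\<Sum>j\<le>k. f (Inr j))"
  unfolding bi_vars_def by (subst sum.union_disjoint) (auto simp: sum.reindex)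

lemma finite_bi_vars: "finite (bi_vars n k)"
  unfolding bi_vars_def by simp

lemma directional_derivative:
  fixes z d :: "'v \<Rightarrow> complex"
  assumes F: "F \<in> poly_funs V" "finite V"
  shows "(\<Sum>v\<in>V. pd v F z * d v) = pd (0::nat) (\<lambda>\<tau>. F (\<lambda>v. z v + \<tau> 0 * d v)) (\<lambda>_. 0)"
proof -
  let ?g = "\<lambda>v (\<tau> :: cvector). z v + \<tau> 0 * d v"
  have tp: "(\<lambda>\<tau>. \<tau> 0) \<in> poly_funs {0::nat}" by (intro poly_funs.var) simp
  have p1: "(\<lambda>\<tau>. \<tau> 0 * d v) \<in> poly_funs {0::nat}" for v by (intro poly_funs.mult poly_funs.const tp)
  have gp: "?g v \<in> poly_funs {0}" for v by (intro poly_funs.add poly_funs.const p1)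
  have "pd 0 (?g v) (\<lambda>_. 0) = d v" for v
    unfolding pd_add[OF poly_funs.const p1] pd_mult[OF tp poly_funs.const] by (simp add: pd_var)
  moreover have "pd 0 (\<lambda>\<tau>. F (\<lambda>v. ?g v \<tau>)) (\<lambda>_. 0) = (\<Sum>v\<in>V. pd v F (\<lambda>v. ?g v (\<lambda>_. 0)) * pd 0 (?g v) (\<lambda>_. 0))"
    by (rule fun_cong[OF pd_comp[of F V ?g "{0}" 0, OF F gp], of "\<lambda>_. 0"])
  ultimately show ?thesis by simp
qed

lemma pd_affine: "pd (0::nat) (\<lambda>\<tau>. A + \<tau> 0 * B) (\<lambda>_. 0) = B"
proof -
  have tp: "(\<lambda>\<tau>. \<tau> 0) \<in> poly_funs {0::nat}" by (intro poly_funs.var) simp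
  have p1: "(\<lambda>\<tau>. \<tau> 0 * B) \<in> poly_funs {0::nat}" by (intro poly_funs.mult poly_funs.const tp)
  show ?thesis
    unfolding pd_add[OF poly_funs.const p1] pd_mult[OF tp poly_funs.const] by (simp add: pd_var)
qed

text \<open>Because \<open>A\<close> consists of whole orbits, the graded parts of a function
  vanishing on \<open>A\<close> vanish there too. They define a closed set, so the function also
  vanishes on the cone over the closure.\<close>

lemma (in graded_space) vanishes_cone_closure:
  assumes A: "A \<subseteq> C" and sat: "\<And>x y. x \<in> A \<Longrightarrow> y \<in> C \<Longrightarrow> pt y = pt x \<Longrightarrow> y \<in> A"
    and f: "f \<in> poly_funs V"
  shows "vanishes (cone (zclosure T (pt ` A))) f \<longleftrightarrow> vanishes A f"
proof
  have sub: "pt ` A \<subseteq> zclosure T (pt ` A)"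
    by (rule closure_of_subset) (use A topspace_T in auto)
  assume "vanishes (cone (zclosure T (pt ` A))) f"
  then show "vanishes A f" using sub A unfolding vanishes_def cone_def by blast
next
  assume v: "vanishes A f"
  obtain P where P: "P \<subseteq> H" "\<forall>x\<in>C. (\<forall>y\<in>C. pt y = pt x \<longrightarrow> f y = 0) \<longleftrightarrow> (\<forall>p\<in>P. p x = 0)"
    using parts[OF f] by blast
  let ?B = "pt ` {x\<in>C. \<forall>p\<in>P. p x = 0}"
  have "x \<in> {x\<in>C. \<forall>p\<in>P. p x = 0}" if x: "x \<in> A" for x
  proof -
    have "\<forall>y\<in>C. pt y = pt x \<longrightarrow> f y = 0" using v sat[OF x] unfolding vanishes_def by blast
    then show ?thesis using P(2) x A by blast
  qed
  then have "pt ` A \<subseteq> ?B" by blast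
  then have cl: "zclosure T (pt ` A) \<subseteq> ?B" using closed_zeros[OF P(1)] by (rule closure_of_minimal)
  show "vanishes (cone (zclosure T (pt ` A))) f"
    unfolding vanishes_def
  proof
    fix z assume z: "z \<in> cone (zclosure T (pt ` A))"
    then have zC: "z \<in> C" and "pt z \<in> ?B" using cl unfolding cone_def by auto
    then obtain x where x: "x \<in> C" "\<forall>p\<in>P. p x = 0" "pt z = pt x" by blast
    then show "f z = 0" using P(2) zC by blast
  qed
qed

section \<open>The cone over the correspondence: irreducibility and equations\<close>

context likelihood_variety
begin

abbreviation "V2 \<equiv> bi_vars n n"

definition Ehat :: "(nat + nat \<Rightarrow> complex) set" where
  "Ehat = {z. z \<circ> Inl \<in> B0 \<and> z \<circ> Inr \<in> cvectors n \<and> crit (z \<circ> Inl) (z \<circ> Inr)}"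

definition Epts :: "(nat + nat \<Rightarrow> complex) set" where
  "Epts = {z\<in>Ehat. z \<circ> Inr \<noteq> 0}"

lemma B0_S: "x \<in> B0 \<Longrightarrow> x \<in> S"
  unfolding B0_def by blast

lemma crit_affine:
  assumes "crit x u" "crit x w"
  shows "crit x (\<lambda>i. u i + c * w i)"
  unfolding crit_def
proof
  fix v assume v: "v \<in> tangent {..n} S x"
  let ?s = "\<Sum>j\<le>n. x j"
  have "(\<Sum>i\<le>n. ((u i + c * w i) / x i - (\<Sum>j\<le>n. u j + c * w j) / ?s) * v i) =
     (\<Sum>i\<le>n. (u i / x i - (\<Sum>j\<le>n. u j) / ?s) * v i + c * ((w i / x i - (\<Sum>j\<le>n. w j) / ?s) * v i))"
    by (intro sum.cong refl) (simp add: sum.distrib sum_distrib_left[symmetric] add_divide_distrib algebra_simps)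
  also have "\<dots> = (\<Sum>i\<le>n. (u i / x i - (\<Sum>j\<le>n. u j) / ?s) * v i) + c * (\<Sum>i\<le>n. (w i / x i - (\<Sum>j\<le>n. w j) / ?s) * v i)"
    by (simp add: sum.distrib sum_distrib_left)
  finally show "(\<Sum>i\<le>n. ((u i + c * w i) / x i - (\<Sum>j\<le>n. u j + c * w j) / ?s) * v i) = 0"
    using assms v unfolding crit_def by simp
qed

lemma chartD:
  assumes "chart e \<tau> W L \<Delta>"
  shows "l \<le> m \<Longrightarrow> i \<le> n \<Longrightarrow> W l i \<in> hom_funs n e" "l \<le> m \<Longrightarrow> i \<le> n \<Longrightarrow> L l i \<in> hom_funs n \<tau>"
    "\<Delta> \<in> hom_funs n (e + \<tau>)"
    "x \<in> S \<Longrightarrow> l \<le> m \<Longrightarrow> k \<le> m \<Longrightarrow> (\<Sum>i\<le>n. L l i x * W k i x) = (if l = k then \<Delta> x else 0)"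
    "x \<in> B0 \<Longrightarrow> crit x (comb W x t)"
    "x \<in> B0 \<Longrightarrow> \<Delta> x \<noteq> 0 \<Longrightarrow> u \<in> cvectors n \<Longrightarrow> crit x u \<Longrightarrow> \<exists>t. u = comb W x t"
  using assms unfolding chart_def by blast+

lemma comb_cvectors: "comb W x t \<in> cvectors n"
  unfolding comb_def cvectors_def by simp

lemma L_comb:
  assumes c: "chart e \<tau> W L \<Delta>" and x: "x \<in> S" and l: "l \<le> m"
  shows "(\<Sum>i\<le>n. L l i x * comb W x t i) = \<Delta> x * t l"
proof -
  have "(\<Sum>i\<le>n. L l i x * comb W x t i) = (\<Sum>k\<le>m. t k * (\<Sum>i\<le>n. L l i x * W k i x))"
    unfolding comb_def by (simp add: sum_distrib_left sum.swap[of _ "{..n}"] mult_ac)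
  also have "\<dots> = (\<Sum>k\<le>m. if k = l then t l * \<Delta> x else 0)"
    by (intro sum.cong refl) (use chartD(4)[OF c x l] in auto)
  finally show ?thesis using l by simp
qed

lemma comb_poly:
  assumes c: "chart e \<tau> W L \<Delta>"
  shows "(\<lambda>x. comb W x t i) \<in> poly_funs {..n}"
proof (cases "i \<le> n")
  case True
  then show ?thesis unfolding comb_def
    by (simp, intro poly_funs_sum poly_funs.mult poly_funs.const hom_poly[OF chartD(1)[OF c]]) auto
qed (simp add: comb_def poly_funs.const)

lemma Ehat_pair: "case_sum x u \<in> Ehat \<longleftrightarrow> x \<in> B0 \<and> u \<in> cvectors n \<and> crit x u"
  unfolding Ehat_def by simp

lemma poly_case_comb:
  assumes c: "chart e \<tau> W L \<Delta>" and f: "f \<in> poly_funs V2"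
  shows "(\<lambda>x. f (case_sum x (comb W x t))) \<in> poly_funs {..n}"
proof -
  let ?g = "\<lambda>w x. case_sum x (comb W x t) w"
  have "?g w \<in> poly_funs {..n}" if "w \<in> V2" for w
    using that comb_poly[OF c] by (cases w) (auto simp: bi_vars_def intro: poly_funs.var)
  from poly_funs_comp[OF f, of ?g, OF this] show ?thesis by simp
qed

lemma generic_point:
  obtains x where "x \<in> B0"
proof (rule generic)
  fix \<gamma> assume "\<not> vanishes S \<gamma>" "\<And>x. x \<in> S \<Longrightarrow> \<gamma> x \<noteq> 0 \<Longrightarrow> x \<in> B0"
  then show thesis using that unfolding vanishes_def by blast
qed

lemma crit_zero: "crit x 0"
  unfolding crit_def by simp

text \<open>A function that does not vanish on \<open>Ehat\<close> stays nonzero along a section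
  \<open>comb W x t\<close> over general \<open>x\<close>. Two such functions are thus nonzero at
  data \<open>u\<close> and \<open>w\<close> over one common \<open>x\<close>. The line through
  \<open>u\<close> and \<open>w\<close> lies in the fibre, and on it the product of two nonzero
  polynomials in one variable is not zero.\<close>

lemma irred_Ehat: "irred V2 Ehat"
  unfolding irred_def
proof (intro conjI ballI impI)
  obtain a where a: "a \<in> B0" by (rule generic_point)
  have "case_sum a 0 \<in> Ehat" unfolding Ehat_pair using a crit_zero by (simp add: cvectors_def)
  then show "Ehat \<noteq> {}" by blast
  fix f g assume f: "f \<in> poly_funs V2" and g: "g \<in> poly_funs V2" and fg: "vanishes Ehat (\<lambda>z. f z * g z)"
  have lift: "\<exists>F\<in>poly_funs {..n}. \<not> vanishes S F \<and>
      (\<forall>x\<in>B0. F x \<noteq> 0 \<longrightarrow> (\<exists>u\<in>cvectors n. crit x u \<and> f (case_sum x u) \<noteq> 0))"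
    if f: "f \<in> poly_funs V2" "\<not> vanishes Ehat f" for f
  proof -
    obtain z where z: "z \<in> Ehat" "f z \<noteq> 0" using f(2) unfolding vanishes_def by blast
    let ?x = "z \<circ> Inl"
    have x: "?x \<in> B0" and u: "z \<circ> Inr \<in> cvectors n" "crit ?x (z \<circ> Inr)" using z(1) unfolding Ehat_def by auto
    obtain e \<tau> W L \<Delta> where c: "chart e \<tau> W L \<Delta>" and \<Delta>: "\<Delta> ?x \<noteq> 0"
      using chart_exists[OF x] by (elim exE conjE)
    obtain t where t: "z \<circ> Inr = comb W ?x t" using chartD(6)[OF c x \<Delta> u] by (elim exE)
    let ?F = "\<lambda>x. f (case_sum x (comb W x t))"
    have "?F ?x = f z" unfolding t[symmetric] case_sum_comp ..
    then have "\<not> vanishes S ?F" by (intro not_vanishesI[OF B0_S[OF x]]) (simp only: z(2) not_False_eq_True)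
    moreover have "\<exists>u\<in>cvectors n. crit y u \<and> f (case_sum y u) \<noteq> 0" if "y \<in> B0" "?F y \<noteq> 0" for y
      using that chartD(5)[OF c that(1)] comb_cvectors by blast
    ultimately show ?thesis using poly_case_comb[OF c f(1)] by (intro bexI[of _ ?F]) auto
  qed
  show "vanishes Ehat f \<or> vanishes Ehat g"
  proof (rule ccontr)
    assume n: "\<not> (vanishes Ehat f \<or> vanishes Ehat g)"
    obtain F where F: "F \<in> poly_funs {..n}" "\<not> vanishes S F"
      "\<forall>x\<in>B0. F x \<noteq> 0 \<longrightarrow> (\<exists>u\<in>cvectors n. crit x u \<and> f (case_sum x u) \<noteq> 0)" using lift[OF f] n by blast
    obtain G where G: "G \<in> poly_funs {..n}" "\<not> vanishes S G"
      "\<forall>x\<in>B0. G x \<noteq> 0 \<longrightarrow> (\<exists>u\<in>cvectors n. crit x u \<and> g (case_sum x u) \<noteq> 0)" using lift[OF g] n by blast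
    have "\<exists>x\<in>B0. F x \<noteq> 0 \<and> G x \<noteq> 0"
    proof (rule generic)
      fix \<gamma> assume \<gamma>: "\<gamma> \<in> poly_funs {..n}" "\<not> vanishes S \<gamma>" "\<And>x. x \<in> S \<Longrightarrow> \<gamma> x \<noteq> 0 \<Longrightarrow> x \<in> B0"
      have "\<not> vanishes S (\<lambda>x. \<gamma> x * (F x * G x))"
        by (intro irred_mult[OF irred_S] \<gamma> F G poly_funs.mult)
      then obtain x where "x \<in> S" "\<gamma> x \<noteq> 0" "F x \<noteq> 0" "G x \<noteq> 0" unfolding vanishes_def by auto
      then show ?thesis using \<gamma>(3) by blast
    qed
    then obtain x u w where x: "x \<in> B0" and u: "u \<in> cvectors n" "crit x u" "f (case_sum x u) \<noteq> 0"
      and w: "w \<in> cvectors n" "crit x w" "g (case_sum x w) \<noteq> 0" using F(3) G(3) by blast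
    \<comment> \<open>The line passes through \<open>u\<close> at parameter 0 and through
      \<open>w\<close> at parameter 1.\<close>
    let ?l = "\<lambda>\<tau> :: cvector. case_sum x (\<lambda>i. u i + \<tau> 0 * (w i + (-1) * u i))"
    have lp: "(\<lambda>\<tau>. ?l \<tau> v) \<in> poly_funs {0}" for v
      by (cases v) (auto intro!: poly_funs_intros)
    have pp: "(\<lambda>\<tau>. f (?l \<tau>)) \<in> poly_funs {0}" "(\<lambda>\<tau>. g (?l \<tau>)) \<in> poly_funs {0}"
      by (rule poly_funs_comp[OF f, of "\<lambda>v \<tau>. ?l \<tau> v", OF lp], rule poly_funs_comp[OF g, of "\<lambda>v \<tau>. ?l \<tau> v", OF lp])
    have "?l \<tau> \<in> Ehat" for \<tau>
    proof -
      have "crit x (\<lambda>i. u i + \<tau> 0 * (w i + (-1) * u i))" by (intro crit_affine u w)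
      then show ?thesis unfolding Ehat_pair using x u(1) w(1) by (auto simp: cvectors_def)
    qed
    then have "f (?l \<tau>) * g (?l \<tau>) = 0" for \<tau> using fg unfolding vanishes_def by blast
    then have z: "(\<lambda>\<tau>. f (?l \<tau>)) = (\<lambda>\<tau>. 0) \<or> (\<lambda>\<tau>. g (?l \<tau>)) = (\<lambda>\<tau>. 0)"
      by (rule poly_funs_nonzero_mult[OF _ pp, rotated]) simp
    have l: "?l (\<lambda>_. 0) = case_sum x u" "?l (\<lambda>_. 1) = case_sum x w" by (auto simp: fun_eq_iff split: sum.split)
    from z show False
    proof
      assume "(\<lambda>\<tau>. f (?l \<tau>)) = (\<lambda>\<tau>. 0)"
      then have "f (?l (\<lambda>_. 0)) = 0" by (rule fun_cong)
      then show False unfolding l using u(3) by blast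
    next
      assume "(\<lambda>\<tau>. g (?l \<tau>)) = (\<lambda>\<tau>. 0)"
      then have "g (?l (\<lambda>_. 1)) = 0" by (rule fun_cong)
      then show False unfolding l using w(3) by blast
    qed
  qed
qed

lemma poly_Inl:
  assumes "f \<in> poly_funs {..n}"
  shows "(\<lambda>z. f (z \<circ> Inl)) \<in> poly_funs V2"
  using poly_funs_comp[OF assms, of "\<lambda>i z. z (Inl i)" V2] by (auto simp: comp_def bi_vars_def intro: poly_funs.var)

lemma Inl_not_vanishes:
  assumes "x \<in> B0" "f x \<noteq> 0"
  shows "\<not> vanishes Ehat (\<lambda>z. f (z \<circ> Inl))"
proof -
  have "case_sum x 0 \<in> Ehat" unfolding Ehat_pair using assms(1) crit_zero by (simp add: cvectors_def)
  then show ?thesis by (rule not_vanishesI) (simp add: assms(2))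
qed

lemma some_Inr_not_vanishes: "\<exists>j\<le>n. \<not> vanishes Ehat (\<lambda>z. z (Inr j))"
proof -
  obtain a where a: "a \<in> B0" by (rule generic_point)
  obtain e \<tau> W L \<Delta> where c: "chart e \<tau> W L \<Delta>" and \<Delta>: "\<Delta> a \<noteq> 0" using chart_exists[OF a] by (elim exE conjE)
  let ?u = "comb W a (\<lambda>_. 1)"
  have "(\<Sum>i\<le>n. L 0 i a * ?u i) \<noteq> 0" using L_comb[OF c B0_S[OF a], of 0] \<Delta> by simp
  then obtain j where j: "j \<le> n" "?u j \<noteq> 0" by (metis (no_types, lifting) atMost_iff mult_eq_0_iff sum.neutral)
  have "case_sum a ?u \<in> Ehat" unfolding Ehat_pair using a chartD(5)[OF c a] comb_cvectors by blast
  then have "\<not> vanishes Ehat (\<lambda>z. z (Inr j))" by (rule not_vanishesI) (simp add: j(2))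
  then show ?thesis using j(1) by blast
qed

text \<open>Some coordinate of \<open>u\<close> does not vanish on \<open>Ehat\<close>. Multiplying
  by it disposes of the zero data, and irreducibility removes the factor again.\<close>

lemma Epts_vanishes:
  assumes f: "f \<in> poly_funs V2"
  shows "vanishes Epts f \<longleftrightarrow> vanishes Ehat f"
proof
  assume v: "vanishes Epts f"
  obtain j where j: "j \<le> n" "\<not> vanishes Ehat (\<lambda>z. z (Inr j))" using some_Inr_not_vanishes by blast
  have "(\<lambda>z. z (Inr j)) \<in> poly_funs V2" using j(1) by (intro poly_funs.var) (simp add: bi_vars_def)
  moreover have "vanishes Ehat (\<lambda>z. z (Inr j) * f z)"
    unfolding vanishes_def
  proof
    fix z assume z: "z \<in> Ehat"
    show "z (Inr j) * f z = 0"
    proof (cases "z \<circ> Inr = 0")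
      case True
      then show ?thesis by (auto dest: fun_cong[of _ _ j])
    next
      case False
      then show ?thesis using v z unfolding Epts_def vanishes_def by simp
    qed
  qed
  ultimately show "vanishes Ehat f" using irred_mult[OF irred_Ehat _ f] j(2) by blast
qed (auto simp: Epts_def vanishes_def)

lemma irred_Epts: "irred V2 Epts"
  unfolding irred_def
proof (intro conjI ballI impI)
  have "\<not> vanishes Ehat (\<lambda>z. 1)" using irred_Ehat unfolding irred_def vanishes_def by auto
  then show "Epts \<noteq> {}" using Epts_vanishes[OF poly_funs.const[of 1]] unfolding vanishes_def by auto
  fix f g assume "f \<in> poly_funs V2" "g \<in> poly_funs V2" "vanishes Epts (\<lambda>z. f z * g z)"
  then show "vanishes Epts f \<or> vanishes Epts g"
    using irred_Ehat Epts_vanishes poly_funs.mult[of f V2 g] unfolding irred_def by blast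
qed

lemma Epts_sub: "Epts \<subseteq> bi_vectors n n"
  unfolding Epts_def Ehat_def bi_vectors_def B0_def S_iff by blast

lemma B0_scale:
  assumes "x \<in> B0" "c \<noteq> 0"
  shows "(\<lambda>i. c * x i) \<in> B0"
proof -
  have "(\<lambda>i. c * x i) \<in> ppt x" unfolding ppt_def using assms(2) by blast
  from tangent_ppt[OF this] show ?thesis
    using assms S_scale[of x c] hom_scale[OF h_hom assms(2), of x] unfolding B0_def by auto
qed

lemma Epts_saturated:
  assumes z: "z \<in> Epts" and w: "w \<in> bi_vectors n n" "bippt w = bippt z"
  shows "w \<in> Epts"
proof -
  obtain b c where bc: "b \<noteq> 0" "c \<noteq> 0" and w_eq: "w = case_sum (\<lambda>i. b * (z \<circ> Inl) i) (\<lambda>j. c * (z \<circ> Inr) j)"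
    using w(2)[symmetric] by (rule bippt_eqE)
  have zE: "z \<circ> Inl \<in> B0" "crit (z \<circ> Inl) (z \<circ> Inr)" using z unfolding Epts_def Ehat_def by auto
  have wE: "w \<circ> Inl = (\<lambda>i. b * (z \<circ> Inl) i)" "w \<circ> Inr = (\<lambda>i. c * (z \<circ> Inr) i)"
    unfolding w_eq by (rule case_sum_comp_Inl, rule case_sum_comp_Inr)
  have "w \<circ> Inl \<in> B0" unfolding wE by (rule B0_scale[OF zE(1) bc(1)])
  moreover have "crit (w \<circ> Inl) (w \<circ> Inr)" unfolding wE crit_scale[OF bc] by (rule zE(2))
  moreover have "w \<circ> Inr \<in> cvectors n" "w \<circ> Inr \<noteq> 0" using w(1) unfolding bi_vectors_def by auto
  ultimately show ?thesis unfolding Epts_def Ehat_def by blast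
qed

lemma critical_pairs_eq: "critical_pairs n X = bippt ` Epts"
proof (intro equalityI subsetI)
  fix p assume p: "p \<in> critical_pairs n X"
  have "p \<in> proj_space n \<times> proj_space n"
    using p closedin_subset[OF closed_X] unfolding critical_pairs_def smooth_locus_def by auto
  then have "p \<in> bippt ` bi_vectors n n" unfolding bippt_image .
  then obtain z where z: "p = bippt z" "z \<in> bi_vectors n n" by (rule imageE)
  then have "z \<circ> Inl \<in> cvectors n - {0}" "z \<circ> Inr \<in> cvectors n - {0}" unfolding bi_vectors_def by auto
  then have "z \<in> Epts"
    using p critical_pairs_iff[of "z \<circ> Inl" "z \<circ> Inr"] unfolding z(1) bippt_def Epts_def Ehat_def by simp
  then show "p \<in> bippt ` Epts" using z(1) by blast
next
  fix p assume "p \<in> bippt ` Epts"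
  then obtain z where z: "p = bippt z" "z \<in> Epts" by (rule imageE)
  then have "z \<circ> Inl \<in> cvectors n - {0}" "z \<circ> Inr \<in> cvectors n - {0}" using Epts_sub unfolding bi_vectors_def by auto
  then show "p \<in> critical_pairs n X"
    using z(2) critical_pairs_iff[of "z \<circ> Inl" "z \<circ> Inr"] unfolding z(1) bippt_def Epts_def Ehat_def by simp
qed

abbreviation "Lc \<equiv> likelihood_correspondence n X"

lemma Lc_eq: "Lc = zclosure (bizariski n n) (bippt ` Epts)"
  unfolding likelihood_correspondence_def critical_pairs_eq ..

lemma closed_Lc: "closedin (bizariski n n) Lc"
  unfolding Lc_eq by simp

lemma irreducible_Lc: "irreducible_in (bizariski n n) Lc"
  unfolding Lc_eq by (rule biproj.irreducible_closure[OF irred_Epts Epts_sub])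

definition Lhat :: "(nat + nat \<Rightarrow> complex) set" where "Lhat = biproj.cone n n Lc"

lemma Lhat_vanishes:
  assumes "f \<in> poly_funs V2"
  shows "vanishes Lhat f \<longleftrightarrow> vanishes Ehat f"
proof -
  have "vanishes Lhat f \<longleftrightarrow> vanishes Epts f"
    unfolding Lhat_def Lc_eq
  proof (rule biproj.vanishes_cone_closure[OF Epts_sub _ assms])
    fix z w assume "z \<in> Epts" "w \<in> bi_vectors n n" "bippt w = bippt z"
    then show "w \<in> Epts" by (rule Epts_saturated)
  qed
  then show ?thesis using Epts_vanishes[OF assms] by simp
qed

lemma critical_sub_Lc: "critical_pairs n X \<subseteq> Lc"
  unfolding Lc_eq critical_pairs_eq
  by (rule closure_of_subset) (unfold topspace_bizariski bippt_image[symmetric], rule image_mono[OF Epts_sub])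

text \<open>\<open>Q\<close> expresses that \<open>u\<close> is recombined from its own frame
  coordinates. The outer factor \<open>\<Delta>\<close> makes it vanish also at points of
  \<open>Ehat\<close> where the chart is undefined, so it is an equation of the whole of
  \<open>Ehat\<close> and hence of the closure.\<close>

lemma chart_equation:
  assumes c: "chart e \<tau> W L \<Delta>" and i: "i \<le> n"
  defines "Q \<equiv> \<lambda>z. \<Delta> (z \<circ> Inl) * (\<Delta> (z \<circ> Inl) * z (Inr i) -
      (\<Sum>l\<le>m. W l i (z \<circ> Inl) * (\<Sum>k\<le>n. L l k (z \<circ> Inl) * z (Inr k))))"
  shows "Q \<in> poly_funs V2" "vanishes Ehat Q"
proof -
  have u: "(\<lambda>z. z (Inr k)) \<in> poly_funs V2" if "k \<le> n" for k
    using that by (intro poly_funs.var) (simp add: bi_vars_def)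
  note hp = poly_Inl[OF hom_poly[OF chartD(3)[OF c]]] poly_Inl[OF hom_poly[OF chartD(1)[OF c]]]
    poly_Inl[OF hom_poly[OF chartD(2)[OF c]]]
  show "Q \<in> poly_funs V2"
    unfolding Q_def by (intro poly_funs.mult poly_funs_diff poly_funs_sum hp u i) auto
  show "vanishes Ehat Q"
    unfolding vanishes_def
  proof
    fix z assume z: "z \<in> Ehat"
    let ?x = "z \<circ> Inl"
    show "Q z = 0"
    proof (cases "\<Delta> ?x = 0")
      case True
      then show ?thesis by (simp add: Q_def)
    next
      case False
      have x: "?x \<in> B0" and uc: "z \<circ> Inr \<in> cvectors n" "crit ?x (z \<circ> Inr)" using z unfolding Ehat_def by auto
      obtain t where t: "z \<circ> Inr = comb W ?x t" using chartD(6)[OF c x False uc] by (elim exE)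
      have "(\<Sum>k\<le>n. L l k ?x * z (Inr k)) = \<Delta> ?x * t l" if "l \<le> m" for l
        using L_comb[OF c B0_S[OF x] that, of t] unfolding t[symmetric] by simp
      then have "(\<Sum>l\<le>m. W l i ?x * (\<Sum>k\<le>n. L l k ?x * z (Inr k))) = \<Delta> ?x * (\<Sum>l\<le>m. t l * W l i ?x)"
        by (simp add: sum_distrib_left mult_ac)
      also have "(\<Sum>l\<le>m. t l * W l i ?x) = z (Inr i)"
        using fun_cong[OF t, of i] i by (simp add: comb_def)
      finally have eq: "(\<Sum>l\<le>m. W l i ?x * (\<Sum>k\<le>n. L l k ?x * z (Inr k))) = \<Delta> ?x * z (Inr i)" .
      show ?thesis unfolding Q_def eq by simp
    qed
  qed
qed

text \<open>Taking the closure adds no points over \<open>B0\<close>: the chart equations hold on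
  the closure, and where \<open>\<Delta>\<close> is nonzero they exhibit \<open>u\<close> as a
  combination of the frame, which is critical.\<close>

lemma Lc_over_B:
  assumes x: "x \<in> B0" and u: "u \<in> cvectors n - {0}" and L: "(ppt x, ppt u) \<in> Lc"
  shows "crit x u"
proof -
  obtain e \<tau> W L \<Delta> where c: "chart e \<tau> W L \<Delta>" and \<Delta>: "\<Delta> x \<noteq> 0" using chart_exists[OF x] by (elim exE conjE)
  let ?z = "case_sum x u"
  have "x \<in> cvectors n - {0}" using B0_S[OF x] S_iff by blast
  then have "?z \<in> bi_vectors n n" using u unfolding bi_vectors_def by simp
  moreover have "bippt ?z \<in> Lc" using L unfolding bippt_def by simp
  ultimately have zL: "?z \<in> Lhat" unfolding Lhat_def biproj.cone_def by blast
  define t where "t l = (\<Sum>k\<le>n. L l k x * u k) / \<Delta> x" for l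
  have "u i = comb W x t i" for i
  proof (cases "i \<le> n")
    case True
    have "vanishes Lhat (\<lambda>z. \<Delta> (z \<circ> Inl) * (\<Delta> (z \<circ> Inl) * z (Inr i) -
      (\<Sum>l\<le>m. W l i (z \<circ> Inl) * (\<Sum>k\<le>n. L l k (z \<circ> Inl) * z (Inr k)))))"
      using Lhat_vanishes[OF chart_equation(1)[OF c True]] chart_equation(2)[OF c True] by blast
    then have "\<Delta> x * (\<Delta> x * u i - (\<Sum>l\<le>m. W l i x * (\<Sum>k\<le>n. L l k x * u k))) = 0"
      using vanishesD[OF _ zL] by force
    then have "\<Delta> x * u i = (\<Sum>l\<le>m. W l i x * (\<Sum>k\<le>n. L l k x * u k))" using \<Delta> by simp
    also have "\<dots> = (\<Sum>l\<le>m. \<Delta> x * (t l * W l i x))"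
      using \<Delta> by (intro sum.cong refl) (simp add: t_def mult.commute)
    also have "\<dots> = \<Delta> x * (\<Sum>l\<le>m. t l * W l i x)" by (simp add: sum_distrib_left)
    finally show ?thesis using \<Delta> True by (simp add: comb_def)
  qed (use u in \<open>auto simp: comb_def cvectors_def\<close>)
  then have "u = comb W x t" by blast
  then show ?thesis using chartD(5)[OF c x] by simp
qed


section \<open>Tangent spaces of the correspondence\<close>

lemma tangent_lift:
  assumes c: "chart e \<tau> W L \<Delta>" and x: "x \<in> B0" and v: "v \<in> tangent {..n} S x"
  shows "case_sum v (\<lambda>i. if i \<le> n then \<Sum>j\<le>n. pd j (\<lambda>x. comb W x t i) x * v j else 0)
    \<in> tangent V2 Ehat (case_sum x (comb W x t))"
proof -
  let ?D = "\<lambda>i. \<Sum>j\<le>n. pd j (\<lambda>x. comb W x t i) x * v j"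
  let ?z = "case_sum x (comb W x t)"
  let ?d = "case_sum v (\<lambda>i. if i \<le> n then ?D i else 0)"
  let ?g = "\<lambda>w y. case_sum y (comb W y t) w"
  have gp: "?g w \<in> poly_funs {..n}" if "w \<in> V2" for w
    using that comb_poly[OF c] by (cases w) (auto simp: bi_vars_def intro: poly_funs.var)
  have gd: "(\<Sum>j\<le>n. pd j (?g w) x * v j) = ?d w" if "w \<in> V2" for w
  proof (cases w)
    case (Inl i)
    then have "i \<le> n" using that by (auto simp: bi_vars_def)
    have "(\<Sum>j\<le>n. pd j (?g w) x * v j) = (\<Sum>j\<le>n. if j = i then v i else 0)"
      by (intro sum.cong refl) (simp add: Inl pd_var)
    then show ?thesis using \<open>i \<le> n\<close> Inl by simp
  next
    case (Inr i)
    then show ?thesis using that by (auto simp: bi_vars_def)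
  qed
  have "(\<Sum>w\<in>V2. pd w F ?z * ?d w) = 0" if F: "F \<in> poly_funs V2" "vanishes Ehat F" for F
  proof -
    \<comment> \<open>\<open>?\<Phi>\<close> is \<open>F\<close> pulled back along the section with
      constant frame coordinates \<open>t\<close>; by the chain rule the section carries
      \<open>v\<close> to the vector claimed.\<close>
    let ?\<Phi> = "\<lambda>y. F (case_sum y (comb W y t))"
    have \<Phi>p: "?\<Phi> \<in> poly_funs {..n}" by (rule poly_case_comb[OF c F(1)])
    have "vanishes S ?\<Phi>"
    proof (rule generic)
      fix \<gamma> assume \<gamma>: "\<gamma> \<in> poly_funs {..n}" "\<not> vanishes S \<gamma>" "\<And>x. x \<in> S \<Longrightarrow> \<gamma> x \<noteq> 0 \<Longrightarrow> x \<in> B0"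
      \<comment> \<open>The section is known to lie in \<open>Ehat\<close> only over
        \<open>B0\<close>. The factor \<open>\<gamma>\<close> is zero at the other points of
        \<open>S\<close>, and irreducibility removes it.\<close>
      have "vanishes S (\<lambda>y. \<gamma> y * ?\<Phi> y)"
        unfolding vanishes_def
      proof
        fix y assume y: "y \<in> S"
        show "\<gamma> y * ?\<Phi> y = 0"
        proof (cases "\<gamma> y = 0")
          case False
          then have "y \<in> B0" by (rule \<gamma>(3)[OF y])
          then have "case_sum y (comb W y t) \<in> Ehat"
            unfolding Ehat_pair using chartD(5)[OF c] comb_cvectors by blast
          then show ?thesis using vanishesD[OF F(2)] by simp
        qed simp
      qed
      then show ?thesis using irred_mult[OF irred_S \<gamma>(1) \<Phi>p \<gamma>(2)] by blast
    qed
    then have "(\<Sum>j\<le>n. pd j ?\<Phi> x * v j) = 0" using v \<Phi>p unfolding tangent_def by blast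
    moreover have "pd j ?\<Phi> x = (\<Sum>w\<in>V2. pd w F ?z * pd j (?g w) x)" for j
      using fun_cong[OF pd_comp[of F V2 ?g "{..n}" j, OF F(1) finite_bi_vars gp], of x] by simp
    ultimately have "0 = (\<Sum>j\<le>n. \<Sum>w\<in>V2. pd w F ?z * (pd j (?g w) x * v j))"
      by (simp add: sum_distrib_right mult.assoc)
    also have "\<dots> = (\<Sum>w\<in>V2. pd w F ?z * (\<Sum>j\<le>n. pd j (?g w) x * v j))"
      by (subst sum.swap) (simp add: sum_distrib_left)
    also have "\<dots> = (\<Sum>w\<in>V2. pd w F ?z * ?d w)" by (intro sum.cong refl) (simp only: gd)
    finally show ?thesis by simp
  qed
  moreover have "?d w = 0" if "w \<notin> V2" for w
    using that v unfolding tangent_def by (cases w) (auto simp: bi_vars_def)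
  ultimately show ?thesis unfolding tangent_def by blast
qed

text \<open>The fibre over \<open>x\<close> is linear, so the line through \<open>u\<close> in
  direction \<open>w\<close> stays in \<open>Ehat\<close>, and functions of the ideal are
  identically zero along it.\<close>

lemma tangent_fibre:
  assumes x: "x \<in> B0" and u: "u \<in> cvectors n" "crit x u" and w: "w \<in> cvectors n" "crit x w"
  shows "case_sum 0 w \<in> tangent V2 Ehat (case_sum x u)"
proof -
  let ?d = "case_sum (0 :: cvector) w" and ?z = "case_sum x u"
  have "(\<Sum>v\<in>V2. pd v F ?z * ?d v) = 0" if F: "F \<in> poly_funs V2" "vanishes Ehat F" for F
  proof -
    have "F (\<lambda>v. ?z v + \<tau> 0 * ?d v) = 0" for \<tau> :: cvector
    proof -
      have "(\<lambda>v. ?z v + \<tau> 0 * ?d v) = case_sum x (\<lambda>i. u i + \<tau> 0 * w i)"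
        by (auto simp: fun_eq_iff split: sum.split)
      moreover have "case_sum x (\<lambda>i. u i + \<tau> 0 * w i) \<in> Ehat"
        unfolding Ehat_pair using x crit_affine[OF u(2) w(2)] u(1) w(1) by (auto simp: cvectors_def)
      ultimately show ?thesis using vanishesD[OF F(2)] by simp
    qed
    then have z: "(\<lambda>\<tau> :: cvector. F (\<lambda>v. ?z v + \<tau> 0 * ?d v)) = (\<lambda>\<tau>. 0)" by blast
    show ?thesis unfolding directional_derivative[OF F(1) finite_bi_vars] z by simp
  qed
  moreover have "?d v = 0" if "v \<notin> V2" for v
  proof (cases v)
    case (Inr b)
    then have "\<not> b \<le> n" using that by (auto simp: bi_vars_def)
    then show ?thesis using w(1) Inr by (simp add: cvectors_def)
  qed simp
  ultimately show ?thesis unfolding tangent_def by blast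
qed

lemma tangent_Inl:
  assumes v: "v \<in> tangent V2 Ehat z"
  shows "v \<circ> Inl \<in> tangent {..n} S (z \<circ> Inl)"
proof -
  let ?g = "\<lambda>i (z :: nat + nat \<Rightarrow> complex). z (Inl i)"
  have gp: "?g i \<in> poly_funs V2" if "i \<in> {..n}" for i using that by (intro poly_funs.var) (simp add: bi_vars_def)
  have "(\<Sum>i\<le>n. pd i f (z \<circ> Inl) * (v \<circ> Inl) i) = 0" if f: "f \<in> poly_funs {..n}" "vanishes S f" for f
  proof -
    let ?F = "\<lambda>z. f (\<lambda>i. ?g i z)"
    have "?F \<in> poly_funs V2" by (rule poly_funs_comp[OF f(1) gp])
    moreover have "vanishes Ehat ?F"
      using f(2) B0_S unfolding vanishes_def Ehat_def comp_def by blast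
    ultimately have "(\<Sum>w\<in>V2. pd w ?F z * v w) = 0" using v unfolding tangent_def by blast
    moreover have "pd w ?F z = (\<Sum>i\<le>n. pd i f (\<lambda>i. ?g i z) * pd w (?g i) z)" for w
      using fun_cong[OF pd_comp[of f "{..n}" ?g V2 w, OF f(1) finite_atMost gp], of z] by simp
    moreover have "(\<Sum>i\<le>n. pd i f (\<lambda>i. ?g i z) * pd (Inl j) (?g i) z) = pd j f (z \<circ> Inl)" if "j \<le> n" for j
    proof -
      have "(\<Sum>i\<le>n. pd i f (\<lambda>i. ?g i z) * pd (Inl j) (?g i) z) = (\<Sum>i\<le>n. if i = j then pd j f (\<lambda>i. ?g i z) else 0)"
        by (intro sum.cong refl) (simp add: pd_var)
      then show ?thesis using that by (simp add: comp_def)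
    qed
    moreover have "(\<Sum>i\<le>n. pd i f (\<lambda>i. ?g i z) * pd (Inr j) (?g i) z) = 0" for j
      by (simp add: pd_var)
    ultimately show ?thesis unfolding sum_bi_vars by simp
  qed
  moreover have "(v \<circ> Inl) i = 0" if "i \<notin> {..n}" for i
  proof -
    have "Inl i \<notin> V2" using that by (auto simp: bi_vars_def)
    then show ?thesis using v unfolding tangent_def by auto
  qed
  ultimately show ?thesis unfolding tangent_def by blast
qed

text \<open>Along a vertical direction killed by \<open>L\<close>, the chart equation is affine with
  slope \<open>\<Delta> x * \<Delta> x * v (Inr i)\<close>. A tangent vector makes the slope
  zero.\<close>

lemma tangent_vertical:
  assumes c: "chart e \<tau> W L \<Delta>" and \<Delta>: "\<Delta> x \<noteq> 0"
    and v: "v \<in> tangent V2 Ehat (case_sum x u)" "v \<circ> Inl = 0"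
    and L0: "\<And>l. l \<le> m \<Longrightarrow> (\<Sum>k\<le>n. L l k x * v (Inr k)) = 0"
    and i: "i \<le> n"
  shows "v (Inr i) = 0"
proof -
  let ?z = "case_sum x u"
  define Q where "Q = (\<lambda>z. \<Delta> (z \<circ> Inl) * (\<Delta> (z \<circ> Inl) * z (Inr i) -
      (\<Sum>l\<le>m. W l i (z \<circ> Inl) * (\<Sum>k\<le>n. L l k (z \<circ> Inl) * z (Inr k)))))"
  have Q: "Q \<in> poly_funs V2" "vanishes Ehat Q" unfolding Q_def by (rule chart_equation[OF c i])+
  have "0 = (\<Sum>w\<in>V2. pd w Q ?z * v w)" using v(1) Q unfolding tangent_def by simp
  also have "\<dots> = pd 0 (\<lambda>\<tau> :: cvector. Q (\<lambda>w. ?z w + \<tau> 0 * v w)) (\<lambda>_. 0)"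
    by (rule directional_derivative[OF Q(1) finite_bi_vars])
  also have "(\<lambda>\<tau> :: cvector. Q (\<lambda>w. ?z w + \<tau> 0 * v w)) =
      (\<lambda>\<tau>. \<Delta> x * (\<Delta> x * u i - (\<Sum>l\<le>m. W l i x * (\<Sum>k\<le>n. L l k x * u k))) + \<tau> 0 * (\<Delta> x * \<Delta> x * v (Inr i)))"
  proof
    fix \<tau> :: cvector
    let ?y = "\<lambda>w. ?z w + \<tau> 0 * v w"
    have yI: "?y \<circ> Inl = x" using v(2) by (auto simp: fun_eq_iff)
    have "(\<Sum>k\<le>n. L l k x * ?y (Inr k)) = (\<Sum>k\<le>n. L l k x * u k)" if "l \<le> m" for l
    proof -
      have "(\<Sum>k\<le>n. L l k x * ?y (Inr k)) = (\<Sum>k\<le>n. L l k x * u k) + \<tau> 0 * (\<Sum>k\<le>n. L l k x * v (Inr k))"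
        by (simp add: sum.distrib sum_distrib_left algebra_simps)
      then show ?thesis using L0[OF that] by simp
    qed
    then have "(\<Sum>l\<le>m. W l i x * (\<Sum>k\<le>n. L l k x * ?y (Inr k))) = (\<Sum>l\<le>m. W l i x * (\<Sum>k\<le>n. L l k x * u k))"
      by (intro sum.cong refl) simp
    then show "Q ?y = \<Delta> x * (\<Delta> x * u i - (\<Sum>l\<le>m. W l i x * (\<Sum>k\<le>n. L l k x * u k))) + \<tau> 0 * (\<Delta> x * \<Delta> x * v (Inr i))"
      unfolding Q_def yI by (simp only:) (simp add: algebra_simps)
  qed
  finally show ?thesis unfolding pd_affine using \<Delta> by simp
qed

text \<open>
  The tangent space at a general point of the correspondence is an extension of the tangent space of \<open>X\<close> by the
  fibre, so its dimension is \<open>R + (m + 1)\<close>.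
\<close>

lemma card_basis_Ehat:
  assumes JL: "basis_of V2 Ehat JL"
  shows "card JL = n + 2"
proof -
  have JLV: "JL \<subseteq> V2" using JL unfolding basis_of_def by blast
  have finJL: "finite JL" using finite_subset[OF JLV finite_bi_vars] .
  obtain a where a: "a \<in> B0" by (rule generic_point)
  obtain e \<tau> W L \<Delta> where c: "chart e \<tau> W L \<Delta>" and \<Delta>a: "\<Delta> a \<noteq> 0" using chart_exists[OF a] by (elim exE conjE)
  obtain \<gamma>L where gL: "\<gamma>L \<in> poly_funs V2" "\<not> vanishes Ehat \<gamma>L"
    and gLp: "\<forall>z\<in>Ehat. \<gamma>L z \<noteq> 0 \<longrightarrow> (\<forall>v\<in>tangent V2 Ehat z. (\<forall>j\<in>JL. v j = 0) \<longrightarrow> v = 0) \<and>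
      (\<exists>b. \<forall>j\<in>JL. b j \<in> tangent V2 Ehat z \<and> b j j \<noteq> 0 \<and> (\<forall>i\<in>JL. i \<noteq> j \<longrightarrow> b j i = 0))"
    using generic_tangent[OF finite_bi_vars irred_Ehat JL] by (elim bexE conjE)
  have "\<exists>z b. z \<in> Ehat \<and> \<gamma>L z \<noteq> 0 \<and> \<Delta> (z \<circ> Inl) \<noteq> 0 \<and>
    (\<forall>v\<in>tangent {..n} S (z \<circ> Inl). (\<forall>j\<in>J. v j = 0) \<longrightarrow> v = 0) \<and>
    (\<forall>j\<in>J. b j \<in> tangent {..n} S (z \<circ> Inl) \<and> b j j \<noteq> 0 \<and> (\<forall>i\<in>J. i \<noteq> j \<longrightarrow> b j i = 0))"
  proof (rule generic)
    fix \<gamma> assume \<gamma>: "\<gamma> \<in> poly_funs {..n}" "\<not> vanishes S \<gamma>" "\<And>x. x \<in> S \<Longrightarrow> \<gamma> x \<noteq> 0 \<Longrightarrow> x \<in> B0"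
      "\<And>x. x \<in> S \<Longrightarrow> \<gamma> x \<noteq> 0 \<Longrightarrow> \<forall>v\<in>tangent {..n} S x. (\<forall>j\<in>J. v j = 0) \<longrightarrow> v = 0"
      "\<And>x. x \<in> S \<Longrightarrow> \<gamma> x \<noteq> 0 \<Longrightarrow>
        \<exists>b. \<forall>j\<in>J. b j \<in> tangent {..n} S x \<and> b j j \<noteq> 0 \<and> (\<forall>i\<in>J. i \<noteq> j \<longrightarrow> b j i = 0)"
    obtain y where y: "y \<in> S" "\<gamma> y \<noteq> 0" using \<gamma>(2) unfolding vanishes_def by blast
    \<comment> \<open>One point is wanted that is general for the correspondence, lies over a
      general point of \<open>X\<close>, and belongs to the chart.\<close>
    have "\<not> vanishes Ehat (\<lambda>z. \<gamma>L z * (\<gamma> (z \<circ> Inl) * \<Delta> (z \<circ> Inl)))"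
      by (intro irred_mult[OF irred_Ehat] poly_funs.mult gL poly_Inl \<gamma>(1) hom_poly[OF chartD(3)[OF c]]
          Inl_not_vanishes[where f = \<gamma>, OF \<gamma>(3)[OF y] y(2)] Inl_not_vanishes[where f = \<Delta>, OF a \<Delta>a])
    then obtain z where z: "z \<in> Ehat" "\<gamma>L z * (\<gamma> (z \<circ> Inl) * \<Delta> (z \<circ> Inl)) \<noteq> 0" unfolding vanishes_def by blast
    then have zz: "\<gamma>L z \<noteq> 0" "\<gamma> (z \<circ> Inl) \<noteq> 0" "\<Delta> (z \<circ> Inl) \<noteq> 0" by auto
    have zS: "z \<circ> Inl \<in> S" using z(1) B0_S unfolding Ehat_def by blast
    from \<gamma>(5)[OF zS zz(2)] obtain b where
      b: "\<forall>j\<in>J. b j \<in> tangent {..n} S (z \<circ> Inl) \<and> b j j \<noteq> 0 \<and> (\<forall>i\<in>J. i \<noteq> j \<longrightarrow> b j i = 0)" by (elim exE)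
    show ?thesis
      using z(1) zz(1,3) \<gamma>(4)[OF zS zz(2)] b by (intro exI[of _ z] exI[of _ b] conjI)
  qed
  then obtain z b where z: "z \<in> Ehat" "\<gamma>L z \<noteq> 0" "\<Delta> (z \<circ> Inl) \<noteq> 0"
    and injJ: "\<forall>v\<in>tangent {..n} S (z \<circ> Inl). (\<forall>j\<in>J. v j = 0) \<longrightarrow> v = 0"
    and b: "\<forall>j\<in>J. b j \<in> tangent {..n} S (z \<circ> Inl) \<and> b j j \<noteq> 0 \<and> (\<forall>i\<in>J. i \<noteq> j \<longrightarrow> b j i = 0)"
    by (elim exE conjE)
  define x where "x = z \<circ> Inl"
  have x: "x \<in> B0" and uc: "z \<circ> Inr \<in> cvectors n" "crit x (z \<circ> Inr)" using z(1) unfolding Ehat_def x_def by auto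
  have \<Delta>x: "\<Delta> x \<noteq> 0" using z(3) unfolding x_def .
  obtain t where t: "z \<circ> Inr = comb W x t" using chartD(6)[OF c x \<Delta>x uc] by (elim exE)
  have "z = case_sum (z \<circ> Inl) (z \<circ> Inr)" by (rule case_sum_comp[symmetric])
  then have zc: "z = case_sum x (comb W x t)" unfolding t x_def[symmetric] .
  let ?T = "tangent V2 Ehat z"
  have dimJL: "cv.dim ?T = card JL"
  proof -
    from gLp z(1,2) have 1: "\<forall>v\<in>?T. (\<forall>j\<in>JL. v j = 0) \<longrightarrow> v = 0"
      and "\<exists>b. \<forall>j\<in>JL. b j \<in> ?T \<and> b j j \<noteq> 0 \<and> (\<forall>i\<in>JL. i \<noteq> j \<longrightarrow> b j i = 0)" by simp_all
    then obtain bb where "\<forall>j\<in>JL. bb j \<in> ?T \<and> bb j j \<noteq> 0 \<and> (\<forall>i\<in>JL. i \<noteq> j \<longrightarrow> bb j i = 0)" by (elim exE)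
    then show ?thesis by (rule dim_tangent_coords[OF finJL 1])
  qed
  define D where "D v i = (\<Sum>j\<le>n. pd j (\<lambda>x. comb W x t i) x * v j)" for v :: cvector and i
  \<comment> \<open>The functionals read off the base component in the coordinates \<open>J\<close>,
    and the frame coordinates of what remains after the lift \<open>D\<close> of the base component
    is subtracted. The dual vectors are lifts of base vectors and frame vectors, so the two blocks
    do not interact.\<close>
  define \<phi> where "\<phi> k v = (case k of Inl j \<Rightarrow> v (Inl j)
      | Inr l \<Rightarrow> \<Sum>i\<le>n. L l i x * (v (Inr i) - D (v \<circ> Inl) i))" for k :: "nat + nat" and v :: "nat + nat \<Rightarrow> complex"
  define unit where "unit l = (\<lambda>k. if k = l then 1 else 0 :: complex)" for l :: nat
  define b2 where "b2 k = (case k of Inl j \<Rightarrow> case_sum (b j) (\<lambda>i. if i \<le> n then D (b j) i else 0)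
      | Inr l \<Rightarrow> case_sum 0 (comb W x (unit l)))" for k :: "nat + nat"
  let ?I = "Inl ` J \<union> Inr ` {..m}"
  have D_add: "D (\<lambda>i. v i + w i) i = D v i + D w i" and D_scale: "D (\<lambda>i. q * v i) i = q * D v i"
    and D_0: "D 0 i = 0" for v w q i
    unfolding D_def by (simp_all add: sum.distrib sum_distrib_left algebra_simps)
  have "cv.dim ?T = card ?I"
  proof (rule dim_eq_card_dual[OF subspace_tangent, where \<phi> = \<phi> and b = b2])
    show "finite ?I" using finite_J by simp
    show "\<phi> k (u + v) = \<phi> k u + \<phi> k v" for k u v
      unfolding \<phi>_def by (cases k) (simp_all add: comp_def D_add sum.distrib[symmetric] algebra_simps)
    show "\<phi> k (\<lambda>i. q * v i) = q * \<phi> k v" for k q v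
      unfolding \<phi>_def by (cases k) (simp_all add: comp_def D_scale sum_distrib_left algebra_simps)
  next
    fix v assume v: "v \<in> ?T" "\<And>k. k \<in> ?I \<Longrightarrow> \<phi> k v = 0"
    have "v \<circ> Inl \<in> tangent {..n} S x" unfolding x_def by (rule tangent_Inl[OF v(1)])
    moreover have "(v \<circ> Inl) j = 0" if "j \<in> J" for j using v(2)[of "Inl j"] that by (simp add: \<phi>_def)
    ultimately have vI: "v \<circ> Inl = 0" using injJ unfolding x_def by blast
    have "(\<Sum>k\<le>n. L l k x * v (Inr k)) = 0" if "l \<le> m" for l
      using v(2)[of "Inr l"] that unfolding \<phi>_def vI D_0 by simp
    then have vR: "v (Inr i) = 0" if "i \<le> n" for i
      using tangent_vertical[OF c \<Delta>x v(1)[unfolded zc] vI _ that] by blast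
    have "v k = 0" for k
    proof (cases k)
      case (Inl j)
      then show ?thesis using fun_cong[OF vI, of j] by simp
    next
      case (Inr i)
      show ?thesis
      proof (cases "i \<le> n")
        case False
        then have "k \<notin> V2" using Inr by (auto simp: bi_vars_def)
        then show ?thesis using v(1) unfolding tangent_def by blast
      qed (use vR Inr in simp)
    qed
    then show "v = 0" by (simp add: fun_eq_iff)
  next
    have LD: "(\<Sum>i\<le>n. L l i x * ((if i \<le> n then D w i else 0) - D w i)) = 0" for l w
      by (rule sum.neutral) simp
    have Lu: "(\<Sum>i\<le>n. L l i x * (comb W x (unit l') i - D 0 i)) = \<Delta> x * unit l' l" if "l \<le> m" for l l'
      using L_comb[OF c B0_S[OF x] that, of "unit l'"] unfolding D_0 by simp
    fix k assume k: "k \<in> ?I"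
    show "b2 k \<in> ?T"
    proof (cases k)
      case (Inl j)
      then have "b j \<in> tangent {..n} S x" using k b unfolding x_def by auto
      from tangent_lift[OF c x this, of t] show ?thesis unfolding b2_def Inl sum.case zc D_def .
    next
      case (Inr l)
      have "case_sum 0 (comb W x (unit l)) \<in> tangent V2 Ehat (case_sum x (comb W x t))"
        by (intro tangent_fibre[OF x] comb_cvectors chartD(5)[OF c x])
      then show ?thesis unfolding b2_def Inr sum.case zc .
    qed
    show "\<phi> k (b2 k) \<noteq> 0"
    proof (cases k)
      case (Inl j)
      then show ?thesis using k b unfolding \<phi>_def b2_def by auto
    next
      case (Inr l)
      then have "l \<le> m" using k by auto
      then show ?thesis using Lu[of l l] \<Delta>x unfolding \<phi>_def b2_def Inr by (simp add: unit_def)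
    qed
    fix k' assume k': "k' \<in> ?I" "k \<noteq> k'"
    show "\<phi> k (b2 k') = 0"
    proof (cases k)
      case k1: (Inl j)
      show ?thesis
      proof (cases k')
        case (Inl j')
        then show ?thesis using k k' b unfolding \<phi>_def b2_def k1 by auto
      next
        case (Inr l')
        then show ?thesis unfolding \<phi>_def b2_def k1 by simp
      qed
    next
      case k1: (Inr l)
      then have lm: "l \<le> m" using k by auto
      show ?thesis
      proof (cases k')
        case (Inl j')
        then show ?thesis using LD[of l "b j'"] unfolding \<phi>_def b2_def k1 by simp
      next
        case (Inr l')
        then have "l \<noteq> l'" using k' k1 by auto
        then show ?thesis using Lu[OF lm, of l'] unfolding \<phi>_def b2_def k1 Inr by (simp add: unit_def)
      qed
    qed
  qed
  moreover have "card ?I = R + Suc m"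
    using finite_J by (subst card_Un_disjoint) (auto simp: card_image)
  ultimately show ?thesis using dimJL m_R by simp
qed

lemma indep_Lhat: "K \<subseteq> V2 \<Longrightarrow> indep Lhat K \<longleftrightarrow> indep Ehat K"
  unfolding indep_def using Lhat_vanishes poly_funs_mono by blast

lemma basis_Lhat: "basis_of V2 Lhat K \<longleftrightarrow> basis_of V2 Ehat K"
  unfolding basis_of_def using indep_Lhat by (metis DiffD1 insert_subset)

text \<open>The rank \<open>n + 2\<close> loses the two scalings. The lower bound wants a basis with
  a coordinate from each factor; a basis of \<open>n + 2\<close> elements has one, since either
  factor offers only \<open>n + 1\<close> coordinates.\<close>

lemma krull_Lc: "krull_dim (subtopology (bizariski n n) Lc) = enat n"
proof -
  have ne: "Lhat \<noteq> {}" using biproj.irred_cone[OF irreducible_Lc] unfolding Lhat_def irred_def by blast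
  then obtain K where K: "basis_of V2 Lhat K" "card K = rk V2 Lhat" by (rule rk_basis[OF finite_bi_vars])
  have cardK: "card K = n + 2" using card_basis_Ehat K(1) basis_Lhat by blast
  have KV: "K \<subseteq> Inl ` {..n} \<union> Inr ` {..n}" using K(1) unfolding basis_of_def bi_vars_def by blast
  have "\<not> K \<subseteq> Inl ` {..n}"
  proof
    assume "K \<subseteq> Inl ` {..n}"
    then have "card K \<le> card (Inl ` {..n} :: (nat + nat) set)" by (intro card_mono) auto
    then show False using cardK by (simp add: card_image)
  qed
  moreover have "\<not> K \<subseteq> Inr ` {..n}"
  proof
    assume "K \<subseteq> Inr ` {..n}"
    then have "card K \<le> card (Inr ` {..n} :: (nat + nat) set)" by (intro card_mono) auto
    then show False using cardK by (simp add: card_image)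
  qed
  ultimately obtain i j where ij: "i \<le> n" "Inl i \<in> K" "j \<le> n" "Inr j \<in> K" using KV by blast
  have "enat (card K - 2) \<le> krull_dim (subtopology (bizariski n n) Lc)"
    by (rule biproj.krull_dim_ge[OF closed_Lc irreducible_Lc K(1)[unfolded Lhat_def] _ biproj_normalizing[OF ij(1,3)]])
       (use ij in auto)
  moreover have "krull_dim (subtopology (bizariski n n) Lc) \<le> enat (rk V2 Lhat - 2)"
    using biproj.krull_dim_le[OF closed_Lc irreducible_Lc] unfolding Lhat_def .
  ultimately show ?thesis using cardK K(2) by simp
qed

text \<open>
  The \<open>n + 3\<close> functions \<open>p\<^sub>i, p\<^sub>j, u\<^sub>0, \<dots>, u\<^sub>n\<close> are algebraically dependent on the correspondence; a component
  of their relation that is homogeneous in \<open>(p\<^sub>i, p\<^sub>j)\<close> bounds the values of \<open>p\<^sub>i / p\<^sub>j\<close> over a general \<open>u\<close>.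
\<close>

lemma coordinate_relation:
  assumes ij: "i \<le> n" "j \<le> n" "i \<noteq> j"
  shows "\<exists>d a k0. (\<forall>k. a k \<in> poly_funs {..n}) \<and> k0 \<le> d \<and> a k0 \<noteq> (\<lambda>u. 0) \<and>
    (\<forall>z\<in>Lhat. (\<Sum>k\<le>d. a k (z \<circ> Inr) * z (Inl i) ^ k * z (Inl j) ^ (d - k)) = 0)"
proof -
  let ?U = "Inr ` {..n} :: (nat + nat) set"
  let ?K = "insert (Inl i) (insert (Inl j) ?U)"
  have KV: "?K \<subseteq> V2" using ij by (auto simp: bi_vars_def)
  have "card (insert (Inl j) ?U) = Suc (card ?U)" "card ?K = Suc (card (insert (Inl j) ?U))"
    using ij by (auto intro!: card_insert_disjoint)
  then have cardK: "card ?K = n + 3" by (simp add: card_image)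
  have "\<not> indep Ehat ?K"
  proof
    assume "indep Ehat ?K"
    then obtain K' where K': "?K \<subseteq> K'" "basis_of V2 Ehat K'"
      using indep_extends_to_basis[OF finite_bi_vars _ KV] by blast
    then have "finite K'" using finite_bi_vars finite_subset unfolding basis_of_def by blast
    then have "n + 3 \<le> card K'" using card_mono[OF _ K'(1)] cardK by simp
    then show False using card_basis_Ehat[OF K'(2)] by simp
  qed
  then obtain G where G: "G \<in> poly_funs ?K" "vanishes Ehat G" "G \<noteq> (\<lambda>x. 0)" unfolding indep_def by blast
  have GL: "vanishes Lhat G" using Lhat_vanishes[OF poly_funs_mono[OF G(1) KV]] G(2) by blast
  obtain N c where c: "\<forall>k. c k \<in> poly_funs (insert (Inl j) ?U)" "G = (\<lambda>z. \<Sum>k\<le>(N::nat). c k z * z (Inl i) ^ k)"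
    using poly_funs_expand[OF G(1)] by (elim exE conjE)
  have "\<forall>k. \<exists>M b. (\<forall>l. b l \<in> poly_funs ?U) \<and> c k = (\<lambda>z. \<Sum>l\<le>(M::nat). b l z * z (Inl j) ^ l)"
    by (intro allI poly_funs_expand c(1)[rule_format])
  then obtain M where "\<forall>k. \<exists>b. (\<forall>l. b l \<in> poly_funs ?U) \<and> c k = (\<lambda>z. \<Sum>l\<le>M k. b l z * z (Inl j) ^ l)"
    by (rule choice[THEN exE])
  then obtain b where b: "\<forall>k. (\<forall>l. b k l \<in> poly_funs ?U) \<and> c k = (\<lambda>z. \<Sum>l\<le>M k. b k l z * z (Inl j) ^ l)"
    by (rule choice[THEN exE])
  \<comment> \<open>The expansions in the two \<open>p\<close>-coordinates leave coefficients
    depending on \<open>u\<close> alone, here padded with zero outside the index set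
    \<open>I\<close>.\<close>
  define B where "B k l = (if k \<le> N \<and> l \<le> M k then b k l else (\<lambda>z. 0))" for k l
  have Bp: "B k l \<in> poly_funs ?U" for k l using b unfolding B_def by (auto intro: poly_funs.const)
  define I where "I = Sigma {..N} (\<lambda>k. {..M k})"
  have finI: "finite I" unfolding I_def by auto
  have GB: "G z = (\<Sum>(k, l)\<in>I. B k l z * (z (Inl i) ^ k * z (Inl j) ^ l))" for z
  proof -
    have "G z = (\<Sum>k\<le>N. \<Sum>l\<le>M k. b k l z * z (Inl j) ^ l * z (Inl i) ^ k)"
      unfolding c(2) using b by (simp add: sum_distrib_right)
    also have "\<dots> = (\<Sum>(k, l)\<in>I. b k l z * z (Inl j) ^ l * z (Inl i) ^ k)"
      unfolding I_def by (subst sum.Sigma) auto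
    also have "\<dots> = (\<Sum>(k, l)\<in>I. B k l z * (z (Inl i) ^ k * z (Inl j) ^ l))"
      by (intro sum.cong refl) (auto simp: I_def B_def)
    finally show ?thesis .
  qed
  obtain k0 l0 where kl: "(k0, l0) \<in> I" "B k0 l0 \<noteq> (\<lambda>z. 0)"
  proof (rule ccontr)
    assume "\<not> thesis"
    then have "\<forall>p\<in>I. B (fst p) (snd p) = (\<lambda>z. 0)" using that by (metis prod.collapse)
    then have "G z = 0" for z unfolding GB by (intro sum.neutral) auto
    then show False using G(3) by blast
  qed
  \<comment> \<open>The total degree of a monomial with nonzero coefficient, so that the component
    of degree \<open>d\<close> is a nontrivial relation.\<close>
  define d where "d = k0 + l0"
  have comp0: "(\<Sum>(k, l)\<in>{p\<in>I. fst p + snd p = d}. B k l z * (z (Inl i) ^ k * z (Inl j) ^ l)) = 0"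
    if z: "z \<in> Lhat" for z
  proof -
    let ?D = "(\<lambda>p. fst p + snd p) ` I"
    let ?a = "\<lambda>d. \<Sum>(k, l)\<in>{p\<in>I. fst p + snd p = d}. B k l z * (z (Inl i) ^ k * z (Inl j) ^ l)"
    have zb: "z \<in> bi_vectors n n" "bippt z \<in> Lc" using z unfolding Lhat_def biproj.cone_def by auto
    have hom0: "(\<Sum>d\<in>?D. q ^ id d * ?a d) = 0" if q: "q \<noteq> 0" for q
    proof -
      \<comment> \<open>Only the first factor is scaled. The coefficients do not change, and the
        powers of \<open>q\<close> separate the degrees in the two
        \<open>p\<close>-coordinates.\<close>
      let ?w = "case_sum (\<lambda>i. q * (z \<circ> Inl) i) (\<lambda>j. 1 * (z \<circ> Inr) j)"
      have "?w \<in> Lhat" unfolding Lhat_def biproj.cone_def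
        using bi_vectors_scale[OF zb(1) q one_neq_zero] bippt_scale[OF q one_neq_zero, of z] zb(2) by simp
      then have "0 = (\<Sum>(k, l)\<in>I. B k l ?w * (?w (Inl i) ^ k * ?w (Inl j) ^ l))" using vanishesD[OF GL] GB by metis
      also have "\<dots> = (\<Sum>(k, l)\<in>I. q ^ (k + l) * (B k l z * (z (Inl i) ^ k * z (Inl j) ^ l)))"
      proof (intro sum.cong refl, clarify)
        fix k l
        have "B k l ?w = B k l z" by (rule poly_funs_cong[OF Bp]) auto
        then show "B k l ?w * (?w (Inl i) ^ k * ?w (Inl j) ^ l) = q ^ (k + l) * (B k l z * (z (Inl i) ^ k * z (Inl j) ^ l))"
          by (simp add: power_mult_distrib power_add)
      qed
      also have "\<dots> = (\<Sum>d\<in>?D. \<Sum>(k, l)\<in>{p\<in>I. fst p + snd p = d}. q ^ (k + l) * (B k l z * (z (Inl i) ^ k * z (Inl j) ^ l)))"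
        by (rule sum.image_gen[OF finI])
      also have "\<dots> = (\<Sum>d\<in>?D. q ^ id d * ?a d)"
        unfolding sum_distrib_left by (intro sum.cong refl) auto
      finally show ?thesis by simp
    qed
    have "d \<in> ?D" using kl(1) unfolding d_def by force
    show ?thesis
      by (rule poly_coeffs_unique[of ?D id ?a d]) (use finI hom0 \<open>d \<in> ?D\<close> in simp_all)
  qed
  define a where "a k u = (if (k, d - k) \<in> I then B k (d - k) (case_sum 0 u) else 0)" for k and u :: cvector
  have Bu: "B k l (case_sum 0 (z \<circ> Inr)) = B k l z" for k l z
    by (rule poly_funs_cong[OF Bp]) auto
  have ap: "a k \<in> poly_funs {..n}" for k
  proof (cases "(k, d - k) \<in> I")
    case True
    have "(\<lambda>u. B k (d - k) (\<lambda>v. case_sum 0 u v)) \<in> poly_funs {..n}"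
      by (rule poly_funs_comp[OF Bp]) (auto intro: poly_funs.var)
    then show ?thesis using True unfolding a_def by simp
  qed (simp add: a_def[abs_def] poly_funs.const)
  have "a k0 \<noteq> (\<lambda>u. 0)"
  proof
    assume z: "a k0 = (\<lambda>u. 0)"
    have "B k0 l0 z = 0" for z
      using fun_cong[OF z, of "z \<circ> Inr"] kl(1) Bu[of k0 l0 z] unfolding a_def d_def by simp
    then show False using kl(2) by blast
  qed
  moreover have "(\<Sum>k\<le>d. a k (z \<circ> Inr) * z (Inl i) ^ k * z (Inl j) ^ (d - k)) = 0" if z: "z \<in> Lhat" for z
  proof -
    have "(\<Sum>(k, l)\<in>{p\<in>I. fst p + snd p = d}. B k l z * (z (Inl i) ^ k * z (Inl j) ^ l)) =
      (\<Sum>k\<in>{k. k \<le> d \<and> (k, d - k) \<in> I}. B k (d - k) z * (z (Inl i) ^ k * z (Inl j) ^ (d - k)))"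
      by (rule sum.reindex_bij_witness[where i = "\<lambda>k. (k, d - k)" and j = fst]) auto
    also have "\<dots> = (\<Sum>k\<le>d. a k (z \<circ> Inr) * z (Inl i) ^ k * z (Inl j) ^ (d - k))"
      by (rule sum.mono_neutral_cong_left) (auto simp: a_def Bu)
    finally show ?thesis using comp0[OF z] by simp
  qed
  ultimately show ?thesis using ap by (intro exI[of _ d] exI[of _ a] exI[of _ k0]) (simp add: d_def)
qed

section \<open>Finiteness of general fibres\<close>

lemma dense_open_nonvanishing:
  assumes fin: "finite A" and a: "\<And>p. p \<in> A \<Longrightarrow> a p \<in> poly_funs {..n}" "\<And>p. p \<in> A \<Longrightarrow> a p \<noteq> (\<lambda>u. 0)"
  shows "\<exists>W. openin (zariski n) W \<and> zclosure (zariski n) W = topspace (zariski n) \<and>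
    (\<forall>U\<in>W. U \<in> proj_space n \<and> (\<forall>p\<in>A. \<exists>u\<in>cvectors n - {0}. ppt u = U \<and> a p u \<noteq> 0))"
proof -
  let ?C = "cvectors n - {0}"
  \<comment> \<open>The functions \<open>a p\<close> need not be homogeneous. Their graded parts
    define the closed set of points all of whose representatives are zeros.\<close>
  have "\<exists>P. \<forall>p\<in>A. P p \<subseteq> proj_forms n \<and>
      (\<forall>x\<in>?C. (\<forall>y\<in>?C. ppt y = ppt x \<longrightarrow> a p y = 0) \<longleftrightarrow> (\<forall>q\<in>P p. q x = 0))"
    using proj.parts[OF a(1)] by (intro bchoice ballI) blast
  then obtain P where P: "\<forall>p\<in>A. P p \<subseteq> proj_forms n \<and>
      (\<forall>x\<in>?C. (\<forall>y\<in>?C. ppt y = ppt x \<longrightarrow> a p y = 0) \<longleftrightarrow> (\<forall>q\<in>P p. q x = 0))" by (elim exE)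
  define Z where "Z p = ppt ` {x\<in>?C. \<forall>q\<in>P p. q x = 0}" for p
  have Zc: "closedin (zariski n) (Z p)" if "p \<in> A" for p
    unfolding Z_def by (rule proj.closed_zeros) (use P that in blast)
  define W where "W = proj_space n - (\<Union>p\<in>A. Z p)"
  have "closedin (zariski n) (\<Union>p\<in>A. Z p)" using fin Zc by (intro closedin_Union) auto
  then have "openin (zariski n) W" unfolding W_def using openin_diff[OF openin_topspace] by (metis topspace_zariski)
  moreover have W_iff: "ppt u \<in> W" if u: "u \<in> ?C" and nz: "\<forall>p\<in>A. a p u \<noteq> 0" for u
  proof -
    have "ppt u \<notin> Z p" if p: "p \<in> A" for p
    proof
      assume "ppt u \<in> Z p"
      then obtain x where "x \<in> ?C" "\<forall>q\<in>P p. q x = 0" "ppt u = ppt x" unfolding Z_def by blast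
      then show False using P p u nz by blast
    qed
    then show ?thesis unfolding W_def proj_space_eq using u by blast
  qed
  have "\<exists>u\<in>?C. ppt u = U \<and> a p u \<noteq> 0" if U: "U \<in> W" and p: "p \<in> A" for U p
  proof -
    have "U \<in> proj_space n" "U \<notin> Z p" using U p unfolding W_def by auto
    then obtain x where x: "U = ppt x" "x \<in> ?C" unfolding proj_space_eq by blast
    then have "\<not> (\<forall>q\<in>P p. q x = 0)" using \<open>U \<notin> Z p\<close> unfolding Z_def by blast
    then show ?thesis using P p x by blast
  qed
  moreover have "zclosure (zariski n) W = topspace (zariski n)"
  proof (rule ccontr)
    assume "zclosure (zariski n) W \<noteq> topspace (zariski n)"
    then have "\<exists>Q\<in>proj_space n. Q \<notin> zclosure (zariski n) W"
      using closure_of_subset_topspace[of "zariski n" W] unfolding topspace_zariski by blast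
    then obtain Q where Q: "Q \<in> proj_space n" "Q \<notin> zclosure (zariski n) W" by blast
    obtain F where F: "F \<subseteq> proj_forms n" "\<forall>x\<in>?C. ppt x \<in> zclosure (zariski n) W \<longleftrightarrow> (\<forall>f\<in>F. f x = 0)"
      using proj.closed_eq_zeros[of n "zclosure (zariski n) W", OF closedin_closure_of] by (elim exE conjE)
    obtain x where x: "Q = ppt x" "x \<in> ?C" using Q(1) unfolding proj_space_eq by blast
    then obtain f where f: "f \<in> F" "f x \<noteq> 0" using F(2) Q(2) by blast
    have fp: "f \<in> poly_funs {..n}" using f(1) F(1) unfolding proj_forms_def hom_funs_def by blast
    have irr: "irred {..n} (UNIV :: cvector set)" using irred_torus[of "{..n}" "{}"] by simp
    have nv: "\<not> vanishes UNIV g" if "g \<noteq> (\<lambda>u. 0)" for g :: "cvector \<Rightarrow> complex" using that unfolding vanishes_def by auto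
    have x0p: "(\<lambda>u. u 0) \<in> poly_funs {..n}" by (intro poly_funs.var) simp
    have x0: "\<not> vanishes UNIV (\<lambda>u :: cvector. u 0)" by (rule not_vanishesI[of "\<lambda>_. 1"]) auto
    \<comment> \<open>A form that vanishes on \<open>W\<close> but not at \<open>Q\<close> would
      have to be zero wherever all \<open>a p\<close> are nonzero, whereas a product of nonzero
      polynomials is nonzero somewhere. The factor \<open>u 0\<close> makes sure that the vector
      found represents a point.\<close>
    have "\<not> vanishes UNIV (\<lambda>u. u 0 * (f u * (\<Prod>p\<in>A. a p u)))"
      by (intro irred_mult[OF irr] irred_prod[OF irr fin] x0p x0 fp poly_funs.mult poly_funs_prod a nv)
         (use f(2) in auto)
    then obtain u where u: "u 0 \<noteq> 0" "f u \<noteq> 0" "\<forall>p\<in>A. a p u \<noteq> 0" unfolding vanishes_def using fin by auto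
    define v where "v i = (if i \<le> n then u i else 0)" for i
    have v: "v 0 \<noteq> 0" "f v \<noteq> 0" "\<forall>p\<in>A. a p v \<noteq> 0"
      using u poly_funs_cong[OF fp, of v u] poly_funs_cong[OF a(1), of _ v u] by (auto simp: v_def)
    have vC: "v \<in> ?C" using v(1) unfolding cvectors_def v_def by (auto dest: fun_cong[of _ _ 0])
    then have "ppt v \<in> W" using W_iff v(3) by blast
    then have "ppt v \<in> zclosure (zariski n) W" using closure_of_subset[of W "zariski n"] unfolding W_def by auto
    then show False using F(2) vC f(1) v(2) by blast
  qed
  ultimately show ?thesis by (intro exI[of _ W]) (auto simp: W_def)
qed

text \<open>Scale a point of the fibre so that some coordinate \<open>x j\<close> is 1. Every other
  coordinate is then a root of a one-variable polynomial given by the relation for its pair with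
  \<open>j\<close>, nonzero over the chosen open set; finitely many vectors remain.\<close>

lemma generically_finite_Lc: "generically_finite_to_one (zariski n) snd Lc"
proof -
  let ?A = "{p \<in> {..n} \<times> {..n}. fst p \<noteq> snd p}"
  have "\<exists>d. \<forall>p\<in>?A. \<exists>a k0. (\<forall>k. a k \<in> poly_funs {..n}) \<and> k0 \<le> d p \<and> a k0 \<noteq> (\<lambda>u. 0) \<and>
    (\<forall>z\<in>Lhat. (\<Sum>k\<le>d p. a k (z \<circ> Inr) * z (Inl (fst p)) ^ k * z (Inl (snd p)) ^ (d p - k)) = 0)"
  proof (rule bchoice, rule ballI)
    fix p assume "p \<in> ?A"
    then have "fst p \<le> n" "snd p \<le> n" "fst p \<noteq> snd p" by auto
    then show "\<exists>d a k0. (\<forall>k. a k \<in> poly_funs {..n}) \<and> k0 \<le> d \<and> a k0 \<noteq> (\<lambda>u. 0) \<and>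
      (\<forall>z\<in>Lhat. (\<Sum>k\<le>d. a k (z \<circ> Inr) * z (Inl (fst p)) ^ k * z (Inl (snd p)) ^ (d - k)) = 0)"
      by (rule coordinate_relation)
  qed
  then obtain d where "\<forall>p\<in>?A. \<exists>a k0. (\<forall>k. a k \<in> poly_funs {..n}) \<and> k0 \<le> d p \<and> a k0 \<noteq> (\<lambda>u. 0) \<and>
    (\<forall>z\<in>Lhat. (\<Sum>k\<le>d p. a k (z \<circ> Inr) * z (Inl (fst p)) ^ k * z (Inl (snd p)) ^ (d p - k)) = 0)" by (elim exE)
  then obtain a where "\<forall>p\<in>?A. \<exists>k0. (\<forall>k. a p k \<in> poly_funs {..n}) \<and> k0 \<le> d p \<and> a p k0 \<noteq> (\<lambda>u. 0) \<and>
    (\<forall>z\<in>Lhat. (\<Sum>k\<le>d p. a p k (z \<circ> Inr) * z (Inl (fst p)) ^ k * z (Inl (snd p)) ^ (d p - k)) = 0)"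
    by (rule bchoice[THEN exE])
  then obtain k0 where k0: "\<forall>p\<in>?A. (\<forall>k. a p k \<in> poly_funs {..n}) \<and> k0 p \<le> d p \<and> a p (k0 p) \<noteq> (\<lambda>u. 0) \<and>
    (\<forall>z\<in>Lhat. (\<Sum>k\<le>d p. a p k (z \<circ> Inr) * z (Inl (fst p)) ^ k * z (Inl (snd p)) ^ (d p - k)) = 0)"
    by (rule bchoice[THEN exE])
  have "finite ?A" by simp
  then have "\<exists>W. openin (zariski n) W \<and> zclosure (zariski n) W = topspace (zariski n) \<and>
    (\<forall>U\<in>W. U \<in> proj_space n \<and> (\<forall>p\<in>?A. \<exists>u\<in>cvectors n - {0}. ppt u = U \<and> a p (k0 p) u \<noteq> 0))"
    by (rule dense_open_nonvanishing) (use k0 in auto)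
  then obtain W where W: "openin (zariski n) W" "zclosure (zariski n) W = topspace (zariski n)"
    and WU: "\<forall>U\<in>W. U \<in> proj_space n \<and> (\<forall>p\<in>?A. \<exists>u\<in>cvectors n - {0}. ppt u = U \<and> a p (k0 p) u \<noteq> 0)"
    by (elim exE conjE)
  have "finite {e \<in> Lc. snd e = U}" if U: "U \<in> W" for U
  proof -
    have "\<forall>p\<in>?A. \<exists>u\<in>cvectors n - {0}. ppt u = U \<and> a p (k0 p) u \<noteq> 0" using WU U by blast
    \<comment> \<open>The representative of \<open>U\<close> may depend on the pair, since the
      coefficients are not homogeneous in \<open>u\<close>. Membership in \<open>Lhat\<close> does
      not depend on representatives, so each of them can be used with the same
      \<open>x\<close>.\<close>
    then obtain u where u: "\<forall>p\<in>?A. u p \<in> cvectors n - {0} \<and> ppt (u p) = U \<and> a p (k0 p) (u p) \<noteq> 0"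
      by (metis (no_types, lifting) bchoice)
    define Rt where "Rt p = {c. (\<Sum>k\<le>d p. a p k (u p) * c ^ k) = 0}" for p
    have finR: "finite (Rt p)" if p: "p \<in> ?A" for p
      unfolding Rt_def polyfun_finite_roots using u k0 p by blast
    let ?R = "insert 1 (\<Union>p\<in>?A. Rt p)"
    let ?F = "{x :: cvector. \<forall>i. (i \<in> {..n} \<longrightarrow> x i \<in> ?R) \<and> (i \<notin> {..n} \<longrightarrow> x i = 0)}"
    have "finite ?R" using finR by auto
    then have "finite ?F" by (intro finite_set_of_finite_funs) auto
    moreover have "{e \<in> Lc. snd e = U} \<subseteq> (\<lambda>x. (ppt x, U)) ` ?F"
    proof
      fix e assume e: "e \<in> {e \<in> Lc. snd e = U}"
      then have "e \<in> proj_space n \<times> proj_space n"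
        using closedin_subset[OF closed_Lc] unfolding topspace_bizariski by blast
      then obtain P where eP: "e = (P, U)" and "P \<in> proj_space n" using e by (cases e) auto
      then obtain y where y: "P = ppt y" "y \<in> cvectors n - {0}" unfolding proj_space_eq by blast
      obtain j where j: "j \<le> n" "y j \<noteq> 0" using cvectors_nonzero_coord[OF y(2)] .
      define x where "x i = inverse (y j) * y i" for i
      have xC: "x \<in> cvectors n - {0}" unfolding x_def[abs_def] by (rule cvectors_scale[OF y(2)]) (use j in simp)
      have Px: "P = ppt x" unfolding x_def[abs_def] y(1) using ppt_scale[of "inverse (y j)" y] j by simp
      have xj: "x j = 1" using j by (simp add: x_def)
      have "x i \<in> ?R" if i: "i \<le> n" for i
      proof (cases "i = j")
        case False
        let ?p = "(i, j)"
        have p: "?p \<in> ?A" using i j False by simp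
        then have up: "u ?p \<in> cvectors n - {0}" "ppt (u ?p) = U" using u by blast+
        have "case_sum x (u ?p) \<in> bi_vectors n n" unfolding bi_vectors_def using xC up(1) by simp
        moreover have "bippt (case_sum x (u ?p)) \<in> Lc" unfolding bippt_def using e eP Px up(2) by simp
        ultimately have "case_sum x (u ?p) \<in> Lhat" unfolding Lhat_def biproj.cone_def by blast
        then have "(\<Sum>k\<le>d ?p. a ?p k (u ?p) * x i ^ k * x j ^ (d ?p - k)) = 0" using k0 p by force
        then have "x i \<in> Rt ?p" unfolding Rt_def xj by simp
        then show ?thesis using p by blast
      qed (simp add: xj)
      then have "x \<in> ?F" using xC unfolding cvectors_def by auto
      then show "e \<in> (\<lambda>x. (ppt x, U)) ` ?F" unfolding eP Px by blast
    qed
    ultimately show ?thesis using finite_subset by blast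
  qed
  then show ?thesis unfolding generically_finite_to_one_def using W by blast
qed

end

section \<open>The projective bundle\<close>

lemma mem_proj_space:
  assumes "P \<in> proj_space n" "x \<in> P"
  shows "P = ppt x" "x \<in> cvectors n - {0}"
proof -
  obtain y where y: "P = ppt y" "y \<in> cvectors n - {0}" using assms(1) unfolding proj_space_eq by (rule imageE)
  then obtain c where c: "c \<noteq> 0" "x = (\<lambda>i. c * y i)" using assms(2) unfolding ppt_def by blast
  show "P = ppt x" unfolding y(1) c(2) ppt_scale[OF c(1)] ..
  show "x \<in> cvectors n - {0}" unfolding c(2) by (rule cvectors_scale[OF y(2) c(1)])
qed

text \<open>One bihomogeneous tuple valid on all of \<open>A\<close> suffices, with the whole
  product as the open neighbourhood.\<close>

lemma regular_mapI:
  assumes A: "A \<subseteq> proj_space n \<times> proj_space m" and h: "h \<in> A \<rightarrow> proj_space k"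
    and G: "\<And>j. j \<le> k \<Longrightarrow> G j \<in> bihom_funs n m d e"
    and hG: "\<And>x y. (ppt x, ppt y) \<in> A \<Longrightarrow> (\<lambda>j. if j \<le> k then G j (case_sum x y) else 0) \<in> h (ppt x, ppt y)"
  shows "regular_map n m k A h"
proof -
  have "\<exists>g. \<forall>j\<in>{..k}. g j \<in> biforms n m d e \<and> poly_eval (g j) = G j"
    using bihom_funs_imp_biforms[OF G] by (intro bchoice ballI) (metis atMost_iff)
  then obtain g where g: "\<forall>j\<in>{..k}. g j \<in> biforms n m d e \<and> poly_eval (g j) = G j" by (elim exE)
  have eq: "(\<lambda>j. if j \<le> k then poly_eval (g j) (case_sum x y) else 0) = (\<lambda>j. if j \<le> k then G j (case_sum x y) else 0)"
    for x y using g by auto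
  have pts: "\<forall>(P, Q)\<in>A. \<forall>x\<in>P. \<forall>y\<in>Q. (\<lambda>j. if j \<le> k then poly_eval (g j) (case_sum x y) else 0) \<in> h (P, Q)"
    unfolding eq
  proof (intro ballI, clarify)
    fix P Q x y assume PQ: "(P, Q) \<in> A" "x \<in> P" "y \<in> Q"
    then have "P = ppt x" "Q = ppt y" using mem_proj_space(1) A by blast+
    then show "(\<lambda>j. if j \<le> k then G j (case_sum x y) else 0) \<in> h (P, Q)" using hG PQ(1) by simp
  qed
  have op: "openin (bizariski n m) (proj_space n \<times> proj_space m)"
    using openin_topspace[of "bizariski n m"] by simp
  show ?thesis
    unfolding regular_map_def
  proof (intro conjI ballI h)
    fix a assume a: "a \<in> A"
    show "\<exists>W d e. \<exists>G :: nat \<Rightarrow> (nat + nat) cpoly.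
        openin (bizariski n m) W \<and> a \<in> W \<and> (\<forall>j\<le>k. G j \<in> biforms n m d e) \<and>
        (\<forall>(P, Q)\<in>A \<inter> W. \<forall>x\<in>P. \<forall>y\<in>Q. (\<lambda>j. if j \<le> k then poly_eval (G j) (case_sum x y) else 0) \<in> h (P, Q))"
      by (rule exI[of _ "proj_space n \<times> proj_space m"], rule exI[of _ d], rule exI[of _ e], rule exI[of _ g])
         (use op a A g pts in blast)
  qed
qed

lemma regular_funI:
  assumes A: "A \<subseteq> proj_space n" and F: "F \<in> hom_funs n d" and G: "G \<in> hom_funs n d"
    and h: "\<And>x. ppt x \<in> A \<Longrightarrow> G x \<noteq> 0 \<and> h (ppt x) = F x / G x"
  shows "regular_fun n A h"
proof -
  obtain f where f: "f \<in> forms n d" "poly_eval f = F" using F by (rule hom_funs_imp_forms)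
  obtain g where g: "g \<in> forms n d" "poly_eval g = G" using G by (rule hom_funs_imp_forms)
  have op: "openin (zariski n) (proj_space n)" using openin_topspace[of "zariski n"] by simp
  have pts: "poly_eval g x \<noteq> 0 \<and> h P = poly_eval f x / poly_eval g x" if "P \<in> A" "x \<in> P" for P x
  proof -
    have "P = ppt x" using mem_proj_space(1) A that by blast
    then show ?thesis using h that(1) unfolding f(2) g(2) by blast
  qed
  show ?thesis
    unfolding regular_fun_def
  proof
    fix P0 assume P0: "P0 \<in> A"
    show "\<exists>W d. \<exists>F\<in>forms n d. \<exists>G\<in>forms n d. openin (zariski n) W \<and> P0 \<in> W \<and>
      (\<forall>P\<in>A \<inter> W. \<forall>x\<in>P. poly_eval G x \<noteq> 0 \<and> h P = poly_eval F x / poly_eval G x)"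
      by (rule exI[of _ "proj_space n"], rule exI[of _ d], rule bexI[OF _ f(1)], rule bexI[OF _ g(1)])
         (use op P0 A pts in blast)
  qed
qed

text \<open>An arbitrary representative; homogeneity makes the maps defined through it independent
  of the choice.\<close>

definition rep :: "ppoint \<Rightarrow> cvector" where "rep P = (SOME x. x \<in> P)"

lemma rep_ppt: "\<exists>c. c \<noteq> 0 \<and> rep (ppt x) = (\<lambda>i. c * x i)"
proof -
  have "rep (ppt x) \<in> ppt x" unfolding rep_def by (rule someI[of "\<lambda>z. z \<in> ppt x", OF ppt_self])
  then show ?thesis unfolding ppt_def by blast
qed

lemma bihom_linear:
  assumes w: "\<And>l. l \<le> k \<Longrightarrow> w l \<in> hom_funs n d"
  shows "(\<lambda>z. \<Sum>l\<le>k. z (Inr l) * w l (z \<circ> Inl)) \<in> bihom_funs n k d 1"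
proof -
  let ?V = "Inl ` {..n} \<union> Inr ` {..k}"
  have "(\<lambda>z. w l (\<lambda>i. z (Inl i))) \<in> poly_funs ?V" if "l \<le> k" for l
    using poly_funs_comp[OF hom_poly[OF w[OF that]], of "\<lambda>i z. z (Inl i)" ?V] by (auto intro: poly_funs.var)
  then have "(\<lambda>z. \<Sum>l\<le>k. z (Inr l) * w l (z \<circ> Inl)) \<in> poly_funs ?V"
    by (intro poly_funs_sum poly_funs.mult poly_funs.var) (auto simp: comp_def)
  moreover have "(\<Sum>l\<le>k. c * y l * w l (\<lambda>i. b * x i)) = b ^ d * c * (\<Sum>l\<le>k. y l * w l x)" if "b \<noteq> 0" for b c x y
    unfolding sum_distrib_left by (intro sum.cong refl) (simp add: hom_scale[OF w that])
  ultimately show ?thesis unfolding bihom_funs_def by simp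
qed

section \<open>Local trivializations and their transition matrices\<close>

context likelihood_variety
begin

abbreviation "B \<equiv> smooth_locus n X - arrangement n"

definition chart_domain :: "(cvector \<Rightarrow> complex) \<Rightarrow> ppoint set" where
  "chart_domain \<Delta> = ppt ` {x\<in>B0. \<Delta> x \<noteq> 0}"

definition dual_comb :: "(nat \<Rightarrow> nat \<Rightarrow> cvector \<Rightarrow> complex) \<Rightarrow> cvector \<Rightarrow> cvector \<Rightarrow> cvector" where
  "dual_comb L x u = (\<lambda>l. if l \<le> m then \<Sum>k\<le>n. u k * L l k x else 0)"

definition chart_map :: "(nat \<Rightarrow> nat \<Rightarrow> cvector \<Rightarrow> complex) \<Rightarrow> ppoint \<times> ppoint \<Rightarrow> ppoint" where
  "chart_map W = (\<lambda>(P, T). ppt (comb W (rep P) (rep T)))"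

definition chart_inv :: "(nat \<Rightarrow> nat \<Rightarrow> cvector \<Rightarrow> complex) \<Rightarrow> ppoint \<times> ppoint \<Rightarrow> ppoint" where
  "chart_inv L = (\<lambda>(P, Q). ppt (dual_comb L (rep P) (rep Q)))"

text \<open>Other representatives multiply the combination by \<open>a ^ e * b\<close>, as
  \<open>W\<close> has degree \<open>e\<close> and the parameters enter linearly.\<close>

lemma chart_map_ppt:
  assumes c: "chart e \<tau> W L \<Delta>"
  shows "chart_map W (ppt x, ppt y) = ppt (comb W x y)"
proof -
  obtain a b where a: "a \<noteq> 0" "rep (ppt x) = (\<lambda>i. a * x i)" and b: "b \<noteq> 0" "rep (ppt y) = (\<lambda>i. b * y i)"
    using rep_ppt by blast
  have "comb W (\<lambda>i. a * x i) (\<lambda>i. b * y i) = (\<lambda>i. (a ^ e * b) * comb W x y i)"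
  proof
    fix i
    show "comb W (\<lambda>i. a * x i) (\<lambda>i. b * y i) i = (a ^ e * b) * comb W x y i"
    proof (cases "i \<le> n")
      case True
      have "(\<Sum>l\<le>m. (b * y l) * W l i (\<lambda>i. a * x i)) = (\<Sum>l\<le>m. (a ^ e * b) * (y l * W l i x))"
        by (intro sum.cong refl) (simp add: hom_scale[OF chartD(1)[OF c _ True] a(1)])
      then show ?thesis using True unfolding comb_def by (simp add: sum_distrib_left)
    qed (simp add: comb_def)
  qed
  then show ?thesis using ppt_scale[of "a ^ e * b" "comb W x y"] a b by (simp add: chart_map_def)
qed

lemma chart_inv_ppt:
  assumes c: "chart e \<tau> W L \<Delta>"
  shows "chart_inv L (ppt x, ppt u) = ppt (dual_comb L x u)"
proof -
  obtain a b where a: "a \<noteq> 0" "rep (ppt x) = (\<lambda>i. a * x i)" and b: "b \<noteq> 0" "rep (ppt u) = (\<lambda>i. b * u i)"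
    using rep_ppt by blast
  have "dual_comb L (\<lambda>i. a * x i) (\<lambda>i. b * u i) = (\<lambda>i. (a ^ \<tau> * b) * dual_comb L x u i)"
  proof
    fix l
    show "dual_comb L (\<lambda>i. a * x i) (\<lambda>i. b * u i) l = (a ^ \<tau> * b) * dual_comb L x u l"
    proof (cases "l \<le> m")
      case True
      have "(\<Sum>k\<le>n. (b * u k) * L l k (\<lambda>i. a * x i)) = (\<Sum>k\<le>n. (a ^ \<tau> * b) * (u k * L l k x))"
        by (intro sum.cong refl) (simp add: hom_scale[OF chartD(2)[OF c True] a(1)])
      then show ?thesis using True unfolding dual_comb_def by (simp add: sum_distrib_left)
    qed (simp add: dual_comb_def)
  qed
  then show ?thesis using ppt_scale[of "a ^ \<tau> * b" "dual_comb L x u"] a b by (simp add: chart_inv_def)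
qed

text \<open>\<open>L\<close> inverts the frame up to the scalar \<open>\<Delta> x\<close>, which is
  invisible in projective space.\<close>

lemma dual_comb_comb:
  assumes c: "chart e \<tau> W L \<Delta>" and x: "x \<in> S" and t: "t \<in> cvectors m"
  shows "dual_comb L x (comb W x t) = (\<lambda>l. \<Delta> x * t l)"
proof
  fix l
  show "dual_comb L x (comb W x t) l = \<Delta> x * t l"
    using L_comb[OF c x, of l t] t unfolding dual_comb_def cvectors_def by (simp add: mult.commute)
qed

lemma comb_nonzero:
  assumes c: "chart e \<tau> W L \<Delta>" and x: "x \<in> S" "\<Delta> x \<noteq> 0" and t: "t \<in> cvectors m - {0}"
  shows "comb W x t \<in> cvectors n - {0}"
proof -
  have "comb W x t \<noteq> 0"
  proof
    assume "comb W x t = 0"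
    moreover have "dual_comb L x (comb W x t) = (\<lambda>l. \<Delta> x * t l)" using t by (intro dual_comb_comb[OF c x(1)]) blast
    ultimately have "(\<lambda>l. \<Delta> x * t l) = dual_comb L x 0" by metis
    then have "\<Delta> x * t l = 0" for l by (simp add: dual_comb_def fun_eq_iff)
    then have "t = 0" using x(2) by (auto simp: fun_eq_iff)
    then show False using t by blast
  qed
  then show ?thesis using comb_cvectors by blast
qed

lemma chart_domainE:
  assumes "ppt x \<in> chart_domain \<Delta>" "\<Delta> \<in> hom_funs n d"
  shows "x \<in> B0" "\<Delta> x \<noteq> 0"
proof -
  obtain y where "y \<in> B0" "\<Delta> y \<noteq> 0" "ppt y = ppt x" using assms(1) unfolding chart_domain_def by auto
  then obtain c where "c \<noteq> 0" "x = (\<lambda>i. c * y i)" using ppt_eq_iff[of y x] by blast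
  then show "x \<in> B0" "\<Delta> x \<noteq> 0"
    using B0_scale[OF \<open>y \<in> B0\<close>] hom_scale[OF assms(2)] \<open>\<Delta> y \<noteq> 0\<close> by auto
qed

lemma B0_cvectors: "x \<in> B0 \<Longrightarrow> x \<in> cvectors n - {0}"
  using B0_S S_iff by blast

lemma chart_domain_sub: "chart_domain \<Delta> \<subseteq> B" "chart_domain \<Delta> \<subseteq> proj_space n"
  unfolding chart_domain_def proj_space_eq using B0_iff B0_S B0_cvectors by blast+

lemma chart_domain_open:
  assumes \<Delta>: "\<Delta> \<in> hom_funs n d"
  shows "openin (subtopology (zariski n) B) (chart_domain \<Delta>)"
proof -
  let ?Z = "ppt ` {x\<in>cvectors n - {0}. \<forall>f\<in>{\<Delta>}. f x = 0}"
  have "closedin (zariski n) ?Z"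
    by (rule proj.closed_zeros) (use \<Delta> in \<open>auto simp: proj_forms_def\<close>)
  then have "openin (zariski n) (topspace (zariski n) - ?Z)" by (rule openin_diff[OF openin_topspace])
  then have op: "openin (zariski n) (proj_space n - ?Z)" unfolding topspace_zariski .
  have "chart_domain \<Delta> = (proj_space n - ?Z) \<inter> B"
  proof (intro equalityI subsetI)
    fix P assume P: "P \<in> chart_domain \<Delta>"
    have "P \<notin> ?Z"
    proof
      assume "P \<in> ?Z"
      then obtain x where "P = ppt x" "\<Delta> x = 0" by blast
      then show False using chart_domainE(2)[OF _ \<Delta>] P by blast
    qed
    moreover have P1: "P \<in> proj_space n" using chart_domain_sub(2) P by (rule subsetD)
    moreover have P2: "P \<in> B" using chart_domain_sub(1) P by (rule subsetD)
    ultimately show "P \<in> (proj_space n - ?Z) \<inter> B" by (intro IntI[OF DiffI[OF P1] P2])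
  next
    fix P assume P: "P \<in> (proj_space n - ?Z) \<inter> B"
    then obtain x where x: "x \<in> B0" "P = ppt x" using B_rep by blast
    then have "\<Delta> x \<noteq> 0" using P B0_cvectors by blast
    then show "P \<in> chart_domain \<Delta>" unfolding chart_domain_def using x by blast
  qed
  then show ?thesis using op unfolding openin_subtopology by blast
qed

lemma Lc_sub: "Lc \<subseteq> proj_space n \<times> proj_space n"
  using closedin_subset[OF closed_Lc] by simp

lemma Lc_over_chart:
  assumes c: "chart e \<tau> W L \<Delta>" and PQ: "(ppt x, ppt u) \<in> Lc" and P: "ppt x \<in> chart_domain \<Delta>"
  obtains t where "t \<in> cvectors m - {0}" "u = comb W x t"
proof -
  note x = chart_domainE[OF P chartD(3)[OF c]]
  have "ppt u \<in> proj_space n" using PQ Lc_sub by blast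
  then have u: "u \<in> cvectors n - {0}" using mem_proj_space(2) ppt_self by blast
  have "crit x u" by (rule Lc_over_B[OF x(1) u PQ])
  then obtain t where t: "u = comb W x t" using chartD(6)[OF c x] u by blast
  \<comment> \<open>Parameters beyond \<open>m\<close> do not enter \<open>comb\<close>; cutting
    them off yields a vector that represents a point of the model fibre.\<close>
  define t' where "t' l = (if l \<le> m then t l else 0)" for l
  have ut: "u = comb W x t'" unfolding t comb_def t'_def by (intro ext) simp
  have "t' \<noteq> 0"
  proof
    assume "t' = 0"
    then have "u = 0" unfolding ut comb_def by (simp add: fun_eq_iff)
    then show False using u by blast
  qed
  then have "t' \<in> cvectors m - {0}" unfolding cvectors_def t'_def by auto
  then show ?thesis using that ut by blast
qed

text \<open>Both maps are given on the whole domain by tuples that are linear in the second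
  argument. They are mutually inverse because \<open>L\<close> inverts \<open>W\<close> up to a
  scalar and because every point of the closure over the chart is a frame combination.\<close>

lemma chart_trivialization:
  assumes c: "chart e \<tau> W L \<Delta>"
  shows "trivialization n n Lc m (chart_domain \<Delta>) (chart_map W) (chart_inv L)"
proof -
  note dom = chart_domainE[OF _ chartD(3)[OF c]]
  have pt: "ppt x \<in> proj_space k \<Longrightarrow> x \<in> cvectors k - {0}" for x k using mem_proj_space(2) ppt_self by blast
  have img: "chart_map W (P, T) \<in> proj_space n \<and> (P, chart_map W (P, T)) \<in> Lc \<and>
      chart_inv L (P, chart_map W (P, T)) = T"
    if PT: "P \<in> chart_domain \<Delta>" "T \<in> proj_space m" for P T
  proof -
    obtain x where x: "P = ppt x" using PT(1) unfolding chart_domain_def by blast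
    obtain y where y: "T = ppt y" "y \<in> cvectors m - {0}" using PT(2) unfolding proj_space_eq by blast
    have xB: "x \<in> B0" "\<Delta> x \<noteq> 0" using dom PT(1) x by blast+
    let ?u = "comb W x y"
    have u: "?u \<in> cvectors n - {0}" by (rule comb_nonzero[OF c B0_S[OF xB(1)] xB(2) y(2)])
    have "(ppt x, ppt ?u) \<in> critical_pairs n X"
      using critical_pairs_iff[OF B0_cvectors[OF xB(1)] u] xB(1) chartD(5)[OF c xB(1)] by blast
    then have "(ppt x, ppt ?u) \<in> Lc" using critical_sub_Lc by blast
    moreover have "ppt (dual_comb L x ?u) = ppt y"
      using dual_comb_comb[OF c B0_S[OF xB(1)], of y] y(2) ppt_scale[OF xB(2), of y] by simp
    moreover have "ppt ?u \<in> proj_space n" using u unfolding proj_space_eq by blast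
    ultimately show ?thesis unfolding x y(1) chart_map_ppt[OF c] chart_inv_ppt[OF c] by blast
  qed
  have inv: "chart_inv L (P, Q) \<in> proj_space m \<and> chart_map W (P, chart_inv L (P, Q)) = Q"
    if PQ: "(P, Q) \<in> Lc" "P \<in> chart_domain \<Delta>" for P Q
  proof -
    have "P \<in> proj_space n" "Q \<in> proj_space n" using PQ(1) Lc_sub by auto
    then obtain x u where xu: "P = ppt x" "Q = ppt u" unfolding proj_space_eq by blast
    have xB: "x \<in> B0" "\<Delta> x \<noteq> 0" using dom PQ(2) xu(1) by blast+
    obtain t where t: "t \<in> cvectors m - {0}" "u = comb W x t"
      using Lc_over_chart[OF c PQ(1)[unfolded xu] PQ(2)[unfolded xu]] .
    have "dual_comb L x u = (\<lambda>l. \<Delta> x * t l)" unfolding t(2) using dual_comb_comb[OF c B0_S[OF xB(1)]] t(1) by blast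
    then have "ppt (dual_comb L x u) = ppt t" using ppt_scale[OF xB(2)] by simp
    then have "chart_inv L (P, Q) = ppt t" unfolding xu chart_inv_ppt[OF c] .
    moreover have "ppt t \<in> proj_space m" using t(1) unfolding proj_space_eq by blast
    ultimately show ?thesis unfolding xu(1) using chart_map_ppt[OF c, of x t] t(2) xu(2) by simp
  qed
  have "regular_map n m n (chart_domain \<Delta> \<times> proj_space m) (chart_map W)"
  proof (rule regular_mapI)
    show "chart_domain \<Delta> \<times> proj_space m \<subseteq> proj_space n \<times> proj_space m" using chart_domain_sub(2) by blast
    show "chart_map W \<in> chart_domain \<Delta> \<times> proj_space m \<rightarrow> proj_space n" using img by blast
    show "(\<lambda>z. \<Sum>l\<le>m. z (Inr l) * W l j (z \<circ> Inl)) \<in> bihom_funs n m e 1" if "j \<le> n" for j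
      by (rule bihom_linear) (rule chartD(1)[OF c _ that])
    fix x y
    show "(\<lambda>j. if j \<le> n then \<Sum>l\<le>m. case_sum x y (Inr l) * W l j (case_sum x y \<circ> Inl) else 0)
        \<in> chart_map W (ppt x, ppt y)"
      unfolding chart_map_ppt[OF c] case_sum_comp_Inl sum.case using ppt_self[of "comb W x y"] unfolding comb_def .
  qed
  moreover have "regular_map n n m {p \<in> Lc. fst p \<in> chart_domain \<Delta>} (chart_inv L)"
  proof (rule regular_mapI)
    show "{p \<in> Lc. fst p \<in> chart_domain \<Delta>} \<subseteq> proj_space n \<times> proj_space n" using Lc_sub by blast
    show "chart_inv L \<in> {p \<in> Lc. fst p \<in> chart_domain \<Delta>} \<rightarrow> proj_space m" using inv by auto
    show "(\<lambda>z. \<Sum>k\<le>n. z (Inr k) * L j k (z \<circ> Inl)) \<in> bihom_funs n n \<tau> 1" if "j \<le> m" for j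
      by (rule bihom_linear) (rule chartD(2)[OF c that])
    fix x u
    show "(\<lambda>j. if j \<le> m then \<Sum>k\<le>n. case_sum x u (Inr k) * L j k (case_sum x u \<circ> Inl) else 0)
        \<in> chart_inv L (ppt x, ppt u)"
      unfolding chart_inv_ppt[OF c] case_sum_comp_Inl sum.case using ppt_self[of "dual_comb L x u"] unfolding dual_comb_def .
  qed
  ultimately show ?thesis unfolding trivialization_def using img inv by blast
qed

text \<open>
  The frames \<open>W / x\<^sub>0\<^bsup>e\<^esup>\<close> are homogeneous of degree \<open>0\<close>, so their transition matrices form a cocycle of
  regular functions.
\<close>

definition transition :: "nat \<Rightarrow> (nat \<Rightarrow> nat \<Rightarrow> cvector \<Rightarrow> complex) \<Rightarrow> nat \<Rightarrow> (nat \<Rightarrow> nat \<Rightarrow> cvector \<Rightarrow> complex) \<Rightarrow>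
    (cvector \<Rightarrow> complex) \<Rightarrow> cvector \<Rightarrow> nat \<Rightarrow> nat \<Rightarrow> complex" where
  "transition e W e' L' \<Delta>' x i j =
     ((\<Sum>k\<le>n. L' i k x * W j k x) * x 0 ^ e') / (x 0 ^ e * \<Delta>' x)"

lemma transition_hom:
  assumes c: "chart e \<tau> W L \<Delta>" and c': "chart e' \<tau>' W' L' \<Delta>'" and ij: "i \<le> m" "j \<le> m"
  shows "(\<lambda>x. (\<Sum>k\<le>n. L' i k x * W j k x) * x 0 ^ e') \<in> hom_funs n (\<tau>' + e + e')"
    "(\<lambda>x. x 0 ^ e * \<Delta>' x) \<in> hom_funs n (\<tau>' + e + e')"
proof -
  have x0: "(\<lambda>x. x 0 ^ k) \<in> hom_funs n k" for k using hom_power[OF hom_var[of 0 n], of k] by simp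
  show "(\<lambda>x. (\<Sum>k\<le>n. L' i k x * W j k x) * x 0 ^ e') \<in> hom_funs n (\<tau>' + e + e')"
    by (intro hom_mult hom_sum x0 chartD(2)[OF c' ij(1)] chartD(1)[OF c ij(2)]) auto
  have "(\<lambda>x. x 0 ^ e * \<Delta>' x) \<in> hom_funs n (e + (e' + \<tau>'))"
    by (intro hom_mult x0 chartD(3)[OF c'])
  then show "(\<lambda>x. x 0 ^ e * \<Delta>' x) \<in> hom_funs n (\<tau>' + e + e')" by (simp add: add_ac)
qed

lemma transition_rep:
  assumes c: "chart e \<tau> W L \<Delta>" and c': "chart e' \<tau>' W' L' \<Delta>'" and ij: "i \<le> m" "j \<le> m"
  shows "transition e W e' L' \<Delta>' (rep (ppt x)) i j = transition e W e' L' \<Delta>' x i j"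
proof -
  obtain b where b: "b \<noteq> 0" "rep (ppt x) = (\<lambda>i. b * x i)" using rep_ppt by blast
  show ?thesis
    unfolding b(2) transition_def
      hom_scale[OF transition_hom(1)[OF c c' ij] b(1), of x]
      hom_scale[OF transition_hom(2)[OF c c' ij] b(1), of x]
    using b(1) by simp
qed

text \<open>The frame vectors of one chart are critical data, so the other frame expresses them,
  with coordinates read off by \<open>L'\<close> up to the factor \<open>\<Delta>'\<close>.\<close>

lemma frame_expansion:
  assumes c: "chart e \<tau> W L \<Delta>" and c': "chart e' \<tau>' W' L' \<Delta>'" and x: "x \<in> B0" "\<Delta>' x \<noteq> 0"
    and j: "j \<le> m" and i: "i \<le> n"
  shows "\<Delta>' x * W j i x = (\<Sum>l\<le>m. (\<Sum>k\<le>n. L' l k x * W j k x) * W' l i x)"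
proof -
  let ?u = "comb W x (\<lambda>l. if l = j then 1 else 0)"
  have u: "?u k = W j k x" if "k \<le> n" for k
  proof -
    have "?u k = (\<Sum>l\<le>m. if l = j then W j k x else 0)" unfolding comb_def if_P[OF that] by (intro sum.cong refl) auto
    then show ?thesis using j by simp
  qed
  have "\<exists>t. ?u = comb W' x t" by (rule chartD(6)[OF c' x comb_cvectors chartD(5)[OF c x(1)]])
  then obtain t where t: "?u = comb W' x t" by (elim exE)
  have Lt: "(\<Sum>k\<le>n. L' l k x * W j k x) = \<Delta>' x * t l" if "l \<le> m" for l
    using L_comb[OF c' B0_S[OF x(1)] that, of t] u unfolding t[symmetric] by simp
  have "W j i x = (\<Sum>l\<le>m. t l * W' l i x)" using fun_cong[OF t, of i] u[OF i] i by (simp add: comb_def)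
  then show ?thesis using Lt by (simp add: sum_distrib_left mult.assoc)
qed

lemma B0_x0: "x \<in> B0 \<Longrightarrow> x 0 \<noteq> 0"
  unfolding B0_def h_nonzero by auto

lemma transition_refl:
  assumes c: "chart e \<tau> W L \<Delta>" and x: "x \<in> B0" "\<Delta> x \<noteq> 0" and ij: "i \<le> m" "j \<le> m"
  shows "transition e W e L \<Delta> x i j = (if i = j then 1 else 0)"
  unfolding transition_def chartD(4)[OF c B0_S[OF x(1)] ij] using x(2) B0_x0[OF x(1)] by simp

text \<open>Expand the first frame in the second and apply the third left inverse; the powers of
  \<open>x 0\<close> that bring the frames to degree 0 telescope.\<close>

lemma transition_cocycle:
  assumes c: "chart e \<tau> W L \<Delta>" and c': "chart e' \<tau>' W' L' \<Delta>'" and c'': "chart e'' \<tau>'' W'' L'' \<Delta>''"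
    and x: "x \<in> B0" "\<Delta>' x \<noteq> 0" "\<Delta>'' x \<noteq> 0" and ik: "i \<le> m" "k \<le> m"
  shows "transition e W e'' L'' \<Delta>'' x i k =
    (\<Sum>j\<le>m. transition e' W' e'' L'' \<Delta>'' x i j * transition e W e' L' \<Delta>' x j k)"
proof -
  have x0: "x 0 \<noteq> 0" by (rule B0_x0[OF x(1)])
  let ?p = "\<lambda>j. \<Sum>q\<le>n. L'' i q x * W' j q x" and ?r = "\<lambda>j. \<Sum>q\<le>n. L' j q x * W k q x"
  have "\<Delta>' x * (\<Sum>q\<le>n. L'' i q x * W k q x) = (\<Sum>q\<le>n. L'' i q x * (\<Delta>' x * W k q x))"
    by (simp add: sum_distrib_left mult_ac)
  also have "\<dots> = (\<Sum>q\<le>n. \<Sum>j\<le>m. L'' i q x * (?r j * W' j q x))"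
    using frame_expansion[OF c c' x(1,2) ik(2)] by (intro sum.cong refl) (simp add: sum_distrib_left)
  also have "\<dots> = (\<Sum>j\<le>m. ?p j * ?r j)"
    by (subst sum.swap) (simp add: sum_distrib_left sum_distrib_right mult_ac)
  finally have e: "(\<Sum>q\<le>n. L'' i q x * W k q x) = (\<Sum>j\<le>m. ?p j * ?r j) / \<Delta>' x" using x(2) by (simp add: field_simps)
  have "(\<Sum>j\<le>m. transition e' W' e'' L'' \<Delta>'' x i j * transition e W e' L' \<Delta>' x j k) =
      (\<Sum>j\<le>m. ?p j * ?r j * (x 0 ^ e'' / (\<Delta>'' x * \<Delta>' x * x 0 ^ e)))"
    unfolding transition_def using x0 by (intro sum.cong refl) (simp add: field_simps)
  also have "\<dots> = (\<Sum>j\<le>m. ?p j * ?r j) * (x 0 ^ e'' / (\<Delta>'' x * \<Delta>' x * x 0 ^ e))"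
    by (simp only: sum_distrib_right)
  also have "\<dots> = transition e W e'' L'' \<Delta>'' x i k"
    unfolding transition_def e by (simp add: field_simps)
  finally show ?thesis by simp
qed

text \<open>The matrix acts as \<open>dual_comb L' x\<close> after \<open>comb W x\<close>, up to
  the nonzero scalar \<open>?q\<close>, and so realizes the change of trivialization on projective
  points.\<close>

lemma transition_coords:
  assumes c: "chart e \<tau> W L \<Delta>" and c': "chart e' \<tau>' W' L' \<Delta>'" and x: "x \<in> B0" "\<Delta>' x \<noteq> 0"
  shows "(\<lambda>i. if i \<le> m then \<Sum>j\<le>m. transition e W e' L' \<Delta>' x i j * y j else 0) \<in> ppt (dual_comb L' x (comb W x y))"
proof -
  have x0: "x 0 \<noteq> 0" by (rule B0_x0[OF x(1)])
  let ?q = "x 0 ^ e' / (x 0 ^ e * \<Delta>' x)"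
  have "(\<Sum>j\<le>m. transition e W e' L' \<Delta>' x i j * y j) = ?q * dual_comb L' x (comb W x y) i" if i: "i \<le> m" for i
  proof -
    have "dual_comb L' x (comb W x y) i = (\<Sum>k\<le>n. \<Sum>j\<le>m. L' i k x * (y j * W j k x))"
      using i unfolding dual_comb_def comb_def by (simp add: sum_distrib_left sum_distrib_right mult_ac)
    also have "\<dots> = (\<Sum>j\<le>m. (\<Sum>k\<le>n. L' i k x * W j k x) * y j)"
      by (subst sum.swap) (simp add: sum_distrib_left sum_distrib_right mult_ac)
    finally have d: "dual_comb L' x (comb W x y) i = (\<Sum>j\<le>m. (\<Sum>k\<le>n. L' i k x * W j k x) * y j)" .
    show ?thesis
      unfolding transition_def d sum_distrib_left[of ?q] by (intro sum.cong refl) simp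
  qed
  then have "(\<lambda>i. if i \<le> m then \<Sum>j\<le>m. transition e W e' L' \<Delta>' x i j * y j else 0) =
      (\<lambda>i. ?q * dual_comb L' x (comb W x y) i)"
    by (auto simp: fun_eq_iff dual_comb_def)
  moreover have "?q \<noteq> 0" using x0 x(2) by simp
  ultimately show ?thesis unfolding ppt_def by blast
qed

lemma projective_bundle_Lc: "projective_bundle_over n n Lc B"
proof -
  \<comment> \<open>All data of a chart are packed into one tuple, so that a single choice yields a
    family of charts indexed by the points of the base.\<close>
  have "\<forall>a\<in>B. \<exists>q. case q of (e, \<tau>, W, L, \<Delta>) \<Rightarrow> chart e \<tau> W L \<Delta> \<and> a \<in> chart_domain \<Delta>"
  proof
    fix a assume "a \<in> B"
    then obtain x where x: "x \<in> B0" "a = ppt x" using B_rep by blast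
    obtain e \<tau> W L \<Delta> where c: "chart e \<tau> W L \<Delta>" and "\<Delta> x \<noteq> 0" using chart_exists[OF x(1)] by (elim exE conjE)
    then have "a \<in> chart_domain \<Delta>" unfolding chart_domain_def x(2) using x(1) by blast
    then show "\<exists>q. case q of (e, \<tau>, W, L, \<Delta>) \<Rightarrow> chart e \<tau> W L \<Delta> \<and> a \<in> chart_domain \<Delta>"
      using c by (intro exI[of _ "(e, \<tau>, W, L, \<Delta>)"]) simp
  qed
  from bchoice[OF this] obtain q where
    q: "\<forall>a\<in>B. case q a of (e, \<tau>, W, L, \<Delta>) \<Rightarrow> chart e \<tau> W L \<Delta> \<and> a \<in> chart_domain \<Delta>" by (elim exE)
  define e where "e a = fst (q a)" for a
  define \<tau> where "\<tau> a = fst (snd (q a))" for a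
  define W where "W a = fst (snd (snd (q a)))" for a
  define L where "L a = fst (snd (snd (snd (q a))))" for a
  define \<Delta> where "\<Delta> a = snd (snd (snd (snd (q a))))" for a
  have c: "chart (e a) (\<tau> a) (W a) (L a) (\<Delta> a)" and dom: "a \<in> chart_domain (\<Delta> a)" if "a \<in> B" for a
    using bspec[OF q that] unfolding e_def \<tau>_def W_def L_def \<Delta>_def by (auto simp: case_prod_beta)
  define g where "g a b P i j = transition (e a) (W a) (e b) (L b) (\<Delta> b) (rep P) i j" for a b P i j
  have g_ppt: "g a b (ppt x) i j = transition (e a) (W a) (e b) (L b) (\<Delta> b) x i j"
    if "a \<in> B" "b \<in> B" "i \<le> m" "j \<le> m" for a b x i j
    unfolding g_def by (rule transition_rep[OF c[OF that(1)] c[OF that(2)] that(3,4)])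
  have inU: "x \<in> B0" "\<Delta> a x \<noteq> 0" if "a \<in> B" "ppt x \<in> chart_domain (\<Delta> a)" for a x
    using chart_domainE[OF that(2) chartD(3)[OF c[OF that(1)]]] by auto
  have Prep: "\<exists>x. P = ppt x" if "P \<in> chart_domain (\<Delta> a)" for P a
    using that unfolding chart_domain_def by blast
  have reg: "regular_fun n (chart_domain (\<Delta> a) \<inter> chart_domain (\<Delta> b)) (\<lambda>P. g a b P i j)"
    if ab: "a \<in> B" "b \<in> B" and ij: "i \<le> m" "j \<le> m" for a b i j
  proof (rule regular_funI[OF _ transition_hom[OF c[OF ab(1)] c[OF ab(2)] ij]])
    show "chart_domain (\<Delta> a) \<inter> chart_domain (\<Delta> b) \<subseteq> proj_space n" using chart_domain_sub(2) by blast
    fix x assume x: "ppt x \<in> chart_domain (\<Delta> a) \<inter> chart_domain (\<Delta> b)"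
    then have "x 0 \<noteq> 0" "\<Delta> b x \<noteq> 0" using inU[OF ab(2), of x] B0_x0 by auto
    then show "x 0 ^ e a * \<Delta> b x \<noteq> 0 \<and>
      g a b (ppt x) i j = (\<Sum>k\<le>n. L b i k x * W a j k x) * x 0 ^ e b / (x 0 ^ e a * \<Delta> b x)"
      unfolding g_ppt[OF ab ij] transition_def by simp
  qed
  have g_refl: "g a a P i j = (if i = j then 1 else 0)"
    if a: "a \<in> B" and P: "P \<in> chart_domain (\<Delta> a)" and ij: "i \<le> m" "j \<le> m" for a P i j
  proof -
    obtain x where x: "P = ppt x" using Prep[OF P] by blast
    show ?thesis unfolding x g_ppt[OF a a ij]
      by (rule transition_refl[OF c[OF a] inU[OF a P[unfolded x]] ij])
  qed
  have coc: "g a d P i k = (\<Sum>j\<le>m. g b d P i j * g a b P j k)"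
    if abd: "a \<in> B" "b \<in> B" "d \<in> B" and P: "P \<in> chart_domain (\<Delta> a) \<inter> chart_domain (\<Delta> b) \<inter> chart_domain (\<Delta> d)"
      and ik: "i \<le> m" "k \<le> m" for a b d P i k
  proof -
    obtain x where x: "P = ppt x" using Prep P by blast
    have xU: "x \<in> B0" "\<Delta> b x \<noteq> 0" "\<Delta> d x \<noteq> 0" using inU abd P x by blast+
    have "(\<Sum>j\<le>m. g b d P i j * g a b P j k) = (\<Sum>j\<le>m. transition (e b) (W b) (e d) (L d) (\<Delta> d) x i j *
        transition (e a) (W a) (e b) (L b) (\<Delta> b) x j k)"
      unfolding x
    proof (intro sum.cong refl)
      fix j assume "j \<in> {..m}"
      then have j: "j \<le> m" by simp
      show "g b d (ppt x) i j * g a b (ppt x) j k = transition (e b) (W b) (e d) (L d) (\<Delta> d) x i j *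
        transition (e a) (W a) (e b) (L b) (\<Delta> b) x j k"
        unfolding g_ppt[OF abd(2,3) ik(1) j] g_ppt[OF abd(1,2) j ik(2)] ..
    qed
    then show ?thesis
      using transition_cocycle[OF c[OF abd(1)] c[OF abd(2)] c[OF abd(3)] xU ik] g_ppt[OF abd(1,3) ik] x by simp
  qed
  have act: "(\<lambda>i. if i \<le> m then (\<Sum>j\<le>m. g a b P i j * y j) else 0) \<in> chart_inv (L b) (P, chart_map (W a) (P, T))"
    if ab: "a \<in> B" "b \<in> B" and P: "P \<in> chart_domain (\<Delta> a) \<inter> chart_domain (\<Delta> b)"
      and T: "T \<in> proj_space m" "y \<in> T" for a b P T y
  proof -
    obtain x where x: "P = ppt x" using Prep P by blast
    have xU: "x \<in> B0" "\<Delta> b x \<noteq> 0" using inU ab P x by blast+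
    have Ty: "T = ppt y" by (rule mem_proj_space(1)[OF T])
    have "(\<lambda>i. if i \<le> m then (\<Sum>j\<le>m. g a b P i j * y j) else 0) =
      (\<lambda>i. if i \<le> m then \<Sum>j\<le>m. transition (e a) (W a) (e b) (L b) (\<Delta> b) x i j * y j else 0)"
    proof
      fix i
      have "(\<Sum>j\<le>m. g a b P i j * y j) = (\<Sum>j\<le>m. transition (e a) (W a) (e b) (L b) (\<Delta> b) x i j * y j)"
        if i: "i \<le> m"
      proof (intro sum.cong refl)
        fix j assume "j \<in> {..m}"
        then have j: "j \<le> m" by simp
        show "g a b P i j * y j = transition (e a) (W a) (e b) (L b) (\<Delta> b) x i j * y j"
          unfolding x g_ppt[OF ab i j] ..
      qed
      then show "(if i \<le> m then (\<Sum>j\<le>m. g a b P i j * y j) else 0) =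
        (if i \<le> m then \<Sum>j\<le>m. transition (e a) (W a) (e b) (L b) (\<Delta> b) x i j * y j else 0)"
        by (rule if_cong[OF refl _ refl])
    qed
    then show ?thesis
      unfolding x Ty chart_map_ppt[OF c[OF ab(1)]] chart_inv_ppt[OF c[OF ab(2)]]
      using transition_coords[OF c[OF ab(1)] c[OF ab(2)] xU, of y] by simp
  qed
  show ?thesis
    unfolding projective_bundle_over_def
  proof (rule exI[of _ m], rule exI[of _ "\<lambda>a. chart_domain (\<Delta> a)"], rule exI[of _ "\<lambda>a. chart_map (W a)"],
      rule exI[of _ "\<lambda>a. chart_inv (L a)"], rule exI[of _ g], intro conjI ballI allI impI)
    fix a assume a: "a \<in> B"
    show "a \<in> chart_domain (\<Delta> a)" by (rule dom[OF a])
    show "openin (subtopology (zariski n) B) (chart_domain (\<Delta> a))" by (rule chart_domain_open[OF chartD(3)[OF c[OF a]]])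
    show "trivialization n n Lc m (chart_domain (\<Delta> a)) (chart_map (W a)) (chart_inv (L a))"
      by (rule chart_trivialization[OF c[OF a]])
  qed (fact reg g_refl coc act)+
qed

end

theorem theorem1p6:
  fixes n :: nat and X :: "ppoint set"
  assumes "closedin (zariski n) X"
    and "irreducible_in (zariski n) X"
    and "defined_over_reals n X"
    and "\<not> X \<subseteq> arrangement n"
  shows "closedin (bizariski n n) (likelihood_correspondence n X) \<and>
         irreducible_in (bizariski n n) (likelihood_correspondence n X) \<and>
         krull_dim (subtopology (bizariski n n) (likelihood_correspondence n X)) = enat n \<and>
         projective_bundle_over n n (likelihood_correspondence n X)
           (smooth_locus n X - arrangement n) \<and>
         generically_finite_to_one (zariski n) snd (likelihood_correspondence n X)"
proof -
  interpret likelihood_variety n X by unfold_locales (rule assms)+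
  show ?thesis
    using closed_Lc irreducible_Lc krull_Lc projective_bundle_Lc generically_finite_Lc by blast
qed

end
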